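(* Let $K$ be an infinite algebraically closed field of prime characteristic $\operatorname{char}(K)>2$, and let $S=K[\![x_1,\dots,x_d]\!]$ where $d>2$. If $f\in S$ is a monomial of degree greater than $3$ and $R^{\bigstar}=S[\![u,v]\!]/(f+uv)$, then $R^{\bigstar}$ has FFRT but it does not have finite Cohen-Macaulay representation type.
   Context: A monomial is an element $x_1^{r_1}\cdots x_d^{r_d}$ with nonnegative integers $r_i$; its degree is $\sum r_i$. $u,v$ are new variables over $S$. For a ring $A$ of prime characteristic $p$, an $A$-module $M$ and a positive integer $e$, $F_*^e(M)$ is the $A$-module equal to $M$ as an abelian group (the element corresponding to $m$ is written $F_*^e(m)$) with $aF_*^e(m)=F_*^e(a^{p^e}m)$. A Noetherian ring $A$ of prime characteristic $p$ has finite F-representation type (FFRT) if there are finitely generated $A$-modules $M_1,\dots,M_s$ such that for every positive integer $e$ there are nonnegative integers $t_{(e,1)},\dots,t_{(e,s)}$ with $F_*^e(A)\cong\bigoplus_{j=1}^s M_j^{\oplus t_{(e,j)}}$ as $A$-modules. A finitely generated module $M$ over a Noetherian local ring $A$ is maximal Cohen-Macaulay (MCM) if $\operatorname{depth}M=\dim A$. A Noetherian local ring has finite Cohen-Macaulay (CM) representation type if there are, up to isomorphism, only finitely many indecomposable MCM modules over it. *)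

theory Defs
  imports
    "HOL-Computational_Algebra.Primes"
    "HOL-Algebra.Algebraic_Closure"
    "HOL-Algebra.Ring_Divisibility"
    "HOL-Algebra.Module"
    "HOL-Library.Extended_Nat"
begin

section \<open>Formal power series in finitely many variables\<close>

text \<open>Exponent vectors $(r_0,\dots,r_{n-1})$ are functions that vanish from index $n$ on.\<close>

definition exps :: "nat \<Rightarrow> (nat \<Rightarrow> nat) set" where
  "exps n = {r. \<forall>i\<ge>n. r i = 0}"

definition mps :: "nat \<Rightarrow> ('a, 'c) ring_scheme \<Rightarrow> ((nat \<Rightarrow> nat) \<Rightarrow> 'a) ring" where
  "mps n R =
    \<lparr>carrier = (exps n \<rightarrow>\<^sub>E carrier R),
     monoid.mult = (\<lambda>f g. \<lambda>r\<in>exps n. \<Oplus>\<^bsub>R\<^esub>s\<in>{s. \<forall>i. s i \<le> r i}. f s \<otimes>\<^bsub>R\<^esub> g (\<lambda>i. r i - s i)),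
     one = (\<lambda>r\<in>exps n. if r = (\<lambda>_. 0) then \<one>\<^bsub>R\<^esub> else \<zero>\<^bsub>R\<^esub>),
     ring.zero = (\<lambda>r\<in>exps n. \<zero>\<^bsub>R\<^esub>),
     add = (\<lambda>f g. \<lambda>r\<in>exps n. f r \<oplus>\<^bsub>R\<^esub> g r)\<rparr>"

definition mps_const :: "nat \<Rightarrow> ('a, 'c) ring_scheme \<Rightarrow> 'a \<Rightarrow> (nat \<Rightarrow> nat) \<Rightarrow> 'a" where
  "mps_const n R a = (\<lambda>r\<in>exps n. if r = (\<lambda>_. 0) then a else \<zero>\<^bsub>R\<^esub>)"

definition mps_var :: "nat \<Rightarrow> ('a, 'c) ring_scheme \<Rightarrow> nat \<Rightarrow> (nat \<Rightarrow> nat) \<Rightarrow> 'a" where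
  "mps_var n R i = (\<lambda>r\<in>exps n. if r = (\<lambda>j. if j = i then 1 else 0) then \<one>\<^bsub>R\<^esub> else \<zero>\<^bsub>R\<^esub>)"

text \<open>$S[[u,v]]/(f+uv)$, where $u$ and $v$ are the variables 0 and 1 of \<open>mps 2 S\<close>.\<close>

definition R_star :: "('a, 'c) ring_scheme \<Rightarrow> 'a \<Rightarrow> ((nat \<Rightarrow> nat) \<Rightarrow> 'a) set ring" where
  "R_star S f =
    (let T = mps 2 S
     in T Quot (PIdl\<^bsub>T\<^esub> (mps_const 2 S f \<oplus>\<^bsub>T\<^esub> mps_var 2 S 0 \<otimes>\<^bsub>T\<^esub> mps_var 2 S 1)))"


section \<open>Rings\<close>

definition ring_char :: "('a, 'c) ring_scheme \<Rightarrow> nat" where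
  "ring_char R =
    (if \<exists>n::nat. n > 0 \<and> [n] \<cdot>\<^bsub>R\<^esub> \<one>\<^bsub>R\<^esub> = \<zero>\<^bsub>R\<^esub>
     then (LEAST n::nat. n > 0 \<and> [n] \<cdot>\<^bsub>R\<^esub> \<one>\<^bsub>R\<^esub> = \<zero>\<^bsub>R\<^esub>) else 0)"

definition noetherian_local :: "('a, 'c) ring_scheme \<Rightarrow> bool" where
  "noetherian_local A \<longleftrightarrow> cring A \<and> noetherian_ring A \<and> (\<exists>!I. maximalideal I A)"

definition max_ideal :: "('a, 'c) ring_scheme \<Rightarrow> 'a set" where
  "max_ideal A = (THE I. maximalideal I A)"

definition krull_dim :: "('a, 'c) ring_scheme \<Rightarrow> enat" where
  "krull_dim A =
    Sup {enat n | n. \<exists>P. (\<forall>i\<le>n. primeideal (P i) A) \<and> (\<forall>i<n. P i \<subset> P (Suc i))}"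


section \<open>Modules\<close>

text \<open>The \<^typ>\<open>('a, 'b) module\<close> record inherits the fields \<open>mult\<close> and \<open>one\<close> from rings.
  They play no role for modules, and nothing below depends on their values.\<close>

definition mod_span :: "('a, 'c) ring_scheme \<Rightarrow> ('a, 'm, 'x) module_scheme \<Rightarrow> 'm set \<Rightarrow> 'm set" where
  "mod_span A M G = (\<lambda>N. submodule N A M) hull G"

definition fg_module :: "('a, 'c) ring_scheme \<Rightarrow> ('a, 'm, 'x) module_scheme \<Rightarrow> bool" where
  "fg_module A M \<longleftrightarrow>
    module A M \<and> (\<exists>G. finite G \<and> G \<subseteq> carrier M \<and> mod_span A M G = carrier M)"

definition mod_iso ::
  "('a, 'c) ring_scheme \<Rightarrow> ('a, 'm, 'x) module_scheme \<Rightarrow> ('a, 'n, 'y) module_scheme \<Rightarrow> bool" where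
  "mod_iso A M N \<longleftrightarrow>
    (\<exists>h. bij_betw h (carrier M) (carrier N) \<and>
      (\<forall>x\<in>carrier M. \<forall>y\<in>carrier M. h (x \<oplus>\<^bsub>M\<^esub> y) = h x \<oplus>\<^bsub>N\<^esub> h y) \<and>
      (\<forall>a\<in>carrier A. \<forall>x\<in>carrier M. h (a \<odot>\<^bsub>M\<^esub> x) = a \<odot>\<^bsub>N\<^esub> h x))"

text \<open>A direct product, which is the direct sum for finite \<open>I\<close>.\<close>

definition mod_dsum :: "'i set \<Rightarrow> ('i \<Rightarrow> ('a, 'm, 'x) module_scheme) \<Rightarrow> ('a, 'i \<Rightarrow> 'm) module" where
  "mod_dsum I M =
    \<lparr>carrier = (\<Pi>\<^sub>E i\<in>I. carrier (M i)),
     monoid.mult = undefined, one = undefined,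
     ring.zero = (\<lambda>i\<in>I. \<zero>\<^bsub>M i\<^esub>),
     add = (\<lambda>x y. \<lambda>i\<in>I. x i \<oplus>\<^bsub>M i\<^esub> y i),
     smult = (\<lambda>a x. \<lambda>i\<in>I. a \<odot>\<^bsub>M i\<^esub> x i)\<rparr>"

definition self_module :: "('a, 'c) ring_scheme \<Rightarrow> ('a, 'a) module" where
  "self_module A =
    \<lparr>carrier = carrier A, monoid.mult = monoid.mult A, one = one A, ring.zero = ring.zero A,
     add = add A, smult = monoid.mult A\<rparr>"

text \<open>The module $F_*^e(M)$.\<close>

definition frobenius_push ::
  "('a, 'c) ring_scheme \<Rightarrow> nat \<Rightarrow> ('a, 'm) module \<Rightarrow> ('a, 'm) module" where
  "frobenius_push A e M =
    M\<lparr>smult := (\<lambda>a m. (a [^]\<^bsub>A\<^esub> (ring_char A ^ e)) \<odot>\<^bsub>M\<^esub> m)\<rparr>"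

definition indecomposable :: "('a, 'c) ring_scheme \<Rightarrow> ('a, 'm, 'x) module_scheme \<Rightarrow> bool" where
  "indecomposable A M \<longleftrightarrow>
    carrier M \<noteq> {\<zero>\<^bsub>M\<^esub>} \<and>
    (\<forall>N\<^sub>1 N\<^sub>2. submodule N\<^sub>1 A M \<and> submodule N\<^sub>2 A M \<and>
       N\<^sub>1 <+>\<^bsub>M\<^esub> N\<^sub>2 = carrier M \<and> N\<^sub>1 \<inter> N\<^sub>2 = {\<zero>\<^bsub>M\<^esub>} \<longrightarrow>
       N\<^sub>1 = {\<zero>\<^bsub>M\<^esub>} \<or> N\<^sub>2 = {\<zero>\<^bsub>M\<^esub>})"

text \<open>The submodule $(x_1,\dots,x_k)M$.\<close>

definition seq_submodule ::
  "('a, 'c) ring_scheme \<Rightarrow> ('a, 'm, 'x) module_scheme \<Rightarrow> 'a list \<Rightarrow> 'm set" where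
  "seq_submodule A M xs = mod_span A M {x \<odot>\<^bsub>M\<^esub> m | x m. x \<in> set xs \<and> m \<in> carrier M}"

text \<open>The first condition says that each $x_{i+1}$ is a nonzerodivisor on
  $M/(x_1,\dots,x_i)M$, the second that $M/(x_1,\dots,x_k)M \neq 0$.\<close>

definition regular_seq ::
  "('a, 'c) ring_scheme \<Rightarrow> ('a, 'm, 'x) module_scheme \<Rightarrow> 'a list \<Rightarrow> bool" where
  "regular_seq A M xs \<longleftrightarrow> set xs \<subseteq> carrier A \<and>
    (\<forall>i<length xs. \<forall>m\<in>carrier M.
       (xs ! i) \<odot>\<^bsub>M\<^esub> m \<in> seq_submodule A M (take i xs) \<longrightarrow> m \<in> seq_submodule A M (take i xs)) \<and>
    seq_submodule A M xs \<noteq> carrier M"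

text \<open>Depth over a local ring. By convention the zero module has infinite depth.\<close>

definition depth :: "('a, 'c) ring_scheme \<Rightarrow> ('a, 'm, 'x) module_scheme \<Rightarrow> enat" where
  "depth A M =
    (if carrier M = {\<zero>\<^bsub>M\<^esub>} then \<infinity>
     else Sup {enat (length xs) | xs. set xs \<subseteq> max_ideal A \<and> regular_seq A M xs})"

definition MCM :: "('a, 'c) ring_scheme \<Rightarrow> ('a, 'm, 'x) module_scheme \<Rightarrow> bool" where
  "MCM A M \<longleftrightarrow> fg_module A M \<and> depth A M = krull_dim A"


section \<open>A type containing all finitely generated modules\<close>

text \<open>HOL cannot quantify over types inside a definition. A finitely generated \<open>A\<close>-module is a
  quotient of some $A^n$, so up to isomorphism its elements are sets of coefficient vectors. Hence
  quantifying over modules with elements in \<^typ>\<open>(nat \<Rightarrow> 'a) set\<close> loses nothing; this is the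
  theorem \<open>fg_module_representative\<close> below.\<close>

type_synonym 'a fgmod = "('a, (nat \<Rightarrow> 'a) set) module"

lemma mod_span_eq_carrier_iff:
  assumes "module A M" "G \<subseteq> carrier M"
  shows "mod_span A M G = carrier M \<longleftrightarrow> (\<forall>N. submodule N A M \<and> G \<subseteq> N \<longrightarrow> N = carrier M)"
proof -
  have "submodule (carrier M) A M" by (rule module.carrier_is_submodule[OF assms(1)])
  moreover have "N \<subseteq> carrier M" if "submodule N A M" for N
    using module.submoduleE(1)[OF assms(1) that] .
  ultimately show ?thesis
    using assms(2) unfolding mod_span_def hull_def by blast
qed

lemma linear_combinations_submodule:
  assumes "module A M" "\<And>i. i < n \<Longrightarrow> g i \<in> carrier M"
  shows "submodule ((\<lambda>c. \<Oplus>\<^bsub>M\<^esub>i\<in>{..<n::nat}. c i \<odot>\<^bsub>M\<^esub> g i) ` ({..<n} \<rightarrow> carrier A)) A M"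
    (is "submodule (?L ` ?C) A M")
proof -
  interpret module A M by fact
  have term_closed: "(\<lambda>i. c i \<odot>\<^bsub>M\<^esub> g i) \<in> {..<n} \<rightarrow> carrier M" if "c \<in> ?C" for c
    using that assms(2) by auto
  have closed: "?L c \<in> carrier M" if "c \<in> ?C" for c
    using term_closed[OF that] by (rule M.finsum_closed)
  have smul: "a \<odot>\<^bsub>M\<^esub> ?L c = ?L (\<lambda>i. a \<otimes>\<^bsub>A\<^esub> c i)" if "a \<in> carrier A" "c \<in> ?C" for a c
  proof -
    have "a \<odot>\<^bsub>M\<^esub> ?L c = (\<Oplus>\<^bsub>M\<^esub>i\<in>{..<n}. a \<odot>\<^bsub>M\<^esub> (c i \<odot>\<^bsub>M\<^esub> g i))"
      by (rule finsum_smult_ldistr) (use that term_closed in auto)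
    also have "\<dots> = ?L (\<lambda>i. a \<otimes>\<^bsub>A\<^esub> c i)"
      by (rule M.finsum_cong') (use that assms(2) in \<open>auto simp: smult_assoc1 Pi_def\<close>)
    finally show ?thesis .
  qed
  have smul_in: "a \<odot>\<^bsub>M\<^esub> x \<in> ?L ` ?C" if "a \<in> carrier A" "x \<in> ?L ` ?C" for a x
  proof -
    from that(2) obtain c where c: "c \<in> ?C" "x = ?L c" by blast
    then show ?thesis using smul[OF that(1) c(1)] that(1) by (intro image_eqI[of _ _ "\<lambda>i. a \<otimes>\<^bsub>A\<^esub> c i"]) auto
  qed
  show ?thesis
  proof (rule submoduleI)
    show "?L ` ?C \<subseteq> carrier M" using closed by blast
    have "?L (\<lambda>i. \<zero>\<^bsub>A\<^esub>) = (\<Oplus>\<^bsub>M\<^esub>i\<in>{..<n}. \<zero>\<^bsub>M\<^esub>)"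
      by (rule M.finsum_cong') (use assms(2) in auto)
    then have "?L (\<lambda>i. \<zero>\<^bsub>A\<^esub>) = \<zero>\<^bsub>M\<^esub>" by simp
    then show "\<zero>\<^bsub>M\<^esub> \<in> ?L ` ?C" by (intro image_eqI[of _ _ "\<lambda>i. \<zero>\<^bsub>A\<^esub>"]) auto
  next
    fix a assume a: "a \<in> ?L ` ?C"
    then have "a \<in> carrier M" using closed by blast
    then have "\<ominus>\<^bsub>M\<^esub> a = (\<ominus>\<^bsub>A\<^esub> \<one>\<^bsub>A\<^esub>) \<odot>\<^bsub>M\<^esub> a" by (simp add: smult_l_minus)
    then show "\<ominus>\<^bsub>M\<^esub> a \<in> ?L ` ?C" using smul_in[OF _ a, of "\<ominus>\<^bsub>A\<^esub> \<one>\<^bsub>A\<^esub>"] by simp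
  next
    fix a b assume "a \<in> ?L ` ?C" "b \<in> ?L ` ?C"
    then obtain c e where c: "c \<in> ?C" "a = ?L c" and e: "e \<in> ?C" "b = ?L e" by blast
    have "?L (\<lambda>i. c i \<oplus>\<^bsub>A\<^esub> e i) = (\<Oplus>\<^bsub>M\<^esub>i\<in>{..<n}. c i \<odot>\<^bsub>M\<^esub> g i \<oplus>\<^bsub>M\<^esub> e i \<odot>\<^bsub>M\<^esub> g i)"
      by (rule M.finsum_cong') (use c e assms(2) in \<open>auto simp: smult_l_distr Pi_def\<close>)
    also have "\<dots> = a \<oplus>\<^bsub>M\<^esub> b"
      unfolding c(2) e(2) by (rule M.finsum_addf) (use c e term_closed in auto)
    finally show "a \<oplus>\<^bsub>M\<^esub> b \<in> ?L ` ?C"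
      using c(1) e(1) by (intro image_eqI[of _ _ "\<lambda>i. c i \<oplus>\<^bsub>A\<^esub> e i"]) auto
  next
    fix a x assume "a \<in> carrier A" "x \<in> ?L ` ?C"
    then show "a \<odot>\<^bsub>M\<^esub> x \<in> ?L ` ?C" by (rule smul_in)
  qed
qed

lemma fg_module_transport:
  fixes M :: "('a, 'm, 'x) module_scheme" and h :: "'m \<Rightarrow> 'n"
  assumes fg: "fg_module A M" and inj: "inj_on h (carrier M)"
  shows "\<exists>N :: ('a, 'n) module. fg_module A N \<and> mod_iso A M N"
proof -
  have mod: "module A M" using fg by (simp add: fg_module_def)
  interpret M: module A M by (rule mod)
  define k where "k = the_inv_into (carrier M) h"
  have kh [simp]: "k (h x) = x" if "x \<in> carrier M" for x
    unfolding k_def using inj that by (rule the_inv_into_f_f)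
  define N :: "('a, 'n) module" where
    "N = \<lparr>carrier = h ` carrier M, monoid.mult = undefined, one = undefined, ring.zero = h \<zero>\<^bsub>M\<^esub>,
          add = (\<lambda>x y. h (k x \<oplus>\<^bsub>M\<^esub> k y)), smult = (\<lambda>a x. h (a \<odot>\<^bsub>M\<^esub> k x))\<rparr>"
  have N_simps: "carrier N = h ` carrier M" "ring.zero N = h \<zero>\<^bsub>M\<^esub>"
      "add N x y = h (k x \<oplus>\<^bsub>M\<^esub> k y)" "smult N a x = h (a \<odot>\<^bsub>M\<^esub> k x)" for x y a
    by (simp_all add: N_def)
  have modN: "module A N"
  proof (rule moduleI)
    show "cring A" by (rule M.R.is_cring)
    show "abelian_group N"
    proof (rule abelian_groupI)
      fix x assume "x \<in> carrier N"
      then obtain m where m: "m \<in> carrier M" "x = h m" by (auto simp: N_simps)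
      then show "\<exists>y\<in>carrier N. y \<oplus>\<^bsub>N\<^esub> x = \<zero>\<^bsub>N\<^esub>"
        by (intro bexI[of _ "h (\<ominus>\<^bsub>M\<^esub> m)"]) (auto simp: N_simps M.M.l_neg)
    qed (auto simp: N_simps M.M.a_ac)
  qed (auto simp: N_simps M.smult_l_distr M.smult_r_distr M.smult_assoc1)
  obtain G where G: "finite G" "G \<subseteq> carrier M" "mod_span A M G = carrier M"
    using fg by (auto simp: fg_module_def)
  have "P = carrier N" if P: "submodule P A N" "h ` G \<subseteq> P" for P
  proof -
    interpret N: module A N by (rule modN)
    define Q where "Q = {m \<in> carrier M. h m \<in> P}"
    note E = N.submoduleE[OF P(1)]
    have "submodule Q A M"
    proof (rule M.submoduleI)
      show "\<zero>\<^bsub>M\<^esub> \<in> Q"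
        using subgroup.one_closed[OF submodule.axioms(1)[OF P(1)]] by (simp add: Q_def N_simps)
    next
      fix a b assume "a \<in> Q" "b \<in> Q"
      then show "a \<oplus>\<^bsub>M\<^esub> b \<in> Q" using E(5)[of "h a" "h b"] by (auto simp: Q_def N_simps)
    next
      fix a x assume "a \<in> carrier A" "x \<in> Q"
      then show "a \<odot>\<^bsub>M\<^esub> x \<in> Q" using E(4)[of a "h x"] by (auto simp: Q_def N_simps)
    next
      fix a assume a: "a \<in> Q"
      then have "\<ominus>\<^bsub>M\<^esub> a = (\<ominus>\<^bsub>A\<^esub> \<one>\<^bsub>A\<^esub>) \<odot>\<^bsub>M\<^esub> a" by (simp add: M.smult_l_minus Q_def)
      then show "\<ominus>\<^bsub>M\<^esub> a \<in> Q"
        using a E(4)[of "\<ominus>\<^bsub>A\<^esub> \<one>\<^bsub>A\<^esub>" "h a"] by (auto simp: Q_def N_simps)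
    qed (auto simp: Q_def)
    moreover have "G \<subseteq> Q" using G(2) P(2) by (auto simp: Q_def)
    ultimately have "Q = carrier M"
      using G(3) mod_span_eq_carrier_iff[OF mod G(2)] by blast
    then show ?thesis using E(1) by (auto simp: Q_def N_simps)
  qed
  then have "mod_span A N (h ` G) = carrier N"
    using mod_span_eq_carrier_iff[OF modN, of "h ` G"] G(2) by (auto simp: N_simps)
  then have "fg_module A N"
    unfolding fg_module_def using modN G by (intro conjI exI[of _ "h ` G"]) (auto simp: N_simps)
  moreover have "mod_iso A M N"
    unfolding mod_iso_def using inj
    by (intro exI[of _ h]) (auto simp: N_simps bij_betw_def)
  ultimately show ?thesis by blast
qed

theorem fg_module_representative:
  fixes A :: "('a, 'c) ring_scheme" and M :: "('a, 'm, 'x) module_scheme"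
  assumes "fg_module A M"
  shows "\<exists>N :: 'a fgmod. fg_module A N \<and> mod_iso A M N"
proof -
  have mod: "module A M" using assms by (simp add: fg_module_def)
  interpret module A M by (rule mod)
  obtain G where G: "finite G" "G \<subseteq> carrier M" "mod_span A M G = carrier M"
    using assms by (auto simp: fg_module_def)
  obtain g and n :: nat where g: "G = g ` {..<n}"
    using finite_imp_nat_seg_image_inj_on[OF G(1)] by (auto simp: lessThan_def)
  have gM: "g i \<in> carrier M" if "i < n" for i using g G(2) that by auto
  define L where "L = (\<lambda>c. \<Oplus>\<^bsub>M\<^esub>i\<in>{..<n}. c i \<odot>\<^bsub>M\<^esub> g i)"
  define C where "C = ({..<n} \<rightarrow> carrier A)"
  have sub: "submodule (L ` C) A M"
    unfolding L_def C_def by (rule linear_combinations_submodule[OF mod gM])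
  have "g j \<in> L ` C" if "j < n" for j
  proof -
    let ?c = "\<lambda>i. if i = j then \<one>\<^bsub>A\<^esub> else \<zero>\<^bsub>A\<^esub>"
    have "L ?c = (\<Oplus>\<^bsub>M\<^esub>i\<in>{..<n}. if j = i then g i else \<zero>\<^bsub>M\<^esub>)"
      unfolding L_def by (rule M.finsum_cong') (use gM in auto)
    also have "\<dots> = g j" by (rule M.finsum_singleton) (use gM that in auto)
    finally show ?thesis by (intro image_eqI[of _ _ ?c]) (auto simp: C_def)
  qed
  then have "G \<subseteq> L ` C" using g by auto
  then have LC: "L ` C = carrier M"
    using G(3) mod_span_eq_carrier_iff[OF mod G(2)] sub by blast
  have "inj_on (\<lambda>m. {c \<in> C. L c = m}) (carrier M)"
  proof (rule inj_onI)
    fix x y assume "x \<in> carrier M" and eq: "{c \<in> C. L c = x} = {c \<in> C. L c = y}"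
    then obtain c where "c \<in> C" "L c = x" using LC by (metis imageE)
    then show "x = y" using eq by blast
  qed
  then show ?thesis by (rule fg_module_transport[OF assms])
qed


section \<open>FFRT and finite Cohen-Macaulay representation type\<close>

definition has_FFRT :: "('a, 'c) ring_scheme \<Rightarrow> bool" where
  "has_FFRT A \<longleftrightarrow>
    cring A \<and> noetherian_ring A \<and> normalization_semidom_class.prime (ring_char A) \<and>
    (\<exists>s. \<exists>M :: nat \<Rightarrow> 'a fgmod. (\<forall>j<s. fg_module A (M j)) \<and>
      (\<forall>e>0. \<exists>t :: nat \<Rightarrow> nat.
        mod_iso A (frobenius_push A e (self_module A))
          (mod_dsum (SIGMA j:{..<s}. {..<t j}) (\<lambda>(j, k). M j))))"

text \<open>To be used for Noetherian local rings only. That \<open>A\<close> is one is deliberately not part of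
  the definition, so that the negation says that infinitely many modules are needed.\<close>

definition finite_CM_type :: "('a, 'c) ring_scheme \<Rightarrow> bool" where
  "finite_CM_type A \<longleftrightarrow>
    (\<exists>\<M> :: 'a fgmod set. finite \<M> \<and> (\<forall>M\<in>\<M>. MCM A M \<and> indecomposable A M) \<and>
      (\<forall>N :: 'a fgmod. MCM A N \<and> indecomposable A N \<longrightarrow> (\<exists>M\<in>\<M>. mod_iso A N M)))"

end

theory Submission
  imports Defs "HOL-Computational_Algebra.Polynomial" "HOL-Library.Function_Algebras"
begin

text \<open>Eliminating $v = -f/u$ identifies $R^\bigstar$ with the ring of series whose exponents lie in the monoid
  $H = \{(m,k) \in \mathbf{Z}^d \times \mathbf{Z} : m \ge 0,\ m + kr \ge 0\}$, where $r$ is the exponent of $f$ and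
  $k$ that of $u$.

  Sorting exponents by their residues modulo $q = p^e$ splits $F_*^e$ of this ring into pieces, the series with
  exponents in $D(c) = \{m \ge 0,\ m + kr \ge c\}$, where $-r \le c \le 0$. Only finitely many $c$ occur.

  For the second part write $f = ab$ with $a$ a variable and let $z$ be a high power of another variable. The
  matrix factorization with rows $(a,z)$ and $(0,b)$ gives a module $N_z$ with four generators. It is an extension
  of the series modules of $D(b)$ and $D(a)$, on both of which $x_1,\dots,x_d,u+v$ is a regular sequence, so it is
  maximal Cohen-Macaulay. Comparing coefficients in the relations between the generators shows that modulo the maximal
  ideal every endomorphism of $N_z$ is triangular with constant diagonal, whence $N_z$ is indecomposable by
  Nakayama's lemma, and that a homomorphism $N_{z'} \to N_z$ kills one of the generators modulo the maximal ideal if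
  $z'$ is a proper divisor of $z$. So the modules $N_z$ are pairwise non-isomorphic.\<close>

section \<open>Laurent series over an exponent group\<close>

text \<open>\<open>MCM\<close> asks for depth equal to Krull dimension, but the dimension is never
  computed by itself: a regular sequence of length d+1, the general bound depth <= dim and an upper
  bound dim <= d+1 close up. The upper bound comes from counting. With respect to a linear order on
  exponents, the exponents that are not leading in a prime grow at most like N^(d+1) with the weight
  bound N, and passing to a larger prime lowers the order of growth. Division with remainder for the
  same order yields Noetherianity and locality. Algebraic closedness enters through q-th roots of
  coefficients, which turn the action through q-th powers on the residue pieces into plain
  multiplication. The degree hypothesis serves to choose two variables: x_\<iota>, the factor a, and
  x_\<gamma>, of which z is a power, such that b divides no power of x_\<gamma> and f does not
  divide a^2. This keeps the four generators minimal and removes the matrix entries that would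
  disturb triangularity. Both properties quantify over modules of a fixed carrier type, so
  everything is proved over the series ring and transported along the ring isomorphism.\<close>

context abelian_monoid
begin

lemma finsum_zero_cong: "(\<And>i. i \<in> A \<Longrightarrow> f i = \<zero>) \<Longrightarrow> finsum G f A = \<zero>"
  by (rule add.finprod_one_eqI)

lemma finsum_mono_neutral:
  assumes "finite B" "A \<subseteq> B" "\<And>i. i \<in> B - A \<Longrightarrow> f i = \<zero>" "\<And>i. i \<in> A \<Longrightarrow> f i \<in> carrier G"
  shows "finsum G f B = finsum G f A"
proof (rule add.finprod_mono_neutral_cong_right)
  show "f \<in> B \<rightarrow> carrier G" using assms(3,4) by (force simp: Pi_def)
qed (use assms in auto)

lemma finsum_delta:
  assumes "finite A" "i \<in> A" "x \<in> carrier G"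
  shows "(\<Oplus>j\<in>A. if j = i then x else \<zero>) = x"
  using finsum_singleton[of i A "\<lambda>_. x"] assms by (simp add: eq_commute)

lemma finsum_if_point:
  assumes "finite A" "i \<in> A \<Longrightarrow> x i \<in> carrier G"
  shows "(\<Oplus>j\<in>A. if j = i then x j else \<zero>) = (if i \<in> A then x i else \<zero>)"
proof (cases "i \<in> A")
  case True
  have "(\<Oplus>j\<in>A. if j = i then x j else \<zero>) = (\<Oplus>j\<in>A. if j = i then x i else \<zero>)"
    by (rule finsum_cong') (use assms True in auto)
  then show ?thesis using finsum_delta[of A i "x i"] assms True by simp
next
  case False
  then show ?thesis by (auto intro!: finsum_zero_cong)
qed

lemma finsum_swap:
  assumes "finite A" "finite B" "\<And>a b. a \<in> A \<Longrightarrow> b \<in> B \<Longrightarrow> f a b \<in> carrier G"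
  shows "(\<Oplus>a\<in>A. \<Oplus>b\<in>B. f a b) = (\<Oplus>b\<in>B. \<Oplus>a\<in>A. f a b)"
  using assms(1,3)
proof (induction A rule: finite_induct)
  case empty
  then show ?case by (simp add: finsum_zero_cong)
next
  case (insert x F)
  have "(\<Oplus>a\<in>insert x F. \<Oplus>b\<in>B. f a b) = (\<Oplus>b\<in>B. f x b) \<oplus> (\<Oplus>b\<in>B. \<Oplus>a\<in>F. f a b)"
    using insert by (subst finsum_insert) auto
  also have "\<dots> = (\<Oplus>b\<in>B. f x b \<oplus> (\<Oplus>a\<in>F. f a b))"
    by (rule finsum_addf[symmetric]) (use insert in auto)
  also have "\<dots> = (\<Oplus>b\<in>B. \<Oplus>a\<in>insert x F. f a b)"
    by (rule finsum_cong') (use insert in auto)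
  finally show ?case .
qed

lemma finsum_cong_closed:
  assumes "\<And>i. i \<in> A \<Longrightarrow> f i = g i" "\<And>i. i \<in> A \<Longrightarrow> g i \<in> carrier G"
  shows "finsum G f A = finsum G g A"
  by (rule finsum_cong') (use assms in auto)

end

text \<open>The weight \<open>w\<close> stands in for a filtration. Finiteness of the support below
  every weight bound forces the weights of the support to be bounded below, and this makes all
  convolution sums finite even over an infinite group.\<close>

definition laurent_carrier :: "('a, 'c) ring_scheme \<Rightarrow> ('g \<Rightarrow> int) \<Rightarrow> ('g \<Rightarrow> 'a) set" where
  "laurent_carrier R w =
    {f. (\<forall>h. f h \<in> carrier R) \<and> (\<forall>n. finite {h. f h \<noteq> \<zero>\<^bsub>R\<^esub> \<and> w h \<le> n})}"

text \<open>Only pairs of nonzero coefficients are summed, so that the definition does not mention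
  the weight; \<open>conv_eq\<close> replaces the index set by any finite superset.\<close>

definition conv ::
  "('a, 'c) ring_scheme \<Rightarrow> ('g::ab_group_add \<Rightarrow> 'a) \<Rightarrow> ('g \<Rightarrow> 'a) \<Rightarrow> 'g \<Rightarrow> 'a" where
  "conv R f g h = (\<Oplus>\<^bsub>R\<^esub>s\<in>{s. f s \<noteq> \<zero>\<^bsub>R\<^esub> \<and> g (h - s) \<noteq> \<zero>\<^bsub>R\<^esub>}. f s \<otimes>\<^bsub>R\<^esub> g (h - s))"

definition lmonom :: "('a, 'c) ring_scheme \<Rightarrow> 'g \<Rightarrow> 'a \<Rightarrow> 'g \<Rightarrow> 'a" where
  "lmonom R g a = (\<lambda>h. if h = g then a else \<zero>\<^bsub>R\<^esub>)"

definition laurent :: "('a, 'c) ring_scheme \<Rightarrow> ('g::ab_group_add \<Rightarrow> int) \<Rightarrow> ('g \<Rightarrow> 'a) ring" where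
  "laurent R w = \<lparr>carrier = laurent_carrier R w, monoid.mult = conv R, one = lmonom R 0 \<one>\<^bsub>R\<^esub>,
     ring.zero = (\<lambda>_. \<zero>\<^bsub>R\<^esub>), add = (\<lambda>f g h. f h \<oplus>\<^bsub>R\<^esub> g h)\<rparr>"

lemma laurent_simps [simp]:
  "carrier (laurent R w) = laurent_carrier R w"
  "monoid.mult (laurent R w) = conv R"
  "one (laurent R w) = lmonom R 0 \<one>\<^bsub>R\<^esub>"
  "ring.zero (laurent R w) = (\<lambda>_. \<zero>\<^bsub>R\<^esub>)"
  "add (laurent R w) = (\<lambda>f g h. f h \<oplus>\<^bsub>R\<^esub> g h)"
  by (simp_all add: laurent_def)

locale laurent_ring = cring R for R :: "('a, 'c) ring_scheme" (structure) +
  fixes w :: "'g::ab_group_add \<Rightarrow> int"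
  assumes w_add: "w (g + h) = w g + w h"
begin

abbreviation LC :: "('g \<Rightarrow> 'a) set" where "LC \<equiv> laurent_carrier R w"

lemma w_0 [simp]: "w 0 = 0"
  using w_add[of 0 0] by simp

lemma w_minus: "w (- g) = - w g"
  using w_add[of g "- g"] by simp

lemma w_diff: "w (g - h) = w g - w h"
  using w_add[of g "- h"] by (simp add: w_minus)

lemma LC_closed [simp]: "f \<in> LC \<Longrightarrow> f h \<in> carrier R"
  by (simp add: laurent_carrier_def)

lemma LC_finite: "f \<in> LC \<Longrightarrow> finite {h. f h \<noteq> \<zero> \<and> w h \<le> n}"
  unfolding laurent_carrier_def by blast

lemma LCI: "(\<And>h. f h \<in> carrier R) \<Longrightarrow> (\<And>n. finite {h. f h \<noteq> \<zero> \<and> w h \<le> n}) \<Longrightarrow> f \<in> LC"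
  unfolding laurent_carrier_def by blast

text \<open>Only finitely many exponents of the support have weight at most 0; the minimum of their
  weights and 0 bounds all others as well.\<close>

lemma LC_bound:
  assumes "f \<in> LC"
  obtains n where "\<And>h. f h \<noteq> \<zero> \<Longrightarrow> n \<le> w h"
proof -
  let ?S = "{h. f h \<noteq> \<zero> \<and> w h \<le> 0}"
  have fin: "finite ?S" using LC_finite[OF assms] .
  have "Min (insert 0 (w ` ?S)) \<le> w h" if "f h \<noteq> \<zero>" for h
  proof (cases "w h \<le> 0")
    case True
    then show ?thesis using fin that by (intro Min_le) auto
  next
    case False
    have "Min (insert 0 (w ` ?S)) \<le> 0" using fin by (intro Min_le) auto
    then show ?thesis using False by simp
  qed
  then show ?thesis using that by blast
qed

lemma LC_subsetI:
  assumes "f \<in> LC" "\<And>h. g h \<in> carrier R" "\<And>h. g h \<noteq> \<zero> \<Longrightarrow> f h \<noteq> \<zero>"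
  shows "g \<in> LC"
proof -
  have "finite {h. g h \<noteq> \<zero> \<and> w h \<le> n}" for n
    by (rule finite_subset[OF _ LC_finite[OF assms(1), of n]]) (use assms(3) in auto)
  then show ?thesis unfolding laurent_carrier_def using assms(2) by blast
qed

text \<open>A lower bound n for the weights in the support of \<open>g\<close> caps the weight of s
  by \<open>w h - n\<close>, and below that bound the support of \<open>f\<close> is finite.\<close>

lemma conv_finite:
  assumes "f \<in> LC" "g \<in> LC"
  shows "finite {s. f s \<noteq> \<zero> \<and> g (h - s) \<noteq> \<zero>}"
proof -
  obtain n where n: "\<And>h. g h \<noteq> \<zero> \<Longrightarrow> n \<le> w h" using LC_bound[OF assms(2)] by blast
  have "w s \<le> w h - n" if "g (h - s) \<noteq> \<zero>" for s
    using n[OF that] by (simp add: w_diff)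
  then show ?thesis
    by (intro finite_subset[OF _ LC_finite[OF assms(1), of "w h - n"]]) auto
qed

lemma conv_eq:
  assumes "f \<in> LC" "g \<in> LC" "finite F" "\<And>s. f s \<noteq> \<zero> \<Longrightarrow> g (h - s) \<noteq> \<zero> \<Longrightarrow> s \<in> F"
  shows "conv R f g h = (\<Oplus>s\<in>F. f s \<otimes> g (h - s))"
  unfolding conv_def
  by (rule finsum_mono_neutral[symmetric]) (use assms in auto)

lemma conv_closed [simp]: "f \<in> LC \<Longrightarrow> g \<in> LC \<Longrightarrow> conv R f g h \<in> carrier R"
  unfolding conv_def by (rule finsum_closed) auto

lemma conv_nonzeroE:
  assumes "conv R f g h \<noteq> \<zero>"
  obtains a b where "f a \<noteq> \<zero>" "g b \<noteq> \<zero>" "h = a + b"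
proof -
  have "{s. f s \<noteq> \<zero> \<and> g (h - s) \<noteq> \<zero>} \<noteq> {}"
    using assms unfolding conv_def by (metis finsum_empty)
  then obtain s where "f s \<noteq> \<zero>" "g (h - s) \<noteq> \<zero>" by blast
  then show ?thesis using that[of s "h - s"] by simp
qed

lemma conv_in_LC [simp]:
  assumes "f \<in> LC" "g \<in> LC"
  shows "conv R f g \<in> LC"
proof -
  obtain nf where nf: "\<And>h. f h \<noteq> \<zero> \<Longrightarrow> nf \<le> w h" using LC_bound[OF assms(1)] by blast
  obtain ng where ng: "\<And>h. g h \<noteq> \<zero> \<Longrightarrow> ng \<le> w h" using LC_bound[OF assms(2)] by blast
  have "finite {h. conv R f g h \<noteq> \<zero> \<and> w h \<le> n}" for n
  proof (rule finite_subset)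
    show "{h. conv R f g h \<noteq> \<zero> \<and> w h \<le> n} \<subseteq>
      (\<lambda>(a, b). a + b) ` ({a. f a \<noteq> \<zero> \<and> w a \<le> n - ng} \<times> {b. g b \<noteq> \<zero> \<and> w b \<le> n - nf})"
    proof
      fix h assume "h \<in> {h. conv R f g h \<noteq> \<zero> \<and> w h \<le> n}"
      then obtain a b where ab: "f a \<noteq> \<zero>" "g b \<noteq> \<zero>" "h = a + b" "w h \<le> n"
        by (auto elim: conv_nonzeroE)
      then have "w a \<le> n - ng" "w b \<le> n - nf" using nf[of a] ng[of b] w_add[of a b] by auto
      then show "h \<in> (\<lambda>(a, b). a + b) ` ({a. f a \<noteq> \<zero> \<and> w a \<le> n - ng} \<times> {b. g b \<noteq> \<zero> \<and> w b \<le> n - nf})"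
        using ab by (intro image_eqI[of _ _ "(a, b)"]) auto
    qed
    show "finite ((\<lambda>(a, b). a + b) ` ({a. f a \<noteq> \<zero> \<and> w a \<le> n - ng} \<times> {b. g b \<noteq> \<zero> \<and> w b \<le> n - nf}))"
      using LC_finite[OF assms(1)] LC_finite[OF assms(2)] by (intro finite_imageI finite_cartesian_product)
  qed
  then show ?thesis
    unfolding laurent_carrier_def using conv_closed[OF assms] by blast
qed

lemma add_eq_eq_diff: "a + b = h \<longleftrightarrow> b = h - a" for a b h :: 'g
  by (metis add.commute add_diff_cancel_left' diff_add_cancel)

text \<open>A form symmetric in the two factors: with it commutativity is an exchange of finite sums
  and associativity a rearrangement of triple sums. The boxes \<open>A\<close> and \<open>B\<close>
  may be any finite sets that contain all contributing pairs.\<close>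

lemma conv_pairs:
  assumes "f \<in> LC" "g \<in> LC" "finite A" "finite B"
    "\<And>a b. f a \<noteq> \<zero> \<Longrightarrow> g b \<noteq> \<zero> \<Longrightarrow> a + b = h \<Longrightarrow> a \<in> A \<and> b \<in> B"
  shows "conv R f g h = (\<Oplus>a\<in>A. \<Oplus>b\<in>B. if a + b = h then f a \<otimes> g b else \<zero>)"
proof -
  have "conv R f g h = (\<Oplus>a\<in>A. f a \<otimes> g (h - a))"
  proof (rule conv_eq)
    fix s assume "f s \<noteq> \<zero>" "g (h - s) \<noteq> \<zero>"
    then show "s \<in> A" using assms(5)[of s "h - s"] by simp
  qed (use assms(1-3) in auto)
  also have "\<dots> = (\<Oplus>a\<in>A. \<Oplus>b\<in>B. if a + b = h then f a \<otimes> g b else \<zero>)"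
  proof (rule finsum_cong_closed)
    fix a assume "a \<in> A"
    have "(\<Oplus>b\<in>B. if a + b = h then f a \<otimes> g b else \<zero>) = (\<Oplus>b\<in>B. if b = h - a then f a \<otimes> g b else \<zero>)"
      by (rule finsum_cong_closed) (use assms(1,2) in \<open>auto simp: add_eq_eq_diff\<close>)
    also have "\<dots> = (if h - a \<in> B then f a \<otimes> g (h - a) else \<zero>)"
      by (rule finsum_if_point) (use assms(1-4) in auto)
    also have "\<dots> = f a \<otimes> g (h - a)"
      using assms(5)[of a "h - a"] assms(1,2) by (cases "f a = \<zero> \<or> g (h - a) = \<zero>") auto
    finally show "f a \<otimes> g (h - a) = (\<Oplus>b\<in>B. if a + b = h then f a \<otimes> g b else \<zero>)" ..
    show "(\<Oplus>b\<in>B. if a + b = h then f a \<otimes> g b else \<zero>) \<in> carrier R"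
      using assms(1-4) by (intro finsum_closed) auto
  qed
  finally show ?thesis .
qed

lemma conv_comm:
  assumes "f \<in> LC" "g \<in> LC"
  shows "conv R f g = conv R g f"
proof
  fix h
  let ?A = "{s. f s \<noteq> \<zero> \<and> g (h - s) \<noteq> \<zero>}" and ?B = "{s. g s \<noteq> \<zero> \<and> f (h - s) \<noteq> \<zero>}"
  have "conv R f g h = (\<Oplus>a\<in>?A. \<Oplus>b\<in>?B. if a + b = h then f a \<otimes> g b else \<zero>)"
    by (rule conv_pairs) (use assms in \<open>auto intro: conv_finite\<close>)
  also have "\<dots> = (\<Oplus>b\<in>?B. \<Oplus>a\<in>?A. if a + b = h then f a \<otimes> g b else \<zero>)"
    by (rule finsum_swap) (use assms in \<open>auto intro: conv_finite\<close>)
  also have "\<dots> = (\<Oplus>b\<in>?B. \<Oplus>a\<in>?A. if b + a = h then g b \<otimes> f a else \<zero>)"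
    by (intro finsum_cong_closed finsum_closed) (use assms in \<open>auto simp: m_comm add.commute\<close>)
  also have "\<dots> = conv R g f h"
    by (rule conv_pairs[symmetric]) (use assms in \<open>auto intro: conv_finite\<close>)
  finally show "conv R f g h = conv R g f h" .
qed

text \<open>In a contributing triple a+b+c = h each weight is at most \<open>w h\<close> minus the
  lower bounds of the other two supports. Hence one finite box carries the whole triple sum,
  whatever the bracketing.\<close>

lemma conv_assoc_aux:
  fixes h :: 'g
  assumes "f \<in> LC" "g \<in> LC" "k \<in> LC"
    and nf: "\<And>h. f h \<noteq> \<zero> \<Longrightarrow> nf \<le> w h" and ng: "\<And>h. g h \<noteq> \<zero> \<Longrightarrow> ng \<le> w h"
    and nk: "\<And>h. k h \<noteq> \<zero> \<Longrightarrow> nk \<le> w h"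
  defines "A \<equiv> {a. f a \<noteq> \<zero> \<and> w a \<le> w h - ng - nk}" and "B \<equiv> {b. g b \<noteq> \<zero> \<and> w b \<le> w h - nf - nk}"
    and "C \<equiv> {c. k c \<noteq> \<zero> \<and> w c \<le> w h - nf - ng}"
  shows "conv R (conv R f g) k h =
    (\<Oplus>a\<in>A. \<Oplus>b\<in>B. \<Oplus>c\<in>C. if a + b + c = h then f a \<otimes> g b \<otimes> k c else \<zero>)"
proof -
  \<comment> \<open>Intermediate exponents a+b. The bound \<open>w h - nk\<close> guarantees that
    every contributing decomposition of a point of \<open>S\<close> lies in \<open>A\<close> and
    \<open>B\<close>, as \<open>conv_pairs\<close> requires.\<close>
  define S where "S = {s \<in> (\<lambda>(a, b). a + b) ` (A \<times> B). w s \<le> w h - nk}"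
  have fin: "finite A" "finite B" "finite C" "finite S"
    unfolding A_def B_def C_def S_def using LC_finite[OF assms(1)] LC_finite[OF assms(2)] LC_finite[OF assms(3)]
    by (auto intro!: finite_imageI finite_cartesian_product)
  note [simp] = assms(1-3)
  have fg: "conv R f g s = (\<Oplus>a\<in>A. \<Oplus>b\<in>B. if a + b = s then f a \<otimes> g b else \<zero>)" if "s \<in> S" for s
  proof (rule conv_pairs)
    fix a b assume "f a \<noteq> \<zero>" "g b \<noteq> \<zero>" "a + b = s"
    then show "a \<in> A \<and> b \<in> B"
      using nf[of a] ng[of b] that w_add[of a b] by (auto simp: A_def B_def S_def)
  qed (use fin in auto)
  have SA: "a + b \<in> S" if "a \<in> A" "b \<in> B" "c \<in> C" "a + b + c = h" for a b c
  proof -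
    have "w a + w b + w c = w h" using that(4) w_add by metis
    then show ?thesis using that nk[of c] w_add[of a b] by (auto simp: S_def C_def)
  qed
  have "conv R (conv R f g) k h = (\<Oplus>s\<in>S. \<Oplus>c\<in>C. if s + c = h then conv R f g s \<otimes> k c else \<zero>)"
  proof (rule conv_pairs)
    fix s c assume sc: "conv R f g s \<noteq> \<zero>" "k c \<noteq> \<zero>" "s + c = h"
    then obtain a b where ab: "f a \<noteq> \<zero>" "g b \<noteq> \<zero>" "s = a + b" by (auto elim: conv_nonzeroE)
    have "w a + w b + w c = w h" using sc(3) ab(3) w_add by metis
    then have "a \<in> A" "b \<in> B" "c \<in> C"
      using nf[OF ab(1)] ng[OF ab(2)] nk[OF sc(2)] ab sc by (auto simp: A_def B_def C_def)
    then show "s \<in> S \<and> c \<in> C" using SA[of a b c] sc(3) ab(3) by simp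
  qed (use fin in auto)
  also have "\<dots> = (\<Oplus>s\<in>S. \<Oplus>c\<in>C. \<Oplus>a\<in>A. \<Oplus>b\<in>B. if a + b = s \<and> s + c = h then f a \<otimes> g b \<otimes> k c else \<zero>)"
  proof (intro finsum_cong_closed finsum_closed)
    fix s c assume "s \<in> S" "c \<in> C"
    then show "(if s + c = h then conv R f g s \<otimes> k c else \<zero>) =
      (\<Oplus>a\<in>A. \<Oplus>b\<in>B. if a + b = s \<and> s + c = h then f a \<otimes> g b \<otimes> k c else \<zero>)"
    proof (cases "s + c = h")
      case True
      have "conv R f g s \<otimes> k c = (\<Oplus>a\<in>A. (\<Oplus>b\<in>B. if a + b = s then f a \<otimes> g b else \<zero>) \<otimes> k c)"
        unfolding fg[OF \<open>s \<in> S\<close>] by (rule finsum_ldistr) (use fin in auto)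
      also have "\<dots> = (\<Oplus>a\<in>A. \<Oplus>b\<in>B. (if a + b = s then f a \<otimes> g b else \<zero>) \<otimes> k c)"
        by (intro finsum_cong_closed finsum_ldistr finsum_closed) (use fin in auto)
      also have "\<dots> = (\<Oplus>a\<in>A. \<Oplus>b\<in>B. if a + b = s \<and> s + c = h then f a \<otimes> g b \<otimes> k c else \<zero>)"
        by (intro finsum_cong_closed finsum_closed) (use True in auto)
      finally show ?thesis using True by simp
    qed (auto intro!: finsum_zero_cong[symmetric] finsum_zero_cong)
  qed auto
  also have "\<dots> = (\<Oplus>c\<in>C. \<Oplus>s\<in>S. \<Oplus>a\<in>A. \<Oplus>b\<in>B. if a + b = s \<and> s + c = h then f a \<otimes> g b \<otimes> k c else \<zero>)"
    by (intro finsum_swap finsum_closed) (use fin in auto)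
  also have "\<dots> = (\<Oplus>c\<in>C. \<Oplus>a\<in>A. \<Oplus>s\<in>S. \<Oplus>b\<in>B. if a + b = s \<and> s + c = h then f a \<otimes> g b \<otimes> k c else \<zero>)"
    by (intro finsum_cong_closed finsum_swap finsum_closed) (use fin in auto)
  also have "\<dots> = (\<Oplus>c\<in>C. \<Oplus>a\<in>A. \<Oplus>b\<in>B. \<Oplus>s\<in>S. if a + b = s \<and> s + c = h then f a \<otimes> g b \<otimes> k c else \<zero>)"
    by (intro finsum_cong_closed finsum_swap finsum_closed) (use fin in auto)
  also have "\<dots> = (\<Oplus>c\<in>C. \<Oplus>a\<in>A. \<Oplus>b\<in>B. if a + b + c = h then f a \<otimes> g b \<otimes> k c else \<zero>)"
  proof (intro finsum_cong_closed finsum_closed)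
    fix c a b assume "c \<in> C" "a \<in> A" "b \<in> B"
    have "(\<Oplus>s\<in>S. if a + b = s \<and> s + c = h then f a \<otimes> g b \<otimes> k c else \<zero>) =
      (\<Oplus>s\<in>S. if s = a + b then (if s + c = h then f a \<otimes> g b \<otimes> k c else \<zero>) else \<zero>)"
      by (rule finsum_cong_closed) auto
    also have "\<dots> = (if a + b \<in> S then (if a + b + c = h then f a \<otimes> g b \<otimes> k c else \<zero>) else \<zero>)"
      by (rule finsum_if_point) (use fin in auto)
    finally show "(\<Oplus>s\<in>S. if a + b = s \<and> s + c = h then f a \<otimes> g b \<otimes> k c else \<zero>) =
      (if a + b + c = h then f a \<otimes> g b \<otimes> k c else \<zero>)"
      using SA[OF \<open>a \<in> A\<close> \<open>b \<in> B\<close> \<open>c \<in> C\<close>] by auto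
  qed auto
  also have "\<dots> = (\<Oplus>a\<in>A. \<Oplus>c\<in>C. \<Oplus>b\<in>B. if a + b + c = h then f a \<otimes> g b \<otimes> k c else \<zero>)"
    by (intro finsum_swap finsum_closed) (use fin in auto)
  also have "\<dots> = (\<Oplus>a\<in>A. \<Oplus>b\<in>B. \<Oplus>c\<in>C. if a + b + c = h then f a \<otimes> g b \<otimes> k c else \<zero>)"
    by (intro finsum_cong_closed finsum_swap finsum_closed) (use fin in auto)
  finally show ?thesis .
qed

text \<open>Commutativity turns the right-bracketed product into (g k) f, to which
  \<open>conv_assoc_aux\<close> applies with the factors rotated; the resulting triple sum is the
  same up to order.\<close>

lemma conv_assoc:
  assumes "f \<in> LC" "g \<in> LC" "k \<in> LC"
  shows "conv R (conv R f g) k = conv R f (conv R g k)"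
proof
  fix h
  obtain nf where nf: "\<And>h. f h \<noteq> \<zero> \<Longrightarrow> nf \<le> w h" using LC_bound[OF assms(1)] by blast
  obtain ng where ng: "\<And>h. g h \<noteq> \<zero> \<Longrightarrow> ng \<le> w h" using LC_bound[OF assms(2)] by blast
  obtain nk where nk: "\<And>h. k h \<noteq> \<zero> \<Longrightarrow> nk \<le> w h" using LC_bound[OF assms(3)] by blast
  note [simp] = assms
  define A where "A = {a. f a \<noteq> \<zero> \<and> w a \<le> w h - ng - nk}"
  define B where "B = {b. g b \<noteq> \<zero> \<and> w b \<le> w h - nf - nk}"
  define C where "C = {c. k c \<noteq> \<zero> \<and> w c \<le> w h - nf - ng}"
  have fin: "finite A" "finite B" "finite C"
    unfolding A_def B_def C_def using LC_finite[OF assms(1)] LC_finite[OF assms(2)] LC_finite[OF assms(3)]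
    by auto
  have swap: "w h - nk - nf = w h - nf - nk" "w h - ng - nf = w h - nf - ng" by simp_all
  have "conv R f (conv R g k) h = conv R (conv R g k) f h"
    by (simp add: conv_comm)
  also have "\<dots> = (\<Oplus>b\<in>B. \<Oplus>c\<in>C. \<Oplus>a\<in>A. if b + c + a = h then g b \<otimes> k c \<otimes> f a else \<zero>)"
    using conv_assoc_aux[OF assms(2,3,1) ng nk nf, of h]
    unfolding A_def B_def C_def swap
    by simp
  also have "\<dots> = (\<Oplus>b\<in>B. \<Oplus>c\<in>C. \<Oplus>a\<in>A. if a + b + c = h then f a \<otimes> g b \<otimes> k c else \<zero>)"
  proof (intro finsum_cong_closed finsum_closed)
    fix a b c :: 'g
    have "b + c + a = a + b + c" by (simp add: ac_simps)
    moreover have "g b \<otimes> k c \<otimes> f a = f a \<otimes> g b \<otimes> k c" by (simp add: m_ac)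
    ultimately show "(if b + c + a = h then g b \<otimes> k c \<otimes> f a else \<zero>) =
      (if a + b + c = h then f a \<otimes> g b \<otimes> k c else \<zero>)" by (simp only:)
  qed auto
  also have "\<dots> = (\<Oplus>b\<in>B. \<Oplus>a\<in>A. \<Oplus>c\<in>C. if a + b + c = h then f a \<otimes> g b \<otimes> k c else \<zero>)"
    by (intro finsum_cong_closed finsum_swap finsum_closed) (use fin in auto)
  also have "\<dots> = (\<Oplus>a\<in>A. \<Oplus>b\<in>B. \<Oplus>c\<in>C. if a + b + c = h then f a \<otimes> g b \<otimes> k c else \<zero>)"
    by (intro finsum_swap finsum_closed) (use fin in auto)
  also have "\<dots> = conv R (conv R f g) k h"
    using conv_assoc_aux[OF assms nf ng nk, of h] unfolding A_def B_def C_def by simp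
  finally show "conv R (conv R f g) k h = conv R f (conv R g k) h" ..
qed

lemma lmonom_in_LC [simp]: "a \<in> carrier R \<Longrightarrow> lmonom R g a \<in> LC"
  by (rule LCI) (auto simp: lmonom_def intro: finite_subset[of _ "{g}"])

lemma lmonom_conv:
  assumes "a \<in> carrier R" "f \<in> LC"
  shows "conv R (lmonom R g a) f h = a \<otimes> f (h - g)"
proof -
  have *: "lmonom R g a s = (if s = g then a else \<zero>)" for s by (simp add: lmonom_def)
  have "conv R (lmonom R g a) f h = (\<Oplus>s\<in>{g}. lmonom R g a s \<otimes> f (h - s))"
    by (rule conv_eq) (use assms in \<open>auto simp: * split: if_splits\<close>)
  then show ?thesis using assms by (simp add: *)
qed

lemma lmonom_lmonom:
  fixes g h :: 'g
  assumes "a \<in> carrier R" "b \<in> carrier R"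
  shows "conv R (lmonom R g a) (lmonom R h b) = lmonom R (g + h) (a \<otimes> b)"
proof
  fix k
  show "conv R (lmonom R g a) (lmonom R h b) k = lmonom R (g + h) (a \<otimes> b) k"
    using assms by (simp add: lmonom_conv) (auto simp: lmonom_def algebra_simps)
qed

lemma add_in_LC [simp]:
  assumes "f \<in> LC" "g \<in> LC"
  shows "(\<lambda>h. f h \<oplus> g h) \<in> LC"
proof -
  have "finite {h. f h \<oplus> g h \<noteq> \<zero> \<and> w h \<le> n}" for n
    by (rule finite_subset[of _ "{h. f h \<noteq> \<zero> \<and> w h \<le> n} \<union> {h. g h \<noteq> \<zero> \<and> w h \<le> n}"])
      (use LC_finite assms in auto)
  then show ?thesis
    unfolding laurent_carrier_def using LC_closed[OF assms(1)] LC_closed[OF assms(2)] by blast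
qed

lemma uminus_in_LC [simp]:
  assumes "f \<in> LC"
  shows "(\<lambda>h. \<ominus> f h) \<in> LC"
  by (rule LC_subsetI[OF assms]) (use assms in auto)

lemma zero_in_LC [simp]: "(\<lambda>_. \<zero>) \<in> LC"
  by (rule LCI) auto

lemma conv_add_left:
  assumes "f \<in> LC" "g \<in> LC" "k \<in> LC"
  shows "conv R (\<lambda>h. f h \<oplus> g h) k = (\<lambda>h. conv R f k h \<oplus> conv R g k h)"
proof
  fix h
  let ?F = "{s. f s \<noteq> \<zero> \<and> k (h - s) \<noteq> \<zero>} \<union> {s. g s \<noteq> \<zero> \<and> k (h - s) \<noteq> \<zero>}"
  have fin: "finite ?F" using conv_finite assms by auto
  note [simp] = assms
  have "conv R (\<lambda>h. f h \<oplus> g h) k h = (\<Oplus>s\<in>?F. (f s \<oplus> g s) \<otimes> k (h - s))"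
    by (rule conv_eq) (use fin in auto)
  also have "\<dots> = (\<Oplus>s\<in>?F. f s \<otimes> k (h - s) \<oplus> g s \<otimes> k (h - s))"
    by (intro finsum_cong_closed) (auto simp: l_distr)
  also have "\<dots> = (\<Oplus>s\<in>?F. f s \<otimes> k (h - s)) \<oplus> (\<Oplus>s\<in>?F. g s \<otimes> k (h - s))"
    by (rule finsum_addf) auto
  also have "(\<Oplus>s\<in>?F. f s \<otimes> k (h - s)) = conv R f k h"
    by (rule conv_eq[symmetric]) (use fin in auto)
  also have "(\<Oplus>s\<in>?F. g s \<otimes> k (h - s)) = conv R g k h"
    by (rule conv_eq[symmetric]) (use fin in auto)
  finally show "conv R (\<lambda>h. f h \<oplus> g h) k h = conv R f k h \<oplus> conv R g k h" .
qed

theorem laurent_cring: "cring (laurent R w)"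
proof (rule cringI)
  show "abelian_group (laurent R w)"
  proof (rule abelian_groupI)
    fix x assume "x \<in> carrier (laurent R w)"
    then show "\<exists>y\<in>carrier (laurent R w). y \<oplus>\<^bsub>laurent R w\<^esub> x = \<zero>\<^bsub>laurent R w\<^esub>"
      by (intro bexI[of _ "\<lambda>h. \<ominus> x h"]) (auto simp: l_neg)
  qed (auto simp: a_ac)
  show "comm_monoid (laurent R w)"
  proof (rule comm_monoidI)
    fix x y assume "x \<in> carrier (laurent R w)" "y \<in> carrier (laurent R w)"
    then show "x \<otimes>\<^bsub>laurent R w\<^esub> y = y \<otimes>\<^bsub>laurent R w\<^esub> x" by (simp add: conv_comm)
  qed (auto simp: conv_assoc fun_eq_iff lmonom_conv)
qed (auto simp: conv_add_left)

lemma laurent_finsum: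
  assumes "finite A" "\<And>i. i \<in> A \<Longrightarrow> f i \<in> LC"
  shows "finsum (laurent R w) f A = (\<lambda>h. \<Oplus>i\<in>A. f i h)"
proof -
  interpret L: cring "laurent R w" by (rule laurent_cring)
  show ?thesis
    using assms
  proof (induction A rule: finite_induct)
    case (insert x F)
    then show ?case by (subst L.finsum_insert) (auto simp: fun_eq_iff finsum_insert)
  qed auto
qed

end

section \<open>Regrouping finite sums along fibres and bijections\<close>

context abelian_monoid
begin

lemma finsum_Sigma:
  assumes "finite A" "\<And>a. a \<in> A \<Longrightarrow> finite (B a)"
    "\<And>a b. a \<in> A \<Longrightarrow> b \<in> B a \<Longrightarrow> f a b \<in> carrier G"
  shows "(\<Oplus>a\<in>A. \<Oplus>b\<in>B a. f a b) = (\<Oplus>p\<in>Sigma A B. f (fst p) (snd p))"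
  using assms
proof (induction A rule: finite_induct)
  case (insert x F)
  have eq: "Sigma (insert x F) B = Pair x ` B x \<union> Sigma F B" by auto
  have "(\<Oplus>p\<in>Sigma (insert x F) B. f (fst p) (snd p)) =
      (\<Oplus>p\<in>Pair x ` B x. f (fst p) (snd p)) \<oplus> (\<Oplus>p\<in>Sigma F B. f (fst p) (snd p))"
    unfolding eq by (rule finsum_Un_disjoint) (use insert in auto)
  also have "(\<Oplus>p\<in>Pair x ` B x. f (fst p) (snd p)) = (\<Oplus>b\<in>B x. f x b)"
    by (subst finsum_reindex) (use insert in \<open>auto simp: inj_on_def\<close>)
  also have "(\<Oplus>p\<in>Sigma F B. f (fst p) (snd p)) = (\<Oplus>a\<in>F. \<Oplus>b\<in>B a. f a b)"
    using insert by auto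
  also have "(\<Oplus>b\<in>B x. f x b) \<oplus> \<dots> = (\<Oplus>a\<in>insert x F. \<Oplus>b\<in>B a. f a b)"
    by (rule finsum_insert[symmetric]) (use insert in auto)
  finally show ?case ..
qed auto

lemma finsum_bij:
  assumes "bij_betw g A B" "\<And>b. b \<in> B \<Longrightarrow> f b \<in> carrier G"
  shows "(\<Oplus>a\<in>A. f (g a)) = (\<Oplus>b\<in>B. f b)"
proof -
  have "inj_on g A" "g ` A = B" using assms(1) by (auto simp: bij_betw_def)
  then show ?thesis using finsum_reindex[of f g A] assms(2) by (auto simp: Pi_def)
qed

lemma finsum_fibres:
  assumes "finite F" "\<And>p. p \<in> F \<Longrightarrow> x p \<in> carrier G"
  shows "(\<Oplus>s\<in>e ` F. \<Oplus>p\<in>{p \<in> F. e p = s}. x p) = (\<Oplus>p\<in>F. x p)"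
proof -
  have "(\<Oplus>s\<in>e ` F. \<Oplus>p\<in>{p \<in> F. e p = s}. x p) = (\<Oplus>q\<in>(SIGMA s:e ` F. {p \<in> F. e p = s}). x (snd q))"
    by (rule finsum_Sigma) (use assms in auto)
  also have "\<dots> = (\<Oplus>p\<in>F. x (snd (e p, p)))"
    by (rule finsum_bij[symmetric]) (use assms in \<open>auto simp: bij_betw_def inj_on_def image_iff\<close>)
  finally show ?thesis by simp
qed

end

text \<open>All equational axioms are checked after applying the injective \<open>h\<close>.
  Existence of negatives is a separate assumption, because \<open>h\<close> need not be onto. It
  serves twice: for power series inside Laurent series, and for series with exponents in a cone
  inside all Laurent series.\<close>

lemma cring_pullback:
  assumes "cring B" and inj: "inj_on h (carrier A)"
    and closed: "\<And>x. x \<in> carrier A \<Longrightarrow> h x \<in> carrier B"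
      "\<And>x y. x \<in> carrier A \<Longrightarrow> y \<in> carrier A \<Longrightarrow> x \<oplus>\<^bsub>A\<^esub> y \<in> carrier A"
      "\<And>x y. x \<in> carrier A \<Longrightarrow> y \<in> carrier A \<Longrightarrow> x \<otimes>\<^bsub>A\<^esub> y \<in> carrier A"
      "\<zero>\<^bsub>A\<^esub> \<in> carrier A" "\<one>\<^bsub>A\<^esub> \<in> carrier A"
    and hom: "\<And>x y. x \<in> carrier A \<Longrightarrow> y \<in> carrier A \<Longrightarrow> h (x \<oplus>\<^bsub>A\<^esub> y) = h x \<oplus>\<^bsub>B\<^esub> h y"
      "\<And>x y. x \<in> carrier A \<Longrightarrow> y \<in> carrier A \<Longrightarrow> h (x \<otimes>\<^bsub>A\<^esub> y) = h x \<otimes>\<^bsub>B\<^esub> h y"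
      "h \<zero>\<^bsub>A\<^esub> = \<zero>\<^bsub>B\<^esub>" "h \<one>\<^bsub>A\<^esub> = \<one>\<^bsub>B\<^esub>"
    and neg: "\<And>x. x \<in> carrier A \<Longrightarrow> \<exists>y\<in>carrier A. y \<oplus>\<^bsub>A\<^esub> x = \<zero>\<^bsub>A\<^esub>"
  shows "cring A"
proof -
  interpret B: cring B by fact
  note D = inj_onD[OF inj]
  show ?thesis
  proof (rule cringI)
    show "abelian_group A"
      by (rule abelian_groupI) (use neg in \<open>auto intro!: D simp: closed hom B.a_ac\<close>)
    show "comm_monoid A"
      by (rule comm_monoidI) (auto intro!: D simp: closed hom B.m_ac)
  qed (auto intro!: D simp: closed hom B.l_distr)
qed

section \<open>Power series rings\<close>

lemma exps_0 [simp]: "(\<lambda>_. 0) \<in> exps n" by (simp add: exps_def)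

lemma exps_le: "r \<in> exps n \<Longrightarrow> (\<And>i. s i \<le> r i) \<Longrightarrow> s \<in> exps n"
  by (simp add: exps_def) (metis le_zero_eq)

lemma exps_diff: "r \<in> exps n \<Longrightarrow> (\<lambda>i. r i - s i) \<in> exps n"
  by (simp add: exps_def)

lemma finite_below:
  assumes "r \<in> exps n"
  shows "finite {s. \<forall>i. s i \<le> (r i :: nat)}"
proof (rule finite_subset)
  show "{s. \<forall>i. s i \<le> r i} \<subseteq> (\<lambda>g i. if i < n then g i else 0) ` ({..<n} \<rightarrow>\<^sub>E {..Max (r ` {..<n})})"
  proof
    fix s assume s: "s \<in> {s. \<forall>i. s i \<le> r i}"
    then have "s i = 0" if "i \<ge> n" for i using assms that by (metis (mono_tags, lifting) exps_def le_zero_eq mem_Collect_eq)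
    then have "s = (\<lambda>i. if i < n then restrict s {..<n} i else 0)" by (auto simp: fun_eq_iff)
    moreover have "s i \<le> Max (r ` {..<n})" if "i < n" for i
      using s that by (intro order.trans[OF _ Max_ge[of _ "r i"]]) auto
    then have "restrict s {..<n} \<in> {..<n} \<rightarrow>\<^sub>E {..Max (r ` {..<n})}" by auto
    ultimately show "s \<in> (\<lambda>g i. if i < n then g i else 0) ` ({..<n} \<rightarrow>\<^sub>E {..Max (r ` {..<n})})"
      by (intro image_eqI)
  qed
qed (auto intro!: finite_PiE)

text \<open>Power series regarded as Laurent series over the group of integer sequences, extended by
  zero outside the nonnegative exponents in the first \<open>n\<close> places.\<close>

definition mps_embed :: "nat \<Rightarrow> ('a, 'c) ring_scheme \<Rightarrow> ((nat \<Rightarrow> nat) \<Rightarrow> 'a) \<Rightarrow> (nat \<Rightarrow> int) \<Rightarrow> 'a" where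
  "mps_embed n R f h = (if (\<forall>i. h i \<ge> 0) \<and> (\<forall>i\<ge>n. h i = 0) then f (\<lambda>i. nat (h i)) else \<zero>\<^bsub>R\<^esub>)"

lemma mps_simps:
  "carrier (mps n R) = (exps n \<rightarrow>\<^sub>E carrier R)"
  "f \<otimes>\<^bsub>mps n R\<^esub> g = (\<lambda>r\<in>exps n. \<Oplus>\<^bsub>R\<^esub>s\<in>{s. \<forall>i. s i \<le> r i}. f s \<otimes>\<^bsub>R\<^esub> g (\<lambda>i. r i - s i))"
  "\<one>\<^bsub>mps n R\<^esub> = (\<lambda>r\<in>exps n. if r = (\<lambda>_. 0) then \<one>\<^bsub>R\<^esub> else \<zero>\<^bsub>R\<^esub>)"
  "\<zero>\<^bsub>mps n R\<^esub> = (\<lambda>r\<in>exps n. \<zero>\<^bsub>R\<^esub>)"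
  "f \<oplus>\<^bsub>mps n R\<^esub> g = (\<lambda>r\<in>exps n. f r \<oplus>\<^bsub>R\<^esub> g r)"
  by (simp_all add: mps_def)

context cring
begin

lemma mps_closed_mult:
  assumes "f \<in> exps n \<rightarrow>\<^sub>E carrier R" "g \<in> exps n \<rightarrow>\<^sub>E carrier R" "r \<in> exps n"
  shows "(\<Oplus>s\<in>{s. \<forall>i. s i \<le> r i}. f s \<otimes> g (\<lambda>i. r i - s i)) \<in> carrier R"
proof (rule finsum_closed, rule Pi_I)
  fix s assume "s \<in> {s. \<forall>i. s i \<le> r i}"
  then have "s \<in> exps n" "(\<lambda>i. r i - s i) \<in> exps n"
    using assms(3) exps_le[of r n s] exps_diff by auto
  then show "f s \<otimes> g (\<lambda>i. r i - s i) \<in> carrier R" using assms(1,2) by auto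
qed

text \<open>The ring axioms are inherited from a Laurent ring with the total degree as weight. The
  coefficients form an arbitrary commutative ring, so the result iterates to power series over power
  series.\<close>

theorem mps_cring: "cring (mps n R)"
proof -
  define w where "w = (\<lambda>h :: nat \<Rightarrow> int. \<Sum>i<n. h i)"
  interpret L: laurent_ring R w
    by unfold_locales (simp add: w_def sum.distrib)
  define e where "e = (\<lambda>r :: nat \<Rightarrow> nat. \<lambda>i. int (r i))"
  define P where "P = {h :: nat \<Rightarrow> int. (\<forall>i. h i \<ge> 0) \<and> (\<forall>i\<ge>n. h i = 0)}"
  have Pe: "P = e ` exps n"
  proof
    show "P \<subseteq> e ` exps n"
    proof
      fix h assume "h \<in> P"
      then show "h \<in> e ` exps n"
        by (intro image_eqI[of _ _ "\<lambda>i. nat (h i)"]) (auto simp: P_def e_def exps_def)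
    qed
  qed (auto simp: P_def e_def exps_def)
  have inj_e: "inj e" by (auto simp: inj_def e_def fun_eq_iff)
  let ?h = "mps_embed n R"
  have he: "?h f (e r) = f r" if "r \<in> exps n" for f r
    using that by (auto simp: mps_embed_def e_def exps_def)
  have hn: "?h f h = \<zero>" if "h \<notin> P" for f h
    using that by (auto simp: mps_embed_def P_def)
  \<comment> \<open>The total degree bounds each of the \<open>n\<close> coordinates; this is what
    places power series in the Laurent carrier.\<close>
  have fin: "finite {h \<in> P. w h \<le> m}" for m
  proof (rule finite_subset)
    show "{h \<in> P. w h \<le> m} \<subseteq> e ` {s. \<forall>i. s i \<le> (if i < n then nat m else 0)}"
    proof
      fix h assume h: "h \<in> {h \<in> P. w h \<le> m}"
      have "h i \<le> m" if "i < n" for i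
        using h that member_le_sum[of i "{..<n}" h] by (auto simp: P_def w_def)
      then show "h \<in> e ` {s. \<forall>i. s i \<le> (if i < n then nat m else 0)}"
        using h by (intro image_eqI[of _ _ "\<lambda>i. nat (h i)"]) (auto simp: P_def e_def fun_eq_iff nat_mono)
    qed
    show "finite (e ` {s. \<forall>i. s i \<le> (if i < n then nat m else 0)})"
      by (intro finite_imageI finite_below[of _ n]) (auto simp: exps_def)
  qed
  have hL: "?h f \<in> L.LC" if "f \<in> exps n \<rightarrow>\<^sub>E carrier R" for f
  proof (rule L.LCI)
    fix h show "?h f h \<in> carrier R"
    proof (cases "h \<in> P")
      case True
      then show ?thesis using that he Pe by auto
    qed (simp add: hn)
    show "finite {h. ?h f h \<noteq> \<zero> \<and> w h \<le> m}" for m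
      by (rule finite_subset[OF _ fin[of m]]) (use hn in auto)
  qed
  have ext: "F = F'" if "\<And>r. r \<in> exps n \<Longrightarrow> F (e r) = F' (e r)" "\<And>h. h \<notin> P \<Longrightarrow> F h = F' h" for F F' :: "(nat \<Rightarrow> int) \<Rightarrow> 'a"
    using that Pe by (metis ext imageE)
  have mult: "?h (f \<otimes>\<^bsub>mps n R\<^esub> g) = conv R (?h f) (?h g)"
    if fg: "f \<in> exps n \<rightarrow>\<^sub>E carrier R" "g \<in> exps n \<rightarrow>\<^sub>E carrier R" for f g
  proof (rule ext)
    fix r assume r: "r \<in> exps n"
    let ?B = "{s. \<forall>i. s i \<le> r i}"
    have sub: "s \<in> exps n" "(\<lambda>i. r i - s i) \<in> exps n" "e r - e s = e (\<lambda>i. r i - s i)" if "s \<in> ?B" for s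
      using that r exps_le[of r n s] exps_diff by (auto simp: e_def fun_eq_iff)
    have "conv R (?h f) (?h g) (e r) = (\<Oplus>s\<in>e ` ?B. ?h f s \<otimes> ?h g (e r - s))"
    proof (rule L.conv_eq)
      fix s assume "?h f s \<noteq> \<zero>" "?h g (e r - s) \<noteq> \<zero>"
      then have "s \<in> P" "e r - s \<in> P" using hn by metis+
      then show "s \<in> e ` ?B"
        by (intro image_eqI[of _ _ "\<lambda>i. nat (s i)"]) (auto simp: P_def e_def fun_eq_iff nat_le_iff)
    qed (use hL fg finite_below[OF r] in auto)
    also have "\<dots> = (\<Oplus>s\<in>?B. ?h f (e s) \<otimes> ?h g (e r - e s))"
      by (rule finsum_reindex) (use inj_e hL fg in \<open>auto intro: inj_on_subset\<close>)
    also have "\<dots> = (\<Oplus>s\<in>?B. f s \<otimes> g (\<lambda>i. r i - s i))"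
    proof (rule finsum_cong_closed)
      fix s assume s: "s \<in> ?B"
      show "?h f (e s) \<otimes> ?h g (e r - e s) = f s \<otimes> g (\<lambda>i. r i - s i)"
        unfolding sub(3)[OF s] using he[OF sub(1)[OF s]] he[OF sub(2)[OF s]] by simp
      show "f s \<otimes> g (\<lambda>i. r i - s i) \<in> carrier R"
        using PiE_mem[OF fg(1) sub(1)[OF s]] PiE_mem[OF fg(2) sub(2)[OF s]] by simp
    qed
    finally show "?h (f \<otimes>\<^bsub>mps n R\<^esub> g) (e r) = conv R (?h f) (?h g) (e r)"
      using r by (simp add: he mps_simps)
  next
    fix h assume h: "h \<notin> P"
    have "conv R (?h f) (?h g) h = \<zero>"
    proof (rule ccontr)
      assume "conv R (?h f) (?h g) h \<noteq> \<zero>"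
      then obtain a b where ab: "?h f a \<noteq> \<zero>" "?h g b \<noteq> \<zero>" "h = a + b"
        by (rule L.conv_nonzeroE)
      then have "a \<in> P" "b \<in> P" using hn by metis+
      then show False using ab(3) h by (auto simp: P_def)
    qed
    then show "?h (f \<otimes>\<^bsub>mps n R\<^esub> g) h = conv R (?h f) (?h g) h" by (simp add: hn h)
  qed
  show ?thesis
  proof (rule cring_pullback[of "laurent R w" ?h])
    show "cring (laurent R w)" by (rule L.laurent_cring)
    show "inj_on ?h (carrier (mps n R))"
    proof (rule inj_onI)
      fix x y assume xy: "x \<in> carrier (mps n R)" "y \<in> carrier (mps n R)" and eq: "?h x = ?h y"
      have "x r = y r" if "r \<in> exps n" for r
        using he[OF that, of x] he[OF that, of y] eq by simp
      then show "x = y" using xy by (auto simp: mps_simps intro: PiE_ext)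
    qed
    fix x assume x: "x \<in> carrier (mps n R)"
    show "?h x \<in> carrier (laurent R w)" using x hL by (simp add: mps_simps)
    show "\<exists>y\<in>carrier (mps n R). y \<oplus>\<^bsub>mps n R\<^esub> x = \<zero>\<^bsub>mps n R\<^esub>"
      using x by (intro bexI[of _ "\<lambda>r\<in>exps n. \<ominus> x r"]) (auto simp: mps_simps l_neg PiE_mem[of x "exps n" "\<lambda>_. carrier R"] fun_eq_iff)
    fix y assume y: "y \<in> carrier (mps n R)"
    show "x \<oplus>\<^bsub>mps n R\<^esub> y \<in> carrier (mps n R)" using x y by (auto simp: mps_simps)
    show "x \<otimes>\<^bsub>mps n R\<^esub> y \<in> carrier (mps n R)" using x y mps_closed_mult[of x n y] by (auto simp: mps_simps)
    show "?h (x \<oplus>\<^bsub>mps n R\<^esub> y) = ?h x \<oplus>\<^bsub>laurent R w\<^esub> ?h y"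
      by (rule ext) (auto simp: he hn mps_simps)
    show "?h (x \<otimes>\<^bsub>mps n R\<^esub> y) = ?h x \<otimes>\<^bsub>laurent R w\<^esub> ?h y"
      using mult x y by (simp add: mps_simps)
  next
    show "?h \<zero>\<^bsub>mps n R\<^esub> = \<zero>\<^bsub>laurent R w\<^esub>" by (rule ext) (auto simp: he hn mps_simps)
    show "?h \<one>\<^bsub>mps n R\<^esub> = \<one>\<^bsub>laurent R w\<^esub>"
    proof (rule ext)
      fix r assume "r \<in> exps n"
      moreover have "e r = 0 \<longleftrightarrow> r = (\<lambda>_. 0)" by (auto simp: e_def fun_eq_iff)
      ultimately show "?h \<one>\<^bsub>mps n R\<^esub> (e r) = \<one>\<^bsub>laurent R w\<^esub> (e r)"
        by (simp add: he mps_simps lmonom_def)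
    next
      fix h assume "h \<notin> P"
      moreover have "0 \<in> P" by (simp add: P_def)
      ultimately show "?h \<one>\<^bsub>mps n R\<^esub> h = \<one>\<^bsub>laurent R w\<^esub> h"
        by (auto simp: hn lmonom_def)
    qed
  qed (auto simp: mps_simps)
qed

lemma mps_finsum:
  assumes "finite A" "\<And>i. i \<in> A \<Longrightarrow> f i \<in> carrier (mps n R)" "m \<in> exps n"
  shows "finsum (mps n R) f A m = (\<Oplus>i\<in>A. f i m)"
proof -
  interpret M: cring "mps n R" by (rule mps_cring)
  show ?thesis
    using assms(1,2)
  proof (induction A rule: finite_induct)
    case empty
    then show ?case using assms(3) by (simp add: mps_simps)
  next
    case (insert x F)
    then have "finsum (mps n R) f (insert x F) = f x \<oplus>\<^bsub>mps n R\<^esub> finsum (mps n R) f F"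
      by (intro M.finsum_insert) auto
    moreover have "f i m \<in> carrier R" if "i \<in> insert x F" for i
      using insert(4)[OF that] assms(3) by (auto simp: mps_simps)
    ultimately show ?case using insert assms(3) by (simp add: mps_simps(5))
  qed
qed

section \<open>Monomials in power series rings\<close>

definition mpm :: "nat \<Rightarrow> (nat \<Rightarrow> nat) \<Rightarrow> (nat \<Rightarrow> nat) \<Rightarrow> 'a" where
  "mpm n a = (\<lambda>r\<in>exps n. if r = a then \<one> else \<zero>)"

lemma mpm_closed [simp]: "mpm n a \<in> carrier (mps n R)"
  by (auto simp: mpm_def mps_simps)

lemma mpm_mult:
  assumes "a \<in> exps n" "g \<in> carrier (mps n R)" "m \<in> exps n"
  shows "(mpm n a \<otimes>\<^bsub>mps n R\<^esub> g) m = (if \<forall>i. a i \<le> m i then g (\<lambda>i. m i - a i) else \<zero>)"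
proof -
  let ?B = "{s. \<forall>i. s i \<le> m i}"
  have g: "g (\<lambda>i. m i - s i) \<in> carrier R" for s
    using exps_diff[OF assms(3)] assms(2) by (auto simp: mps_simps)
  have "(mpm n a \<otimes>\<^bsub>mps n R\<^esub> g) m = (\<Oplus>s\<in>?B. mpm n a s \<otimes> g (\<lambda>i. m i - s i))"
    using assms by (simp add: mps_simps)
  also have "\<dots> = (\<Oplus>s\<in>?B. if s = a then g (\<lambda>i. m i - s i) else \<zero>)"
    by (rule finsum_cong_closed) (use assms exps_le g in \<open>auto simp: mpm_def\<close>)
  also have "\<dots> = (if a \<in> ?B then g (\<lambda>i. m i - a i) else \<zero>)"
    by (rule finsum_if_point) (use finite_below[OF assms(3)] g in auto)
  finally show ?thesis by simp
qed

lemma mpm_mpm: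
  assumes "a \<in> exps n" "b \<in> exps n"
  shows "mpm n a \<otimes>\<^bsub>mps n R\<^esub> mpm n b = mpm n (\<lambda>i. a i + b i)"
proof -
  interpret M: cring "mps n R" by (rule mps_cring)
  show ?thesis
  proof (rule PiE_ext[of _ "exps n" "\<lambda>_. carrier R"])
    show "mpm n a \<otimes>\<^bsub>mps n R\<^esub> mpm n b \<in> exps n \<rightarrow>\<^sub>E carrier R"
      using M.m_closed[OF mpm_closed mpm_closed, of a b] by (simp add: mps_simps(1))
    show "mpm n (\<lambda>i. a i + b i) \<in> exps n \<rightarrow>\<^sub>E carrier R"
      using mpm_closed by (simp add: mps_simps(1))
    fix m assume m: "m \<in> exps n"
    have "(\<forall>i. a i \<le> m i) \<and> (\<lambda>i. m i - a i) = b \<longleftrightarrow> m = (\<lambda>i. a i + b i)"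
      by (auto simp: fun_eq_iff) (metis le_add_diff_inverse)+
    then show "(mpm n a \<otimes>\<^bsub>mps n R\<^esub> mpm n b) m = mpm n (\<lambda>i. a i + b i) m"
      unfolding mpm_mult[OF assms(1) mpm_closed m] using m assms exps_diff[OF m] by (auto simp: mpm_def)
  qed
qed

lemma mps_var_eq: "mps_var n R i = mpm n (\<lambda>j. if j = i then 1 else 0)"
  by (simp add: mps_var_def mpm_def)

lemma mps_one_eq: "\<one>\<^bsub>mps n R\<^esub> = mpm n (\<lambda>_. 0)"
  by (simp add: mps_simps mpm_def)

lemma mps_var_pow:
  assumes "i < n"
  shows "mps_var n R i [^]\<^bsub>mps n R\<^esub> (k :: nat) = mpm n (\<lambda>j. if j = i then k else 0)"
proof -
  interpret M: cring "mps n R" by (rule mps_cring)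
  show ?thesis
  proof (induction k)
    case 0
    have "(\<lambda>j. if j = i then 0 else 0) = (\<lambda>_. 0 :: nat)" by auto
    then show ?case using mps_one_eq by simp
  next
    case (Suc k)
    have "(\<lambda>j. (if j = i then k else 0) + (if j = i then 1 else 0)) = (\<lambda>j. if j = i then Suc k else 0)" by auto
    then show ?case using Suc assms mpm_mpm[of "\<lambda>j. if j = i then k else 0" n "\<lambda>j. if j = i then 1 else 0"]
      by (simp add: mps_var_eq exps_def)
  qed
qed

lemma mps_monomial:
  fixes r :: "nat \<Rightarrow> nat"
  assumes "k \<le> n"
  shows "(\<Otimes>\<^bsub>mps n R\<^esub>i\<in>{..<k}. mps_var n R i [^]\<^bsub>mps n R\<^esub> r i) = mpm n (\<lambda>i. if i < k then r i else 0)"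
  using assms
proof (induction k)
  case 0
  interpret M: cring "mps n R" by (rule mps_cring)
  show ?case using mps_one_eq by simp
next
  case (Suc k)
  interpret M: cring "mps n R" by (rule mps_cring)
  have eq: "(\<lambda>j. (if j = k then r k else 0) + (if j < k then r j else 0)) = (\<lambda>j. if j < Suc k then r j else 0)"
    by (auto simp: fun_eq_iff less_Suc_eq)
  have "(\<Otimes>\<^bsub>mps n R\<^esub>i\<in>{..<Suc k}. mps_var n R i [^]\<^bsub>mps n R\<^esub> r i)
      = mps_var n R k [^]\<^bsub>mps n R\<^esub> r k \<otimes>\<^bsub>mps n R\<^esub> (\<Otimes>\<^bsub>mps n R\<^esub>i\<in>{..<k}. mps_var n R i [^]\<^bsub>mps n R\<^esub> r i)"
    unfolding lessThan_Suc using Suc by (intro M.finprod_insert) (auto simp: mps_var_pow)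
  also have "\<dots> = mpm n (\<lambda>j. if j = k then r k else 0) \<otimes>\<^bsub>mps n R\<^esub> mpm n (\<lambda>i. if i < k then r i else 0)"
    using Suc by (simp add: mps_var_pow)
  also have "\<dots> = mpm n (\<lambda>j. if j < Suc k then r j else 0)"
    using Suc by (subst mpm_mpm) (auto simp: exps_def eq)
  finally show ?case .
qed

end

section \<open>The exponent group and the Laurent presentation of the hypersurface\<close>

text \<open>Exponents live in integer polynomials, because these form a linearly ordered group. The monomial
  $x_0^{m_0}\cdots x_{d-1}^{m_{d-1}}u^k$ has the exponent with coefficient $m_i$ at $i<d$ and with the
  weight $k+2\sum m_i$ as leading coefficient, at $d$; so the order refines the weight. The relation
  makes $v$ a monomial with exponent $(r,-1)$.\<close>

locale exponents =
  fixes d :: nat and r :: "nat \<Rightarrow> nat"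
  assumes r_pos: "0 < (\<Sum>i<d. r i)"
begin

definition wt :: "int poly \<Rightarrow> int" where "wt h = coeff h d"

text \<open>The exponent of u, recovered from the weight. The weight counts the x-exponents twice
  because on \<open>HH\<close> the exponent of u can be as low as minus their sum; with the factor 2
  the weight stays at least that sum.\<close>

definition uu :: "int poly \<Rightarrow> int" where "uu h = coeff h d - 2 * (\<Sum>i<d. coeff h i)"

definition vec :: "(nat \<Rightarrow> int) \<Rightarrow> int \<Rightarrow> int poly" where
  "vec m k = (\<Sum>i<d. monom (m i) i) + monom (k + 2 * (\<Sum>i<d. m i)) d"

definition Grp :: "int poly set" where "Grp = {h. \<forall>i>d. coeff h i = 0}"

definition Cone :: "(nat \<Rightarrow> int) \<Rightarrow> int poly set" where
  "Cone c = {h \<in> Grp. \<forall>i<d. 0 \<le> coeff h i \<and> c i \<le> coeff h i + int (r i) * uu h}"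

abbreviation HH :: "int poly set" where "HH \<equiv> Cone (\<lambda>_. 0)"

lemma wt_add: "wt (g + h) = wt g + wt h" by (simp add: wt_def)

lemma uu_add [simp]: "uu (g + h) = uu g + uu h" by (simp add: uu_def sum.distrib)
lemma uu_diff [simp]: "uu (g - h) = uu g - uu h" by (simp add: uu_def sum_subtractf)
lemma uu_0 [simp]: "uu 0 = 0" by (simp add: uu_def)

lemma Grp_add [simp]: "g \<in> Grp \<Longrightarrow> h \<in> Grp \<Longrightarrow> g + h \<in> Grp" by (simp add: Grp_def)
lemma Grp_diff [simp]: "g \<in> Grp \<Longrightarrow> h \<in> Grp \<Longrightarrow> g - h \<in> Grp" by (simp add: Grp_def)
lemma Grp_0 [simp]: "0 \<in> Grp" by (simp add: Grp_def)

lemma coeff_vec: "coeff (vec m k) i = (if i < d then m i else if i = d then k + 2 * (\<Sum>i<d. m i) else 0)"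
  by (auto simp: vec_def coeff_sum)

lemma coeff_vec_less [simp]: "i < d \<Longrightarrow> coeff (vec m k) i = m i"
  by (simp add: coeff_vec)

lemma uu_vec [simp]: "uu (vec m k) = k" by (simp add: uu_def coeff_vec)
lemma vec_in_Grp [simp]: "vec m k \<in> Grp" by (simp add: Grp_def coeff_vec)

lemma wt_eq: "wt h = uu h + 2 * (\<Sum>i<d. coeff h i)" by (simp add: wt_def uu_def)

lemma Grp_eqI:
  assumes "g \<in> Grp" "h \<in> Grp" "\<And>i. i < d \<Longrightarrow> coeff g i = coeff h i" "uu g = uu h"
  shows "g = h"
proof (rule poly_eqI)
  fix i
  have "(\<Sum>i<d. coeff g i) = (\<Sum>i<d. coeff h i)" using assms(3) by (intro sum.cong) auto
  then have "coeff g d = coeff h d" using assms(4) by (simp add: uu_def)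
  then show "coeff g i = coeff h i"
    using assms by (cases "i < d"; cases "i = d") (auto simp: Grp_def)
qed

lemma vec_coeff [simp]: "h \<in> Grp \<Longrightarrow> vec (coeff h) (uu h) = h"
  by (rule Grp_eqI) auto

lemma vec_add: "vec m k + vec m' k' = vec (\<lambda>i. m i + m' i) (k + k')"
  by (rule Grp_eqI) auto

lemma vec_diff: "vec m k - vec m' k' = vec (\<lambda>i. m i - m' i) (k - k')"
  by (rule Grp_eqI) auto

lemma vec_zero: "vec (\<lambda>_. 0) 0 = 0"
  by (rule Grp_eqI) auto

lemma vec_cong: "(\<And>i. i < d \<Longrightarrow> m i = m' i) \<Longrightarrow> vec m k = vec m' k"
  by (rule Grp_eqI) auto

lemma vec_eq_iff: "vec m k = vec m' k' \<longleftrightarrow> (\<forall>i<d. m i = m' i) \<and> k = k'"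
  by (metis coeff_vec_less uu_vec vec_cong)

section \<open>Cones of exponents: translation, boundedness and finiteness\<close>

lemma ConeD:
  assumes "h \<in> Cone c"
  shows "h \<in> Grp" "i < d \<Longrightarrow> 0 \<le> coeff h i" "i < d \<Longrightarrow> c i \<le> coeff h i + int (r i) * uu h"
  using assms by (auto simp: Cone_def)

lemma vec_in_Cone: "vec m k \<in> Cone c \<longleftrightarrow> (\<forall>i<d. 0 \<le> m i \<and> c i \<le> m i + int (r i) * k)"
  by (auto simp: Cone_def)

lemma Cone_add: "g \<in> HH \<Longrightarrow> h \<in> Cone c \<Longrightarrow> g + h \<in> Cone c"
  by (auto simp: Cone_def algebra_simps add_nonneg_nonneg add_mono) (smt (verit))

lemma Cone_0 [simp]: "0 \<in> HH" by (simp add: Cone_def)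

lemma r_pos': obtains l where "l < d" "0 < r l"
  using r_pos by (metis (no_types, lifting) gr0I lessThan_iff sum.neutral less_irrefl)

text \<open>Some variable l occurs in f, and the cone inequalities at l give
  \<open>- uu h \<le> coeff h l\<close>. So the weight dominates the sum of the x-exponents, and it
  vanishes only at 0.\<close>

lemma HH_bounds:
  assumes "h \<in> HH"
  shows "i < d \<Longrightarrow> coeff h i \<le> wt h" "0 \<le> wt h" "wt h = 0 \<Longrightarrow> h = 0"
proof -
  note D = ConeD[OF assms]
  let ?S = "\<Sum>i<d. coeff h i"
  obtain l where l: "l < d" "0 < r l" by (rule r_pos')
  have S: "coeff h i \<le> ?S" if "i < d" for i
    using that D by (intro member_le_sum) auto
  have "- uu h \<le> coeff h l"
  proof (cases "uu h \<le> 0")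
    case True
    then have "int (r l) * uu h \<le> 1 * uu h" using l by (intro mult_right_mono_neg) auto
    then show ?thesis using D(3)[OF l(1)] by simp
  next
    case False
    then show ?thesis using D(2)[OF l(1)] by simp
  qed
  then have *: "?S \<le> wt h" using S[OF l(1)] by (simp add: wt_eq)
  have S0: "0 \<le> ?S" using D by (intro sum_nonneg) auto
  show "coeff h i \<le> wt h" if "i < d" using S[OF that] * by simp
  show "0 \<le> wt h" using * S0 by simp
  show "h = 0" if "wt h = 0"
  proof (rule Grp_eqI)
    have "?S = 0" using * S0 that by simp
    then show "coeff h i = coeff 0 i" if "i < d" for i
      using sum_nonneg_eq_0_iff[of "{..<d}" "coeff h"] D that by auto
    show "uu h = uu 0" using \<open>?S = 0\<close> \<open>wt h = 0\<close> by (simp add: wt_eq)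
  qed (use D in auto)
qed

text \<open>An element of \<open>Grp\<close> is given by d+1 integers. This d+1 is the growth order
  that ends up as the bound on the Krull dimension.\<close>

lemma Grp_box_finite: "finite {h \<in> Grp. \<forall>i\<le>d. a \<le> coeff h i \<and> coeff h i < b}"
  and Grp_box_card: "card {h \<in> Grp. \<forall>i\<le>d. a \<le> coeff h i \<and> coeff h i < b} \<le> nat (b - a) ^ Suc d"
proof -
  let ?B = "{h \<in> Grp. \<forall>i\<le>d. a \<le> coeff h i \<and> coeff h i < b}"
  let ?P = "{..d} \<rightarrow>\<^sub>E {a..<b}"
  have inj: "inj_on (\<lambda>h. restrict (coeff h) {..d}) ?B"
  proof (rule inj_onI)
    fix x y assume x: "x \<in> ?B" and y: "y \<in> ?B" and eq: "restrict (coeff x) {..d} = restrict (coeff y) {..d}"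
    have "coeff x i = coeff y i" for i
    proof (cases "i \<le> d")
      case True
      then show ?thesis using fun_cong[OF eq, of i] by simp
    next
      case False
      then show ?thesis using x y by (simp add: Grp_def)
    qed
    then show "x = y" by (rule poly_eqI)
  qed
  have sub: "(\<lambda>h. restrict (coeff h) {..d}) ` ?B \<subseteq> ?P" by (auto split: if_splits)
  have fin: "finite ?P" by (rule finite_PiE) auto
  show "finite ?B" by (rule inj_on_finite[OF inj sub fin])
  have "card ?B \<le> card ?P" by (rule card_inj_on_le[OF inj sub fin])
  also have "\<dots> = nat (b - a) ^ Suc d" by (simp add: card_PiE)
  finally show "card ?B \<le> nat (b - a) ^ Suc d" .
qed

lemma HH_subset_box: "{h \<in> HH. wt h < n} \<subseteq> {h \<in> Grp. \<forall>i\<le>d. 0 \<le> coeff h i \<and> coeff h i < n}"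
proof
  fix h assume h: "h \<in> {h \<in> HH. wt h < n}"
  have "0 \<le> coeff h i \<and> coeff h i < n" if "i \<le> d" for i
  proof (cases "i = d")
    case True
    then show ?thesis using h HH_bounds(2)[of h] by (simp add: wt_def)
  next
    case False
    then have "i < d" using that by simp
    then show ?thesis using h HH_bounds(1)[of h i] ConeD(2)[of h "\<lambda>_. 0" i] by auto
  qed
  then show "h \<in> {h \<in> Grp. \<forall>i\<le>d. 0 \<le> coeff h i \<and> coeff h i < n}" using h ConeD(1)[of h "\<lambda>_. 0"] by auto
qed

lemma HH_finite: "finite {h \<in> HH. wt h < n}"
  by (rule finite_subset[OF HH_subset_box Grp_box_finite])

lemma HH_card: "card {h \<in> HH. wt h < n} \<le> nat n ^ Suc d"
  using order.trans[OF card_mono[OF Grp_box_finite HH_subset_box[of n]] Grp_box_card[of 0 n]] by simp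

text \<open>\<open>Cone c\<close> is the union of two translates of \<open>HH\<close>, with corners
  at u-exponent t and t-1: on either side of this threshold one of the two families of inequalities
  implies the other. The cases that occur are t = 0, for -r <= c <= 0, and t = 1, for 0 <= c <=
  r.\<close>

lemma Cone_shift:
  fixes c :: "nat \<Rightarrow> int" and t :: int
  assumes "\<And>i. i < d \<Longrightarrow> c i \<le> int (r i) * t" "\<And>i. i < d \<Longrightarrow> int (r i) * (t - 1) \<le> c i" "h \<in> Cone c"
  shows "uu h \<ge> t \<Longrightarrow> h - vec (\<lambda>_. 0) t \<in> HH"
    and "uu h < t \<Longrightarrow> h - vec (\<lambda>i. c i - int (r i) * (t - 1)) (t - 1) \<in> HH"
    and "vec (\<lambda>_. 0) t \<in> Cone c" and "vec (\<lambda>i. c i - int (r i) * (t - 1)) (t - 1) \<in> Cone c"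
proof -
  note D = ConeD[OF assms(3)]
  show "h - vec (\<lambda>_. 0) t \<in> HH" if "uu h \<ge> t"
  proof -
    have "0 \<le> coeff h i + int (r i) * (uu h - t)" if "i < d" for i
      using D(2)[OF that] \<open>uu h \<ge> t\<close> by simp
    then show ?thesis using D by (simp add: Cone_def)
  qed
  show "h - vec (\<lambda>i. c i - int (r i) * (t - 1)) (t - 1) \<in> HH" if u: "uu h < t"
  proof -
    have "0 \<le> coeff h i - (c i - int (r i) * (t - 1)) \<and>
      0 \<le> coeff h i - (c i - int (r i) * (t - 1)) + int (r i) * (uu h - (t - 1))" if "i < d" for i
    proof -
      have "int (r i) * uu h \<le> int (r i) * (t - 1)" using u by (intro mult_left_mono) auto
      then show ?thesis using D(3)[OF that] by (simp add: algebra_simps)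
    qed
    then show ?thesis using D by (simp add: Cone_def)
  qed
  show "vec (\<lambda>_. 0) t \<in> Cone c" using assms(1) by (simp add: vec_in_Cone)
  show "vec (\<lambda>i. c i - int (r i) * (t - 1)) (t - 1) \<in> Cone c"
    using assms(2) by (simp add: vec_in_Cone)
qed

lemma Cone_finite:
  fixes c :: "nat \<Rightarrow> int"
  assumes "\<And>i. i < d \<Longrightarrow> c i \<le> int (r i) * t" "\<And>i. i < d \<Longrightarrow> int (r i) * (t - 1) \<le> c i"
  shows "finite {h \<in> Cone c. wt h \<le> n}"
proof -
  let ?p = "vec (\<lambda>_. 0) t" and ?q = "vec (\<lambda>i. c i - int (r i) * (t - 1)) (t - 1)"
  let ?F = "\<lambda>q. (\<lambda>g. g + q) ` {g \<in> HH. wt g < n - wt q + 1}"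
  have "{h \<in> Cone c. wt h \<le> n} \<subseteq> ?F ?p \<union> ?F ?q"
  proof
    fix h assume h: "h \<in> {h \<in> Cone c. wt h \<le> n}"
    then have "h - ?p \<in> HH \<or> h - ?q \<in> HH"
      using Cone_shift(1,2)[of c t h] assms by (cases "uu h \<ge> t") auto
    moreover have "h \<in> ?F q" if "h - q \<in> HH" for q
    proof (rule image_eqI[of _ _ "h - q"])
      show "h - q \<in> {g \<in> HH. wt g < n - wt q + 1}"
        using that h wt_add[of "h - q" q] by simp
    qed simp
    ultimately show "h \<in> ?F ?p \<union> ?F ?q" by blast
  qed
  moreover have "finite (?F ?p \<union> ?F ?q)" by (intro finite_UnI finite_imageI HH_finite)
  ultimately show ?thesis by (rule finite_subset)
qed

text \<open>The sign of an integer polynomial is that of its leading coefficient. A positive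
  difference in \<open>Grp\<close> has degree at most \<open>d\<close>, so its coefficient at
  \<open>d\<close>, the weight, is nonnegative.\<close>

lemma wt_mono:
  assumes "g \<in> Grp" "h \<in> Grp" "g \<le> h"
  shows "wt g \<le> wt h"
proof (cases "g = h")
  case False
  have "degree (h - g) \<le> d"
    using Grp_diff[OF assms(2,1)] by (intro degree_le) (auto simp: Grp_def)
  moreover have "0 < lead_coeff (h - g)"
  proof -
    have "0 < h - g" using assms(3) False by simp
    then have "pos_poly (h - g)" by (simp add: less_poly_def)
    then show ?thesis by (simp add: pos_poly_def last_coeffs_eq_coeff_degree)
  qed
  ultimately have "0 \<le> coeff (h - g) d"
    using coeff_eq_0[of "h - g" d] by (cases "degree (h - g) = d") (force simp del: coeff_diff)+
  then show ?thesis by (simp add: wt_def)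
qed simp

end

section \<open>The series ring of the cone and the substitution map to it\<close>

locale hypersurface = field K + exponents d r
  for K :: "'k ring" (structure) and d :: nat and r :: "nat \<Rightarrow> nat"
begin

sublocale L: laurent_ring K wt
  by unfold_locales (rule wt_add)

abbreviation LL :: "(int poly \<Rightarrow> 'k) ring" where "LL \<equiv> laurent K wt"

sublocale LR: cring LL by (rule L.laurent_cring)

definition QQ :: "(int poly \<Rightarrow> 'k) ring" where
  "QQ = LL\<lparr>carrier := {f \<in> L.LC. \<forall>h. h \<notin> HH \<longrightarrow> f h = \<zero>}\<rparr>"

lemma QQ_simps [simp]:
  "monoid.mult QQ = conv K" "one QQ = lmonom K 0 \<one>" "ring.zero QQ = (\<lambda>_. \<zero>)"
  "add QQ = (\<lambda>f g h. f h \<oplus> g h)"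
  by (simp_all add: QQ_def)

lemma supp_in_LC:
  assumes "\<And>h. f h \<in> carrier K" "\<And>h. f h \<noteq> \<zero> \<Longrightarrow> h \<in> HH"
  shows "f \<in> L.LC"
proof (rule L.LCI)
  show "finite {h. f h \<noteq> \<zero> \<and> wt h \<le> n}" for n
    by (rule finite_subset[OF _ HH_finite[of "n + 1"]]) (use assms(2) in auto)
qed (rule assms)

lemma conv_supp:
  assumes "\<And>h. f h \<noteq> \<zero> \<Longrightarrow> h \<in> HH" "\<And>h. g h \<noteq> \<zero> \<Longrightarrow> h \<in> Cone c" "conv K f g h \<noteq> \<zero>"
  shows "h \<in> Cone c"
  using assms Cone_add by (metis L.conv_nonzeroE)

lemma QQ_I:
  assumes "\<And>h. f h \<in> carrier K" "\<And>h. f h \<noteq> \<zero> \<Longrightarrow> h \<in> HH"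
  shows "f \<in> carrier QQ"
  using supp_in_LC[OF assms] assms(2) by (auto simp: QQ_def)

lemma QQ_LC: "f \<in> carrier QQ \<Longrightarrow> f \<in> L.LC"
  by (simp add: QQ_def)

lemma QQ_closed: "f \<in> carrier QQ \<Longrightarrow> f h \<in> carrier K"
  using QQ_LC by simp

lemma QQ_supp: "f \<in> carrier QQ \<Longrightarrow> f h \<noteq> \<zero> \<Longrightarrow> h \<in> HH"
  unfolding QQ_def by auto

lemma QQ_cring: "cring QQ"
proof (rule cring_pullback[of LL "\<lambda>f. f"])
  fix x assume x: "x \<in> carrier QQ"
  have "(\<lambda>h. \<ominus> x h) \<in> carrier QQ"
    by (rule QQ_I) (use QQ_closed[OF x] QQ_supp[OF x] in \<open>metis a_inv_closed minus_zero\<close>)+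
  then show "\<exists>y\<in>carrier QQ. y \<oplus>\<^bsub>QQ\<^esub> x = \<zero>\<^bsub>QQ\<^esub>"
    by (rule bexI[rotated]) (simp add: l_neg QQ_closed[OF x])
  show "x \<in> carrier LL" using QQ_LC[OF x] by simp
  fix y assume y: "y \<in> carrier QQ"
  show "x \<otimes>\<^bsub>QQ\<^esub> y \<in> carrier QQ"
  proof (rule QQ_I)
    show "(x \<otimes>\<^bsub>QQ\<^esub> y) h \<in> carrier K" for h using QQ_LC[OF x] QQ_LC[OF y] by simp
    show "h \<in> HH" if "(x \<otimes>\<^bsub>QQ\<^esub> y) h \<noteq> \<zero>" for h
      by (rule conv_supp[of x y]) (use that QQ_supp x y in auto)
  qed
  show "x \<oplus>\<^bsub>QQ\<^esub> y \<in> carrier QQ"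
  proof (rule QQ_I)
    show "(x \<oplus>\<^bsub>QQ\<^esub> y) h \<in> carrier K" for h using QQ_closed[OF x] QQ_closed[OF y] by simp
    show "h \<in> HH" if "(x \<oplus>\<^bsub>QQ\<^esub> y) h \<noteq> \<zero>" for h
    proof (rule ccontr)
      assume "h \<notin> HH"
      then have "x h = \<zero>" "y h = \<zero>" using QQ_supp x y by blast+
      then show False using that by simp
    qed
  qed
next
  show "\<zero>\<^bsub>QQ\<^esub> \<in> carrier QQ" "\<one>\<^bsub>QQ\<^esub> \<in> carrier QQ"
    by (rule QQ_I; auto simp: lmonom_def split: if_splits)+
qed (auto simp: L.laurent_cring)

text \<open>The exponent of the image of u^i v^j x^m, where \<open>fst p\<close> holds i and j and
  \<open>snd p\<close> holds m; each v contributes (r,-1).\<close>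

definition e :: "(nat \<Rightarrow> nat) \<times> (nat \<Rightarrow> nat) \<Rightarrow> int poly" where
  "e p = vec (\<lambda>i. int (snd p i) + int (fst p 1) * int (r i)) (int (fst p 0) - int (fst p 1))"

text \<open>Sending $v$ to minus the monomial of exponent $(r,-1)$ turns $f+uv=0$ into a monomial identity.\<close>

definition sg :: "(nat \<Rightarrow> nat) \<times> (nat \<Rightarrow> nat) \<Rightarrow> 'k" where
  "sg p = (\<ominus> \<one>) [^] fst p 1"

definition IX :: "((nat \<Rightarrow> nat) \<times> (nat \<Rightarrow> nat)) set" where
  "IX = exps 2 \<times> exps d"

definition fib :: "int poly \<Rightarrow> ((nat \<Rightarrow> nat) \<times> (nat \<Rightarrow> nat)) set" where
  "fib h = {p \<in> IX. e p = h}"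

abbreviation SS :: "((nat \<Rightarrow> nat) \<Rightarrow> 'k) ring" where "SS \<equiv> mps d K"
abbreviation TT :: "((nat \<Rightarrow> nat) \<Rightarrow> (nat \<Rightarrow> nat) \<Rightarrow> 'k) ring" where "TT \<equiv> mps 2 SS"

text \<open>Substitution of monomials for u, v and x, carried out coefficientwise. It makes sense
  because the fibres of \<open>e\<close> are finite.\<close>

definition phi :: "((nat \<Rightarrow> nat) \<Rightarrow> (nat \<Rightarrow> nat) \<Rightarrow> 'k) \<Rightarrow> int poly \<Rightarrow> 'k" where
  "phi t h = (\<Oplus>p\<in>fib h. sg p \<otimes> t (fst p) (snd p))"

definition padd :: "(nat \<Rightarrow> nat) \<times> (nat \<Rightarrow> nat) \<Rightarrow> (nat \<Rightarrow> nat) \<times> (nat \<Rightarrow> nat) \<Rightarrow> (nat \<Rightarrow> nat) \<times> (nat \<Rightarrow> nat)" where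
  "padd p q = ((\<lambda>i. fst p i + fst q i), (\<lambda>i. snd p i + snd q i))"

definition pdiff :: "(nat \<Rightarrow> nat) \<times> (nat \<Rightarrow> nat) \<Rightarrow> (nat \<Rightarrow> nat) \<times> (nat \<Rightarrow> nat) \<Rightarrow> (nat \<Rightarrow> nat) \<times> (nat \<Rightarrow> nat)" where
  "pdiff p q = ((\<lambda>i. fst p i - fst q i), (\<lambda>i. snd p i - snd q i))"

definition below :: "(nat \<Rightarrow> nat) \<times> (nat \<Rightarrow> nat) \<Rightarrow> ((nat \<Rightarrow> nat) \<times> (nat \<Rightarrow> nat)) set" where
  "below p = {s. \<forall>i. s i \<le> fst p i} \<times> {s. \<forall>i. s i \<le> snd p i}"

lemma S_cring: "cring SS" by (rule mps_cring)
lemma T_cring: "cring TT" by (rule cring.mps_cring[OF S_cring])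

lemma e_padd: "e (padd p q) = e p + e q"
  unfolding e_def vec_add by (rule vec_eq_iff[THEN iffD2]) (auto simp: padd_def algebra_simps)

lemma sg_closed [simp]: "sg p \<in> carrier K" by (simp add: sg_def)

lemma sg_padd: "sg (padd p q) = sg p \<otimes> sg q"
  by (simp add: sg_def padd_def nat_pow_mult)

lemma sg_square: "sg p \<otimes> sg p = \<one>"
proof -
  have "(\<ominus> \<one>) [^] (2 :: nat) = \<one>" by (simp add: numeral_2_eq_2 l_minus r_minus)
  then have "((\<ominus> \<one>) [^] (2 :: nat)) [^] (fst p 1) = \<one>" by simp
  then show ?thesis by (simp add: sg_def nat_pow_mult nat_pow_pow mult_2)
qed

lemma e_in_HH: "e p \<in> HH"
proof -
  have "0 \<le> int (snd p i) + int (fst p 1) * int (r i) + int (r i) * (int (fst p 0) - int (fst p 1))" for i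
    by (simp add: algebra_simps)
  then show ?thesis by (simp add: e_def vec_in_Cone)
qed

text \<open>For a variable l of f the exponent of v is at most the coordinate of h at l, since r l
  >= 1. Then \<open>uu h\<close> fixes the exponent of u, and the coordinates of h bound those of
  x.\<close>

lemma fib_finite: "finite (fib h)"
proof -
  obtain l where l: "l < d" "0 < r l" by (rule r_pos')
  define M where "M = nat (poly.coeff h l)"
  define N where "N = nat (\<Sum>i<d. \<bar>poly.coeff h i\<bar>)"
  have "fib h \<subseteq> below ((\<lambda>i. if i < 2 then M + nat \<bar>uu h\<bar> else 0), (\<lambda>i. if i < d then N else 0))"
  proof
    fix p assume p: "p \<in> fib h"
    then have pe: "h = e p" and IX: "fst p \<in> exps 2" "snd p \<in> exps d" by (auto simp: fib_def IX_def)
    have c: "poly.coeff h i = int (snd p i) + int (fst p 1) * int (r i)" if "i < d" for i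
      using that by (simp add: pe e_def)
    have "int (fst p 1) * 1 \<le> int (fst p 1) * int (r l)" using l by (intro mult_left_mono) auto
    then have 1: "fst p 1 \<le> M" using c[OF l(1)] by (simp add: M_def le_nat_iff)
    have "int (fst p 0) = uu h + int (fst p 1)" by (simp add: pe e_def)
    then have 0: "fst p 0 \<le> M + nat \<bar>uu h\<bar>" using 1 by linarith
    have s: "snd p i \<le> N" if "i < d" for i
    proof -
      have "int (snd p i) \<le> \<bar>poly.coeff h i\<bar>" using c[OF that] by simp
      also have "\<dots> \<le> (\<Sum>i<d. \<bar>poly.coeff h i\<bar>)" using that by (intro member_le_sum) auto
      finally show ?thesis by (simp add: N_def le_nat_iff sum_nonneg)
    qed
    have "fst p i \<le> (if i < 2 then M + nat \<bar>uu h\<bar> else 0)" for i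
      using 0 1 IX(1) by (cases "i = 0"; cases "i = 1") (auto simp: exps_def)
    moreover have "snd p i \<le> (if i < d then N else 0)" for i
      using s IX(2) by (auto simp: exps_def)
    ultimately show "p \<in> below ((\<lambda>i. if i < 2 then M + nat \<bar>uu h\<bar> else 0), (\<lambda>i. if i < d then N else 0))"
      by (cases p) (auto simp: below_def)
  qed
  moreover have "finite (below ((\<lambda>i. if i < 2 then M + nat \<bar>uu h\<bar> else 0), (\<lambda>i. if i < d then N else 0)))"
    unfolding below_def by (intro finite_cartesian_product finite_below[of _ 2] finite_below[of _ d]) (auto simp: exps_def)
  ultimately show ?thesis by (rule finite_subset)
qed

lemma T_coeff_closed: "t \<in> carrier TT \<Longrightarrow> p \<in> IX \<Longrightarrow> t (fst p) (snd p) \<in> carrier K"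
  using PiE_mem[of t "exps 2" "\<lambda>_. exps d \<rightarrow>\<^sub>E carrier K" "fst p"]
    PiE_mem[of "t (fst p)" "exps d" "\<lambda>_. carrier K" "snd p"]
  by (auto simp: mps_simps IX_def)

lemma below_IX: "c \<in> IX \<Longrightarrow> p \<in> below c \<Longrightarrow> p \<in> IX" "c \<in> IX \<Longrightarrow> pdiff c p \<in> IX"
  using exps_le[of "fst c" 2 "fst p"] exps_le[of "snd c" d "snd p"]
  by (auto simp: below_def IX_def pdiff_def intro: exps_diff)

lemma below_finite: "c \<in> IX \<Longrightarrow> finite (below c)"
  by (auto simp: below_def IX_def intro!: finite_cartesian_product finite_below)

lemma T_ext:
  assumes "s \<in> carrier TT" "t \<in> carrier TT" "\<And>p. p \<in> IX \<Longrightarrow> s (fst p) (snd p) = t (fst p) (snd p)"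
  shows "s = t"
proof (rule PiE_ext[of _ "exps 2" "\<lambda>_. carrier SS"])
  show "s \<in> exps 2 \<rightarrow>\<^sub>E carrier SS" "t \<in> exps 2 \<rightarrow>\<^sub>E carrier SS" using assms by (simp_all add: mps_simps)
  fix \<rho> assume rho: "\<rho> \<in> exps 2"
  show "s \<rho> = t \<rho>"
  proof (rule PiE_ext[of _ "exps d" "\<lambda>_. carrier K"])
    show "s \<rho> \<in> exps d \<rightarrow>\<^sub>E carrier K" "t \<rho> \<in> exps d \<rightarrow>\<^sub>E carrier K"
      using assms rho by (auto simp: mps_simps PiE_mem)
    show "s \<rho> m = t \<rho> m" if "m \<in> exps d" for m
      using assms(3)[of "(\<rho>, m)"] rho that by (simp add: IX_def)
  qed
qed

lemma T_mult_coeff: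
  assumes s: "s \<in> carrier TT" and t: "t \<in> carrier TT" and c: "c \<in> IX"
  shows "(s \<otimes>\<^bsub>TT\<^esub> t) (fst c) (snd c) =
    (\<Oplus>p\<in>below c. s (fst p) (snd p) \<otimes> t (fst (pdiff c p)) (snd (pdiff c p)))"
proof -
  interpret S: cring SS by (rule S_cring)
  have c': "fst c \<in> exps 2" "snd c \<in> exps d" using c by (auto simp: IX_def)
  let ?A = "{\<sigma>. \<forall>i. \<sigma> i \<le> fst c i}" and ?B = "{m. \<forall>i. m i \<le> snd c i}"
  have fin: "finite ?A" "finite ?B" using finite_below c' by auto
  have in2: "\<sigma> \<in> exps 2" "(\<lambda>i. fst c i - \<sigma> i) \<in> exps 2" if "\<sigma> \<in> ?A" for \<sigma>
    using that c' exps_le[of "fst c" 2 \<sigma>] exps_diff by auto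
  have ind: "m \<in> exps d" "(\<lambda>i. snd c i - m i) \<in> exps d" if "m \<in> ?B" for m
    using that c' exps_le[of "snd c" d m] exps_diff by auto
  have sc: "s \<sigma> \<in> carrier SS" if "\<sigma> \<in> exps 2" for \<sigma> using s that by (auto simp: mps_simps)
  have tc: "t \<sigma> \<in> carrier SS" if "\<sigma> \<in> exps 2" for \<sigma> using t that by (auto simp: mps_simps)
  have cl: "g m \<in> carrier K" if "g \<in> carrier SS" "m \<in> exps d" for g m using that by (auto simp: mps_simps)
  have "(s \<otimes>\<^bsub>TT\<^esub> t) (fst c) (snd c) = (\<Oplus>\<^bsub>SS\<^esub>\<sigma>\<in>?A. s \<sigma> \<otimes>\<^bsub>SS\<^esub> t (\<lambda>i. fst c i - \<sigma> i)) (snd c)"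
    using c' by (simp add: mps_simps(2)[of 2])
  also have "\<dots> = (\<Oplus>\<sigma>\<in>?A. (s \<sigma> \<otimes>\<^bsub>SS\<^esub> t (\<lambda>i. fst c i - \<sigma> i)) (snd c))"
    by (rule mps_finsum) (use fin in2 sc tc c' in \<open>auto intro!: S.m_closed\<close>)
  also have "\<dots> = (\<Oplus>\<sigma>\<in>?A. \<Oplus>m\<in>?B. s \<sigma> m \<otimes> t (\<lambda>i. fst c i - \<sigma> i) (\<lambda>i. snd c i - m i))"
    by (rule finsum_cong_closed)
      (use c' in2 ind sc tc cl in \<open>auto simp: mps_simps(2)[of d] intro!: finsum_closed\<close>)
  also have "\<dots> = (\<Oplus>p\<in>?A \<times> ?B. s (fst p) (snd p) \<otimes> t (\<lambda>i. fst c i - fst p i) (\<lambda>i. snd c i - snd p i))"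
    by (rule finsum_Sigma) (use fin in2 ind sc tc cl in auto)
  finally show ?thesis by (simp add: below_def pdiff_def)
qed

lemma phi_closed [simp]: "t \<in> carrier TT \<Longrightarrow> phi t h \<in> carrier K"
  unfolding phi_def by (rule finsum_closed) (auto simp: fib_def T_coeff_closed)

lemma phi_supp: "phi t h \<noteq> \<zero> \<Longrightarrow> h \<in> HH"
proof (rule ccontr)
  assume "phi t h \<noteq> \<zero>" "h \<notin> HH"
  then have "fib h = {}" using e_in_HH by (auto simp: fib_def)
  then show False using \<open>phi t h \<noteq> \<zero>\<close> by (simp add: phi_def)
qed

lemma phi_in_LC: "t \<in> carrier TT \<Longrightarrow> phi t \<in> L.LC"
  by (rule supp_in_LC) (auto dest: phi_supp)

lemma phi_in_QQ: "t \<in> carrier TT \<Longrightarrow> phi t \<in> carrier QQ"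
  by (rule QQ_I) (auto dest: phi_supp)

text \<open>Both sides sum over pairs of monomials whose exponents add up to h. The product in
  \<open>TT\<close> groups the pairs by the product monomial c, the convolution by the exponent of
  the first factor p; the passage between the two is (c,p) to (p,c-p).\<close>

lemma phi_mult:
  assumes s: "s \<in> carrier TT" and t: "t \<in> carrier TT"
  shows "phi (s \<otimes>\<^bsub>TT\<^esub> t) = conv K (phi s) (phi t)"
proof
  fix h
  let ?S = "\<lambda>p. sg p \<otimes> s (fst p) (snd p)" and ?T = "\<lambda>p. sg p \<otimes> t (fst p) (snd p)"
  \<comment> \<open>All monomials whose exponent has weight at most \<open>wt h\<close>. No other
    first factor contributes, because weights on \<open>HH\<close> are nonnegative.\<close>
  define F where "F = (\<Union>g\<in>{g \<in> HH. wt g < wt h + 1}. fib g)"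
  have finF: "finite F" unfolding F_def by (intro finite_UN_I HH_finite fib_finite)
  have FE: "p \<in> F \<longleftrightarrow> p \<in> IX \<and> wt (e p) \<le> wt h" for p
    using e_in_HH by (auto simp: F_def fib_def)
  have Fib: "{p \<in> F. e p = a} = fib a" if "a \<in> e ` F" for a
    using that FE by (auto simp: fib_def)
  have cl: "?S p \<in> carrier K" "?T p \<in> carrier K" if "p \<in> IX" for p
    using that T_coeff_closed s t by auto
  have "conv K (phi s) (phi t) h = (\<Oplus>a\<in>e ` F. phi s a \<otimes> phi t (h - a))"
  proof (rule L.conv_eq)
    fix a assume a: "phi s a \<noteq> \<zero>" "phi t (h - a) \<noteq> \<zero>"
    then have "fib a \<noteq> {}" by (auto simp: phi_def)
    then obtain p where p: "p \<in> IX" "e p = a" by (auto simp: fib_def)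
    have "0 \<le> wt (h - a)" using phi_supp[OF a(2)] HH_bounds(2) by auto
    then have "p \<in> F" using p FE[of p] by (simp add: L.w_diff)
    then show "a \<in> e ` F" using p(2) by blast
  qed (use finF s t phi_in_LC in auto)
  also have "\<dots> = (\<Oplus>a\<in>e ` F. \<Oplus>p\<in>{p \<in> F. e p = a}. ?S p \<otimes> phi t (h - e p))"
  proof (rule finsum_cong_closed)
    fix a assume a: "a \<in> e ` F"
    have "phi s a \<otimes> phi t (h - a) = (\<Oplus>p\<in>fib a. ?S p \<otimes> phi t (h - a))"
      unfolding phi_def[of s] by (rule finsum_ldistr) (use cl t fib_finite in \<open>auto simp: fib_def\<close>)
    also have "\<dots> = (\<Oplus>p\<in>{p \<in> F. e p = a}. ?S p \<otimes> phi t (h - e p))"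
      unfolding Fib[OF a] by (rule finsum_cong_closed) (use cl t in \<open>auto simp: fib_def\<close>)
    finally show "phi s a \<otimes> phi t (h - a) = (\<Oplus>p\<in>{p \<in> F. e p = a}. ?S p \<otimes> phi t (h - e p))" .
    show "(\<Oplus>p\<in>{p \<in> F. e p = a}. ?S p \<otimes> phi t (h - e p)) \<in> carrier K"
      by (rule finsum_closed) (use cl t FE in auto)
  qed
  also have "\<dots> = (\<Oplus>p\<in>F. ?S p \<otimes> phi t (h - e p))"
    by (rule finsum_fibres) (use finF cl t FE in auto)
  also have "\<dots> = (\<Oplus>p\<in>F. \<Oplus>q\<in>fib (h - e p). ?S p \<otimes> ?T q)"
    unfolding phi_def[of t]
    by (intro finsum_cong_closed finsum_rdistr finsum_closed) (use cl FE fib_finite in \<open>auto simp: fib_def\<close>)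
  also have "\<dots> = (\<Oplus>x\<in>(SIGMA p:F. fib (h - e p)). ?S (fst x) \<otimes> ?T (snd x))"
    by (rule finsum_Sigma) (use finF fib_finite cl FE in \<open>auto simp: fib_def\<close>)
  also have "\<dots> = (\<Oplus>y\<in>(SIGMA c:fib h. below c). ?S (snd y) \<otimes> ?T (pdiff (fst y) (snd y)))"
  proof -
    let ?g = "\<lambda>y :: ((nat \<Rightarrow> nat) \<times> (nat \<Rightarrow> nat)) \<times> ((nat \<Rightarrow> nat) \<times> (nat \<Rightarrow> nat)). (snd y, pdiff (fst y) (snd y))"
    have pd: "padd p (pdiff c p) = c" if "p \<in> below c" for p c
      using that by (cases c) (auto simp: padd_def pdiff_def below_def)
    have dp: "pdiff (padd p q) p = q" for p q
      by (cases q) (auto simp: padd_def pdiff_def)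
    have bel: "p \<in> IX \<and> pdiff c p \<in> IX" if "p \<in> below c" "c \<in> IX" for p c
      using that exps_le[of "fst c" 2 "fst p"] exps_le[of "snd c" d "snd p"]
      by (auto simp: below_def IX_def pdiff_def intro: exps_diff)
    have "bij_betw ?g (SIGMA c:fib h. below c) (SIGMA p:F. fib (h - e p))"
    proof (rule bij_betwI[where g = "\<lambda>x. (padd (fst x) (snd x), fst x)"])
      show "?g \<in> (SIGMA c:fib h. below c) \<rightarrow> (SIGMA p:F. fib (h - e p))"
      proof
        fix y assume "y \<in> (SIGMA c:fib h. below c)"
        then obtain c p where y: "y = (c, p)" "c \<in> IX" "e c = h" "p \<in> below c" by (auto simp: fib_def)
        have "e p + e (pdiff c p) = h" using e_padd[of p "pdiff c p"] pd[OF y(4)] y(3) by simp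
        moreover from this have "wt (e p) \<le> wt h"
          using HH_bounds(2)[OF e_in_HH[of "pdiff c p"]] by (auto simp: wt_add)
        ultimately show "?g y \<in> (SIGMA p:F. fib (h - e p))"
          using bel[OF y(4,2)] y FE by (auto simp: fib_def algebra_simps)
      qed
      show "(\<lambda>x. (padd (fst x) (snd x), fst x)) \<in> (SIGMA p:F. fib (h - e p)) \<rightarrow> (SIGMA c:fib h. below c)"
        using FE by (auto simp: fib_def e_padd) (auto simp: padd_def IX_def exps_def below_def)
    qed (auto simp: pd dp)
    then show ?thesis
      by (rule finsum_bij[where g = ?g and f = "\<lambda>x. ?S (fst x) \<otimes> ?T (snd x)", symmetric, simplified])
        (use cl FE in \<open>auto simp: fib_def\<close>)
  qed
  also have "\<dots> = (\<Oplus>c\<in>fib h. \<Oplus>p\<in>below c. ?S p \<otimes> ?T (pdiff c p))"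
  proof (rule finsum_Sigma[symmetric])
    fix c p assume "c \<in> fib h" "p \<in> below c"
    then have "p \<in> IX" "pdiff c p \<in> IX" using below_IX(1)[of c p] below_IX(2)[of c p] by (simp_all add: fib_def)
    then show "?S p \<otimes> ?T (pdiff c p) \<in> carrier K" using cl by blast
  qed (use fib_finite below_finite in \<open>auto simp: fib_def\<close>)
  also have "\<dots> = phi (s \<otimes>\<^bsub>TT\<^esub> t) h"
    unfolding phi_def
  proof (rule finsum_cong_closed)
    fix c assume "c \<in> fib h"
    then have c: "c \<in> IX" by (simp add: fib_def)
    have bel: "p \<in> IX" "pdiff c p \<in> IX" "padd p (pdiff c p) = c" if "p \<in> below c" for p
      using that c exps_le[of "fst c" 2 "fst p"] exps_le[of "snd c" d "snd p"]
      by (auto simp: below_def IX_def pdiff_def padd_def prod_eq_iff intro: exps_diff)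
    have finb: "finite (below c)"
      using c by (auto simp: below_def IX_def intro!: finite_cartesian_product finite_below)
    have "(\<Oplus>p\<in>below c. ?S p \<otimes> ?T (pdiff c p)) =
      (\<Oplus>p\<in>below c. sg c \<otimes> (s (fst p) (snd p) \<otimes> t (fst (pdiff c p)) (snd (pdiff c p))))"
    proof (rule finsum_cong_closed)
      fix p assume p: "p \<in> below c"
      note [simp] = T_coeff_closed[OF s bel(1)[OF p]] T_coeff_closed[OF t bel(2)[OF p]]
      have "sg c = sg p \<otimes> sg (pdiff c p)" using sg_padd[of p "pdiff c p"] bel(3)[OF p] by simp
      then show "?S p \<otimes> ?T (pdiff c p) = sg c \<otimes> (s (fst p) (snd p) \<otimes> t (fst (pdiff c p)) (snd (pdiff c p)))"
        by (simp add: m_ac)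
      show "sg c \<otimes> (s (fst p) (snd p) \<otimes> t (fst (pdiff c p)) (snd (pdiff c p))) \<in> carrier K" by simp
    qed
    also have "\<dots> = sg c \<otimes> (s \<otimes>\<^bsub>TT\<^esub> t) (fst c) (snd c)"
      unfolding T_mult_coeff[OF s t c]
      by (rule finsum_rdistr[symmetric]) (use finb bel T_coeff_closed s t in auto)
    finally show "(\<Oplus>p\<in>below c. ?S p \<otimes> ?T (pdiff c p)) = sg c \<otimes> (s \<otimes>\<^bsub>TT\<^esub> t) (fst c) (snd c)" .
    interpret T: cring TT by (rule T_cring)
    show "sg c \<otimes> (s \<otimes>\<^bsub>TT\<^esub> t) (fst c) (snd c) \<in> carrier K"
      using T_coeff_closed[OF T.m_closed[OF s t] c] by simp
  qed
  finally show "phi (s \<otimes>\<^bsub>TT\<^esub> t) h = conv K (phi s) (phi t) h" ..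
qed

lemma T_add_coeff:
  assumes "p \<in> IX"
  shows "(s \<oplus>\<^bsub>TT\<^esub> t) (fst p) (snd p) = s (fst p) (snd p) \<oplus> t (fst p) (snd p)"
  using assms by (simp add: mps_simps(5) IX_def mem_Times_iff)

lemma phi_add:
  assumes s: "s \<in> carrier TT" and t: "t \<in> carrier TT"
  shows "phi (s \<oplus>\<^bsub>TT\<^esub> t) h = phi s h \<oplus> phi t h"
proof -
  have cl: "s (fst p) (snd p) \<in> carrier K" "t (fst p) (snd p) \<in> carrier K" "p \<in> IX" if "p \<in> fib h" for p
    using that T_coeff_closed s t by (auto simp: fib_def)
  have "phi (s \<oplus>\<^bsub>TT\<^esub> t) h = (\<Oplus>p\<in>fib h. sg p \<otimes> s (fst p) (snd p) \<oplus> sg p \<otimes> t (fst p) (snd p))"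
    unfolding phi_def by (rule finsum_cong_closed) (use cl in \<open>auto simp: T_add_coeff r_distr\<close>)
  also have "\<dots> = phi s h \<oplus> phi t h"
    unfolding phi_def by (rule finsum_addf) (use cl in auto)
  finally show ?thesis .
qed

end

lemma (in cring) mps_const_mult:
  assumes "a \<in> carrier R" "g \<in> carrier (mps n R)" "m \<in> exps n"
  shows "(mps_const n R a \<otimes>\<^bsub>mps n R\<^esub> g) m = a \<otimes> g m"
proof -
  let ?B = "{s. \<forall>i. s i \<le> m i}"
  have g: "g s \<in> carrier R" if "s \<in> exps n" for s using assms(2) that by (auto simp: mps_simps)
  have g': "g (\<lambda>i. m i - s i) \<in> carrier R" for s using g[OF exps_diff[OF assms(3)]] .
  have "(mps_const n R a \<otimes>\<^bsub>mps n R\<^esub> g) m = (\<Oplus>s\<in>?B. mps_const n R a s \<otimes> g (\<lambda>i. m i - s i))"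
    using assms by (simp add: mps_simps)
  also have "\<dots> = (\<Oplus>s\<in>?B. if s = (\<lambda>_. 0) then a \<otimes> g (\<lambda>i. m i - s i) else \<zero>)"
    by (rule finsum_cong_closed) (use assms exps_le g' g[OF assms(3)] in \<open>auto simp: mps_const_def\<close>)
  also have "\<dots> = (if (\<lambda>_. 0) \<in> ?B then a \<otimes> g (\<lambda>i. m i - 0) else \<zero>)"
    by (rule finsum_if_point) (use finite_below[OF assms(3)] g[OF assms(3)] assms in auto)
  finally show ?thesis by simp
qed

section \<open>Kernel and image of the substitution map\<close>

context hypersurface
begin

text \<open>Cuts \<open>r\<close> off beyond \<open>d\<close>, where its values are unconstrained,
  so that the exponent of f is a genuine exponent vector.\<close>

definition rd :: "nat \<Rightarrow> nat" where "rd = (\<lambda>i. if i < d then r i else 0)"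
definition o2 :: "nat \<Rightarrow> nat" where "o2 = (\<lambda>i. if i < 2 then 1 else 0)"

definition mon :: "(nat \<Rightarrow> nat) \<Rightarrow> 'k" where
  "mon = (\<Otimes>\<^bsub>SS\<^esub>i\<in>{..<d}. mps_var d K i [^]\<^bsub>SS\<^esub> r i)"

definition eqn :: "(nat \<Rightarrow> nat) \<Rightarrow> (nat \<Rightarrow> nat) \<Rightarrow> 'k" where
  "eqn = mps_const 2 SS mon \<oplus>\<^bsub>TT\<^esub> mps_var 2 SS 0 \<otimes>\<^bsub>TT\<^esub> mps_var 2 SS 1"

lemma rd_exps [simp]: "rd \<in> exps d" by (simp add: rd_def exps_def)
lemma o2_exps [simp]: "o2 \<in> exps 2" by (simp add: o2_def exps_def)

lemma mon_eq: "mon = mpm d rd"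
  using mps_monomial[of d d r] by (simp add: mon_def rd_def)

lemma var_prod: "mps_var 2 SS 0 \<otimes>\<^bsub>TT\<^esub> mps_var 2 SS 1 = cring.mpm SS 2 o2"
proof -
  interpret S: cring SS by (rule S_cring)
  have "(\<lambda>j. (if j = 0 then 1 else 0) + (if j = 1 then 1 else 0)) = o2"
    by (auto simp: o2_def fun_eq_iff)
  then show ?thesis
    using S.mpm_mpm[of "\<lambda>j. if j = 0 then 1 else 0" 2 "\<lambda>j. if j = 1 then 1 else 0"]
    by (simp add: S.mps_var_eq exps_def)
qed

lemma const_closed: "mps_const 2 SS mon \<in> carrier TT"
proof -
  interpret S: cring SS by (rule S_cring)
  show ?thesis unfolding mon_eq by (auto simp: mps_simps(1)[of 2] mps_const_def)
qed

lemma var_prod_closed: "cring.mpm SS 2 o2 \<in> carrier TT"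
proof -
  interpret S: cring SS by (rule S_cring)
  show ?thesis by simp
qed

lemma eqn_closed: "eqn \<in> carrier TT"
proof -
  interpret T: cring TT by (rule T_cring)
  show ?thesis unfolding eqn_def var_prod using const_closed var_prod_closed by simp
qed

lemma eqn_mult_coeff:
  assumes t: "t \<in> carrier TT" and p: "\<rho> \<in> exps 2" "m \<in> exps d"
  shows "(t \<otimes>\<^bsub>TT\<^esub> eqn) \<rho> m =
    (if \<forall>i. rd i \<le> m i then t \<rho> (\<lambda>i. m i - rd i) else \<zero>) \<oplus>
    (if \<forall>i. o2 i \<le> \<rho> i then t (\<lambda>i. \<rho> i - o2 i) m else \<zero>)"
proof -
  interpret S: cring SS by (rule S_cring)
  interpret T: cring TT by (rule T_cring)
  have pI: "(\<rho>, m) \<in> IX" using p by (simp add: IX_def)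
  have "t \<otimes>\<^bsub>TT\<^esub> eqn = mps_const 2 SS mon \<otimes>\<^bsub>TT\<^esub> t \<oplus>\<^bsub>TT\<^esub> cring.mpm SS 2 o2 \<otimes>\<^bsub>TT\<^esub> t"
    unfolding eqn_def var_prod using const_closed var_prod_closed t by (simp add: T.r_distr T.m_comm)
  then have "(t \<otimes>\<^bsub>TT\<^esub> eqn) \<rho> m = (mps_const 2 SS mon \<otimes>\<^bsub>TT\<^esub> t) \<rho> m \<oplus> (cring.mpm SS 2 o2 \<otimes>\<^bsub>TT\<^esub> t) \<rho> m"
    using T_add_coeff[OF pI] by simp
  also have "(mps_const 2 SS mon \<otimes>\<^bsub>TT\<^esub> t) \<rho> m = (if \<forall>i. rd i \<le> m i then t \<rho> (\<lambda>i. m i - rd i) else \<zero>)"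
  proof -
    have "t \<rho> \<in> carrier SS" using t p by (auto simp: mps_simps(1)[of 2])
    then show ?thesis
      using S.mps_const_mult[of mon t 2 \<rho>] t p mpm_mult[OF rd_exps, of "t \<rho>" m] by (simp add: mon_eq)
  qed
  also have "(cring.mpm SS 2 o2 \<otimes>\<^bsub>TT\<^esub> t) \<rho> m = (if \<forall>i. o2 i \<le> \<rho> i then t (\<lambda>i. \<rho> i - o2 i) m else \<zero>)"
    using S.mpm_mult[OF o2_exps t p(1)] p(2) by (simp add: mps_simps(4)[of d])
  finally show ?thesis .
qed

lemma phi_delta:
  assumes "t \<in> carrier TT" "q \<in> IX"
    "\<And>p. p \<in> IX \<Longrightarrow> t (fst p) (snd p) = (if p = q then \<one> else \<zero>)"
  shows "phi t h = (if e q = h then sg q else \<zero>)"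
proof -
  have "phi t h = (\<Oplus>p\<in>fib h. if p = q then sg p else \<zero>)"
    unfolding phi_def by (rule finsum_cong_closed) (use assms in \<open>auto simp: fib_def\<close>)
  also have "\<dots> = (if q \<in> fib h then sg q else \<zero>)"
    by (rule finsum_if_point) (use fib_finite in auto)
  finally show ?thesis using assms(2) by (simp add: fib_def)
qed

text \<open>f and uv are both sent to the exponent (r,0), with signs 1 and -1.\<close>

lemma phi_eqn: "phi eqn = (\<lambda>_. \<zero>)"
proof
  fix h
  interpret S: cring SS by (rule S_cring)
  let ?p1 = "((\<lambda>_. 0), rd)" and ?p2 = "(o2, (\<lambda>_. 0))"
  have IX: "?p1 \<in> IX" "?p2 \<in> IX" by (auto simp: IX_def)
  have "phi eqn h = phi (mps_const 2 SS mon) h \<oplus> phi (cring.mpm SS 2 o2) h"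
    unfolding eqn_def var_prod by (rule phi_add[OF const_closed var_prod_closed])
  also have "phi (mps_const 2 SS mon) h = (if e ?p1 = h then sg ?p1 else \<zero>)"
    by (rule phi_delta[OF const_closed IX(1)])
      (auto simp: mps_const_def mon_eq mpm_def mps_simps(4) IX_def prod_eq_iff)
  also have "phi (cring.mpm SS 2 o2) h = (if e ?p2 = h then sg ?p2 else \<zero>)"
    by (rule phi_delta[OF var_prod_closed IX(2)])
      (auto simp: S.mpm_def mps_simps(3,4) IX_def prod_eq_iff)
  also have "e ?p1 = e ?p2"
    unfolding e_def vec_eq_iff by (simp add: rd_def o2_def)
  also have "sg ?p1 = \<one>" by (simp add: sg_def)
  also have "sg ?p2 = \<ominus> \<one>" by (simp add: sg_def o2_def)
  finally show "phi eqn h = \<zero>" by (simp add: r_neg)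
qed

lemma phi_one: "phi \<one>\<^bsub>TT\<^esub> = \<one>\<^bsub>QQ\<^esub>"
proof
  fix h
  interpret T: cring TT by (rule T_cring)
  let ?q = "((\<lambda>_. 0), (\<lambda>_. 0)) :: (nat \<Rightarrow> nat) \<times> (nat \<Rightarrow> nat)"
  have "phi \<one>\<^bsub>TT\<^esub> h = (if e ?q = h then sg ?q else \<zero>)"
    by (rule phi_delta[OF T.one_closed]) (auto simp: mps_simps(3,4) IX_def prod_eq_iff)
  moreover have "e ?q = 0" by (simp add: e_def vec_zero)
  ultimately show "phi \<one>\<^bsub>TT\<^esub> h = \<one>\<^bsub>QQ\<^esub> h" by (auto simp: sg_def lmonom_def)
qed

lemma phi_hom: "ring_hom_ring TT QQ phi"
proof (rule ring_hom_ringI)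
  show "ring TT" using T_cring by (simp add: cring_def)
  show "ring QQ" using QQ_cring by (simp add: cring_def)
qed (auto simp: phi_in_QQ phi_mult phi_add phi_one fun_eq_iff)

definition mk2 :: "nat \<Rightarrow> nat \<Rightarrow> nat \<Rightarrow> nat" where
  "mk2 i j = (\<lambda>x. if x = 0 then i else if x = 1 then j else 0)"

lemma mk2_exps [simp]: "mk2 i j \<in> exps 2" by (simp add: mk2_def exps_def)
lemma mk2_simps [simp]: "mk2 i j 0 = i" "mk2 i j (Suc 0) = j" by (simp_all add: mk2_def)
lemma mk2_eta: "\<rho> \<in> exps 2 \<Longrightarrow> mk2 (\<rho> 0) (\<rho> 1) = \<rho>"
  by (auto simp: mk2_def exps_def fun_eq_iff)

lemma e_mk2: "e (mk2 i j, m) = vec (\<lambda>l. int (m l) + int j * int (r l)) (int i - int j)"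
  by (simp add: e_def)

text \<open>The coefficients of a quotient $g$ of $t$ by $f+uv$ up to normal form satisfy
  $g_{i,j} = t_{i+1,j+1} - f g_{i+1,j+1}$. The first argument bounds the number of unfoldings; as $f$
  has positive degree, the total degree of the exponent suffices.\<close>

primrec quo :: "nat \<Rightarrow> ((nat \<Rightarrow> nat) \<Rightarrow> (nat \<Rightarrow> nat) \<Rightarrow> 'k) \<Rightarrow> nat \<Rightarrow> nat \<Rightarrow> (nat \<Rightarrow> nat) \<Rightarrow> 'k" where
  "quo 0 t i j m = \<zero>"
| "quo (Suc n) t i j m = t (mk2 (Suc i) (Suc j)) m \<ominus>
     (if \<forall>l. rd l \<le> m l then quo n t (Suc i) (Suc j) (\<lambda>l. m l - rd l) else \<zero>)"

definition quot :: "((nat \<Rightarrow> nat) \<Rightarrow> (nat \<Rightarrow> nat) \<Rightarrow> 'k) \<Rightarrow> nat \<Rightarrow> nat \<Rightarrow> (nat \<Rightarrow> nat) \<Rightarrow> 'k" where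
  "quot t i j m = quo (Suc (\<Sum>l<d. m l)) t i j m"

lemma quo_closed:
  assumes "t \<in> carrier TT"
  shows "m \<in> exps d \<Longrightarrow> quo n t i j m \<in> carrier K"
proof (induction n arbitrary: i j m)
  case 0
  then show ?case by simp
next
  case (Suc n)
  then show ?case
    using T_coeff_closed[OF assms, of "(mk2 (Suc i) (Suc j), m)"] exps_diff[OF Suc.prems]
    by (auto simp: IX_def)
qed

text \<open>Positivity of the degree of f is what makes the recursion for \<open>quo\<close> run
  out.\<close>

lemma rd_sum_less:
  assumes "\<forall>l. rd l \<le> m l"
  shows "(\<Sum>l<d. m l - rd l) < (\<Sum>l<d. m l)"
proof -
  have "(\<Sum>l<d. m l) = (\<Sum>l<d. (m l - rd l) + rd l)"
    using assms by (intro sum.cong) auto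
  also have "\<dots> = (\<Sum>l<d. m l - rd l) + (\<Sum>l<d. r l)"
    by (simp add: sum.distrib rd_def)
  finally show ?thesis using r_pos by simp
qed

text \<open>Every bound above the total degree allows all unfoldings that can occur, so the value no
  longer depends on it; hence \<open>quot\<close> obeys the recursion without a bound.\<close>

lemma quo_stable:
  "(\<Sum>l<d. m l) < n \<Longrightarrow> (\<Sum>l<d. m l) < n' \<Longrightarrow> quo n t i j m = quo n' t i j m"
proof (induction n arbitrary: n' i j m)
  case (Suc n)
  then obtain k where k: "n' = Suc k" by (cases n') auto
  have "quo n t (Suc i) (Suc j) (\<lambda>l. m l - rd l) = quo k t (Suc i) (Suc j) (\<lambda>l. m l - rd l)"
    if "\<forall>l. rd l \<le> m l"
    using rd_sum_less[OF that] Suc.prems k by (intro Suc.IH) auto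
  then show ?case by (simp add: k)
qed simp

lemma quot_rec:
  "quot t i j m = t (mk2 (Suc i) (Suc j)) m \<ominus>
     (if \<forall>l. rd l \<le> m l then quot t (Suc i) (Suc j) (\<lambda>l. m l - rd l) else \<zero>)"
proof -
  have "quo (\<Sum>l<d. m l) t (Suc i) (Suc j) (\<lambda>l. m l - rd l) = quot t (Suc i) (Suc j) (\<lambda>l. m l - rd l)"
    if "\<forall>l. rd l \<le> m l"
    unfolding quot_def using rd_sum_less[OF that] by (intro quo_stable) auto
  then show ?thesis unfolding quot_def[of t i j m] by simp
qed

lemma quot_closed: "t \<in> carrier TT \<Longrightarrow> m \<in> exps d \<Longrightarrow> quot t i j m \<in> carrier K"
  unfolding quot_def by (rule quo_closed)

text \<open>No monomial of t is divisible by uv. On such monomials \<open>e\<close> is injective,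
  since the difference of the exponents of u and v, one of which is 0, determines both. So at each
  exponent reached, \<open>phi t\<close> has up to sign a single coefficient of t.\<close>

lemma phi_normal_form_inj:
  assumes t: "t \<in> carrier TT" and phi: "\<And>h. phi t h = \<zero>"
    and nf: "\<And>i j m. m \<in> exps d \<Longrightarrow> t (mk2 (Suc i) (Suc j)) m = \<zero>"
  shows "t = \<zero>\<^bsub>TT\<^esub>"
proof (rule T_ext[OF t])
  interpret T: cring TT by (rule T_cring)
  show "\<zero>\<^bsub>TT\<^esub> \<in> carrier TT" by simp
  fix p assume p: "p \<in> IX"
  obtain \<rho> m where pm: "p = (\<rho>, m)" by (cases p)
  have rho: "\<rho> \<in> exps 2" "m \<in> exps d" using p pm by (auto simp: IX_def)
  have "t \<rho> m = \<zero>"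
  proof (cases "\<rho> 0 > 0 \<and> \<rho> 1 > 0")
    case True
    then obtain i j where "\<rho> 0 = Suc i" "\<rho> 1 = Suc j" by (metis gr0_implies_Suc)
    then show ?thesis using nf[OF rho(2), of i j] mk2_eta[OF rho(1)] by simp
  next
    case False
    have zero: "t (fst q) (snd q) = \<zero>" if q: "q \<in> fib (e p)" "q \<noteq> p" for q
    proof (rule ccontr)
      assume nz: "t (fst q) (snd q) \<noteq> \<zero>"
      obtain \<sigma> m' where qm: "q = (\<sigma>, m')" by (cases q)
      have sig: "\<sigma> \<in> exps 2" "m' \<in> exps d" and eq: "e q = e p" using q qm by (auto simp: fib_def IX_def)
      have "\<not> (\<sigma> 0 > 0 \<and> \<sigma> 1 > 0)"
      proof
        assume "\<sigma> 0 > 0 \<and> \<sigma> 1 > 0"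
        then obtain i j where "\<sigma> 0 = Suc i" "\<sigma> 1 = Suc j" by (metis gr0_implies_Suc)
        then show False using nf[OF sig(2), of i j] mk2_eta[OF sig(1)] nz qm by simp
      qed
      moreover have "int (\<sigma> 0) - int (\<sigma> 1) = int (\<rho> 0) - int (\<rho> 1)"
        and m: "\<forall>i<d. int (m' i) + int (\<sigma> 1) * int (r i) = int (m i) + int (\<rho> 1) * int (r i)"
        using eq unfolding e_def vec_eq_iff by (auto simp: pm qm)
      ultimately have 01: "\<sigma> 0 = \<rho> 0" "\<sigma> 1 = \<rho> 1" using False by auto
      then have "\<sigma> = \<rho>" using mk2_eta[OF sig(1)] mk2_eta[OF rho(1)] by simp
      moreover have "m' = m"
      proof
        fix i show "m' i = m i" using m 01(2) sig(2) rho(2) by (cases "i < d") (auto simp: exps_def)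
      qed
      ultimately show False using q(2) pm qm by simp
    qed
    have "phi t (e p) = (\<Oplus>q\<in>fib (e p). if q = p then sg q \<otimes> t (fst q) (snd q) else \<zero>)"
      unfolding phi_def using zero p T_coeff_closed[OF t]
      by (intro finsum_cong_closed) (auto simp: fib_def)
    also have "\<dots> = (if p \<in> fib (e p) then sg p \<otimes> t (fst p) (snd p) else \<zero>)"
      by (rule finsum_if_point) (use fib_finite T_coeff_closed[OF t] in \<open>auto simp: fib_def\<close>)
    also have "\<dots> = sg p \<otimes> t (fst p) (snd p)" using p by (simp add: fib_def)
    finally have "sg p \<otimes> t (fst p) (snd p) = \<zero>" using phi by simp
    then have "sg p \<otimes> (sg p \<otimes> t (fst p) (snd p)) = \<zero>" by simp
    then show ?thesis
      using T_coeff_closed[OF t p] sg_square[of p] pm by (simp add: m_assoc[symmetric])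
  qed
  then show "t (fst p) (snd p) = \<zero>\<^bsub>TT\<^esub> (fst p) (snd p)"
    using rho by (simp add: pm mps_simps(4))
qed

text \<open>Subtracting the multiple of f+uv prescribed by \<open>quot\<close> leaves a series
  without monomials divisible by uv, and on those series \<open>phi\<close> is injective.\<close>

lemma kernel_phi: "a_kernel TT QQ phi = PIdl\<^bsub>TT\<^esub> eqn"
proof
  interpret T: cring TT by (rule T_cring)
  show "PIdl\<^bsub>TT\<^esub> eqn \<subseteq> a_kernel TT QQ phi"
  proof
    fix x assume "x \<in> PIdl\<^bsub>TT\<^esub> eqn"
    then obtain t where t: "t \<in> carrier TT" "x = t \<otimes>\<^bsub>TT\<^esub> eqn" by (auto simp: cgenideal_def)
    have "conv K (phi t) (\<lambda>_. \<zero>) = (\<lambda>_. \<zero>)"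
      using LR.r_null[of "phi t"] phi_in_LC[OF t(1)] by simp
    then have "phi x = \<zero>\<^bsub>QQ\<^esub>"
      using phi_mult[OF t(1) eqn_closed] t(2) phi_eqn by simp
    then show "x \<in> a_kernel TT QQ phi"
      using t eqn_closed by (simp add: a_kernel_def' )
  qed
  show "a_kernel TT QQ phi \<subseteq> PIdl\<^bsub>TT\<^esub> eqn"
  proof
    fix t assume "t \<in> a_kernel TT QQ phi"
    then have t: "t \<in> carrier TT" and t0: "phi t = (\<lambda>_. \<zero>)" by (auto simp: a_kernel_def')
    define g where "g = (\<lambda>\<rho>\<in>exps 2. \<lambda>m\<in>exps d. quot t (\<rho> 0) (\<rho> 1) m)"
    have g: "g \<in> carrier TT" by (auto simp: g_def mps_simps quot_closed[OF t])
    have ge: "g \<otimes>\<^bsub>TT\<^esub> eqn \<in> carrier TT" using g eqn_closed by simp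
    define t' where "t' = t \<ominus>\<^bsub>TT\<^esub> g \<otimes>\<^bsub>TT\<^esub> eqn"
    have t': "t' \<in> carrier TT" using t ge by (simp add: t'_def)
    have tsum: "t = t' \<oplus>\<^bsub>TT\<^esub> g \<otimes>\<^bsub>TT\<^esub> eqn"
      using t ge by (simp add: t'_def T.minus_eq T.a_assoc T.l_neg)
    have "t' = \<zero>\<^bsub>TT\<^esub>"
    proof (rule phi_normal_form_inj[OF t'])
      fix h
      have "conv K (phi g) (\<lambda>_. \<zero>) = (\<lambda>_. \<zero>)"
        using LR.r_null[of "phi g"] phi_in_LC[OF g] by simp
      then have "phi (g \<otimes>\<^bsub>TT\<^esub> eqn) h = \<zero>" using phi_mult[OF g eqn_closed] phi_eqn by simp
      moreover have "phi t h = phi t' h \<oplus> phi (g \<otimes>\<^bsub>TT\<^esub> eqn) h"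
        using phi_add[OF t' ge, of h] tsum by simp
      ultimately show "phi t' h = \<zero>" using t0 phi_closed[OF t'] by simp
    next
      fix i j m assume m: "m \<in> exps d"
      let ?q = "(mk2 (Suc i) (Suc j), m)"
      have IX: "?q \<in> IX" using m by (simp add: IX_def)
      have dif: "(\<lambda>x. mk2 (Suc i) (Suc j) x - o2 x) = mk2 i j" "\<forall>x. o2 x \<le> mk2 (Suc i) (Suc j) x"
        by (auto simp: mk2_def o2_def fun_eq_iff)
      have "(g \<otimes>\<^bsub>TT\<^esub> eqn) (mk2 (Suc i) (Suc j)) m =
        (if \<forall>l. rd l \<le> m l then quot t (Suc i) (Suc j) (\<lambda>l. m l - rd l) else \<zero>) \<oplus> quot t i j m"
        using eqn_mult_coeff[OF g mk2_exps m, of "Suc i" "Suc j"] m exps_diff[OF m] dif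
        by (auto simp: g_def)
      also have "\<dots> = t (mk2 (Suc i) (Suc j)) m"
        unfolding quot_rec[of t i j m]
        using T_coeff_closed[OF t IX] quot_closed[OF t exps_diff[OF m]]
        by (auto simp: minus_eq a_ac r_neg r_neg2 r_neg1)
      finally have "t (mk2 (Suc i) (Suc j)) m = t' (mk2 (Suc i) (Suc j)) m \<oplus> t (mk2 (Suc i) (Suc j)) m"
        using T_add_coeff[OF IX, of t' "g \<otimes>\<^bsub>TT\<^esub> eqn"] tsum by simp
      then show "t' (mk2 (Suc i) (Suc j)) m = \<zero>"
        using T_coeff_closed[OF t IX] T_coeff_closed[OF t' IX]
        by (metis add.r_cancel_one' fst_conv snd_conv)
    qed
    then have "t = g \<otimes>\<^bsub>TT\<^esub> eqn" using tsum ge by simp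
    then show "t \<in> PIdl\<^bsub>TT\<^esub> eqn" using g by (auto simp: cgenideal_def)
  qed
qed

text \<open>Monomials not divisible by uv suffice: an exponent with u-coordinate k comes from u^k if
  k >= 0 and from v^(-k) otherwise, and in the latter case the second cone inequality leaves a
  nonnegative exponent for x. The sign of v is undone because \<open>sg\<close> squares to
  1.\<close>

lemma phi_surj: "phi ` carrier TT = carrier QQ"
proof
  show "phi ` carrier TT \<subseteq> carrier QQ" using phi_in_QQ by auto
  show "carrier QQ \<subseteq> phi ` carrier TT"
  proof
    fix y assume y: "y \<in> carrier QQ"
    define t where "t = (\<lambda>\<rho>\<in>exps 2. \<lambda>m\<in>exps d.
      if \<rho> 0 = 0 \<or> \<rho> 1 = 0 then sg (\<rho>, m) \<otimes> y (e (\<rho>, m)) else \<zero>)"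
    have t: "t \<in> carrier TT" by (auto simp: t_def mps_simps QQ_closed[OF y])
    have "phi t h = y h" for h
    proof (cases "h \<in> HH")
      case False
      then show ?thesis using phi_supp[of t h] QQ_supp[OF y, of h] by metis
    next
      case True
      define i j where "i = nat (uu h)" and "j = nat (- uu h)"
      define m where "m = (\<lambda>l. if l < d then nat (poly.coeff h l - int j * int (r l)) else 0)"
      let ?q = "(mk2 i j, m)"
      have md: "m \<in> exps d" by (simp add: m_def exps_def)
      have q: "?q \<in> IX" by (simp add: IX_def md)
      have ml: "int (m l) = poly.coeff h l - int j * int (r l)" if "l < d" for l
        using ConeD(2,3)[OF True that] that by (cases "uu h \<le> 0") (auto simp: m_def j_def algebra_simps)
      have eq: "e ?q = h"
        by (rule Grp_eqI) (use ConeD(1)[OF True] ml in \<open>auto simp: e_mk2 i_def j_def\<close>)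
      have ij: "i = 0 \<or> j = 0" by (auto simp: i_def j_def)
      have zero: "t (fst p) (snd p) = \<zero>" if p: "p \<in> fib h" "p \<noteq> ?q" for p
      proof (rule ccontr)
        assume nz: "t (fst p) (snd p) \<noteq> \<zero>"
        obtain \<sigma> m' where qm: "p = (\<sigma>, m')" by (cases p)
        have sig: "\<sigma> \<in> exps 2" "m' \<in> exps d" and eq': "e p = e ?q" using p qm eq by (auto simp: fib_def IX_def)
        have s0: "\<sigma> 0 = 0 \<or> \<sigma> 1 = 0" using nz sig qm by (auto simp: t_def split: if_splits)
        have "int (\<sigma> 0) - int (\<sigma> 1) = int i - int j"
          and m: "\<forall>l<d. int (m' l) + int (\<sigma> 1) * int (r l) = int (m l) + int j * int (r l)"
          using eq' unfolding e_def vec_eq_iff by (auto simp: qm)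
        then have 01: "\<sigma> 0 = i" "\<sigma> 1 = j" using s0 ij by auto
        then have "\<sigma> = mk2 i j" using mk2_eta[OF sig(1)] by simp
        moreover have "m' = m"
        proof
          fix l show "m' l = m l" using m 01(2) sig(2) md by (cases "l < d") (auto simp: exps_def)
        qed
        ultimately show False using p(2) qm by simp
      qed
      have "phi t h = (\<Oplus>p\<in>fib h. if p = ?q then sg p \<otimes> t (fst p) (snd p) else \<zero>)"
        unfolding phi_def using zero q T_coeff_closed[OF t]
        by (intro finsum_cong_closed) (auto simp: fib_def)
      also have "\<dots> = (if ?q \<in> fib h then sg ?q \<otimes> t (fst ?q) (snd ?q) else \<zero>)"
        by (rule finsum_if_point) (use fib_finite T_coeff_closed[OF t] in \<open>auto simp: fib_def\<close>)
      also have "\<dots> = sg ?q \<otimes> (sg ?q \<otimes> y h)"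
        using q eq ij md by (simp add: fib_def t_def)
      also have "\<dots> = y h" using sg_square[of ?q] QQ_closed[OF y] by (simp add: m_assoc[symmetric])
      finally show ?thesis .
    qed
    then show "y \<in> phi ` carrier TT" using t by (intro image_eqI[of _ _ t]) auto
  qed
qed

theorem R_star_iso:
  "\<exists>\<psi>. \<psi> \<in> ring_iso (R_star SS mon) QQ" and R_star_cring: "cring (R_star SS mon)"
proof -
  interpret T: cring TT by (rule T_cring)
  interpret ring_hom_ring TT QQ phi by (rule phi_hom)
  have eq: "R_star SS mon = TT Quot (a_kernel TT QQ phi)"
    by (simp add: R_star_def Let_def kernel_phi eqn_def)
  show "\<exists>\<psi>. \<psi> \<in> ring_iso (R_star SS mon) QQ"
    unfolding eq using FactRing_iso_set[OF phi_surj] by blast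
  have "ideal (a_kernel TT QQ phi) TT" unfolding kernel_phi by (rule T.cgenideal_ideal[OF eqn_closed])
  then show "cring (R_star SS mon)" unfolding eq by (rule ideal.quotient_is_cring) (rule T_cring)
qed

end

section \<open>Leading exponents\<close>

text \<open>Dickson's lemma, by induction on the number of coordinates. A basis for the first n
  coordinates handles all vectors whose last entry is large; the finitely many remaining values of
  the last entry are treated slice by slice.\<close>

lemma dickson:
  fixes A :: "(nat \<Rightarrow> nat) set"
  assumes "A \<subseteq> exps n"
  shows "\<exists>F\<subseteq>A. finite F \<and> (\<forall>a\<in>A. \<exists>f\<in>F. \<forall>i. f i \<le> a i)"
  using assms
proof (induction n arbitrary: A)
  case 0
  then have "A \<subseteq> {\<lambda>_. 0}" by (auto simp: exps_def fun_eq_iff)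
  then have "finite A" by (rule finite_subset) simp
  then show ?case by (intro exI[of _ A]) auto
next
  case (Suc n)
  define p where "p = (\<lambda>(a :: nat \<Rightarrow> nat) i. if i < n then a i else 0)"
  have basis: "\<exists>F\<subseteq>B. finite F \<and> (\<forall>a\<in>B. \<exists>f\<in>F. \<forall>i<n. f i \<le> a i)" for B :: "(nat \<Rightarrow> nat) set"
  proof -
    have "p ` B \<subseteq> exps n" by (auto simp: p_def exps_def)
    from Suc.IH[OF this] obtain F where F: "F \<subseteq> p ` B" "finite F" "\<forall>a\<in>p ` B. \<exists>f\<in>F. \<forall>i. f i \<le> a i"
      by blast
    obtain G where G: "G \<subseteq> B" "finite G" "F = p ` G" using finite_subset_image[OF F(2,1)] by blast
    have "\<exists>f\<in>G. \<forall>i<n. f i \<le> a i" if "a \<in> B" for a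
    proof -
      obtain f where f: "f \<in> G" "\<forall>i. p f i \<le> p a i" using F(3) G(3) \<open>a \<in> B\<close> by blast
      have "f i \<le> a i" if "i < n" for i using f(2)[rule_format, of i] that by (simp add: p_def)
      then show ?thesis using f(1) by blast
    qed
    then show ?thesis using G by blast
  qed
  obtain F where F: "F \<subseteq> A" "finite F" "\<forall>a\<in>A. \<exists>f\<in>F. \<forall>i<n. f i \<le> a i" using basis[of A] by blast
  \<comment> \<open>Any common upper bound of the last entries in \<open>F\<close> would serve; the
    sum avoids the maximum of a possibly empty set.\<close>
  define M where "M = (\<Sum>f\<in>F. f n)"
  have M: "f n \<le> M" if "f \<in> F" for f
    unfolding M_def using F(2) that by (intro member_le_sum) auto
  have "\<forall>c. \<exists>G\<subseteq>{a \<in> A. a n = c}. finite G \<and> (\<forall>a\<in>{a \<in> A. a n = c}. \<exists>f\<in>G. \<forall>i<n. f i \<le> a i)"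
    using basis by blast
  from choice[OF this] obtain G where G0: "\<And>c. G c \<subseteq> {a \<in> A. a n = c} \<and> finite (G c) \<and>
    (\<forall>a\<in>{a \<in> A. a n = c}. \<exists>f\<in>G c. \<forall>i<n. f i \<le> a i)" by blast
  have G: "\<And>c. G c \<subseteq> {a \<in> A. a n = c}" "\<And>c. finite (G c)"
    "\<And>c a. a \<in> A \<Longrightarrow> a n = c \<Longrightarrow> \<exists>f\<in>G c. \<forall>i<n. f i \<le> a i"
    using G0 by blast+
  let ?H = "F \<union> (\<Union>c\<in>{..<M}. G c)"
  have "\<exists>f\<in>?H. \<forall>i. f i \<le> a i" if a: "a \<in> A" for a
  proof -
    have ext: "\<forall>i. f i \<le> a i" if "f \<in> A" "\<forall>i<n. f i \<le> a i" "f n \<le> a n" for f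
    proof
      fix i
      show "f i \<le> a i"
        using that Suc.prems by (cases "i < n"; cases "i = n") (auto simp: exps_def subset_eq)
    qed
    show ?thesis
    proof (cases "a n < M")
      case True
      obtain f where f: "f \<in> G (a n)" "\<forall>i<n. f i \<le> a i" using G(3)[OF a refl] by blast
      then have "f \<in> A" "f n = a n" using G(1)[of "a n"] by auto
      then have "\<forall>i. f i \<le> a i" using ext[of f] f(2) by simp
      moreover have "f \<in> ?H" using f(1) True by blast
      ultimately show ?thesis by blast
    next
      case False
      obtain f where "f \<in> F" "\<forall>i<n. f i \<le> a i" using F(3) a by blast
      then show ?thesis using ext[of f] M[of f] False F(1) by (meson UnI1 le_trans not_less subsetD)
    qed
  qed
  moreover have "?H \<subseteq> A" "finite ?H" using F(1,2) G(1,2) by auto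
  ultimately show ?case by blast
qed

lemma (in abelian_monoid) finsum_fibres_superset:
  assumes "finite F" "finite T" "e ` F \<subseteq> T" "\<And>p. p \<in> F \<Longrightarrow> x p \<in> carrier G"
  shows "(\<Oplus>s\<in>T. \<Oplus>p\<in>{p \<in> F. e p = s}. x p) = (\<Oplus>p\<in>F. x p)"
proof -
  have "(\<Oplus>s\<in>T. \<Oplus>p\<in>{p \<in> F. e p = s}. x p) = (\<Oplus>s\<in>e ` F. \<Oplus>p\<in>{p \<in> F. e p = s}. x p)"
    by (rule finsum_mono_neutral) (use assms in \<open>auto intro!: finsum_zero_cong finsum_closed\<close>)
  also have "\<dots> = (\<Oplus>p\<in>F. x p)" by (rule finsum_fibres[OF assms(1,4)])
  finally show ?thesis .
qed

text \<open>Gaussian elimination: an equation with a nonzero coefficient is solved for the pivot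
  unknown \<open>b0\<close> and substituted into the others, which leaves one equation and one
  unknown fewer.\<close>

lemma (in field) homogeneous_system:
  assumes "finite Z" "finite B" "card Z < card B"
    "\<And>b z. b \<in> B \<Longrightarrow> z \<in> Z \<Longrightarrow> M b z \<in> carrier R"
  shows "\<exists>l. (\<forall>b. l b \<in> carrier R) \<and> (\<exists>b\<in>B. l b \<noteq> \<zero>) \<and> (\<forall>z\<in>Z. (\<Oplus>b\<in>B. l b \<otimes> M b z) = \<zero>)"
  using assms
proof (induction Z arbitrary: B M rule: finite_induct)
  case empty
  then have "B \<noteq> {}" by auto
  then show ?case by (intro exI[of _ "\<lambda>_. \<one>"]) auto
next
  case (insert z Z)
  show ?case
  proof (cases "\<forall>b\<in>B. M b z = \<zero>")
    case True
    have "card Z < card B" using insert by simp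
    then obtain l where l: "\<forall>b. l b \<in> carrier R" "\<exists>b\<in>B. l b \<noteq> \<zero>" "\<forall>z\<in>Z. (\<Oplus>b\<in>B. l b \<otimes> M b z) = \<zero>"
      using insert.IH[OF insert.prems(1), of M] insert.prems(3) by auto
    moreover have "(\<Oplus>b\<in>B. l b \<otimes> M b z) = \<zero>"
      by (rule finsum_zero_cong) (use True l(1) in auto)
    ultimately show ?thesis by blast
  next
    case False
    then obtain b0 where b0: "b0 \<in> B" "M b0 z \<noteq> \<zero>" by blast
    define p where "p = inv (M b0 z)"
    have p: "p \<in> carrier R" "p \<otimes> M b0 z = \<one>"
      using b0 insert.prems(3)[OF b0(1), of z] by (auto simp: p_def field_Units)
    let ?B = "B - {b0}"
    have Mc: "M b y \<in> carrier R" if "b \<in> B" "y = z \<or> y \<in> Z" for b y using insert.prems(3) that by auto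
    define M' where "M' = (\<lambda>b y. M b y \<ominus> M b z \<otimes> p \<otimes> M b0 y)"
    have "card Z < card ?B" using insert b0 by simp
    moreover have "M' b y \<in> carrier R" if "b \<in> ?B" "y \<in> Z" for b y
      using Mc p b0 that by (auto simp: M'_def)
    ultimately obtain l where l: "\<forall>b. l b \<in> carrier R" "\<exists>b\<in>?B. l b \<noteq> \<zero>"
      "\<forall>y\<in>Z. (\<Oplus>b\<in>?B. l b \<otimes> M' b y) = \<zero>"
      using insert.IH[of ?B M'] insert.prems(1) by blast
    define s where "s = (\<Oplus>b\<in>?B. l b \<otimes> M b z \<otimes> p)"
    have s: "s \<in> carrier R" unfolding s_def by (rule finsum_closed) (use l Mc p in auto)
    define l' where "l' = (\<lambda>b. if b = b0 then \<ominus> s else l b)"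
    have split: "(\<Oplus>b\<in>B. l' b \<otimes> M b y) = \<ominus> s \<otimes> M b0 y \<oplus> (\<Oplus>b\<in>?B. l b \<otimes> M b y)" if y: "y = z \<or> y \<in> Z" for y
    proof -
      have "(\<Oplus>b\<in>B. l' b \<otimes> M b y) = (\<Oplus>b\<in>insert b0 ?B. l' b \<otimes> M b y)" using b0 by (simp add: insert_absorb)
      also have "\<dots> = l' b0 \<otimes> M b0 y \<oplus> (\<Oplus>b\<in>?B. l' b \<otimes> M b y)"
        by (rule finsum_insert) (use insert.prems(1) l Mc s y b0 in \<open>auto simp: l'_def\<close>)
      also have "(\<Oplus>b\<in>?B. l' b \<otimes> M b y) = (\<Oplus>b\<in>?B. l b \<otimes> M b y)"
        by (rule finsum_cong_closed) (use l Mc y in \<open>auto simp: l'_def\<close>)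
      finally show ?thesis by (simp add: l'_def)
    qed
    have sM: "s \<otimes> M b0 y = (\<Oplus>b\<in>?B. l b \<otimes> (M b z \<otimes> p \<otimes> M b0 y))" if y: "y = z \<or> y \<in> Z" for y
    proof -
      have "s \<otimes> M b0 y = (\<Oplus>b\<in>?B. l b \<otimes> M b z \<otimes> p \<otimes> M b0 y)"
        unfolding s_def by (rule finsum_ldistr) (use insert.prems(1) l Mc p y b0 in auto)
      also have "\<dots> = (\<Oplus>b\<in>?B. l b \<otimes> (M b z \<otimes> p \<otimes> M b0 y))"
        by (rule finsum_cong_closed) (use l Mc p y b0 in \<open>auto simp: m_assoc\<close>)
      finally show ?thesis .
    qed
    have "(\<Oplus>b\<in>B. l' b \<otimes> M b y) = \<zero>" if y: "y = z \<or> y \<in> Z" for y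
    proof (cases "y = z")
      case True
      have sz: "s \<otimes> M b0 z = (\<Oplus>b\<in>?B. l b \<otimes> M b z)"
        unfolding sM[OF disjI1[OF refl]]
        by (rule finsum_cong_closed) (use l Mc p b0 in \<open>auto simp: m_assoc\<close>)
      show ?thesis
        unfolding True split[OF disjI1[OF refl]] sz[symmetric] using s Mc[OF b0(1)] by (simp add: l_minus l_neg)
    next
      case False
      then have yZ: "y \<in> Z" using y by simp
      have "(\<Oplus>b\<in>?B. l b \<otimes> M b y) = (\<Oplus>b\<in>?B. l b \<otimes> M' b y \<oplus> l b \<otimes> (M b z \<otimes> p \<otimes> M b0 y))"
      proof (rule finsum_cong_closed)
        fix b assume b: "b \<in> ?B"
        have c: "M b y \<in> carrier R" "M b z \<otimes> p \<otimes> M b0 y \<in> carrier R" "l b \<in> carrier R"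
          using l Mc[of b] Mc[of b0] p b b0 y by auto
        have "M b y = M' b y \<oplus> M b z \<otimes> p \<otimes> M b0 y"
          unfolding M'_def minus_eq using c by (simp add: a_assoc l_neg)
        moreover have "M' b y \<in> carrier R" unfolding M'_def minus_eq using c by simp
        ultimately show "l b \<otimes> M b y = l b \<otimes> M' b y \<oplus> l b \<otimes> (M b z \<otimes> p \<otimes> M b0 y)"
          and "l b \<otimes> M' b y \<oplus> l b \<otimes> (M b z \<otimes> p \<otimes> M b0 y) \<in> carrier R"
          using c by (simp_all add: r_distr)
      qed
      also have "\<dots> = (\<Oplus>b\<in>?B. l b \<otimes> M' b y) \<oplus> (\<Oplus>b\<in>?B. l b \<otimes> (M b z \<otimes> p \<otimes> M b0 y))"
        by (rule finsum_addf) (use l Mc p b0 y in \<open>auto simp: M'_def\<close>)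
      also have "\<dots> = s \<otimes> M b0 y" unfolding sM[OF y, symmetric] using l(3) yZ s Mc[OF b0(1) y] by simp
      finally show ?thesis using split[OF y] s Mc[OF b0(1) y] by (simp add: l_minus l_neg)
    qed
    moreover have "\<forall>b. l' b \<in> carrier R" using l s by (simp add: l'_def)
    moreover have "\<exists>b\<in>B. l' b \<noteq> \<zero>" using l(2) by (auto simp: l'_def)
    ultimately show ?thesis by blast
  qed
qed

section \<open>Finite bases of exponent sets and well-foundedness of the order\<close>

context exponents
begin

text \<open>A map to natural vectors under which the componentwise order implies divisibility in
  \<open>HH\<close>. The positive and negative parts of \<open>uu h\<close> force comparable
  exponents to have u-exponents on the same side of 0, where the minimum is taken by the same one of
  the two cone inequalities.\<close>

definition flat :: "int poly \<Rightarrow> nat \<Rightarrow> nat" where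
  "flat h = (\<lambda>i. if i < d then nat (min (coeff h i) (coeff h i + int (r i) * uu h))
     else if i = d then nat (uu h) else if i = Suc d then nat (- uu h) else 0)"

lemma flat_le_imp_diff:
  assumes f: "f \<in> HH" and h: "h \<in> HH" and le: "\<And>i. flat f i \<le> flat h i"
  shows "h - f \<in> HH"
proof -
  have k: "nat (uu f) \<le> nat (uu h)" "nat (- uu f) \<le> nat (- uu h)"
    using le[of d] le[of "Suc d"] by (auto simp: flat_def)
  have "0 \<le> coeff h i - coeff f i \<and> 0 \<le> coeff h i - coeff f i + int (r i) * (uu h - uu f)" if i: "i < d" for i
  proof -
    note Df = ConeD(2,3)[OF f i] and Dh = ConeD(2,3)[OF h i]
    have m: "min (coeff f i) (coeff f i + int (r i) * uu f) \<le> min (coeff h i) (coeff h i + int (r i) * uu h)"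
      using le[of i] i Df Dh by (auto simp: flat_def nat_le_eq_zle)
    show ?thesis
    proof (cases "uu h \<ge> 0")
      case True
      then have "0 \<le> uu f \<or> uu h = 0 \<and> uu f = 0" "uu f \<le> uu h" using k by auto
      then have 0: "0 \<le> uu f" using True by auto
      have "0 \<le> int (r i) * uu f" "0 \<le> int (r i) * uu h" "0 \<le> int (r i) * (uu h - uu f)"
        using 0 True \<open>uu f \<le> uu h\<close> by auto
      then show ?thesis using m by auto
    next
      case False
      then have 0: "uu f \<le> 0" "uu h \<le> uu f" using k by auto
      have "int (r i) * uu f \<le> 0" "int (r i) * uu h \<le> 0" "int (r i) * (uu h - uu f) \<le> 0"
        using 0 False by (auto simp: mult_nonneg_nonpos)
      then show ?thesis using m by (auto simp: algebra_simps)
    qed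
  qed
  then show ?thesis using ConeD(1)[OF f] ConeD(1)[OF h] by (simp add: Cone_def)
qed

text \<open>Dickson's lemma pulled back along \<open>flat\<close>; this is the source of
  Noetherianity.\<close>

lemma monoid_ideal_basis:
  assumes "E \<subseteq> HH"
  shows "\<exists>F\<subseteq>E. finite F \<and> (\<forall>h\<in>E. \<exists>f\<in>F. h - f \<in> HH)"
proof -
  have "flat ` E \<subseteq> exps (Suc (Suc d))" by (auto simp: flat_def exps_def)
  from dickson[OF this] obtain G where G: "G \<subseteq> flat ` E" "finite G"
    "\<forall>a\<in>flat ` E. \<exists>f\<in>G. \<forall>i. f i \<le> a i" by blast
  obtain F where F: "F \<subseteq> E" "finite F" "G = flat ` F" using finite_subset_image[OF G(2,1)] by blast
  have "\<exists>f\<in>F. h - f \<in> HH" if h: "h \<in> E" for h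
  proof -
    obtain f where "f \<in> F" "\<forall>i. flat f i \<le> flat h i" using G(3) F(3) h by blast
    then show ?thesis using flat_le_imp_diff[of f h] assms h F(1) by blast
  qed
  then show ?thesis using F by blast
qed

text \<open>The order refines the weight, and \<open>HH\<close> has finitely many elements of
  bounded weight; so each element has only finitely many predecessors in \<open>HH\<close>.\<close>

lemma HH_wf: "wf {(b, a). b \<in> HH \<and> a \<in> HH \<and> b < a}"
proof -
  have fin: "finite {c \<in> HH. c < a}" if "a \<in> HH" for a
    by (rule finite_subset[OF _ HH_finite[of "wt a + 1"]])
      (use wt_mono that ConeD(1) in \<open>force simp: less_imp_le\<close>)
  have "{(b, a). b \<in> HH \<and> a \<in> HH \<and> b < a} \<subseteq> measure (\<lambda>a. card {c \<in> HH. c < a})"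
    using fin by (auto intro!: psubset_card_mono)
  then show ?thesis by (rule wf_subset[rotated]) simp
qed

lemma HH_below_finite: "a \<in> HH \<Longrightarrow> finite {c \<in> HH. c \<le> a}"
  by (rule finite_subset[OF _ HH_finite[of "wt a + 1"]]) (use wt_mono ConeD(1) in force)

end

section \<open>Leading exponents and division with remainder\<close>

context hypersurface
begin

sublocale QR: cring QQ by (rule QQ_cring)

text \<open>The smallest exponent, as is usual for power series, not the largest.\<close>

definition lead :: "(int poly \<Rightarrow> 'k) \<Rightarrow> int poly \<Rightarrow> bool" where
  "lead f h \<longleftrightarrow> f h \<noteq> \<zero> \<and> (\<forall>g. f g \<noteq> \<zero> \<longrightarrow> h \<le> g)"

definition lexp :: "(int poly \<Rightarrow> 'k) set \<Rightarrow> int poly set" where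
  "lexp I = {h. \<exists>f\<in>I. lead f h}"

lemma lead_exists:
  assumes f: "f \<in> carrier QQ" and nz: "f g \<noteq> \<zero>"
  obtains h where "lead f h"
proof -
  let ?S = "{h. f h \<noteq> \<zero> \<and> wt h \<le> wt g}"
  have fin: "finite ?S" using L.LC_finite[OF QQ_LC[OF f]] .
  have ne: "?S \<noteq> {}" using nz by auto
  have M: "Min ?S \<in> ?S" using Min_in[OF fin ne] .
  have "Min ?S \<le> h" if "f h \<noteq> \<zero>" for h
  proof (cases "wt h \<le> wt g")
    case True
    then show ?thesis using fin that by (intro Min_le) auto
  next
    case False
    show ?thesis
    proof (rule ccontr)
      assume "\<not> Min ?S \<le> h"
      then have "wt h \<le> wt (Min ?S)"
        using M that QQ_supp[OF f] ConeD(1) by (intro wt_mono) auto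
      then show False using M False by simp
    qed
  qed
  then show ?thesis using that[of "Min ?S"] M by (auto simp: lead_def)
qed

lemma lexp_HH: "ideal I QQ \<Longrightarrow> lexp I \<subseteq> HH"
  unfolding lexp_def lead_def using QQ_supp ideal.Icarr[of I QQ] by blast

lemma lmonom_QQ: "h \<in> HH \<Longrightarrow> a \<in> carrier K \<Longrightarrow> lmonom K h a \<in> carrier QQ"
  by (rule QQ_I) (auto simp: lmonom_def split: if_splits)

lemma ideal_lmonom:
  assumes "ideal I QQ" "f \<in> I" "h \<in> HH" "a \<in> carrier K"
  shows "(\<lambda>g. a \<otimes> f (g - h)) \<in> I"
proof -
  have "f \<in> carrier QQ" using assms ideal.Icarr by metis
  then have "conv K (lmonom K h a) f = (\<lambda>g. a \<otimes> f (g - h))"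
    using QQ_LC assms(4) L.lmonom_conv by auto
  moreover have "conv K (lmonom K h a) f \<in> I"
    using ideal.I_l_closed[OF assms(1,2) lmonom_QQ[OF assms(3,4)]] by simp
  ultimately show ?thesis by simp
qed

lemma lexp_add:
  assumes "ideal I QQ" "g \<in> lexp I" "h \<in> HH"
  shows "g + h \<in> lexp I"
proof -
  obtain f where f: "f \<in> I" "lead f g" using assms(2) by (auto simp: lexp_def)
  have fc: "f x \<in> carrier K" for x using QQ_closed ideal.Icarr[OF assms(1) f(1)] by simp
  have "(\<lambda>x. \<one> \<otimes> f (x - h)) \<in> I" using ideal_lmonom[OF assms(1) f(1) assms(3)] by simp
  moreover have "lead (\<lambda>x. \<one> \<otimes> f (x - h)) (g + h)"
    using f(2) fc by (auto simp: lead_def le_diff_eq)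
  ultimately show ?thesis by (auto simp: lexp_def)
qed

lemma ideal_finsum:
  assumes "ideal I QQ" "finite A" "\<And>i. i \<in> A \<Longrightarrow> f i \<in> I"
  shows "(\<lambda>h. \<Oplus>i\<in>A. f i h) \<in> I"
  using assms(2,3)
proof (induction A rule: finite_induct)
  case empty
  show ?case using additive_subgroup.zero_closed[OF ideal.axioms(1)[OF assms(1)]] by simp
next
  case (insert x F)
  have c: "f i h \<in> carrier K" if "i \<in> insert x F" for i h
    using insert.prems[OF that] QQ_closed ideal.Icarr[OF assms(1)] by auto
  have "(\<lambda>h. \<Oplus>i\<in>insert x F. f i h) = (\<lambda>h. f x h \<oplus> (\<Oplus>i\<in>F. f i h))"
    using insert c by (auto simp: fun_eq_iff)
  then show ?case
    using additive_subgroup.a_closed[OF ideal.axioms(1)[OF assms(1)], of "f x" "\<lambda>h. \<Oplus>i\<in>F. f i h"] insert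
    by simp
qed

lemma ideal_diff:
  assumes "ideal I QQ" "f \<in> I" "g \<in> I"
  shows "(\<lambda>h. f h \<ominus> g h) \<in> I"
proof -
  have g: "g \<in> carrier QQ" using assms ideal.Icarr by metis
  have "(\<ominus> \<one>) \<in> carrier K" by simp
  then have "(\<lambda>h. \<ominus> \<one> \<otimes> g (h - 0)) \<in> I" by (intro ideal_lmonom[OF assms(1,3)]) auto
  moreover have "(\<lambda>h. \<ominus> \<one> \<otimes> g (h - 0)) = (\<lambda>h. \<ominus> g h)" using QQ_closed[OF g] by (auto simp: l_minus)
  ultimately show ?thesis
    using additive_subgroup.a_closed[OF ideal.axioms(1)[OF assms(1)] assms(2), of "\<lambda>h. \<ominus> g h"]
    by (simp add: minus_eq)
qed

lemma QQ_diff: "f \<in> carrier QQ \<Longrightarrow> g \<in> carrier QQ \<Longrightarrow> (\<lambda>h. f h \<ominus> g h) \<in> carrier QQ"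
  using ideal_diff[OF QR.oneideal] by simp

lemma QQ_finsum: "finite A \<Longrightarrow> (\<And>i. i \<in> A \<Longrightarrow> f i \<in> carrier QQ) \<Longrightarrow> (\<lambda>h. \<Oplus>i\<in>A. f i h) \<in> carrier QQ"
  by (rule ideal_finsum[OF QR.oneideal])

lemma normalized_lead:
  assumes "ideal I QQ" "h \<in> lexp I"
  obtains f where "f \<in> I" "lead f h" "f h = \<one>"
proof -
  obtain f where f: "f \<in> I" "lead f h" using assms(2) by (auto simp: lexp_def)
  have fc: "f x \<in> carrier K" for x using QQ_closed ideal.Icarr[OF assms(1) f(1)] by simp
  have u: "f h \<in> Units K" using f(2) fc by (simp add: lead_def field_Units)
  have "inv (f h) \<in> Units K" using u by (rule Units_inv_Units)
  then have ic: "inv (f h) \<in> carrier K" "inv (f h) \<noteq> \<zero>" by (auto simp: field_Units)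
  have "(\<lambda>g. inv (f h) \<otimes> f (g - 0)) \<in> I" by (rule ideal_lmonom[OF assms(1) f(1)]) (use ic in auto)
  moreover have "lead (\<lambda>g. inv (f h) \<otimes> f (g - 0)) h"
    using f(2) fc ic by (auto simp: lead_def integral_iff)
  ultimately show ?thesis using that[of "\<lambda>g. inv (f h) \<otimes> f (g - 0)"] u by simp
qed

text \<open>Every series is reduced modulo an ideal to one without exponents in the leading ideal. The
  quotients \<open>a\<close> respect the weight filtration; this is what makes the Artin-Rees estimate below
  linear.\<close>

theorem division:
  assumes I: "ideal I QQ"
  obtains F g where "finite F" "F \<subseteq> HH" "\<And>\<epsilon>. \<epsilon> \<in> F \<Longrightarrow> g \<epsilon> \<in> I"
    "\<And>y. y \<in> carrier QQ \<Longrightarrow> \<exists>a. \<exists>\<rho>\<in>carrier QQ. (\<forall>\<epsilon>\<in>F. a \<epsilon> \<in> carrier QQ) \<and>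
      (\<forall>h. y h = \<rho> h \<oplus> (\<Oplus>\<epsilon>\<in>F. conv K (a \<epsilon>) (g \<epsilon>) h)) \<and> (\<forall>h\<in>lexp I. \<rho> h = \<zero>) \<and>
      (\<forall>n. (\<forall>h. y h \<noteq> \<zero> \<longrightarrow> n \<le> wt h) \<longrightarrow> (\<forall>\<epsilon>\<in>F. \<forall>h. a \<epsilon> h \<noteq> \<zero> \<longrightarrow> n \<le> wt h + wt \<epsilon>))"
proof -
  let ?E = "lexp I"
  have EH: "?E \<subseteq> HH" by (rule lexp_HH[OF I])
  obtain F where F: "F \<subseteq> ?E" "finite F" "\<forall>h\<in>?E. \<exists>f\<in>F. h - f \<in> HH"
    using monoid_ideal_basis[OF EH] by blast
  have "\<forall>\<epsilon>\<in>F. \<exists>f. f \<in> I \<and> lead f \<epsilon> \<and> f \<epsilon> = \<one>"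
    using F(1) normalized_lead[OF I] by (metis subsetD)
  then obtain g where g: "\<And>\<epsilon>. \<epsilon> \<in> F \<Longrightarrow> g \<epsilon> \<in> I" "\<And>\<epsilon>. \<epsilon> \<in> F \<Longrightarrow> lead (g \<epsilon>) \<epsilon>" "\<And>\<epsilon>. \<epsilon> \<in> F \<Longrightarrow> g \<epsilon> \<epsilon> = \<one>"
    by metis
  \<comment> \<open>\<tau> fixes, for each leading exponent, one basis element that divides it; so
    every leading exponent is cancelled by exactly one generator.\<close>
  obtain \<tau> where tau: "\<And>h. h \<in> ?E \<Longrightarrow> \<tau> h \<in> F" "\<And>h. h \<in> ?E \<Longrightarrow> h - \<tau> h \<in> HH"
    using F(3) by metis
  have gQ: "g \<epsilon> \<in> carrier QQ" if "\<epsilon> \<in> F" for \<epsilon> using g(1)[OF that] ideal.Icarr[OF I] by simp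
  \<comment> \<open>The coefficient at \<open>a\<close> of the shift of \<open>g (\<tau> b)\<close>
    that has leading exponent \<open>b\<close>. It is 1 at a = b and 0 for a < b, so the elimination
    is triangular.\<close>
  define G where "G = (\<lambda>b a. g (\<tau> b) (a - b + \<tau> b))"
  have Gc: "G b a \<in> carrier K" if "b \<in> ?E" for a b using QQ_closed[OF gQ[OF tau(1)[OF that]]] by (simp add: G_def)
  have G1: "G b b = \<one>" if "b \<in> ?E" for b using g(3)[OF tau(1)[OF that]] by (simp add: G_def)
  have Gle: "b \<le> a" if "b \<in> ?E" "G b a \<noteq> \<zero>" for a b
  proof -
    have "\<tau> b \<le> a - b + \<tau> b" using g(2)[OF tau(1)[OF that(1)]] that(2) unfolding lead_def G_def by blast
    then show ?thesis by simp
  qed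
  define B where "B = (\<lambda>a. {b \<in> ?E. b < a})"
  have Bfin: "finite {b \<in> ?E. b \<le> a}" if "a \<in> HH" for a
    by (rule finite_subset[OF _ HH_below_finite[OF that]]) (use EH in auto)
  have Bfin': "finite (B a)" if "a \<in> HH" for a
    by (rule finite_subset[OF _ Bfin[OF that]]) (auto simp: B_def)
  have main: "\<exists>a. \<exists>\<rho>\<in>carrier QQ. (\<forall>\<epsilon>\<in>F. a \<epsilon> \<in> carrier QQ) \<and>
      (\<forall>h. y h = \<rho> h \<oplus> (\<Oplus>\<epsilon>\<in>F. conv K (a \<epsilon>) (g \<epsilon>) h)) \<and> (\<forall>h\<in>lexp I. \<rho> h = \<zero>) \<and>
      (\<forall>n. (\<forall>h. y h \<noteq> \<zero> \<longrightarrow> n \<le> wt h) \<longrightarrow> (\<forall>\<epsilon>\<in>F. \<forall>h. a \<epsilon> h \<noteq> \<zero> \<longrightarrow> n \<le> wt h + wt \<epsilon>))"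
    if y: "y \<in> carrier QQ" for y
  proof -
    let ?R = "{(b, a). b \<in> HH \<and> a \<in> HH \<and> b < a}"
    \<comment> \<open>Well-founded recursion along the order on \<open>HH\<close>: the coefficient
      at \<open>a\<close> is fixed by the finitely many smaller leading exponents, in such a way
      that the sum of the shifts agrees with \<open>y\<close> on \<open>lexp I\<close>.\<close>
    define c where "c = wfrec ?R (\<lambda>c a. y a \<ominus> (\<Oplus>b\<in>B a. c b \<otimes> G b a))"
    have rel: "(b, a) \<in> ?R" if "b \<in> B a" "a \<in> ?E" for a b
      using that EH by (auto simp: B_def)
    have c_cut: "c a = y a \<ominus> (\<Oplus>b\<in>B a. cut c ?R a b \<otimes> G b a)" for a
      unfolding c_def by (subst wfrec[OF HH_wf]) simp
    have cc: "c a \<in> carrier K" if "a \<in> ?E" for a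
      using that
    proof (induction a rule: wf_induct_rule[OF HH_wf])
      case (1 a)
      have "(\<Oplus>b\<in>B a. cut c ?R a b \<otimes> G b a) \<in> carrier K"
      proof (rule finsum_closed, rule Pi_I)
        fix b assume b: "b \<in> B a"
        have bE: "b \<in> ?E" using b by (simp add: B_def)
        have "c b \<in> carrier K" by (rule 1(1)[OF rel[OF b 1(2)] bE])
        then show "cut c ?R a b \<otimes> G b a \<in> carrier K"
          using cut_apply[OF rel[OF b 1(2)], of c] Gc[OF bE] by simp
      qed
      then show ?case unfolding c_cut[of a] using QQ_closed[OF y] by simp
    qed
    have c_rec: "c a = y a \<ominus> (\<Oplus>b\<in>B a. c b \<otimes> G b a)" if a: "a \<in> ?E" for a
    proof -
      have "(\<Oplus>b\<in>B a. cut c ?R a b \<otimes> G b a) = (\<Oplus>b\<in>B a. c b \<otimes> G b a)"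
      proof (rule finsum_cong_closed)
        fix b assume b: "b \<in> B a"
        then have bE: "b \<in> ?E" by (simp add: B_def)
        show "cut c ?R a b \<otimes> G b a = c b \<otimes> G b a" using cut_apply[OF rel[OF b a], of c] by simp
        show "c b \<otimes> G b a \<in> carrier K" using cc[OF bE] Gc[OF bE] by simp
      qed
      then show ?thesis using c_cut[of a] by simp
    qed
    \<comment> \<open>The elimination never starts below the weight of \<open>y\<close>; this gives
      the filtration estimate for the quotients.\<close>
    have c_wt: "c a = \<zero>" if "a \<in> ?E" "\<forall>h. y h \<noteq> \<zero> \<longrightarrow> n \<le> wt h" "wt a < n" for a n
      using that(1,3)
    proof (induction a rule: wf_induct_rule[OF HH_wf])
      case (1 a)
      have "(\<Oplus>b\<in>B a. c b \<otimes> G b a) = \<zero>"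
      proof (rule finsum_zero_cong)
        fix b assume b: "b \<in> B a"
        have bE: "b \<in> ?E" using b by (simp add: B_def)
        have "wt b \<le> wt a" using b 1(2) EH ConeD(1) by (intro wt_mono) (auto simp: B_def)
        then have "c b = \<zero>" using 1(3) by (intro 1(1)[OF rel[OF b 1(2)] bE]) simp
        then show "c b \<otimes> G b a = \<zero>" using Gc[OF bE] by simp
      qed
      moreover have "y a = \<zero>" using that(2) 1(3) by force
      ultimately show ?case using c_rec[OF 1(2)] by simp
    qed
    \<comment> \<open>Sorts the coefficients \<open>c b\<close> by the basis element chosen for
      \<open>b\<close>, one quotient series for each \<epsilon>.\<close>
    define a where "a = (\<lambda>\<epsilon> h. if h \<in> HH \<and> h + \<epsilon> \<in> ?E \<and> \<tau> (h + \<epsilon>) = \<epsilon> then c (h + \<epsilon>) else \<zero>)"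
    have aQ: "a \<epsilon> \<in> carrier QQ" for \<epsilon>
      by (rule QQ_I) (auto simp: a_def cc split: if_splits)
    have sum: "(\<Oplus>\<epsilon>\<in>F. conv K (a \<epsilon>) (g \<epsilon>) h) = (\<Oplus>b\<in>{b \<in> ?E. b \<le> h}. c b \<otimes> G b h)" if h: "h \<in> HH" for h
    proof -
      let ?B = "{b \<in> ?E. b \<le> h}"
      have "conv K (a \<epsilon>) (g \<epsilon>) h = (\<Oplus>b\<in>{b \<in> ?B. \<tau> b = \<epsilon>}. c b \<otimes> G b h)" if e: "\<epsilon> \<in> F" for \<epsilon>
      proof -
        let ?C = "{b \<in> ?B. \<tau> b = \<epsilon>}"
        have finC: "finite ?C" by (rule finite_subset[OF _ Bfin[OF h]]) auto
        have "conv K (a \<epsilon>) (g \<epsilon>) h = (\<Oplus>s\<in>(\<lambda>b. b - \<epsilon>) ` ?C. a \<epsilon> s \<otimes> g \<epsilon> (h - s))"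
        proof (rule L.conv_eq)
          fix s assume s: "a \<epsilon> s \<noteq> \<zero>" "g \<epsilon> (h - s) \<noteq> \<zero>"
          have "s + \<epsilon> \<in> ?E" "\<tau> (s + \<epsilon>) = \<epsilon>" using s(1) by (auto simp: a_def split: if_splits)
          moreover have "\<epsilon> \<le> h - s" using g(2)[OF e] s(2) by (simp add: lead_def)
          then have "s + \<epsilon> \<le> h" by (simp add: algebra_simps)
          ultimately show "s \<in> (\<lambda>b. b - \<epsilon>) ` ?C" by (intro image_eqI[of _ _ "s + \<epsilon>"]) auto
        qed (use QQ_LC[OF aQ] QQ_LC[OF gQ[OF e]] finC in auto)
        also have "\<dots> = (\<Oplus>b\<in>?C. a \<epsilon> (b - \<epsilon>) \<otimes> g \<epsilon> (h - (b - \<epsilon>)))"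
          by (rule finsum_reindex) (use QQ_closed[OF aQ] QQ_closed[OF gQ[OF e]] in \<open>auto simp: inj_on_def\<close>)
        also have "\<dots> = (\<Oplus>b\<in>?C. c b \<otimes> G b h)"
        proof (rule finsum_cong_closed)
          fix b assume b: "b \<in> ?C"
          then have bE: "b \<in> ?E" and t: "\<tau> b = \<epsilon>" by auto
          have "a \<epsilon> (b - \<epsilon>) = c b" using tau(2)[OF bE] bE t by (simp add: a_def)
          moreover have "h - (b - \<epsilon>) = h - b + \<epsilon>" by simp
          ultimately show "a \<epsilon> (b - \<epsilon>) \<otimes> g \<epsilon> (h - (b - \<epsilon>)) = c b \<otimes> G b h" unfolding G_def t by (simp only:)
          show "c b \<otimes> G b h \<in> carrier K" using cc[OF bE] Gc[OF bE] by simp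
        qed
        finally show ?thesis .
      qed
      then have "(\<Oplus>\<epsilon>\<in>F. conv K (a \<epsilon>) (g \<epsilon>) h) = (\<Oplus>\<epsilon>\<in>F. \<Oplus>b\<in>{b \<in> ?B. \<tau> b = \<epsilon>}. c b \<otimes> G b h)"
        by (intro finsum_cong_closed finsum_closed) (use cc Gc in auto)
      also have "\<dots> = (\<Oplus>b\<in>?B. c b \<otimes> G b h)"
        by (rule finsum_fibres_superset) (use F(2) Bfin[OF h] tau(1) cc Gc in auto)
      finally show ?thesis .
    qed
    define q where "q = (\<lambda>h. \<Oplus>\<epsilon>\<in>F. conv K (a \<epsilon>) (g \<epsilon>) h)"
    have qQ: "q \<in> carrier QQ"
      unfolding q_def using F(2) QR.m_closed[OF aQ gQ] by (intro QQ_finsum) auto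
    define \<rho> where "\<rho> = (\<lambda>h. y h \<ominus> q h)"
    have rQ: "\<rho> \<in> carrier QQ" unfolding \<rho>_def by (rule QQ_diff[OF y qQ])
    have "y h = \<rho> h \<oplus> q h" for h
      using QQ_closed[OF y] QQ_closed[OF qQ] by (simp add: \<rho>_def minus_eq a_assoc l_neg)
    moreover have "\<rho> h = \<zero>" if h: "h \<in> ?E" for h
    proof -
      have hH: "h \<in> HH" using h EH by auto
      have "q h = (\<Oplus>b\<in>insert h (B h). c b \<otimes> G b h)"
        unfolding q_def sum[OF hH] using h by (intro arg_cong[where f = "finsum K _"]) (auto simp: B_def)
      also have "\<dots> = c h \<otimes> G h h \<oplus> (\<Oplus>b\<in>B h. c b \<otimes> G b h)"
        by (rule finsum_insert) (use Bfin'[OF hH] cc Gc h in \<open>auto simp: B_def\<close>)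
      also have "\<dots> = y h"
      proof -
        have "(\<Oplus>b\<in>B h. c b \<otimes> G b h) \<in> carrier K"
          by (rule finsum_closed) (use cc Gc in \<open>auto simp: B_def\<close>)
        then show ?thesis
          using c_rec[OF h] G1[OF h] cc[OF h] QQ_closed[OF y] by (simp add: minus_eq a_assoc l_neg)
      qed
      finally show ?thesis using QQ_closed[OF y] by (simp add: \<rho>_def)
    qed
    moreover have "n \<le> wt h + wt \<epsilon>" if "\<forall>h. y h \<noteq> \<zero> \<longrightarrow> n \<le> wt h" "a \<epsilon> h \<noteq> \<zero>" for n \<epsilon> h
      using c_wt[of "h + \<epsilon>" n] that
      by (cases "wt h + wt \<epsilon> < n") (auto simp: a_def wt_add split: if_splits)
    ultimately show ?thesis using rQ aQ unfolding q_def by blast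
  qed
  show ?thesis
    by (rule that[OF F(2) _ g(1) main]) (use F(1) EH in auto)
qed

end

section \<open>Noetherianity, locality and dimension\<close>

context hypersurface
begin

text \<open>If y lies in I, so does its remainder; a nonzero remainder would have its leading
  exponent in \<open>lexp I\<close>, where it vanishes.\<close>

lemma ideal_reduction:
  assumes I: "ideal I QQ"
  obtains F g where "finite F" "F \<subseteq> HH" "\<And>\<epsilon>. \<epsilon> \<in> F \<Longrightarrow> g \<epsilon> \<in> I"
    "\<And>y. y \<in> I \<Longrightarrow> \<exists>a. (\<forall>\<epsilon>\<in>F. a \<epsilon> \<in> carrier QQ) \<and>
      (\<forall>h. y h = (\<Oplus>\<epsilon>\<in>F. conv K (a \<epsilon>) (g \<epsilon>) h)) \<and>
      (\<forall>n. (\<forall>h. y h \<noteq> \<zero> \<longrightarrow> n \<le> wt h) \<longrightarrow> (\<forall>\<epsilon>\<in>F. \<forall>h. a \<epsilon> h \<noteq> \<zero> \<longrightarrow> n \<le> wt h + wt \<epsilon>))"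
proof (rule division[OF I])
  fix F g
  assume F: "finite F" "F \<subseteq> HH" and g: "\<And>\<epsilon>. \<epsilon> \<in> F \<Longrightarrow> g \<epsilon> \<in> I"
    and div: "\<And>y. y \<in> carrier QQ \<Longrightarrow> \<exists>a. \<exists>\<rho>\<in>carrier QQ. (\<forall>\<epsilon>\<in>F. a \<epsilon> \<in> carrier QQ) \<and>
      (\<forall>h. y h = \<rho> h \<oplus> (\<Oplus>\<epsilon>\<in>F. conv K (a \<epsilon>) (g \<epsilon>) h)) \<and> (\<forall>h\<in>lexp I. \<rho> h = \<zero>) \<and>
      (\<forall>n. (\<forall>h. y h \<noteq> \<zero> \<longrightarrow> n \<le> wt h) \<longrightarrow> (\<forall>\<epsilon>\<in>F. \<forall>h. a \<epsilon> h \<noteq> \<zero> \<longrightarrow> n \<le> wt h + wt \<epsilon>))"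
  show ?thesis
  proof (rule that[OF F g])
    fix y assume y: "y \<in> I"
    have yQ: "y \<in> carrier QQ" by (rule ideal.Icarr[OF I y])
    obtain a \<rho> where a: "\<rho> \<in> carrier QQ" "\<forall>\<epsilon>\<in>F. a \<epsilon> \<in> carrier QQ"
      "\<forall>h. y h = \<rho> h \<oplus> (\<Oplus>\<epsilon>\<in>F. conv K (a \<epsilon>) (g \<epsilon>) h)" "\<forall>h\<in>lexp I. \<rho> h = \<zero>"
      "\<forall>n. (\<forall>h. y h \<noteq> \<zero> \<longrightarrow> n \<le> wt h) \<longrightarrow> (\<forall>\<epsilon>\<in>F. \<forall>h. a \<epsilon> h \<noteq> \<zero> \<longrightarrow> n \<le> wt h + wt \<epsilon>)"
      using div[OF yQ] by blast
    define q where "q = (\<lambda>h. \<Oplus>\<epsilon>\<in>F. conv K (a \<epsilon>) (g \<epsilon>) h)"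
    have q: "q \<in> I"
      unfolding q_def
    proof (rule ideal_finsum[OF I F(1)])
      fix \<epsilon> assume "\<epsilon> \<in> F"
      then show "conv K (a \<epsilon>) (g \<epsilon>) \<in> I" using ideal.I_l_closed[OF I g, of \<epsilon> "a \<epsilon>"] a(2) by simp
    qed
    have yq: "y h = \<rho> h \<oplus> q h" for h using a(3) by (simp add: q_def)
    have "\<rho> h = y h \<ominus> q h" for h
      unfolding yq using QQ_closed[OF a(1)] QQ_closed[OF ideal.Icarr[OF I q]]
      by (simp add: minus_eq a_assoc r_neg)
    then have "\<rho> = (\<lambda>h. y h \<ominus> q h)" by auto
    then have rI: "\<rho> \<in> I" using ideal_diff[OF I y q] by simp
    have "\<rho> h = \<zero>" for h
    proof (rule ccontr)
      assume "\<rho> h \<noteq> \<zero>"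
      then obtain h' where "lead \<rho> h'" using lead_exists[OF a(1)] by blast
      then show False using rI a(4) by (auto simp: lexp_def lead_def)
    qed
    then have "y h = (\<Oplus>\<epsilon>\<in>F. conv K (a \<epsilon>) (g \<epsilon>) h)" for h
      using yq QQ_closed[OF ideal.Icarr[OF I q]] unfolding q_def by simp
    then show "\<exists>a. (\<forall>\<epsilon>\<in>F. a \<epsilon> \<in> carrier QQ) \<and> (\<forall>h. y h = (\<Oplus>\<epsilon>\<in>F. conv K (a \<epsilon>) (g \<epsilon>) h)) \<and>
      (\<forall>n. (\<forall>h. y h \<noteq> \<zero> \<longrightarrow> n \<le> wt h) \<longrightarrow> (\<forall>\<epsilon>\<in>F. \<forall>h. a \<epsilon> h \<noteq> \<zero> \<longrightarrow> n \<le> wt h + wt \<epsilon>))"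
      using a(2,5) by blast
  qed
qed

theorem QQ_noetherian: "noetherian_ring QQ"
proof (rule QR.noetherian_ringI)
  fix I assume I: "ideal I QQ"
  show "\<exists>A\<subseteq>carrier QQ. finite A \<and> I = Idl\<^bsub>QQ\<^esub> A"
  proof (rule ideal_reduction[OF I])
    fix F g
    assume F: "finite F" and g: "\<And>\<epsilon>. \<epsilon> \<in> F \<Longrightarrow> g \<epsilon> \<in> I"
      and div: "\<And>y. y \<in> I \<Longrightarrow> \<exists>a. (\<forall>\<epsilon>\<in>F. a \<epsilon> \<in> carrier QQ) \<and>
        (\<forall>h. y h = (\<Oplus>\<epsilon>\<in>F. conv K (a \<epsilon>) (g \<epsilon>) h)) \<and>
        (\<forall>n. (\<forall>h. y h \<noteq> \<zero> \<longrightarrow> n \<le> wt h) \<longrightarrow> (\<forall>\<epsilon>\<in>F. \<forall>h. a \<epsilon> h \<noteq> \<zero> \<longrightarrow> n \<le> wt h + wt \<epsilon>))"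
    have sub: "g ` F \<subseteq> carrier QQ" using g ideal.Icarr[OF I] by auto
    have J: "ideal (Idl\<^bsub>QQ\<^esub> (g ` F)) QQ" by (rule QR.genideal_ideal[OF sub])
    have "Idl\<^bsub>QQ\<^esub> (g ` F) \<subseteq> I" by (rule QR.genideal_minimal[OF I]) (use g in auto)
    moreover have "y \<in> Idl\<^bsub>QQ\<^esub> (g ` F)" if "y \<in> I" for y
    proof -
      obtain a where a: "\<forall>\<epsilon>\<in>F. a \<epsilon> \<in> carrier QQ" "\<And>h. y h = (\<Oplus>\<epsilon>\<in>F. conv K (a \<epsilon>) (g \<epsilon>) h)"
        using div[OF \<open>y \<in> I\<close>] by blast
      have "(\<lambda>h. \<Oplus>\<epsilon>\<in>F. conv K (a \<epsilon>) (g \<epsilon>) h) \<in> Idl\<^bsub>QQ\<^esub> (g ` F)"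
      proof (rule ideal_finsum[OF J F])
        fix \<epsilon> assume e: "\<epsilon> \<in> F"
        have "g \<epsilon> \<in> Idl\<^bsub>QQ\<^esub> (g ` F)" using QR.genideal_self[OF sub] e by auto
        then show "conv K (a \<epsilon>) (g \<epsilon>) \<in> Idl\<^bsub>QQ\<^esub> (g ` F)"
          using ideal.I_l_closed[OF J, of "g \<epsilon>" "a \<epsilon>"] a(1) e by simp
      qed
      moreover have "y = (\<lambda>h. \<Oplus>\<epsilon>\<in>F. conv K (a \<epsilon>) (g \<epsilon>) h)" using a(2) by auto
      ultimately show ?thesis by simp
    qed
    ultimately show ?thesis using F sub by (intro exI[of _ "g ` F"]) auto
  qed
qed

text \<open>Every exponent of \<open>HH\<close> is then a leading exponent of I, so the remainder of
  1 is 0.\<close>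

lemma zero_in_lexp_imp_one:
  assumes I: "ideal I QQ" and "0 \<in> lexp I"
  shows "\<one>\<^bsub>QQ\<^esub> \<in> I"
proof (rule division[OF I])
  fix F g
  assume F: "finite F" and g: "\<And>\<epsilon>. \<epsilon> \<in> F \<Longrightarrow> g \<epsilon> \<in> I"
    and div: "\<And>y. y \<in> carrier QQ \<Longrightarrow> \<exists>a. \<exists>\<rho>\<in>carrier QQ. (\<forall>\<epsilon>\<in>F. a \<epsilon> \<in> carrier QQ) \<and>
      (\<forall>h. y h = \<rho> h \<oplus> (\<Oplus>\<epsilon>\<in>F. conv K (a \<epsilon>) (g \<epsilon>) h)) \<and> (\<forall>h\<in>lexp I. \<rho> h = \<zero>) \<and>
      (\<forall>n. (\<forall>h. y h \<noteq> \<zero> \<longrightarrow> n \<le> wt h) \<longrightarrow> (\<forall>\<epsilon>\<in>F. \<forall>h. a \<epsilon> h \<noteq> \<zero> \<longrightarrow> n \<le> wt h + wt \<epsilon>))"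
  let ?y = "\<one>\<^bsub>QQ\<^esub>"
  have yQ: "?y \<in> carrier QQ" by (rule QR.one_closed)
  obtain a \<rho> where a: "\<rho> \<in> carrier QQ" "\<forall>\<epsilon>\<in>F. a \<epsilon> \<in> carrier QQ"
    "\<forall>h. ?y h = \<rho> h \<oplus> (\<Oplus>\<epsilon>\<in>F. conv K (a \<epsilon>) (g \<epsilon>) h)" "\<forall>h\<in>lexp I. \<rho> h = \<zero>"
    using div[OF yQ] by blast
  have q: "(\<lambda>h. \<Oplus>\<epsilon>\<in>F. conv K (a \<epsilon>) (g \<epsilon>) h) \<in> I" (is "?q \<in> I")
  proof (rule ideal_finsum[OF I F(1)])
    fix \<epsilon> assume "\<epsilon> \<in> F"
    then show "conv K (a \<epsilon>) (g \<epsilon>) \<in> I" using ideal.I_l_closed[OF I g, of \<epsilon> "a \<epsilon>"] a(2) by simp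
  qed
  have "\<rho> h = \<zero>" for h
  proof (cases "h \<in> HH")
    case True
    then show ?thesis using lexp_add[OF I assms(2) True] a(4) by simp
  next
    case False
    then show ?thesis using QQ_supp[OF a(1)] by blast
  qed
  then have "?y = ?q" using a(3) QQ_closed[OF ideal.Icarr[OF I q]] by (auto simp: fun_eq_iff)
  then show ?thesis using q by simp
qed

section \<open>The maximal ideal and the Artin-Rees estimate\<close>

definition MM :: "(int poly \<Rightarrow> 'k) set" where "MM = {f \<in> carrier QQ. f 0 = \<zero>}"

text \<open>In \<open>HH\<close> the only decomposition of 0 is 0+0, because weights are nonnegative
  and vanish only at 0.\<close>

lemma conv_0:
  assumes "f \<in> carrier QQ" "g \<in> carrier QQ"
  shows "conv K f g 0 = f 0 \<otimes> g 0"
proof -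
  have "conv K f g 0 = (\<Oplus>s\<in>{0}. f s \<otimes> g (0 - s))"
  proof (rule L.conv_eq)
    fix s assume "f s \<noteq> \<zero>" "g (0 - s) \<noteq> \<zero>"
    then have s: "s \<in> HH" "0 - s \<in> HH" using QQ_supp assms by blast+
    then have "wt s = 0" using HH_bounds(2)[of s] HH_bounds(2)[of "0 - s"] by (simp add: L.w_minus)
    then show "s \<in> {0}" using HH_bounds(3)[OF s(1)] by simp
  qed (use assms QQ_LC in auto)
  then show ?thesis using assms QQ_closed by simp
qed

text \<open>A series with nonzero constant term has leading exponent 0, hence generates the unit
  ideal. This takes the place of constructing inverses of series.\<close>

lemma proper_ideal_subset_MM:
  assumes I: "ideal I QQ" "I \<noteq> carrier QQ"
  shows "I \<subseteq> MM"
proof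
  fix f assume f: "f \<in> I"
  have fQ: "f \<in> carrier QQ" using ideal.Icarr[OF I(1) f] .
  have "f 0 = \<zero>"
  proof (rule ccontr)
    assume nz: "f 0 \<noteq> \<zero>"
    have "0 \<le> g" if "f g \<noteq> \<zero>" for g
    proof (rule ccontr)
      assume "\<not> 0 \<le> g"
      moreover have gH: "g \<in> HH" using QQ_supp[OF fQ that] .
      ultimately have "wt g \<le> wt 0" using ConeD(1) by (intro wt_mono) auto
      then have "wt g = 0" using HH_bounds(2)[OF gH] by simp
      then show False using HH_bounds(3)[OF gH] \<open>\<not> 0 \<le> g\<close> by simp
    qed
    then have "lead f 0" using nz by (simp add: lead_def)
    then have "0 \<in> lexp I" using f by (auto simp: lexp_def)
    then have "\<one>\<^bsub>QQ\<^esub> \<in> I" by (rule zero_in_lexp_imp_one[OF I(1)])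
    then show False using ideal.one_imp_carrier[OF I(1)] I(2) by simp
  qed
  then show "f \<in> MM" using fQ by (simp add: MM_def)
qed

lemma MM_ideal: "ideal MM QQ"
proof (rule idealI)
  show "ring QQ" by (rule QR.ring_axioms)
  show "subgroup MM (add_monoid QQ)"
  proof (rule QR.add.subgroupI)
    show "MM \<noteq> {}" using QR.zero_closed by (auto simp: MM_def)
    fix a assume a: "a \<in> MM"
    have "(\<lambda>h. \<zero>\<^bsub>QQ\<^esub> h \<ominus> a h) \<in> carrier QQ"
      using a by (intro QQ_diff QR.zero_closed) (simp add: MM_def)
    moreover have "(\<lambda>h. \<zero>\<^bsub>QQ\<^esub> h \<ominus> a h) = (\<lambda>h. \<ominus> a h)"
      using a QQ_closed by (auto simp: MM_def minus_eq)
    ultimately have n: "(\<lambda>h. \<ominus> a h) \<in> carrier QQ" by simp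
    have "(\<ominus>\<^bsub>QQ\<^esub> a) = (\<lambda>h. \<ominus> a h)"
      using QR.minus_equality[of "\<lambda>h. \<ominus> a h" a] n a QQ_closed by (auto simp: MM_def l_neg)
    then show "\<ominus>\<^bsub>QQ\<^esub> a \<in> MM" using n a by (simp add: MM_def)
  next
    fix a b assume "a \<in> MM" "b \<in> MM"
    then show "a \<oplus>\<^bsub>QQ\<^esub> b \<in> MM"
      using QR.a_closed[of a b] by (simp add: MM_def)
  qed (auto simp: MM_def)
next
  fix a x assume a: "a \<in> MM" and x: "x \<in> carrier QQ"
  have aQ: "a \<in> carrier QQ" "a 0 = \<zero>" using a by (auto simp: MM_def)
  show "x \<otimes>\<^bsub>QQ\<^esub> a \<in> MM" "a \<otimes>\<^bsub>QQ\<^esub> x \<in> MM"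
    using QR.m_closed[OF x aQ(1)] QR.m_closed[OF aQ(1) x] conv_0[OF x aQ(1)] conv_0[OF aQ(1) x] aQ(2) QQ_closed[OF x]
    by (auto simp: MM_def)
qed

lemma MM_proper: "MM \<noteq> carrier QQ"
proof -
  have "\<one>\<^bsub>QQ\<^esub> \<notin> MM" by (simp add: MM_def lmonom_def)
  then show ?thesis using QR.one_closed by auto
qed

lemma MM_maximal: "maximalideal MM QQ"
proof (rule maximalidealI[OF MM_ideal])
  show "carrier QQ \<noteq> MM" using MM_proper by simp
  fix J assume J: "ideal J QQ" "MM \<subseteq> J" "J \<subseteq> carrier QQ"
  then show "J = MM \<or> J = carrier QQ" using proper_ideal_subset_MM[of J] by auto
qed

lemma maximal_eq_MM: "maximalideal I QQ \<Longrightarrow> I = MM"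
proof -
  assume I: "maximalideal I QQ"
  then have "ideal I QQ" "I \<noteq> carrier QQ"
    using maximalideal.axioms(1) maximalideal.I_notcarr by auto
  then have "I \<subseteq> MM" by (rule proper_ideal_subset_MM)
  then show "I = MM"
    using maximalideal.I_maximal[OF I MM_ideal] MM_proper by (auto simp: MM_def)
qed

theorem QQ_local: "noetherian_local QQ"
  unfolding noetherian_local_def
  by (intro conjI ex1I[of _ MM] QR.is_cring QQ_noetherian MM_maximal maximal_eq_MM)

lemma max_ideal_QQ: "max_ideal QQ = MM"
  unfolding max_ideal_def
  by (rule the_equality[where P = "\<lambda>I. maximalideal I QQ"]) (rule MM_maximal, erule maximal_eq_MM)

text \<open>Division is applied to J = I + (y), each basis element of J being written once as an
  element of I plus a multiple of y. The quotients lose at most the weight of a basis exponent, and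
  the new coefficient of y is assembled from them; so the loss \<kappa> does not depend on
  n.\<close>

lemma artin_rees:
  assumes I: "ideal I QQ" and y: "y \<in> carrier QQ"
  obtains \<kappa> :: nat where "\<And>i t n. i \<in> I \<Longrightarrow> t \<in> carrier QQ \<Longrightarrow>
    (\<And>h. i h \<oplus> conv K y t h \<noteq> \<zero> \<Longrightarrow> n + int \<kappa> \<le> wt h) \<Longrightarrow>
    \<exists>i'\<in>I. \<exists>t'\<in>carrier QQ. (\<forall>h. i h \<oplus> conv K y t h = i' h \<oplus> conv K y t' h) \<and> (\<forall>h. t' h \<noteq> \<zero> \<longrightarrow> n \<le> wt h)"
proof -
  define J where "J = {x \<in> carrier QQ. \<exists>i\<in>I. \<exists>t\<in>carrier QQ. x = (\<lambda>h. i h \<oplus> conv K y t h)}"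
  have IQ: "i \<in> carrier QQ" if "i \<in> I" for i using ideal.Icarr[OF I that] .
  note yL = QQ_LC[OF y]
  note ab = ideal.axioms(1)[OF I]
  have Jeq: "J = I <+>\<^bsub>QQ\<^esub> PIdl\<^bsub>QQ\<^esub> y"
  proof -
    have "conv K y t = conv K t y" if "t \<in> carrier QQ" for t
      using L.conv_comm[OF yL QQ_LC[OF that]] .
    then have "J = (\<Union>i\<in>I. \<Union>t\<in>carrier QQ. {i \<oplus>\<^bsub>QQ\<^esub> t \<otimes>\<^bsub>QQ\<^esub> y})"
      using QR.a_closed[OF IQ QR.m_closed[OF _ y]] by (auto simp: J_def)
    then show ?thesis by (auto simp: set_add_def set_mult_def cgenideal_def)
  qed
  have J: "ideal J QQ" unfolding Jeq by (rule QR.add_ideals[OF I QR.cgenideal_ideal[OF y]])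
  show ?thesis
  proof (rule ideal_reduction[OF J])
    fix F g
    assume F: "finite F" "F \<subseteq> HH" and g: "\<And>\<epsilon>. \<epsilon> \<in> F \<Longrightarrow> g \<epsilon> \<in> J"
      and div: "\<And>x. x \<in> J \<Longrightarrow> \<exists>a. (\<forall>\<epsilon>\<in>F. a \<epsilon> \<in> carrier QQ) \<and>
        (\<forall>h. x h = (\<Oplus>\<epsilon>\<in>F. conv K (a \<epsilon>) (g \<epsilon>) h)) \<and>
        (\<forall>n. (\<forall>h. x h \<noteq> \<zero> \<longrightarrow> n \<le> wt h) \<longrightarrow> (\<forall>\<epsilon>\<in>F. \<forall>h. a \<epsilon> h \<noteq> \<zero> \<longrightarrow> n \<le> wt h + wt \<epsilon>))"
    have "\<forall>\<epsilon>\<in>F. \<exists>i s. i \<in> I \<and> s \<in> carrier QQ \<and> g \<epsilon> = (\<lambda>h. i h \<oplus> conv K y s h)"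
      using g by (auto simp: J_def)
    then obtain i0 s0 where is0: "\<And>\<epsilon>. \<epsilon> \<in> F \<Longrightarrow> i0 \<epsilon> \<in> I" "\<And>\<epsilon>. \<epsilon> \<in> F \<Longrightarrow> s0 \<epsilon> \<in> carrier QQ"
      "\<And>\<epsilon>. \<epsilon> \<in> F \<Longrightarrow> g \<epsilon> = (\<lambda>h. i0 \<epsilon> h \<oplus> conv K y (s0 \<epsilon>) h)" by metis
    \<comment> \<open>Weights on \<open>HH\<close> are nonnegative, so the sum dominates the weight
      of each basis exponent.\<close>
    define \<kappa> where "\<kappa> = nat (\<Sum>\<epsilon>\<in>F. wt \<epsilon>)"
    have wF: "0 \<le> wt \<epsilon>" if "\<epsilon> \<in> F" for \<epsilon> using F(2) that HH_bounds(2) by auto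
    have kap: "wt \<epsilon> \<le> int \<kappa>" if "\<epsilon> \<in> F" for \<epsilon>
      using member_le_sum[of \<epsilon> F wt] F(1) wF that sum_nonneg[of F wt] by (simp add: \<kappa>_def)
    show ?thesis
    proof (rule that[of \<kappa>])
      fix i t n
      assume i: "i \<in> I" and t: "t \<in> carrier QQ" and wt: "\<And>h. i h \<oplus> conv K y t h \<noteq> \<zero> \<Longrightarrow> n + int \<kappa> \<le> wt h"
      define x where "x = (\<lambda>h. i h \<oplus> conv K y t h)"
      have "x \<in> carrier QQ" unfolding x_def
        using QR.a_closed[OF IQ[OF i] QR.m_closed[OF y t]] by simp
      then have "x \<in> J" unfolding J_def using i t x_def by blast
      then obtain a where a0: "\<forall>\<epsilon>\<in>F. a \<epsilon> \<in> carrier QQ" "\<forall>h. x h = (\<Oplus>\<epsilon>\<in>F. conv K (a \<epsilon>) (g \<epsilon>) h)"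
        "\<forall>n. (\<forall>h. x h \<noteq> \<zero> \<longrightarrow> n \<le> wt h) \<longrightarrow> (\<forall>\<epsilon>\<in>F. \<forall>h. a \<epsilon> h \<noteq> \<zero> \<longrightarrow> n \<le> wt h + wt \<epsilon>)"
        using div by blast
      have "\<forall>h. x h \<noteq> \<zero> \<longrightarrow> n + int \<kappa> \<le> wt h" using wt unfolding x_def by simp
      then have "\<forall>\<epsilon>\<in>F. \<forall>h. a \<epsilon> h \<noteq> \<zero> \<longrightarrow> n + int \<kappa> \<le> wt h + wt \<epsilon>" using a0(3) by blast
      then have a: "\<And>\<epsilon>. \<epsilon> \<in> F \<Longrightarrow> a \<epsilon> \<in> carrier QQ" "\<And>h. x h = (\<Oplus>\<epsilon>\<in>F. conv K (a \<epsilon>) (g \<epsilon>) h)"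
        "\<And>\<epsilon> h. \<epsilon> \<in> F \<Longrightarrow> a \<epsilon> h \<noteq> \<zero> \<Longrightarrow> n + int \<kappa> \<le> wt h + wt \<epsilon>"
        using a0(1,2) by blast+
      define i' where "i' = (\<lambda>h. \<Oplus>\<epsilon>\<in>F. conv K (a \<epsilon>) (i0 \<epsilon>) h)"
      define t' where "t' = (\<lambda>h. \<Oplus>\<epsilon>\<in>F. conv K (a \<epsilon>) (s0 \<epsilon>) h)"
      have ai: "conv K (a \<epsilon>) (i0 \<epsilon>) \<in> I" if "\<epsilon> \<in> F" for \<epsilon>
        using ideal.I_l_closed[OF I is0(1)[OF that] a(1)[OF that]] by simp
      have as: "conv K (a \<epsilon>) (s0 \<epsilon>) \<in> carrier QQ" if "\<epsilon> \<in> F" for \<epsilon>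
        using QR.m_closed[OF a(1)[OF that] is0(2)[OF that]] by simp
      have i'I: "i' \<in> I" unfolding i'_def by (rule ideal_finsum[OF I F(1) ai])
      have t'Q: "t' \<in> carrier QQ" unfolding t'_def by (rule QQ_finsum[OF F(1) as])
      have "x h = i' h \<oplus> conv K y t' h" for h
      proof -
        have yt': "conv K y t' = (\<lambda>h. \<Oplus>\<epsilon>\<in>F. conv K y (conv K (a \<epsilon>) (s0 \<epsilon>)) h)"
        proof -
          have "t' = finsum LL (\<lambda>\<epsilon>. conv K (a \<epsilon>) (s0 \<epsilon>)) F"
            unfolding t'_def using QQ_LC[OF as] by (intro L.laurent_finsum[symmetric] F(1)) auto
          then have "conv K y t' = finsum LL (\<lambda>\<epsilon>. conv K y (conv K (a \<epsilon>) (s0 \<epsilon>))) F"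
            using LR.finsum_rdistr[OF F(1), of y "\<lambda>\<epsilon>. conv K (a \<epsilon>) (s0 \<epsilon>)"] yL QQ_LC[OF as] by auto
          also have "\<dots> = (\<lambda>h. \<Oplus>\<epsilon>\<in>F. conv K y (conv K (a \<epsilon>) (s0 \<epsilon>)) h)"
            by (rule L.laurent_finsum[OF F(1)]) (use yL QQ_LC[OF as] in auto)
          finally show ?thesis .
        qed
        have "x h = (\<Oplus>\<epsilon>\<in>F. conv K (a \<epsilon>) (i0 \<epsilon>) h \<oplus> conv K y (conv K (a \<epsilon>) (s0 \<epsilon>)) h)"
          unfolding a(2)
        proof (rule finsum_cong_closed)
          fix \<epsilon> assume e: "\<epsilon> \<in> F"
          note aQ = a(1)[OF e] and iQ = IQ[OF is0(1)[OF e]] and sQ = is0(2)[OF e]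
          have "conv K (a \<epsilon>) (g \<epsilon>) = a \<epsilon> \<otimes>\<^bsub>QQ\<^esub> (i0 \<epsilon> \<oplus>\<^bsub>QQ\<^esub> y \<otimes>\<^bsub>QQ\<^esub> s0 \<epsilon>)"
            using is0(3)[OF e] by simp
          also have "\<dots> = a \<epsilon> \<otimes>\<^bsub>QQ\<^esub> i0 \<epsilon> \<oplus>\<^bsub>QQ\<^esub> y \<otimes>\<^bsub>QQ\<^esub> (a \<epsilon> \<otimes>\<^bsub>QQ\<^esub> s0 \<epsilon>)"
            using aQ iQ sQ y by (simp only: QR.r_distr QR.m_closed QR.m_lcomm)
          finally show "conv K (a \<epsilon>) (g \<epsilon>) h = conv K (a \<epsilon>) (i0 \<epsilon>) h \<oplus> conv K y (conv K (a \<epsilon>) (s0 \<epsilon>)) h" by simp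
          show "conv K (a \<epsilon>) (i0 \<epsilon>) h \<oplus> conv K y (conv K (a \<epsilon>) (s0 \<epsilon>)) h \<in> carrier K"
            using QQ_LC[OF aQ] QQ_LC[OF iQ] QQ_LC[OF as[OF e]] yL by auto
        qed
        also have "\<dots> = i' h \<oplus> conv K y t' h"
          unfolding i'_def yt'
        proof (rule finsum_addf)
          show "(\<lambda>\<epsilon>. conv K (a \<epsilon>) (i0 \<epsilon>) h) \<in> F \<rightarrow> carrier K" using QQ_closed[OF IQ[OF ai]] by auto
          show "(\<lambda>\<epsilon>. conv K y (conv K (a \<epsilon>) (s0 \<epsilon>)) h) \<in> F \<rightarrow> carrier K"
            using QQ_LC[OF as] yL by auto
        qed
        finally show ?thesis .
      qed
      moreover have "n \<le> wt h" if "t' h \<noteq> \<zero>" for h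
      proof -
        have "\<exists>\<epsilon>\<in>F. conv K (a \<epsilon>) (s0 \<epsilon>) h \<noteq> \<zero>"
        proof (rule ccontr)
          assume "\<not> (\<exists>\<epsilon>\<in>F. conv K (a \<epsilon>) (s0 \<epsilon>) h \<noteq> \<zero>)"
          then have "t' h = \<zero>" unfolding t'_def by (intro finsum_zero_cong) blast
          then show False using that by simp
        qed
        then obtain \<epsilon> where e: "\<epsilon> \<in> F" "conv K (a \<epsilon>) (s0 \<epsilon>) h \<noteq> \<zero>" by blast
        then obtain p q where pq: "a \<epsilon> p \<noteq> \<zero>" "s0 \<epsilon> q \<noteq> \<zero>" "h = p + q"
          by (auto elim: L.conv_nonzeroE)
        have "0 \<le> wt q" using QQ_supp[OF is0(2)[OF e(1)] pq(2)] HH_bounds(2) by auto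
        then show ?thesis using a(3)[OF e(1) pq(1)] kap[OF e(1)] pq(3) by (simp add: wt_add)
      qed
      ultimately show "\<exists>i'\<in>I. \<exists>t'\<in>carrier QQ. (\<forall>h. i h \<oplus> conv K y t h = i' h \<oplus> conv K y t' h) \<and>
          (\<forall>h. t' h \<noteq> \<zero> \<longrightarrow> n \<le> wt h)"
        using i'I t'Q unfolding x_def by blast
    qed
  qed
qed

end

text \<open>If each counting function dominates the increments of its predecessor, then each has growth order
  at most one less than its predecessor.\<close>

lemma growth_descent:
  fixes c :: "nat \<Rightarrow> nat \<Rightarrow> nat"
  assumes mono: "\<And>j a b. a \<le> b \<Longrightarrow> c j a \<le> c j b"
    and c0: "\<And>N. c 0 N \<le> N ^ n"
    and step: "\<And>j. j \<le> n \<Longrightarrow> \<exists>\<kappa>. \<forall>N. c (Suc j) (N + \<kappa>) + c j N \<le> c j (N + \<kappa>)"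
  shows "c (Suc n) N = 0"
proof -
  \<comment> \<open>Telescoping t increments, with monotonicity to compare each of them with the
    first.\<close>
  have iter: "\<exists>\<kappa>. \<forall>t N. t * c (Suc j) N \<le> c j (N + t * \<kappa>)" if j: "j \<le> n" for j
  proof -
    obtain \<kappa> where k: "\<And>N. c (Suc j) (N + \<kappa>) + c j N \<le> c j (N + \<kappa>)" using step[OF j] by blast
    have "t * c (Suc j) N \<le> c j (N + t * \<kappa>)" for t N
    proof (induction t)
      case (Suc t)
      have "c (Suc j) N \<le> c (Suc j) (N + t * \<kappa> + \<kappa>)" by (rule mono) simp
      then have "Suc t * c (Suc j) N \<le> c (Suc j) (N + t * \<kappa> + \<kappa>) + c j (N + t * \<kappa>)" using Suc by simp
      also have "\<dots> \<le> c j (N + t * \<kappa> + \<kappa>)" by (rule k)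
      finally show ?case by (simp add: algebra_simps)
    qed simp
    then show ?thesis by blast
  qed
  have "\<exists>C. \<forall>N. c j N \<le> C * (N + 1) ^ (n - j)" if "j \<le> n" for j
    using that
  proof (induction j)
    case 0
    have "c 0 N \<le> 1 * (N + 1) ^ n" for N
      using c0[of N] power_mono[of N "N + 1" n] by simp
    then show ?case by (metis diff_zero)
  next
    case (Suc j)
    then obtain C where C: "\<And>N. c j N \<le> C * (N + 1) ^ (n - j)" by auto
    obtain \<kappa> where k: "\<And>t N. t * c (Suc j) N \<le> c j (N + t * \<kappa>)" using iter[of j] Suc.prems by auto
    have nj: "n - j = Suc (n - Suc j)" using Suc.prems by simp
    have "c (Suc j) N \<le> C * (\<kappa> + 1) ^ (n - j) * (N + 1) ^ (n - Suc j)" for N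
    proof -
      \<comment> \<open>With t = N+1 the argument grows only proportionally to N, and one factor N+1
        can be cancelled.\<close>
      have "(N + 1) * c (Suc j) N \<le> c j (N + (N + 1) * \<kappa>)" by (rule k)
      also have "\<dots> \<le> C * (N + (N + 1) * \<kappa> + 1) ^ (n - j)" by (rule C)
      also have "N + (N + 1) * \<kappa> + 1 = (\<kappa> + 1) * (N + 1)" by (simp add: algebra_simps)
      also have "C * ((\<kappa> + 1) * (N + 1)) ^ (n - j) = (N + 1) * (C * (\<kappa> + 1) ^ (n - j) * (N + 1) ^ (n - Suc j))"
        unfolding power_mult_distrib nj by (simp only: power_Suc ac_simps)
      finally show ?thesis by (simp only: mult_le_cancel1)
    qed
    then show ?case by blast
  qed
  from this[OF order.refl] obtain C where C: "\<And>N. c n N \<le> C" by auto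
  obtain \<kappa> where k: "\<And>t N. t * c (Suc n) N \<le> c n (N + t * \<kappa>)" using iter[of n] by auto
  \<comment> \<open>Here t = C+1 exceeds the constant bound C, which leaves only the value
    0.\<close>
  have "Suc C * c (Suc n) N \<le> C" using order.trans[OF k C] .
  then show ?thesis by (cases "c (Suc n) N") auto
qed

section \<open>The upper bound on the Krull dimension\<close>

context hypersurface
begin

text \<open>Plays the role of the Hilbert function of the quotient by I for the weight
  filtration.\<close>

definition cnt :: "(int poly \<Rightarrow> 'k) set \<Rightarrow> nat \<Rightarrow> nat" where
  "cnt I N = card {h \<in> HH. wt h < int N \<and> h \<notin> lexp I}"

lemma cnt_finite: "finite {h \<in> HH. wt h < int N \<and> P h}"
  by (rule finite_subset[OF _ HH_finite[of "int N"]]) auto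

lemma cnt_mono: "a \<le> b \<Longrightarrow> cnt I a \<le> cnt I b"
  unfolding cnt_def by (rule card_mono[OF cnt_finite]) auto

lemma cnt_bound: "cnt I N \<le> N ^ Suc d"
proof -
  have "cnt I N \<le> card {h \<in> HH. wt h < int N}"
    unfolding cnt_def by (rule card_mono[OF HH_finite]) auto
  then show ?thesis using HH_card[of "int N"] by simp
qed

text \<open>Pick y in J outside P. The standard exponents of P of weight below N are no more than
  the exponents of weight below N + \<kappa> that are leading in J but not in P. For otherwise some
  combination z of the former would have yz of order at least N + \<kappa> modulo P; Artin-Rees and
  primality then put into P a series that agrees with z below weight N, although no exponent of z is
  leading in P.\<close>

lemma cnt_step:
  assumes P: "primeideal P QQ" and J: "ideal J QQ" and PJ: "P \<subset> J"
  shows "\<exists>\<kappa>. \<forall>N. cnt J (N + \<kappa>) + cnt P N \<le> cnt P (N + \<kappa>)"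
proof -
  have I: "ideal P QQ" using P by (rule primeideal.axioms(1))
  obtain y where y: "y \<in> J" "y \<notin> P" using PJ by blast
  have yQ: "y \<in> carrier QQ" using ideal.Icarr[OF J y(1)] .
  have PQ: "x \<in> carrier QQ" if "x \<in> P" for x using ideal.Icarr[OF I that] .
  have sub: "lexp P \<subseteq> lexp J" using PJ by (auto simp: lexp_def)
  obtain \<kappa> :: nat where AR: "\<And>i t n. i \<in> P \<Longrightarrow> t \<in> carrier QQ \<Longrightarrow>
    (\<And>h. i h \<oplus> conv K y t h \<noteq> \<zero> \<Longrightarrow> n + int \<kappa> \<le> wt h) \<Longrightarrow>
    \<exists>i'\<in>P. \<exists>t'\<in>carrier QQ. (\<forall>h. i h \<oplus> conv K y t h = i' h \<oplus> conv K y t' h) \<and> (\<forall>h. t' h \<noteq> \<zero> \<longrightarrow> n \<le> wt h)"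
    using artin_rees[OF I yQ] by blast
  show ?thesis
  proof (intro exI[of _ \<kappa>] allI)
    fix N
    define B where "B = {h \<in> HH. wt h < int N \<and> h \<notin> lexp P}"
    define Z where "Z = {h \<in> HH. wt h < int (N + \<kappa>) \<and> h \<in> lexp J \<and> h \<notin> lexp P}"
    have finB: "finite B" and finZ: "finite Z" unfolding B_def Z_def by (rule cnt_finite)+
    have "card B \<le> card Z"
    proof (rule ccontr)
      assume "\<not> card B \<le> card Z"
      then have less: "card Z < card B" by simp
      have "\<forall>b\<in>B. \<exists>\<rho> q. \<rho> \<in> carrier QQ \<and> q \<in> P \<and> (\<forall>h. y (h - b) = \<rho> h \<oplus> q h) \<and> (\<forall>h\<in>lexp P. \<rho> h = \<zero>)"
      proof
        fix b assume b: "b \<in> B"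
        have yb: "(\<lambda>h. \<one> \<otimes> y (h - b)) \<in> carrier QQ"
          by (rule ideal_lmonom[OF QR.oneideal yQ]) (use b in \<open>auto simp: B_def\<close>)
        show "\<exists>\<rho> q. \<rho> \<in> carrier QQ \<and> q \<in> P \<and> (\<forall>h. y (h - b) = \<rho> h \<oplus> q h) \<and> (\<forall>h\<in>lexp P. \<rho> h = \<zero>)"
        proof (rule division[OF I])
          fix F g
          assume F: "finite F" and g: "\<And>\<epsilon>. \<epsilon> \<in> F \<Longrightarrow> g \<epsilon> \<in> P"
            and div: "\<And>y. y \<in> carrier QQ \<Longrightarrow> \<exists>a. \<exists>\<rho>\<in>carrier QQ. (\<forall>\<epsilon>\<in>F. a \<epsilon> \<in> carrier QQ) \<and>
              (\<forall>h. y h = \<rho> h \<oplus> (\<Oplus>\<epsilon>\<in>F. conv K (a \<epsilon>) (g \<epsilon>) h)) \<and> (\<forall>h\<in>lexp P. \<rho> h = \<zero>) \<and>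
              (\<forall>n. (\<forall>h. y h \<noteq> \<zero> \<longrightarrow> n \<le> wt h) \<longrightarrow> (\<forall>\<epsilon>\<in>F. \<forall>h. a \<epsilon> h \<noteq> \<zero> \<longrightarrow> n \<le> wt h + wt \<epsilon>))"
          obtain a \<rho> where a: "\<rho> \<in> carrier QQ" "\<forall>\<epsilon>\<in>F. a \<epsilon> \<in> carrier QQ"
            "\<forall>h. \<one> \<otimes> y (h - b) = \<rho> h \<oplus> (\<Oplus>\<epsilon>\<in>F. conv K (a \<epsilon>) (g \<epsilon>) h)" "\<forall>h\<in>lexp P. \<rho> h = \<zero>"
            using div[OF yb] by blast
          have "(\<lambda>h. \<Oplus>\<epsilon>\<in>F. conv K (a \<epsilon>) (g \<epsilon>) h) \<in> P"
          proof (rule ideal_finsum[OF I F(1)])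
            fix \<epsilon> assume "\<epsilon> \<in> F"
            then show "conv K (a \<epsilon>) (g \<epsilon>) \<in> P" using ideal.I_l_closed[OF I g, of \<epsilon> "a \<epsilon>"] a(2) by simp
          qed
          then show ?thesis using a QQ_closed[OF yQ]
            by (intro exI[of _ \<rho>] exI[of _ "\<lambda>h. \<Oplus>\<epsilon>\<in>F. conv K (a \<epsilon>) (g \<epsilon>) h"]) simp
        qed
      qed
      then obtain \<rho> q where rq: "\<And>b. b \<in> B \<Longrightarrow> \<rho> b \<in> carrier QQ" "\<And>b. b \<in> B \<Longrightarrow> q b \<in> P"
        "\<And>b h. b \<in> B \<Longrightarrow> y (h - b) = \<rho> b h \<oplus> q b h" "\<And>b h. b \<in> B \<Longrightarrow> h \<in> lexp P \<Longrightarrow> \<rho> b h = \<zero>"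
        by metis
      have rc: "\<rho> b h \<in> carrier K" if "b \<in> B" for b h using QQ_closed[OF rq(1)[OF that]] .
      have qc: "q b h \<in> carrier K" if "b \<in> B" for b h using QQ_closed[OF PQ[OF rq(2)[OF that]]] .
      \<comment> \<open>One equation for each exponent in \<open>Z\<close>: the combination of the
        remainders shall have no coefficient there.\<close>
      obtain l where l: "\<And>b. l b \<in> carrier K" "\<exists>b\<in>B. l b \<noteq> \<zero>" "\<And>z. z \<in> Z \<Longrightarrow> (\<Oplus>b\<in>B. l b \<otimes> \<rho> b z) = \<zero>"
        using homogeneous_system[OF finZ finB less, of \<rho>] rc by blast
      define z where "z = (\<lambda>h. if h \<in> B then l h else \<zero>)"
      have zQ: "z \<in> carrier QQ" by (rule QQ_I) (auto simp: z_def l B_def split: if_splits)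
      define R where "R = (\<lambda>h. \<Oplus>b\<in>B. l b \<otimes> \<rho> b h)"
      define S where "S = (\<lambda>h. \<Oplus>b\<in>B. l b \<otimes> q b h)"
      have lI: "(\<lambda>h. l b \<otimes> x h) \<in> I'" if "ideal I' QQ" "x \<in> I'" for I' x b
        using ideal_lmonom[OF that Cone_0 l(1)[of b]] by simp
      have RQ: "R \<in> carrier QQ" unfolding R_def by (rule QQ_finsum[OF finB lI[OF QR.oneideal rq(1)]])
      have SP: "S \<in> P" unfolding S_def by (rule ideal_finsum[OF I finB lI[OF I rq(2)]])
      have yz: "conv K y z h = R h \<oplus> S h" for h
      proof -
        have "conv K y z h = conv K z y h" using L.conv_comm[OF QQ_LC[OF yQ] QQ_LC[OF zQ]] by simp
        also have "\<dots> = (\<Oplus>b\<in>B. z b \<otimes> y (h - b))"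
          by (rule L.conv_eq[OF QQ_LC[OF zQ] QQ_LC[OF yQ] finB]) (auto simp: z_def split: if_splits)
        also have "\<dots> = (\<Oplus>b\<in>B. l b \<otimes> \<rho> b h \<oplus> l b \<otimes> q b h)"
        proof (rule finsum_cong_closed)
          fix b assume b: "b \<in> B"
          show "z b \<otimes> y (h - b) = l b \<otimes> \<rho> b h \<oplus> l b \<otimes> q b h"
            unfolding rq(3)[OF b] using b l(1) rc[OF b] qc[OF b] by (simp add: z_def r_distr)
          show "l b \<otimes> \<rho> b h \<oplus> l b \<otimes> q b h \<in> carrier K" using l(1) rc[OF b] qc[OF b] by simp
        qed
        also have "\<dots> = R h \<oplus> S h" unfolding R_def S_def by (rule finsum_addf) (use l(1) rc qc in auto)
        finally show ?thesis .
      qed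
      have yzQ: "conv K y z \<in> carrier QQ" using QR.m_closed[OF yQ zQ] by simp
      have SQ: "S \<in> carrier QQ" by (rule PQ[OF SP])
      \<comment> \<open>Subtracting \<open>S\<close>, which lies in P, exhibits \<open>R\<close> as
        an element of P plus a multiple of y, the form that the Artin-Rees estimate accepts.\<close>
      define i where "i = (\<lambda>h. \<zero>\<^bsub>QQ\<^esub> h \<ominus> S h)"
      have iP: "i \<in> P" unfolding i_def
        by (rule ideal_diff[OF I _ SP]) (rule additive_subgroup.zero_closed[OF ideal.axioms(1)[OF I]])
      have Ri: "i h \<oplus> conv K y z h = R h" for h
        using QQ_closed[OF SQ] QQ_closed[OF RQ] unfolding yz i_def minus_eq
        by (simp add: a_lcomm l_neg)
      have RJ: "R \<in> J"
      proof -
        have "conv K y z \<in> J" using ideal.I_r_closed[OF J y(1) zQ] by simp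
        moreover have "i \<in> J" using iP PJ by auto
        ultimately have "i \<oplus>\<^bsub>QQ\<^esub> conv K y z \<in> J"
          using additive_subgroup.a_closed[OF ideal.axioms(1)[OF J]] by blast
        then show ?thesis using Ri by simp
      qed
      \<comment> \<open>The leading exponent of \<open>R\<close> is leading in J, is not leading in
        P since the remainders vanish there, and avoids \<open>Z\<close>; so its weight is
        large.\<close>
      have Rwt: "int N + int \<kappa> \<le> wt h" if "R h \<noteq> \<zero>" for h
      proof -
        obtain h' where h': "lead R h'" using lead_exists[OF RQ \<open>R h \<noteq> \<zero>\<close>] .
        have hH: "h' \<in> HH" using h' QQ_supp[OF RQ] by (simp add: lead_def)
        have "h' \<in> lexp J" using h' RJ by (auto simp: lexp_def)
        moreover have "h' \<notin> lexp P"
        proof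
          assume "h' \<in> lexp P"
          then have "R h' = \<zero>" unfolding R_def by (intro finsum_zero_cong) (simp add: rq(4) l(1))
          then show False using h' by (simp add: lead_def)
        qed
        moreover have "h' \<notin> Z" using h' l(3)[of h'] by (auto simp: lead_def R_def)
        ultimately have "int N + int \<kappa> \<le> wt h'" using hH by (auto simp: Z_def)
        also have "wt h' \<le> wt h"
          using h' \<open>R h \<noteq> \<zero>\<close> ConeD(1)[OF hH] ConeD(1)[OF QQ_supp[OF RQ \<open>R h \<noteq> \<zero>\<close>]]
          by (intro wt_mono) (auto simp: lead_def)
        finally show ?thesis .
      qed
      obtain i' t where t: "i' \<in> P" "t \<in> carrier QQ" "\<And>h. i h \<oplus> conv K y z h = i' h \<oplus> conv K y t h"
        "\<And>h. t h \<noteq> \<zero> \<Longrightarrow> int N \<le> wt h"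
        using AR[OF iP zQ, of "int N"] Rwt unfolding Ri by blast
      \<comment> \<open>The product of y with s is in P, and s agrees with z below weight N, where t
        has no exponents.\<close>
      define s where "s = (\<lambda>h. z h \<ominus> t h)"
      have sQ: "s \<in> carrier QQ" unfolding s_def by (rule QQ_diff[OF zQ t(2)])
      have "conv K y s = (\<lambda>h. i' h \<ominus> i h)"
      proof
        fix h
        have "z = s \<oplus>\<^bsub>QQ\<^esub> t"
          using QQ_closed[OF zQ] QQ_closed[OF t(2)] by (auto simp: s_def minus_eq a_assoc l_neg)
        then have "conv K y z = conv K y s \<oplus>\<^bsub>QQ\<^esub> conv K y t"
          using QR.r_distr[OF sQ t(2) yQ] by simp
        then have "conv K y z h = conv K y s h \<oplus> conv K y t h" by simp
        then have eq: "i h \<oplus> (conv K y s h \<oplus> conv K y t h) = i' h \<oplus> conv K y t h" using t(3)[of h] by simp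
        have c: "i h \<in> carrier K" "i' h \<in> carrier K" "conv K y s h \<in> carrier K" "conv K y t h \<in> carrier K"
          using QQ_closed[OF PQ[OF iP]] QQ_closed[OF PQ[OF t(1)]] QQ_LC[OF yQ] QQ_LC[OF sQ] QQ_LC[OF t(2)] by auto
        have "i h \<oplus> conv K y s h = i' h" using eq c by (simp add: a_assoc[symmetric])
        then show "conv K y s h = i' h \<ominus> i h" using c by (metis a_comm a_closed minus_eq a_assoc r_neg r_zero a_inv_closed)
      qed
      then have "y \<otimes>\<^bsub>QQ\<^esub> s \<in> P" using ideal_diff[OF I t(1) iP] by simp
      then have sP: "s \<in> P" using primeideal.I_prime[OF P yQ sQ] y(2) by blast
      obtain b where b: "b \<in> B" "l b \<noteq> \<zero>" using l(2) by blast
      have low: "s h = z h" if "wt h < int N" for h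
      proof -
        have "t h = \<zero>" using t(4)[of h] that by force
        then show ?thesis using QQ_closed[OF zQ] by (simp add: s_def minus_eq)
      qed
      have "s b \<noteq> \<zero>" using low[of b] b by (simp add: B_def z_def)
      then obtain h where h: "lead s h" using lead_exists[OF sQ] by blast
      have hH: "h \<in> HH" using h QQ_supp[OF sQ] by (simp add: lead_def)
      have "wt h \<le> wt b"
        using h \<open>s b \<noteq> \<zero>\<close> ConeD(1)[OF hH] b(1) ConeD(1) by (intro wt_mono) (auto simp: lead_def B_def)
      then have "wt h < int N" using b(1) by (simp add: B_def)
      then have "z h \<noteq> \<zero>" using low[of h] h by (simp add: lead_def)
      then have "h \<in> B" unfolding z_def by (metis (full_types))
      moreover have "h \<in> lexp P" using h sP by (auto simp: lexp_def)
      ultimately show False by (simp add: B_def)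
    qed
    moreover have "cnt P (N + \<kappa>) = cnt J (N + \<kappa>) + card Z"
    proof -
      have "{h \<in> HH. wt h < int (N + \<kappa>) \<and> h \<notin> lexp P} =
        {h \<in> HH. wt h < int (N + \<kappa>) \<and> h \<notin> lexp J} \<union> Z" using sub by (auto simp: Z_def)
      moreover have "card ({h \<in> HH. wt h < int (N + \<kappa>) \<and> h \<notin> lexp J} \<union> Z) =
        card {h \<in> HH. wt h < int (N + \<kappa>) \<and> h \<notin> lexp J} + card Z"
        by (rule card_Un_disjoint[OF cnt_finite finZ]) (auto simp: Z_def)
      ultimately show ?thesis by (simp add: cnt_def)
    qed
    ultimately show "cnt J (N + \<kappa>) + cnt P N \<le> cnt P (N + \<kappa>)"
      by (simp add: cnt_def B_def)
  qed
qed

text \<open>A strict chain of d+3 primes would bring the growth order from d+1 down below 0. Then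
  already the count for N = 1 vanishes, so 0 is a leading exponent of the last prime, which would be
  the unit ideal.\<close>

theorem krull_dim_QQ_le: "krull_dim QQ \<le> enat (Suc d)"
  unfolding krull_dim_def
proof (rule Sup_least)
  fix x assume "x \<in> {enat n | n. \<exists>P. (\<forall>i\<le>n. primeideal (P i) QQ) \<and> (\<forall>i<n. P i \<subset> P (Suc i))}"
  then obtain n P where x: "x = enat n" and P: "\<forall>i\<le>n. primeideal (P i) QQ" "\<forall>i<n. P i \<subset> P (Suc i)" by blast
  have "n \<le> Suc d"
  proof (rule ccontr)
    assume "\<not> n \<le> Suc d"
    then have n: "Suc (Suc d) \<le> n" by simp
    have "cnt (P (Suc (Suc d))) 1 = 0"
    proof (rule growth_descent[of "\<lambda>j. cnt (P j)" "Suc d"])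
      fix j assume "j \<le> Suc d"
      then have "j < n" "Suc j \<le> n" using n by auto
      then show "\<exists>\<kappa>. \<forall>N. cnt (P (Suc j)) (N + \<kappa>) + cnt (P j) N \<le> cnt (P j) (N + \<kappa>)"
        using P by (intro cnt_step) (auto intro: primeideal.axioms(1))
    qed (rule cnt_mono cnt_bound; assumption?)+
    then have "{h \<in> HH. wt h < int 1 \<and> h \<notin> lexp (P (Suc (Suc d)))} = {}"
      unfolding cnt_def using cnt_finite[of 1] by (metis card_0_eq)
    then have "0 \<in> lexp (P (Suc (Suc d)))" using L.w_0 Cone_0 by force
    moreover have pr: "primeideal (P (Suc (Suc d))) QQ" using P n by simp
    ultimately have "\<one>\<^bsub>QQ\<^esub> \<in> P (Suc (Suc d))" by (intro zero_in_lexp_imp_one primeideal.axioms(1))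
    then have "P (Suc (Suc d)) = carrier QQ"
      using ideal.one_imp_carrier[OF primeideal.axioms(1)[OF pr]] by simp
    then show False using primeideal.I_notcarr[OF pr] by simp
  qed
  then show "x \<le> enat (Suc d)" using x by simp
qed

end

section \<open>Semilinear isomorphisms\<close>

lemma mod_span_Inter: "mod_span A M G = \<Inter>{N. submodule N A M \<and> G \<subseteq> N}"
  by (simp add: mod_span_def hull_def)

lemma mod_span_subset: "G \<subseteq> mod_span A M G"
  by (auto simp: mod_span_Inter)

lemma mod_span_minimal: "submodule N A M \<Longrightarrow> G \<subseteq> N \<Longrightarrow> mod_span A M G \<subseteq> N"
  by (auto simp: mod_span_Inter)

lemma submoduleD:
  assumes "submodule N A M"
  shows "\<zero>\<^bsub>M\<^esub> \<in> N" "x \<in> N \<Longrightarrow> y \<in> N \<Longrightarrow> x \<oplus>\<^bsub>M\<^esub> y \<in> N" "a \<in> carrier A \<Longrightarrow> x \<in> N \<Longrightarrow> a \<odot>\<^bsub>M\<^esub> x \<in> N"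
    "N \<subseteq> carrier M"
proof -
  have s: "subgroup N (add_monoid M)" using submodule.axioms(1)[OF assms] .
  show "\<zero>\<^bsub>M\<^esub> \<in> N" using subgroup.one_closed[OF s] by simp
  show "x \<in> N \<Longrightarrow> y \<in> N \<Longrightarrow> x \<oplus>\<^bsub>M\<^esub> y \<in> N" using subgroup.m_closed[OF s] by simp
  show "a \<in> carrier A \<Longrightarrow> x \<in> N \<Longrightarrow> a \<odot>\<^bsub>M\<^esub> x \<in> N" using submodule.smult_closed[OF assms] .
  show "N \<subseteq> carrier M" using subgroup.subset[OF s] by simp
qed

section \<open>Submodules generated by a sequence of scalars\<close>

context module
begin

lemma uminus_smult: "x \<in> carrier M \<Longrightarrow> \<ominus>\<^bsub>M\<^esub> x = (\<ominus> \<one>) \<odot>\<^bsub>M\<^esub> x"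
  by (simp add: smult_l_minus)

lemma submoduleI':
  assumes "N \<subseteq> carrier M" "\<zero>\<^bsub>M\<^esub> \<in> N" "\<And>x y. x \<in> N \<Longrightarrow> y \<in> N \<Longrightarrow> x \<oplus>\<^bsub>M\<^esub> y \<in> N"
    "\<And>a x. a \<in> carrier R \<Longrightarrow> x \<in> N \<Longrightarrow> a \<odot>\<^bsub>M\<^esub> x \<in> N"
  shows "submodule N R M"
proof (rule submoduleI)
  fix x assume "x \<in> N"
  then show "\<ominus>\<^bsub>M\<^esub> x \<in> N" using assms(1,4) uminus_smult[of x] by auto
qed (use assms in auto)

lemma submodule_diff:
  assumes "submodule N R M" "x \<in> N" "y \<in> N"
  shows "x \<ominus>\<^bsub>M\<^esub> y \<in> N"
  using submoduleE(3)[OF assms(1,3)] submoduleD(2)[OF assms(1,2)] by (simp add: a_minus_def)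

lemma span_submodule:
  assumes "G \<subseteq> carrier M"
  shows "submodule (mod_span R M G) R M"
proof (rule submoduleI')
  show "mod_span R M G \<subseteq> carrier M"
    using mod_span_minimal[OF carrier_is_submodule assms] .
  show "\<zero>\<^bsub>M\<^esub> \<in> mod_span R M G"
    by (auto simp: mod_span_Inter intro: submoduleD)
qed (auto simp: mod_span_Inter intro: submoduleD)

lemma seq_submodule_is_submodule:
  "set xs \<subseteq> carrier R \<Longrightarrow> submodule (seq_submodule R M xs) R M"
  unfolding seq_submodule_def by (rule span_submodule) (blast intro: smult_closed)

lemma seq_submodule_mem:
  "x \<in> set xs \<Longrightarrow> m \<in> carrier M \<Longrightarrow> x \<odot>\<^bsub>M\<^esub> m \<in> seq_submodule R M xs"
  unfolding seq_submodule_def by (rule subsetD[OF mod_span_subset]) blast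

lemma seq_submodule_le:
  "submodule N R M \<Longrightarrow> (\<And>x m. x \<in> set xs \<Longrightarrow> m \<in> carrier M \<Longrightarrow> x \<odot>\<^bsub>M\<^esub> m \<in> N) \<Longrightarrow> seq_submodule R M xs \<subseteq> N"
  unfolding seq_submodule_def by (rule mod_span_minimal) blast+

lemma seq_submodule_mono: "set xs \<subseteq> set ys \<Longrightarrow> seq_submodule R M xs \<subseteq> seq_submodule R M ys"
  unfolding seq_submodule_def mod_span_Inter by blast

lemma seq_submodule_Nil: "seq_submodule R M [] = {\<zero>\<^bsub>M\<^esub>}"
proof
  have "submodule {\<zero>\<^bsub>M\<^esub>} R M" by (rule submoduleI') auto
  then show "seq_submodule R M [] \<subseteq> {\<zero>\<^bsub>M\<^esub>}" by (rule seq_submodule_le) auto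
  show "{\<zero>\<^bsub>M\<^esub>} \<subseteq> seq_submodule R M []"
    using submoduleD(1)[OF seq_submodule_is_submodule[of "[]"]] by simp
qed

lemma seq_submodule_snoc:
  assumes "set xs \<subseteq> carrier R" "x \<in> carrier R" "y \<in> seq_submodule R M (xs @ [x])"
  shows "\<exists>z\<in>seq_submodule R M xs. \<exists>m\<in>carrier M. y = z \<oplus>\<^bsub>M\<^esub> x \<odot>\<^bsub>M\<^esub> m"
proof -
  let ?N = "{y. \<exists>z\<in>seq_submodule R M xs. \<exists>m\<in>carrier M. y = z \<oplus>\<^bsub>M\<^esub> x \<odot>\<^bsub>M\<^esub> m}"
  have sub: "submodule (seq_submodule R M xs) R M" by (rule seq_submodule_is_submodule[OF assms(1)])
  note S = submoduleD[OF sub]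
  have "submodule ?N R M"
  proof (rule submoduleI')
    show "?N \<subseteq> carrier M" using S(4) assms(2) by auto
    show "\<zero>\<^bsub>M\<^esub> \<in> ?N" using S(1) assms(2)
      by (intro CollectI bexI[of _ "\<zero>\<^bsub>M\<^esub>"]) auto
  next
    fix a b assume "a \<in> ?N" "b \<in> ?N"
    then obtain z m z' m' where z: "z \<in> seq_submodule R M xs" "m \<in> carrier M" "a = z \<oplus>\<^bsub>M\<^esub> x \<odot>\<^bsub>M\<^esub> m"
      "z' \<in> seq_submodule R M xs" "m' \<in> carrier M" "b = z' \<oplus>\<^bsub>M\<^esub> x \<odot>\<^bsub>M\<^esub> m'" by blast
    have zc: "z \<in> carrier M" "z' \<in> carrier M" using z S(4) by auto
    have "a \<oplus>\<^bsub>M\<^esub> b = (z \<oplus>\<^bsub>M\<^esub> z') \<oplus>\<^bsub>M\<^esub> x \<odot>\<^bsub>M\<^esub> (m \<oplus>\<^bsub>M\<^esub> m')"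
      using z(2,3,5,6) zc assms(2) by (simp add: smult_r_distr M.a_ac)
    then show "a \<oplus>\<^bsub>M\<^esub> b \<in> ?N" using S(2)[OF z(1,4)] z(2,5) by blast
  next
    fix a b assume a: "a \<in> carrier R" and "b \<in> ?N"
    then obtain z m where z: "z \<in> seq_submodule R M xs" "m \<in> carrier M" "b = z \<oplus>\<^bsub>M\<^esub> x \<odot>\<^bsub>M\<^esub> m" by blast
    have zc: "z \<in> carrier M" using z S(4) by auto
    have "a \<odot>\<^bsub>M\<^esub> b = a \<odot>\<^bsub>M\<^esub> z \<oplus>\<^bsub>M\<^esub> x \<odot>\<^bsub>M\<^esub> (a \<odot>\<^bsub>M\<^esub> m)"
      using z zc a assms(2) by (simp add: smult_r_distr smult_assoc1[symmetric] R.m_comm)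
    then show "a \<odot>\<^bsub>M\<^esub> b \<in> ?N" using S(3)[OF a z(1)] a z(2) by blast
  qed
  moreover have "x' \<odot>\<^bsub>M\<^esub> m \<in> ?N" if x': "x' \<in> set (xs @ [x])" and m: "m \<in> carrier M" for x' m
  proof (cases "x' \<in> set xs")
    case True
    have "x' \<odot>\<^bsub>M\<^esub> m = x' \<odot>\<^bsub>M\<^esub> m \<oplus>\<^bsub>M\<^esub> x \<odot>\<^bsub>M\<^esub> \<zero>\<^bsub>M\<^esub>"
      using True assms(1,2) m by (simp add: subsetD)
    then show ?thesis using seq_submodule_mem[OF True m] by blast
  next
    case False
    then have "x' \<odot>\<^bsub>M\<^esub> m = \<zero>\<^bsub>M\<^esub> \<oplus>\<^bsub>M\<^esub> x \<odot>\<^bsub>M\<^esub> m" using x' assms(2) m by simp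
    then show ?thesis using S(1) m by blast
  qed
  ultimately have "seq_submodule R M (xs @ [x]) \<subseteq> ?N" by (rule seq_submodule_le)
  then show ?thesis using assms(3) by blast
qed

end

text \<open>Isomorphism of modules over two rings along \<psi>. With the identity in place of \<psi>
  it is \<open>mod_iso\<close>, so isomorphisms over one ring and changes of ring compose in the
  same calculus.\<close>

definition semilinear_iso ::
  "('a, 'c) ring_scheme \<Rightarrow> ('b, 'd) ring_scheme \<Rightarrow> ('a \<Rightarrow> 'b) \<Rightarrow>
    ('a, 'm, 'x) module_scheme \<Rightarrow> ('b, 'n, 'y) module_scheme \<Rightarrow> ('m \<Rightarrow> 'n) \<Rightarrow> bool" where
  "semilinear_iso A B \<psi> M N h \<longleftrightarrow>
    bij_betw \<psi> (carrier A) (carrier B) \<and> bij_betw h (carrier M) (carrier N) \<and>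
    (\<forall>x\<in>carrier M. \<forall>y\<in>carrier M. h (x \<oplus>\<^bsub>M\<^esub> y) = h x \<oplus>\<^bsub>N\<^esub> h y) \<and>
    (\<forall>a\<in>carrier A. \<forall>x\<in>carrier M. h (a \<odot>\<^bsub>M\<^esub> x) = \<psi> a \<odot>\<^bsub>N\<^esub> h x)"

lemma mod_iso_semilinear: "mod_iso A M N \<longleftrightarrow> (\<exists>h. semilinear_iso A A (\<lambda>a. a) M N h)"
  by (simp add: mod_iso_def semilinear_iso_def bij_betw_def)

lemma semilinear_iso_trans:
  assumes "semilinear_iso A B \<psi> M N h" "semilinear_iso B C \<chi> N P k"
  shows "semilinear_iso A C (\<lambda>a. \<chi> (\<psi> a)) M P (\<lambda>x. k (h x))"
proof -
  have b: "bij_betw \<psi> (carrier A) (carrier B)" "bij_betw h (carrier M) (carrier N)"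
    "bij_betw \<chi> (carrier B) (carrier C)" "bij_betw k (carrier N) (carrier P)"
    using assms by (auto simp: semilinear_iso_def)
  have "h x \<in> carrier N" if "x \<in> carrier M" for x using b(2) that bij_betwE by blast
  moreover have "\<psi> a \<in> carrier B" if "a \<in> carrier A" for a using b(1) that bij_betwE by blast
  ultimately show ?thesis
    using assms bij_betw_trans[OF b(1,3)] bij_betw_trans[OF b(2,4)]
    by (simp add: semilinear_iso_def comp_def)
qed

lemma semilinear_iso_cong:
  assumes "semilinear_iso A B \<psi> M N h" "\<And>a. a \<in> carrier A \<Longrightarrow> \<psi> a = \<chi> a"
  shows "semilinear_iso A B \<chi> M N h"
  using assms bij_betw_cong[of "carrier A" \<psi> \<chi>] by (simp add: semilinear_iso_def)

lemma semilinear_iso_sym: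
  assumes "module A M" "semilinear_iso A B \<psi> M N h"
  shows "semilinear_iso B A (inv_into (carrier A) \<psi>) N M (inv_into (carrier M) h)"
proof -
  interpret module A M by fact
  have b: "bij_betw \<psi> (carrier A) (carrier B)" "bij_betw h (carrier M) (carrier N)"
    using assms by (auto simp: semilinear_iso_def)
  let ?k = "inv_into (carrier M) h" and ?\<chi> = "inv_into (carrier A) \<psi>"
  have kh: "?k (h x) = x" if "x \<in> carrier M" for x using bij_betw_inv_into_left[OF b(2) that] .
  have kc: "?k y \<in> carrier M" "h (?k y) = y" if "y \<in> carrier N" for y
    using bij_betw_inv_into_right[OF b(2) that] bij_betwE[OF bij_betw_inv_into[OF b(2)]] that by auto
  have cc: "?\<chi> y \<in> carrier A" "\<psi> (?\<chi> y) = y" if "y \<in> carrier B" for y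
    using bij_betw_inv_into_right[OF b(1) that] bij_betwE[OF bij_betw_inv_into[OF b(1)]] that by auto
  have "?k (x \<oplus>\<^bsub>N\<^esub> y) = ?k x \<oplus>\<^bsub>M\<^esub> ?k y" if "x \<in> carrier N" "y \<in> carrier N" for x y
  proof -
    have "h (?k x \<oplus>\<^bsub>M\<^esub> ?k y) = x \<oplus>\<^bsub>N\<^esub> y" using assms(2) that kc by (simp add: semilinear_iso_def)
    then show ?thesis using kh[of "?k x \<oplus>\<^bsub>M\<^esub> ?k y"] kc that by simp
  qed
  moreover have "?k (a \<odot>\<^bsub>N\<^esub> x) = ?\<chi> a \<odot>\<^bsub>M\<^esub> ?k x" if "a \<in> carrier B" "x \<in> carrier N" for a x
  proof -
    have "h (?\<chi> a \<odot>\<^bsub>M\<^esub> ?k x) = a \<odot>\<^bsub>N\<^esub> x" using assms(2) that kc cc by (simp add: semilinear_iso_def)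
    then show ?thesis using kh[of "?\<chi> a \<odot>\<^bsub>M\<^esub> ?k x"] kc cc that by simp
  qed
  ultimately show ?thesis
    using bij_betw_inv_into[OF b(1)] bij_betw_inv_into[OF b(2)] by (simp add: semilinear_iso_def)
qed

section \<open>Invariance of spans, regular sequences, depth and indecomposability\<close>

locale semilinear = M: module A M + N: module B N
  for A :: "('a, 'c) ring_scheme" and M :: "('a, 'm, 'x) module_scheme"
    and B :: "('b, 'd) ring_scheme" and N :: "('b, 'n, 'y) module_scheme" +
  fixes \<psi> h
  assumes iso: "semilinear_iso A B \<psi> M N h"
begin

lemma bij_psi: "bij_betw \<psi> (carrier A) (carrier B)" and bij_h: "bij_betw h (carrier M) (carrier N)"
  using iso by (auto simp: semilinear_iso_def)

lemma h_add: "x \<in> carrier M \<Longrightarrow> y \<in> carrier M \<Longrightarrow> h (x \<oplus>\<^bsub>M\<^esub> y) = h x \<oplus>\<^bsub>N\<^esub> h y"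
  and h_smult: "a \<in> carrier A \<Longrightarrow> x \<in> carrier M \<Longrightarrow> h (a \<odot>\<^bsub>M\<^esub> x) = \<psi> a \<odot>\<^bsub>N\<^esub> h x"
  using iso by (auto simp: semilinear_iso_def)

lemma h_closed [simp]: "x \<in> carrier M \<Longrightarrow> h x \<in> carrier N"
  using bij_betwE[OF bij_h] by blast

lemma psi_closed [simp]: "a \<in> carrier A \<Longrightarrow> \<psi> a \<in> carrier B"
  using bij_betwE[OF bij_psi] by blast

lemma h_inj: "inj_on h (carrier M)" and h_surj: "h ` carrier M = carrier N"
  using bij_h by (auto simp: bij_betw_def)

lemma psi_surj: "\<psi> ` carrier A = carrier B"
  using bij_psi by (auto simp: bij_betw_def)

lemma h_zero: "h \<zero>\<^bsub>M\<^esub> = \<zero>\<^bsub>N\<^esub>"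
proof -
  have "h \<zero>\<^bsub>M\<^esub> \<oplus>\<^bsub>N\<^esub> h \<zero>\<^bsub>M\<^esub> = h \<zero>\<^bsub>M\<^esub>" using h_add[of "\<zero>\<^bsub>M\<^esub>" "\<zero>\<^bsub>M\<^esub>"] by simp
  then show ?thesis by (metis N.M.add.l_cancel_one' M.M.zero_closed h_closed)
qed

lemma h_mem_iff: "L \<subseteq> carrier M \<Longrightarrow> x \<in> carrier M \<Longrightarrow> h x \<in> h ` L \<longleftrightarrow> x \<in> L"
  using h_inj by (meson inj_on_image_mem_iff)

lemma image_submodule:
  assumes "submodule L A M"
  shows "submodule (h ` L) B N"
proof (rule N.submoduleI')
  note S = submoduleD[OF assms]
  show "h ` L \<subseteq> carrier N" using S(4) by auto
  show "\<zero>\<^bsub>N\<^esub> \<in> h ` L" using S(1) h_zero by (metis image_eqI)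
next
  fix x y assume "x \<in> h ` L" "y \<in> h ` L"
  then show "x \<oplus>\<^bsub>N\<^esub> y \<in> h ` L"
    using submoduleD[OF assms] h_add by (smt (verit) imageE image_eqI subsetD)
next
  fix a x assume a: "a \<in> carrier B" "x \<in> h ` L"
  then obtain a' x' where "a' \<in> carrier A" "a = \<psi> a'" "x' \<in> L" "x = h x'" using psi_surj by blast
  then show "a \<odot>\<^bsub>N\<^esub> x \<in> h ` L"
    using submoduleD(3,4)[OF assms] h_smult[of a' x'] by (metis image_eqI subsetD)
qed

lemma inverse: "semilinear B N A M (inv_into (carrier A) \<psi>) (inv_into (carrier M) h)"
  by (intro semilinear.intro semilinear_axioms.intro N.module_axioms M.module_axioms
      semilinear_iso_sym[OF M.module_axioms iso])

lemma inv_h [simp]: "x \<in> carrier M \<Longrightarrow> inv_into (carrier M) h (h x) = x"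
  using bij_betw_inv_into_left[OF bij_h] .

lemma inv_psi [simp]: "a \<in> carrier A \<Longrightarrow> inv_into (carrier A) \<psi> (\<psi> a) = a"
  using bij_betw_inv_into_left[OF bij_psi] .

lemma inv_h_image: "L \<subseteq> carrier M \<Longrightarrow> inv_into (carrier M) h ` h ` L = L"
  by (rule inv_into_image_cancel[OF h_inj])

lemma h_inv [simp]: "y \<in> carrier N \<Longrightarrow> h (inv_into (carrier M) h y) = y"
  using bij_betw_inv_into_right[OF bij_h] .

lemma image_span_le: "G \<subseteq> carrier M \<Longrightarrow> mod_span B N (h ` G) \<subseteq> h ` mod_span A M G"
  by (rule mod_span_minimal[OF image_submodule[OF M.span_submodule]]) (auto simp: mod_span_subset[THEN subsetD])

text \<open>The reverse inclusion is \<open>image_span_le\<close> for the inverse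
  isomorphism.\<close>

lemma image_span:
  assumes G: "G \<subseteq> carrier M"
  shows "mod_span B N (h ` G) = h ` mod_span A M G"
proof
  interpret I: semilinear B N A M "inv_into (carrier A) \<psi>" "inv_into (carrier M) h" by (rule inverse)
  have hG: "h ` G \<subseteq> carrier N" using G by auto
  have "mod_span A M G \<subseteq> inv_into (carrier M) h ` mod_span B N (h ` G)"
    using I.image_span_le[OF hG] inv_h_image[OF G] by simp
  moreover have "mod_span B N (h ` G) \<subseteq> carrier N" using submoduleD(4)[OF N.span_submodule[OF hG]] .
  ultimately show "h ` mod_span A M G \<subseteq> mod_span B N (h ` G)" by (force simp: subset_iff)
qed (rule image_span_le[OF G])

lemma image_seq_submodule:
  assumes "set xs \<subseteq> carrier A"
  shows "seq_submodule B N (map \<psi> xs) = h ` seq_submodule A M xs"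
proof -
  have eq: "{x \<odot>\<^bsub>N\<^esub> m | x m. x \<in> set (map \<psi> xs) \<and> m \<in> carrier N} =
      h ` {x \<odot>\<^bsub>M\<^esub> m | x m. x \<in> set xs \<and> m \<in> carrier M}" (is "?L = ?R")
  proof
    show "?L \<subseteq> ?R"
    proof
      fix y assume "y \<in> ?L"
      then obtain x m where xm: "x \<in> set xs" "m \<in> carrier N" "y = \<psi> x \<odot>\<^bsub>N\<^esub> m" by auto
      then obtain m' where m': "m' \<in> carrier M" "m = h m'" using h_surj by blast
      then have "y = h (x \<odot>\<^bsub>M\<^esub> m')" using xm assms h_smult[of x m'] by auto
      then show "y \<in> ?R" using xm m' by blast
    qed
    show "?R \<subseteq> ?L"
    proof
      fix y assume "y \<in> ?R"
      then obtain x m where xm: "x \<in> set xs" "m \<in> carrier M" "y = h (x \<odot>\<^bsub>M\<^esub> m)" by blast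
      then have "y = \<psi> x \<odot>\<^bsub>N\<^esub> h m" using assms h_smult[of x m] by auto
      then show "y \<in> ?L" using xm by (intro CollectI exI[of _ "\<psi> x"] exI[of _ "h m"]) auto
    qed
  qed
  have "{x \<odot>\<^bsub>M\<^esub> m | x m. x \<in> set xs \<and> m \<in> carrier M} \<subseteq> carrier M" using assms by auto
  then show ?thesis unfolding seq_submodule_def eq by (rule image_span)
qed

lemma regular_seq_image:
  assumes "regular_seq A M xs"
  shows "regular_seq B N (map \<psi> xs)"
proof -
  have xs: "set xs \<subseteq> carrier A" and reg: "\<And>i m. i < length xs \<Longrightarrow> m \<in> carrier M \<Longrightarrow>
      (xs ! i) \<odot>\<^bsub>M\<^esub> m \<in> seq_submodule A M (take i xs) \<Longrightarrow> m \<in> seq_submodule A M (take i xs)"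
    and ne: "seq_submodule A M xs \<noteq> carrier M"
    using assms by (auto simp: regular_seq_def)
  have sub: "seq_submodule A M ys \<subseteq> carrier M" if "set ys \<subseteq> carrier A" for ys
    using submoduleD(4)[OF M.seq_submodule_is_submodule[OF that]] .
  have tk: "set (take i xs) \<subseteq> carrier A" for i using xs set_take_subset by fastforce
  have "m \<in> seq_submodule B N (take i (map \<psi> xs))"
    if i: "i < length xs" and m: "m \<in> carrier N" "(map \<psi> xs ! i) \<odot>\<^bsub>N\<^esub> m \<in> seq_submodule B N (take i (map \<psi> xs))" for i m
  proof -
    obtain m' where m': "m' \<in> carrier M" "m = h m'" using m(1) h_surj by blast
    have xi: "xs ! i \<in> carrier A" using xs i by auto
    have "h ((xs ! i) \<odot>\<^bsub>M\<^esub> m') \<in> h ` seq_submodule A M (take i xs)"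
      using m(2) i m' xi h_smult image_seq_submodule[OF tk[of i]] by (simp add: take_map)
    then have "(xs ! i) \<odot>\<^bsub>M\<^esub> m' \<in> seq_submodule A M (take i xs)"
      using h_mem_iff[OF sub[OF tk[of i]], of "(xs ! i) \<odot>\<^bsub>M\<^esub> m'"] xi m'(1) by simp
    then have "m' \<in> seq_submodule A M (take i xs)" using reg i m' by blast
    then show ?thesis using m'(2) image_seq_submodule[OF tk[of i]] by (simp add: take_map)
  qed
  moreover have "seq_submodule B N (map \<psi> xs) \<noteq> carrier N"
    unfolding image_seq_submodule[OF xs] h_surj[symmetric] using ne h_inj sub[OF xs]
    by (metis inj_on_image_eq_iff order.refl)
  ultimately show ?thesis using xs unfolding regular_seq_def by auto
qed

lemma carrier_zero_iff: "carrier N = {\<zero>\<^bsub>N\<^esub>} \<longleftrightarrow> carrier M = {\<zero>\<^bsub>M\<^esub>}"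
proof -
  have "carrier N = {\<zero>\<^bsub>N\<^esub>} \<longleftrightarrow> h ` carrier M = h ` {\<zero>\<^bsub>M\<^esub>}" using h_surj h_zero by simp
  also have "\<dots> \<longleftrightarrow> carrier M = {\<zero>\<^bsub>M\<^esub>}" by (rule inj_on_image_eq_iff[OF h_inj]) auto
  finally show ?thesis .
qed

text \<open>Regular sequences are pushed forward. Equality of depths will follow by applying this to
  the inverse as well.\<close>

lemma depth_le:
  assumes "\<psi> ` max_ideal A \<subseteq> max_ideal B"
  shows "depth A M \<le> depth B N"
proof (cases "carrier M = {\<zero>\<^bsub>M\<^esub>}")
  case True
  then show ?thesis using carrier_zero_iff by (simp add: depth_def)
next
  case False
  have "Sup {enat (length xs) | xs. set xs \<subseteq> max_ideal A \<and> regular_seq A M xs} \<le>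
    Sup {enat (length xs) | xs. set xs \<subseteq> max_ideal B \<and> regular_seq B N xs}"
  proof (rule Sup_subset_mono, rule subsetI)
    fix n assume "n \<in> {enat (length xs) | xs. set xs \<subseteq> max_ideal A \<and> regular_seq A M xs}"
    then obtain xs where "n = enat (length (map \<psi> xs))" "set (map \<psi> xs) \<subseteq> max_ideal B" "regular_seq B N (map \<psi> xs)"
      using assms regular_seq_image by fastforce
    then show "n \<in> {enat (length xs) | xs. set xs \<subseteq> max_ideal B \<and> regular_seq B N xs}" by blast
  qed
  then show ?thesis using False carrier_zero_iff by (simp add: depth_def)
qed

lemma fg_image:
  assumes "fg_module A M"
  shows "fg_module B N"
proof -
  obtain G where G: "finite G" "G \<subseteq> carrier M" "mod_span A M G = carrier M"
    using assms by (auto simp: fg_module_def)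
  then show ?thesis unfolding fg_module_def
    using image_span[OF G(2)] h_surj N.module_axioms by (intro conjI exI[of _ "h ` G"]) auto
qed

lemma indecomposable_image:
  assumes "indecomposable A M"
  shows "indecomposable B N"
proof -
  interpret I: semilinear B N A M "inv_into (carrier A) \<psi>" "inv_into (carrier M) h" by (rule inverse)
  let ?k = "inv_into (carrier M) h"
  have "N\<^sub>1 = {\<zero>\<^bsub>N\<^esub>} \<or> N\<^sub>2 = {\<zero>\<^bsub>N\<^esub>}"
    if sub: "submodule N\<^sub>1 B N" "submodule N\<^sub>2 B N" and sum: "N\<^sub>1 <+>\<^bsub>N\<^esub> N\<^sub>2 = carrier N"
      and int: "N\<^sub>1 \<inter> N\<^sub>2 = {\<zero>\<^bsub>N\<^esub>}" for N\<^sub>1 N\<^sub>2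
  proof -
    note S1 = submoduleD[OF sub(1)] and S2 = submoduleD[OF sub(2)]
    have "?k ` N\<^sub>1 <+>\<^bsub>M\<^esub> ?k ` N\<^sub>2 = carrier M"
    proof
      show "?k ` N\<^sub>1 <+>\<^bsub>M\<^esub> ?k ` N\<^sub>2 \<subseteq> carrier M"
        using S1(4) S2(4) by (auto simp: set_add_def set_mult_def subset_iff)
      show "carrier M \<subseteq> ?k ` N\<^sub>1 <+>\<^bsub>M\<^esub> ?k ` N\<^sub>2"
      proof
        fix x assume x: "x \<in> carrier M"
        then have "h x \<in> N\<^sub>1 <+>\<^bsub>N\<^esub> N\<^sub>2" using sum by simp
        then obtain a b where ab: "a \<in> N\<^sub>1" "b \<in> N\<^sub>2" "h x = a \<oplus>\<^bsub>N\<^esub> b"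
          by (auto simp: set_add_def set_mult_def)
        have "?k (h x) = ?k a \<oplus>\<^bsub>M\<^esub> ?k b" unfolding ab(3) using ab S1(4) S2(4) by (intro I.h_add) auto
        then have "x = ?k a \<oplus>\<^bsub>M\<^esub> ?k b" using inv_h[OF x] by simp
        then show "x \<in> ?k ` N\<^sub>1 <+>\<^bsub>M\<^esub> ?k ` N\<^sub>2"
          using ab(1,2) unfolding set_add_def set_mult_def by auto
      qed
    qed
    moreover have "?k ` N\<^sub>1 \<inter> ?k ` N\<^sub>2 = {\<zero>\<^bsub>M\<^esub>}"
      using inj_on_image_Int[OF I.h_inj S1(4) S2(4)] int I.h_zero by simp
    ultimately have "?k ` N\<^sub>1 = {\<zero>\<^bsub>M\<^esub>} \<or> ?k ` N\<^sub>2 = {\<zero>\<^bsub>M\<^esub>}"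
      using assms I.image_submodule[OF sub(1)] I.image_submodule[OF sub(2)]
      unfolding indecomposable_def by blast
    moreover have "h ` ?k ` L = L" if "L \<subseteq> carrier N" for L
      using that by (auto simp: image_image subset_iff)
    ultimately show ?thesis using S1(4) S2(4) h_zero by (metis image_empty image_insert)
  qed
  moreover have "carrier N \<noteq> {\<zero>\<^bsub>N\<^esub>}" using assms carrier_zero_iff by (auto simp: indecomposable_def)
  ultimately show ?thesis unfolding indecomposable_def by blast
qed

end

section \<open>Transport along ring isomorphisms\<close>

locale ring_isomorphism = A: cring A + B: cring B
  for A :: "('a, 'c) ring_scheme" and B :: "('b, 'd) ring_scheme" +
  fixes \<psi>
  assumes iso: "\<psi> \<in> ring_iso A B"
begin

lemma inverse: "ring_isomorphism B A (inv_into (carrier A) \<psi>)"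
  by (intro ring_isomorphism.intro ring_isomorphism_axioms.intro A.cring_axioms B.cring_axioms
      ring_iso_set_sym[OF A.ring_axioms iso])

lemma bij: "bij_betw \<psi> (carrier A) (carrier B)"
  using iso by (simp add: ring_iso_def)

lemma hom: "ring_hom_ring A B \<psi>"
  by (rule ring_hom_ringI2[OF A.ring_axioms B.ring_axioms]) (use iso in \<open>simp add: ring_iso_def\<close>)

definition pull :: "'b set \<Rightarrow> 'a set" where "pull I = {a \<in> carrier A. \<psi> a \<in> I}"

lemma image_pull: "I \<subseteq> carrier B \<Longrightarrow> \<psi> ` pull I = I"
proof
  assume I: "I \<subseteq> carrier B"
  show "\<psi> ` pull I \<subseteq> I" by (auto simp: pull_def)
  show "I \<subseteq> \<psi> ` pull I"
  proof
    fix y assume y: "y \<in> I"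
    then obtain a where "a \<in> carrier A" "\<psi> a = y" using I bij by (metis bij_betw_def imageE subsetD)
    then show "y \<in> \<psi> ` pull I" using y by (auto simp: pull_def)
  qed
qed

lemma ideal_pull: "ideal I B \<Longrightarrow> ideal (pull I) A"
  unfolding pull_def by (rule ring_hom_ring.ideal_vimage[OF hom])

lemma prime_pull: "primeideal I B \<Longrightarrow> primeideal (pull I) A"
proof -
  assume P: "primeideal I B"
  show "primeideal (pull I) A"
    using ring_hom_ring.primeideal_vimage[OF hom A.cring_axioms P] unfolding pull_def .
qed

lemma inv_pull:
  assumes "I \<subseteq> carrier A"
  shows "ring_isomorphism.pull B (inv_into (carrier A) \<psi>) I = \<psi> ` I"
proof -
  interpret I: ring_isomorphism B A "inv_into (carrier A) \<psi>" by (rule inverse)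
  show ?thesis
  proof
    show "I.pull I \<subseteq> \<psi> ` I"
    proof
      fix b assume "b \<in> I.pull I"
      then have "b \<in> carrier B" "inv_into (carrier A) \<psi> b \<in> I" by (auto simp: I.pull_def)
      then show "b \<in> \<psi> ` I" using bij_betw_inv_into_right[OF bij, of b] by (metis image_eqI)
    qed
    show "\<psi> ` I \<subseteq> I.pull I"
    proof
      fix b assume "b \<in> \<psi> ` I"
      then obtain a where a: "a \<in> I" "b = \<psi> a" by blast
      then have "a \<in> carrier A" using assms by auto
      then show "b \<in> I.pull I"
        unfolding I.pull_def using a bij_betw_inv_into_left[OF bij, of a] bij_betwE[OF bij] by simp
    qed
  qed
qed

lemma ideal_image: "ideal I A \<Longrightarrow> ideal (\<psi> ` I) B"
  using ring_isomorphism.ideal_pull[OF inverse] inv_pull ideal.Icarr by (metis subsetI)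

lemma maximal_image:
  assumes "maximalideal I A"
  shows "maximalideal (\<psi> ` I) B"
proof (rule maximalidealI)
  have I: "ideal I A" using assms by (rule maximalideal.axioms(1))
  have IA: "I \<subseteq> carrier A" using ideal.Icarr[OF I] by auto
  show "ideal (\<psi> ` I) B" by (rule ideal_image[OF I])
  show "carrier B \<noteq> \<psi> ` I"
    using bij IA maximalideal.I_notcarr[OF assms] by (metis bij_betw_def inj_on_image_eq_iff order.refl)
  fix J assume J: "ideal J B" "\<psi> ` I \<subseteq> J" "J \<subseteq> carrier B"
  have "I \<subseteq> pull J" using J(2) IA by (auto simp: pull_def)
  then have "pull J = I \<or> pull J = carrier A"
    using maximalideal.I_maximal[OF assms ideal_pull[OF J(1)]] by (auto simp: pull_def)
  then show "J = \<psi> ` I \<or> J = carrier B"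
    using image_pull[OF J(3)] bij by (auto simp: bij_betw_def)
qed

lemma noetherian_local_transport:
  assumes "noetherian_local B"
  shows "noetherian_local A"
proof -
  interpret I: ring_isomorphism B A "inv_into (carrier A) \<psi>" by (rule inverse)
  have nB: "noetherian_ring B" and "\<exists>!I. maximalideal I B" using assms by (auto simp: noetherian_local_def)
  then obtain m where m: "maximalideal m B" "\<And>I. maximalideal I B \<Longrightarrow> I = m" by blast
  have mx: "maximalideal (inv_into (carrier A) \<psi> ` m) A" by (rule I.maximal_image[OF m(1)])
  have "I = inv_into (carrier A) \<psi> ` m" if I: "maximalideal I A" for I
  proof -
    have "\<psi> ` I = m" by (rule m(2)[OF maximal_image[OF I]])
    moreover have "I \<subseteq> carrier A" using ideal.Icarr[OF maximalideal.axioms(1)[OF I]] by auto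
    ultimately show ?thesis using bij by (metis bij_betw_def inv_into_image_cancel)
  qed
  then have "\<exists>!I. maximalideal I A" using mx by blast
  moreover have "noetherian_ring A"
  proof (rule A.noetherian_ringI)
    fix I assume I: "ideal I A"
    obtain F where F: "F \<subseteq> carrier B" "finite F" "\<psi> ` I = Idl\<^bsub>B\<^esub> F"
      using noetherian_ring.finetely_gen[OF nB ideal_image[OF I]] by blast
    have "F \<subseteq> \<psi> ` I" using F B.genideal_self by simp
    then obtain G where G: "G \<subseteq> I" "finite G" "F = \<psi> ` G" using finite_subset_image[OF F(2)] by blast
    have IA: "I \<subseteq> carrier A" using ideal.Icarr[OF I] by auto
    have GA: "G \<subseteq> carrier A" using G(1) IA by simp
    have J: "ideal (Idl\<^bsub>A\<^esub> G) A" by (rule A.genideal_ideal[OF GA])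
    have "Idl\<^bsub>A\<^esub> G \<subseteq> I" by (rule A.genideal_minimal[OF I G(1)])
    moreover have "I \<subseteq> Idl\<^bsub>A\<^esub> G"
    proof
      fix x assume x: "x \<in> I"
      have "Idl\<^bsub>B\<^esub> F \<subseteq> \<psi> ` (Idl\<^bsub>A\<^esub> G)"
        by (rule B.genideal_minimal[OF ideal_image[OF J]]) (use G(3) A.genideal_self[OF GA] in auto)
      then have "\<psi> x \<in> \<psi> ` (Idl\<^bsub>A\<^esub> G)" using x F(3) by auto
      then show "x \<in> Idl\<^bsub>A\<^esub> G"
        using bij x IA ideal.Icarr[OF J] by (auto simp: bij_betw_def inj_on_def)
    qed
    ultimately show "\<exists>G\<subseteq>carrier A. finite G \<and> I = Idl\<^bsub>A\<^esub> G" using G(2) GA by blast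
  qed
  ultimately show ?thesis using A.cring_axioms by (simp add: noetherian_local_def)
qed

lemma krull_dim_le: "krull_dim B \<le> krull_dim A"
  unfolding krull_dim_def
proof (rule Sup_subset_mono, rule subsetI)
  fix x assume "x \<in> {enat n | n. \<exists>P. (\<forall>i\<le>n. primeideal (P i) B) \<and> (\<forall>i<n. P i \<subset> P (Suc i))}"
  then obtain n P where x: "x = enat n" and P: "\<forall>i\<le>n. primeideal (P i) B" "\<forall>i<n. P i \<subset> P (Suc i)" by blast
  have "pull (P i) \<subset> pull (P (Suc i))" if i: "i < n" for i
  proof -
    have PB: "P j \<subseteq> carrier B" if "j \<le> n" for j
      using P(1) that ideal.Icarr[OF primeideal.axioms(1), of "P j" B] by auto
    have ss: "P i \<subset> P (Suc i)" using P(2) i by blast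
    have "\<psi> ` pull (P i) = P i" "\<psi> ` pull (P (Suc i)) = P (Suc i)"
      using i by (auto intro!: image_pull PB)
    then have "pull (P i) \<noteq> pull (P (Suc i))" using ss by (metis less_irrefl)
    moreover have "pull (P i) \<subseteq> pull (P (Suc i))" using ss unfolding pull_def by blast
    ultimately show ?thesis by blast
  qed
  then have "\<forall>i\<le>n. primeideal (pull (P i)) A" "\<forall>i<n. pull (P i) \<subset> pull (P (Suc i))"
    using P(1) prime_pull by auto
  then show "x \<in> {enat n | n. \<exists>P. (\<forall>i\<le>n. primeideal (P i) A) \<and> (\<forall>i<n. P i \<subset> P (Suc i))}"
    using x by (intro CollectI exI[of _ n] conjI exI[of _ "\<lambda>i. pull (P i)"]) auto
qed

lemma krull_dim_eq: "krull_dim A = krull_dim B"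
  using krull_dim_le ring_isomorphism.krull_dim_le[OF inverse] by (rule antisym[rotated])

lemma max_ideal_image:
  assumes "noetherian_local B"
  shows "\<psi> ` max_ideal A = max_ideal B"
proof -
  have "\<exists>!I. maximalideal I A" using noetherian_local_transport[OF assms] by (simp add: noetherian_local_def)
  then have "maximalideal (max_ideal A) A" unfolding max_ideal_def by (rule theI')
  then have m: "maximalideal (\<psi> ` max_ideal A) B" by (rule maximal_image)
  have "\<exists>!I. maximalideal I B" using assms by (simp add: noetherian_local_def)
  then show ?thesis unfolding max_ideal_def[of B] using m by (metis the_equality)
qed

end

section \<open>Depth\<close>

context abelian_group
begin

lemma add_minus_cancel:
  assumes "x \<in> carrier G" "y \<in> carrier G"
  shows "y \<oplus> (x \<ominus> y) = x"
proof -
  have "y \<oplus> (x \<ominus> y) = (x \<oplus> \<ominus> y) \<oplus> y" unfolding a_minus_def using assms by (simp add: a_comm)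
  also have "\<dots> = x \<oplus> (\<ominus> y \<oplus> y)" by (rule a_assoc) (use assms in auto)
  finally show ?thesis using assms by (simp add: l_neg)
qed

lemma minus_add_cancel:
  assumes "x \<in> carrier G" "y \<in> carrier G"
  shows "(x \<ominus> y) \<oplus> y = x"
  using add_minus_cancel[OF assms] a_comm[of y "x \<ominus> y"] assms by simp

lemma add_diff_cancel_right:
  assumes "x \<in> carrier G" "y \<in> carrier G"
  shows "(x \<oplus> y) \<ominus> y = x"
  unfolding a_minus_def using assms by (simp add: a_assoc r_neg)

lemma add_diff_cancel_left:
  assumes "x \<in> carrier G" "y \<in> carrier G"
  shows "(x \<oplus> y) \<ominus> x = y"
  using add_diff_cancel_right[OF assms(2,1)] a_comm[OF assms] by simp

lemma sum_zero_eq_uminus: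
  assumes "x \<in> carrier G" "y \<in> carrier G" "x \<oplus> y = \<zero>"
  shows "y = \<ominus> x"
  using minus_equality[of y x] assms a_comm[of x y] by simp

end

text \<open>An ideal maximal among those that contain I and are disjoint from a multiplicative set
  is prime: if a and b lay outside, both enlarged ideals would meet \<open>S\<close>, while the
  product of the two elements found lies in \<open>P\<close>. Noetherianity makes every chain attain
  its union.\<close>

lemma (in cring) prime_avoiding:
  assumes I: "ideal I R" and S: "\<one> \<in> S" "S \<subseteq> carrier R" "\<And>s t. s \<in> S \<Longrightarrow> t \<in> S \<Longrightarrow> s \<otimes> t \<in> S"
    and disj: "I \<inter> S = {}" and noeth: "noetherian_ring R"
  obtains P where "primeideal P R" "I \<subseteq> P" "P \<inter> S = {}"
proof -
  let ?FF = "{J. ideal J R \<and> I \<subseteq> J \<and> J \<inter> S = {}}"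
  have "\<exists>M\<in>?FF. \<forall>Y\<in>?FF. M \<subseteq> Y \<longrightarrow> Y = M"
  proof (rule subset_Zorn_nonempty)
    show "?FF \<noteq> {}" using I disj by blast
    fix C assume C: "C \<noteq> {}" "subset.chain ?FF C"
    have "subset.chain {J. ideal J R} C" using C(2) by (auto simp: subset.chain_def)
    then have "\<Union>C \<in> C" by (rule noetherian_ring.ideal_chain_is_trivial[OF noeth C(1)])
    then show "\<Union>C \<in> ?FF" using C(2) by (auto simp: subset.chain_def)
  qed
  then obtain P where P0: "P \<in> ?FF" and max0: "\<forall>Y\<in>?FF. P \<subseteq> Y \<longrightarrow> Y = P" by (elim bexE)
  have P: "ideal P R" "I \<subseteq> P" "P \<inter> S = {}" using P0 by simp_all
  have max: "J = P" if J: "ideal J R" "P \<subseteq> J" "J \<inter> S = {}" for J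
  proof -
    have "J \<in> ?FF" using J P(2) by (intro CollectI conjI order.trans[OF P(2)])
    from bspec[OF max0 this] show ?thesis using J(2) by (rule mp)
  qed
  have PR: "x \<in> carrier R" if "x \<in> P" for x using ideal.Icarr[OF P(1) that] .
  have meet: "\<exists>p\<in>P. \<exists>r\<in>carrier R. p \<oplus> r \<otimes> a \<in> S" if a: "a \<in> carrier R" "a \<notin> P" for a
  proof -
    let ?J = "P <+>\<^bsub>R\<^esub> PIdl a"
    have J: "ideal ?J R" by (rule add_ideals[OF P(1) cgenideal_ideal[OF a(1)]])
    have "P \<subseteq> ?J"
    proof
      fix x assume x: "x \<in> P"
      have "x = x \<oplus> \<zero> \<otimes> a" using PR[OF x] a(1) by simp
      then show "x \<in> ?J" using x by (auto simp: set_add_def set_mult_def cgenideal_def)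
    qed
    moreover have "a \<in> ?J"
    proof -
      have "a = \<zero> \<oplus> \<one> \<otimes> a" using a(1) by simp
      moreover have "\<zero> \<in> P" using additive_subgroup.zero_closed[OF ideal.axioms(1)[OF P(1)]] .
      ultimately show ?thesis by (auto simp: set_add_def set_mult_def cgenideal_def)
    qed
    ultimately have "?J \<inter> S \<noteq> {}" using max[OF J] a(2) by blast
    then show ?thesis by (auto simp: set_add_def set_mult_def cgenideal_def)
  qed
  have "primeideal P R"
  proof (rule primeidealI[OF P(1)])
    show "cring R" by (rule cring_axioms)
    show "carrier R \<noteq> P" using P(3) S(1) by auto
    fix a b assume ab: "a \<in> carrier R" "b \<in> carrier R" "a \<otimes> b \<in> P"
    show "a \<in> P \<or> b \<in> P"
    proof (rule ccontr)
      assume "\<not> (a \<in> P \<or> b \<in> P)"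
      then obtain p q s t where pq: "p \<in> P" "q \<in> carrier R" "p \<oplus> q \<otimes> a \<in> S"
        "s \<in> P" "t \<in> carrier R" "s \<oplus> t \<otimes> b \<in> S" using meet ab(1,2) by metis
      have c: "p \<in> carrier R" "s \<in> carrier R" using pq PR by auto
      have "(p \<oplus> q \<otimes> a) \<otimes> (s \<oplus> t \<otimes> b) = (s \<oplus> t \<otimes> b) \<otimes> p \<oplus> (q \<otimes> a) \<otimes> s \<oplus> (q \<otimes> t) \<otimes> (a \<otimes> b)"
        using c pq ab by (simp add: l_distr r_distr m_ac a_ac)
      also have "\<dots> \<in> P"
        using pq c ab ideal.I_l_closed[OF P(1)] additive_subgroup.a_closed[OF ideal.axioms(1)[OF P(1)]]
        by (simp add: m_closed)
      finally show False using S(3)[OF pq(3,6)] P(3) by blast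
    qed
  qed
  then show ?thesis using that P(2,3) by blast
qed

section \<open>Regular sequences and chains of primes; Nakayama's lemma\<close>

context module
begin

text \<open>The annihilator of M/(xs)M.\<close>

definition colon :: "'a list \<Rightarrow> 'a set" where
  "colon xs = {a \<in> carrier R. \<forall>m\<in>carrier M. a \<odot>\<^bsub>M\<^esub> m \<in> seq_submodule R M xs}"

lemma colon_ideal:
  assumes "set xs \<subseteq> carrier R"
  shows "ideal (colon xs) R"
proof (rule idealI)
  note S = submoduleD[OF seq_submodule_is_submodule[OF assms]]
  show "ring R" by (rule R.ring_axioms)
  show "subgroup (colon xs) (add_monoid R)"
  proof (rule R.add.subgroupI)
    show "colon xs \<noteq> {}" using S(1) by (auto simp: colon_def intro!: exI[of _ "\<zero>"])
    show "\<ominus> a \<in> colon xs" if "a \<in> colon xs" for a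
      using that submoduleE(3)[OF seq_submodule_is_submodule[OF assms]] by (auto simp: colon_def smult_l_minus)
    show "a \<oplus> b \<in> colon xs" if "a \<in> colon xs" "b \<in> colon xs" for a b
      using that S(2) by (auto simp: colon_def smult_l_distr)
  qed (auto simp: colon_def)
  fix a x assume ax: "a \<in> colon xs" "x \<in> carrier R"
  then show "x \<otimes> a \<in> colon xs" using S(3) by (auto simp: colon_def smult_assoc1)
  then show "a \<otimes> x \<in> colon xs" using ax R.m_comm[of a x] by (simp add: colon_def)
qed

text \<open>Each \<open>x\<^sub>i\<close> is a nonzerodivisor modulo its predecessors, so below a prime containing the annihilator
  of $M/(x_1,\dots,x_i)M$ there is one that contains the annihilator of $M/(x_1,\dots,x_{i-1})M$ but
  not \<open>x\<^sub>i\<close>.\<close>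

lemma regular_seq_length_le:
  assumes reg: "regular_seq R M xs" and noeth: "noetherian_ring R"
  shows "enat (length xs) \<le> krull_dim R"
proof -
  let ?k = "length xs"
  have xs: "set xs \<subseteq> carrier R" and step: "\<And>i m. i < ?k \<Longrightarrow> m \<in> carrier M \<Longrightarrow>
      (xs ! i) \<odot>\<^bsub>M\<^esub> m \<in> seq_submodule R M (take i xs) \<Longrightarrow> m \<in> seq_submodule R M (take i xs)"
    and ne: "seq_submodule R M xs \<noteq> carrier M"
    using reg by (auto simp: regular_seq_def)
  have tk: "set (take i xs) \<subseteq> carrier R" for i using xs set_take_subset by fastforce
  \<comment> \<open>Induction from the end of the sequence: the chain has j steps, and its bottom
    contains the annihilator belonging to the sequence without its last j elements.\<close>
  have "\<exists>P. (\<forall>i\<le>j. primeideal (P i) R) \<and> (\<forall>i<j. P i \<subset> P (Suc i)) \<and> colon (take (?k - j) xs) \<subseteq> P 0"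
    if "j \<le> ?k" for j
    using that
  proof (induction j)
    case 0
    have "\<one> \<notin> colon xs"
    proof
      assume "\<one> \<in> colon xs"
      then have "carrier M \<subseteq> seq_submodule R M xs" by (auto simp: colon_def)
      then show False using ne submoduleD(4)[OF seq_submodule_is_submodule[OF xs]] by auto
    qed
    then obtain P where "primeideal P R" "colon xs \<subseteq> P"
      using R.prime_avoiding[OF colon_ideal[OF xs], of "{\<one>}"] noeth by auto
    then show ?case by (intro exI[of _ "\<lambda>_. P"]) auto
  next
    case (Suc j)
    then obtain P where P: "\<And>i. i \<le> j \<Longrightarrow> primeideal (P i) R" "\<And>i. i < j \<Longrightarrow> P i \<subset> P (Suc i)"
      "colon (take (?k - j) xs) \<subseteq> P 0" by auto
    define n where "n = ?k - Suc j"
    have n: "n < ?k" "?k - j = Suc n" using Suc.prems by (auto simp: n_def)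
    define x where "x = xs ! n"
    have xR: "x \<in> carrier R" using xs n by (auto simp: x_def)
    have tks: "take (Suc n) xs = take n xs @ [x]" using n by (simp add: x_def take_Suc_conv_app_nth)
    have Q: "primeideal (P 0) R" using P(1) by simp
    have xQ: "x \<in> P 0"
    proof -
      have "x \<in> colon (take (Suc n) xs)"
        using xR seq_submodule_mem[of x "take (Suc n) xs"] tks by (auto simp: colon_def)
      then show ?thesis using P(3) n(2) by auto
    qed
    \<comment> \<open>A prime disjoint from this multiplicative set is contained in
      \<open>P 0\<close> and omits x.\<close>
    define S where "S = {s \<otimes> x [^] e | s e. s \<in> carrier R \<and> s \<notin> P 0 \<and> (e :: nat) \<in> UNIV}"
    have one: "\<one> \<notin> P 0" using ideal.one_imp_carrier[OF primeideal.axioms(1)[OF Q]] primeideal.I_notcarr[OF Q] by blast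
    have "\<one> \<in> S" unfolding S_def using one by (intro CollectI exI[of _ \<one>] exI[of _ 0]) auto
    moreover have "S \<subseteq> carrier R" using xR by (auto simp: S_def)
    moreover have "a \<otimes> b \<in> S" if "a \<in> S" "b \<in> S" for a b
    proof -
      obtain s e where se: "s \<in> carrier R" "s \<notin> P 0" "a = s \<otimes> x [^] (e :: nat)"
        using \<open>a \<in> S\<close> unfolding S_def by blast
      obtain s' e' where se': "s' \<in> carrier R" "s' \<notin> P 0" "b = s' \<otimes> x [^] (e' :: nat)"
        using \<open>b \<in> S\<close> unfolding S_def by blast
      have "a \<otimes> b = (s \<otimes> s') \<otimes> x [^] (e + e')"
        using se se' xR by (simp add: R.nat_pow_mult[symmetric] R.m_ac)
      moreover have "s \<otimes> s' \<notin> P 0" using primeideal.I_prime[OF Q se(1) se'(1)] se(2) se'(2) by blast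
      ultimately show ?thesis using R.m_closed[OF se(1) se'(1)] unfolding S_def by blast
    qed
    moreover have "colon (take n xs) \<inter> S = {}"
    proof (rule ccontr)
      assume "colon (take n xs) \<inter> S \<noteq> {}"
      then obtain s e where s: "s \<in> carrier R" "s \<notin> P 0" "s \<otimes> x [^] (e :: nat) \<in> colon (take n xs)"
        by (auto simp: S_def)
      \<comment> \<open>x is a nonzerodivisor modulo its predecessors, so powers of x can be
        cancelled from an annihilating element.\<close>
      have "s \<in> colon (take n xs)"
        using s(3)
      proof (induction e)
        case 0
        then show ?case using s(1) by simp
      next
        case (Suc e)
        have "s \<otimes> x [^] e \<in> colon (take n xs)"
        proof -
          have "(s \<otimes> x [^] e) \<odot>\<^bsub>M\<^esub> m \<in> seq_submodule R M (take n xs)" if m: "m \<in> carrier M" for m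
          proof (rule step[OF n(1)])
            show "(s \<otimes> x [^] e) \<odot>\<^bsub>M\<^esub> m \<in> carrier M" using s xR m by simp
            have "xs ! n \<odot>\<^bsub>M\<^esub> ((s \<otimes> x [^] e) \<odot>\<^bsub>M\<^esub> m) = (s \<otimes> x [^] Suc e) \<odot>\<^bsub>M\<^esub> m"
              using s xR m by (simp add: x_def[symmetric] smult_assoc1[symmetric] R.m_ac)
            then show "xs ! n \<odot>\<^bsub>M\<^esub> ((s \<otimes> x [^] e) \<odot>\<^bsub>M\<^esub> m) \<in> seq_submodule R M (take n xs)"
              using Suc.prems m by (simp add: colon_def)
          qed
          then show ?thesis using s xR by (simp add: colon_def)
        qed
        then show ?case by (rule Suc.IH)
      qed
      moreover have "colon (take n xs) \<subseteq> colon (take (Suc n) xs)"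
        using seq_submodule_mono[of "take n xs" "take (Suc n) xs"] tks by (auto simp: colon_def)
      ultimately show False using P(3) n(2) s(2) by auto
    qed
    ultimately obtain P' where P': "primeideal P' R" "colon (take n xs) \<subseteq> P'" "P' \<inter> S = {}"
      using R.prime_avoiding[OF colon_ideal[OF tk[of n]] _ _ _ _ noeth, of S] by blast
    have P'R: "P' \<subseteq> carrier R" using ideal.Icarr[OF primeideal.axioms(1)[OF P'(1)]] by auto
    have "P' \<subset> P 0"
    proof
      show "P' \<subseteq> P 0"
      proof
        fix s assume s: "s \<in> P'"
        show "s \<in> P 0"
        proof (rule ccontr)
          assume "s \<notin> P 0"
          then have "s \<otimes> x [^] (0::nat) \<in> S" unfolding S_def using s P'R by blast
          moreover have "s \<in> carrier R" using s P'R by blast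
          ultimately have "s \<in> S" by simp
          then show False using s P'(3) by blast
        qed
      qed
      have "\<one> \<otimes> x [^] (1::nat) \<in> S" unfolding S_def using one by blast
      then have "x \<in> S" using xR by simp
      then show "P' \<noteq> P 0" using P'(3) xQ by blast
    qed
    then show ?case
      using P P' n by (intro exI[of _ "\<lambda>i. case i of 0 \<Rightarrow> P' | Suc i \<Rightarrow> P i"])
        (auto simp: n_def split: nat.split)
  qed
  from this[of ?k] show ?thesis
    unfolding krull_dim_def by (intro Sup_upper) blast
qed

lemma depth_le_krull_dim:
  assumes "carrier M \<noteq> {\<zero>\<^bsub>M\<^esub>}" "noetherian_ring R"
  shows "depth R M \<le> krull_dim R"
  unfolding depth_def using assms(1) regular_seq_length_le[OF _ assms(2)] by (auto intro!: Sup_least)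

text \<open>Elimination in place of a determinant: the relation for the last generator is solved by
  inverting 1 - c_n and substituted into the others, whose coefficients stay in J.\<close>

lemma nakayama:
  assumes J: "ideal J R" "\<And>a. a \<in> J \<Longrightarrow> \<one> \<ominus> a \<in> Units R"
    and e: "\<And>i. i < n \<Longrightarrow> e i \<in> carrier M" and L: "submodule L R M"
    and gen: "\<And>k. k < n \<Longrightarrow> \<exists>l\<in>L. \<exists>c. (\<forall>i. c i \<in> J) \<and> e k = l \<oplus>\<^bsub>M\<^esub> (\<Oplus>\<^bsub>M\<^esub>i\<in>{..<n::nat}. c i \<odot>\<^bsub>M\<^esub> e i)"
    and k: "k < n"
  shows "e k \<in> L"
  using e gen k
proof (induction n arbitrary: k)
  case (Suc n)
  note SL = submoduleD[OF L]
  have JR: "a \<in> carrier R" if "a \<in> J" for a using ideal.Icarr[OF J(1) that] .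
  have ec: "e i \<in> carrier M" if "i \<le> n" for i using Suc.prems(1) that by simp
  have fin: "(\<Oplus>\<^bsub>M\<^esub>i\<in>{..<Suc n}. c i \<odot>\<^bsub>M\<^esub> e i) = c n \<odot>\<^bsub>M\<^esub> e n \<oplus>\<^bsub>M\<^esub> (\<Oplus>\<^bsub>M\<^esub>i\<in>{..<n}. c i \<odot>\<^bsub>M\<^esub> e i)"
    and finc: "(\<Oplus>\<^bsub>M\<^esub>i\<in>{..<n}. c i \<odot>\<^bsub>M\<^esub> e i) \<in> carrier M" if "\<forall>i. c i \<in> J" for c
  proof -
    show "(\<Oplus>\<^bsub>M\<^esub>i\<in>{..<Suc n}. c i \<odot>\<^bsub>M\<^esub> e i) = c n \<odot>\<^bsub>M\<^esub> e n \<oplus>\<^bsub>M\<^esub> (\<Oplus>\<^bsub>M\<^esub>i\<in>{..<n}. c i \<odot>\<^bsub>M\<^esub> e i)"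
      unfolding lessThan_Suc by (rule M.finsum_insert) (use that JR ec in auto)
    show "(\<Oplus>\<^bsub>M\<^esub>i\<in>{..<n}. c i \<odot>\<^bsub>M\<^esub> e i) \<in> carrier M"
      by (rule M.finsum_closed) (use that JR ec in auto)
  qed
  obtain l c where l: "l \<in> L" "\<forall>i. c i \<in> J" "e n = l \<oplus>\<^bsub>M\<^esub> (\<Oplus>\<^bsub>M\<^esub>i\<in>{..<Suc n}. c i \<odot>\<^bsub>M\<^esub> e i)"
    using Suc.prems(2)[of n] by blast
  let ?s = "\<Oplus>\<^bsub>M\<^esub>i\<in>{..<n}. c i \<odot>\<^bsub>M\<^esub> e i"
  have lc: "l \<in> carrier M" and sc: "?s \<in> carrier M" and cn: "c n \<in> carrier R" "c n \<in> J"
    using l SL(4) finc JR by auto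
  obtain u where u: "u \<in> carrier R" "u \<otimes> (\<one> \<ominus> c n) = \<one>"
    using J(2)[OF cn(2)] unfolding Units_def by blast
  have en: "e n = u \<odot>\<^bsub>M\<^esub> l \<oplus>\<^bsub>M\<^esub> u \<odot>\<^bsub>M\<^esub> ?s"
  proof -
    have eq: "e n = l \<oplus>\<^bsub>M\<^esub> (c n \<odot>\<^bsub>M\<^esub> e n \<oplus>\<^bsub>M\<^esub> ?s)" using l(3) fin[OF l(2)] by simp
    have enc: "e n \<in> carrier M" using ec by simp
    have "(\<one> \<ominus> c n) \<odot>\<^bsub>M\<^esub> e n = \<one> \<odot>\<^bsub>M\<^esub> e n \<oplus>\<^bsub>M\<^esub> (\<ominus> c n) \<odot>\<^bsub>M\<^esub> e n"
      unfolding R.minus_eq by (rule smult_l_distr[OF R.one_closed R.a_inv_closed[OF cn(1)] enc])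
    also have "\<dots> = e n \<oplus>\<^bsub>M\<^esub> \<ominus>\<^bsub>M\<^esub> (c n \<odot>\<^bsub>M\<^esub> e n)"
      using smult_l_minus[OF cn(1) enc] smult_one[OF enc] by simp
    also have "\<dots> = (l \<oplus>\<^bsub>M\<^esub> ?s) \<oplus>\<^bsub>M\<^esub> c n \<odot>\<^bsub>M\<^esub> e n \<oplus>\<^bsub>M\<^esub> \<ominus>\<^bsub>M\<^esub> (c n \<odot>\<^bsub>M\<^esub> e n)"
    proof -
      have "e n = (l \<oplus>\<^bsub>M\<^esub> ?s) \<oplus>\<^bsub>M\<^esub> c n \<odot>\<^bsub>M\<^esub> e n"
        using trans[OF eq] M.a_comm[OF smult_closed[OF cn(1) enc] sc]
          M.a_assoc[OF lc sc smult_closed[OF cn(1) enc]] by simp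
      then show ?thesis by (rule arg_cong[where f = "\<lambda>x. x \<oplus>\<^bsub>M\<^esub> \<ominus>\<^bsub>M\<^esub> (c n \<odot>\<^bsub>M\<^esub> e n)"])
    qed
    also have "\<dots> = l \<oplus>\<^bsub>M\<^esub> ?s"
      using M.a_assoc[OF M.a_closed[OF lc sc] smult_closed[OF cn(1) enc] M.a_inv_closed[OF smult_closed[OF cn(1) enc]]]
        M.r_neg[OF smult_closed[OF cn(1) enc]] M.r_zero[OF M.a_closed[OF lc sc]] by simp
    finally have "u \<odot>\<^bsub>M\<^esub> ((\<one> \<ominus> c n) \<odot>\<^bsub>M\<^esub> e n) = u \<odot>\<^bsub>M\<^esub> (l \<oplus>\<^bsub>M\<^esub> ?s)" by simp
    then show ?thesis
      using u cn ec lc sc by (simp add: smult_assoc1[symmetric] smult_r_distr)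
  qed
  have us: "u \<odot>\<^bsub>M\<^esub> ?s = (\<Oplus>\<^bsub>M\<^esub>i\<in>{..<n}. (u \<otimes> c i) \<odot>\<^bsub>M\<^esub> e i)"
  proof -
    have "u \<odot>\<^bsub>M\<^esub> ?s = (\<Oplus>\<^bsub>M\<^esub>i\<in>{..<n}. u \<odot>\<^bsub>M\<^esub> (c i \<odot>\<^bsub>M\<^esub> e i))"
      by (rule finsum_smult_ldistr) (use u l JR ec in auto)
    also have "\<dots> = (\<Oplus>\<^bsub>M\<^esub>i\<in>{..<n}. (u \<otimes> c i) \<odot>\<^bsub>M\<^esub> e i)"
      by (rule M.finsum_cong') (use u l JR ec in \<open>auto simp: smult_assoc1\<close>)
    finally show ?thesis .
  qed
  have IH: "e k \<in> L" if k: "k < n" for k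
  proof (rule Suc.IH)
    show "e i \<in> carrier M" if "i < n" for i using ec that by simp
    show "k < n" by fact
    fix k assume k: "k < n"
    obtain l' b where b: "l' \<in> L" "\<forall>i. b i \<in> J" "e k = l' \<oplus>\<^bsub>M\<^esub> (\<Oplus>\<^bsub>M\<^esub>i\<in>{..<Suc n}. b i \<odot>\<^bsub>M\<^esub> e i)"
      using Suc.prems(2)[of k] k by auto
    have l'c: "l' \<in> carrier M" and bn: "b n \<in> carrier R" using b SL(4) JR by auto
    define a where "a = (\<lambda>i. b i \<oplus> b n \<otimes> (u \<otimes> c i))"
    have aJ: "\<forall>i. a i \<in> J"
      unfolding a_def using b(2) l(2) u(1) JR
      by (auto intro!: additive_subgroup.a_closed[OF ideal.axioms(1)[OF J(1)]] ideal.I_l_closed[OF J(1)])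
    have "b n \<odot>\<^bsub>M\<^esub> e n = (b n \<otimes> u) \<odot>\<^bsub>M\<^esub> l \<oplus>\<^bsub>M\<^esub> b n \<odot>\<^bsub>M\<^esub> (u \<odot>\<^bsub>M\<^esub> ?s)"
      using en bn u lc sc by (simp add: smult_r_distr smult_assoc1)
    also have "b n \<odot>\<^bsub>M\<^esub> (u \<odot>\<^bsub>M\<^esub> ?s) = (\<Oplus>\<^bsub>M\<^esub>i\<in>{..<n}. (b n \<otimes> (u \<otimes> c i)) \<odot>\<^bsub>M\<^esub> e i)"
    proof -
      have "b n \<odot>\<^bsub>M\<^esub> (\<Oplus>\<^bsub>M\<^esub>i\<in>{..<n}. (u \<otimes> c i) \<odot>\<^bsub>M\<^esub> e i) = (\<Oplus>\<^bsub>M\<^esub>i\<in>{..<n}. b n \<odot>\<^bsub>M\<^esub> ((u \<otimes> c i) \<odot>\<^bsub>M\<^esub> e i))"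
        by (rule finsum_smult_ldistr) (use u l JR ec bn in auto)
      also have "\<dots> = (\<Oplus>\<^bsub>M\<^esub>i\<in>{..<n}. (b n \<otimes> (u \<otimes> c i)) \<odot>\<^bsub>M\<^esub> e i)"
        by (rule M.finsum_cong') (use u l JR ec bn in \<open>auto simp: smult_assoc1\<close>)
      finally show ?thesis using us by simp
    qed
    finally have bne: "b n \<odot>\<^bsub>M\<^esub> e n = (b n \<otimes> u) \<odot>\<^bsub>M\<^esub> l \<oplus>\<^bsub>M\<^esub> (\<Oplus>\<^bsub>M\<^esub>i\<in>{..<n}. (b n \<otimes> (u \<otimes> c i)) \<odot>\<^bsub>M\<^esub> e i)" .
    let ?A = "\<Oplus>\<^bsub>M\<^esub>i\<in>{..<n}. (b n \<otimes> (u \<otimes> c i)) \<odot>\<^bsub>M\<^esub> e i" and ?B = "\<Oplus>\<^bsub>M\<^esub>i\<in>{..<n}. b i \<odot>\<^bsub>M\<^esub> e i"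
    have Ac: "?A \<in> carrier M" by (rule M.finsum_closed) (use u l JR ec bn in auto)
    have Bc: "?B \<in> carrier M" by (rule finc[OF b(2)])
    have "(\<Oplus>\<^bsub>M\<^esub>i\<in>{..<n}. a i \<odot>\<^bsub>M\<^esub> e i) =
      (\<Oplus>\<^bsub>M\<^esub>i\<in>{..<n}. b i \<odot>\<^bsub>M\<^esub> e i \<oplus>\<^bsub>M\<^esub> (b n \<otimes> (u \<otimes> c i)) \<odot>\<^bsub>M\<^esub> e i)"
      by (rule M.finsum_cong') (use b l u JR ec bn in \<open>auto simp: a_def smult_l_distr\<close>)
    also have "\<dots> = ?B \<oplus>\<^bsub>M\<^esub> ?A"
      by (rule M.finsum_addf) (use b l u JR ec bn in auto)
    finally have sum: "(\<Oplus>\<^bsub>M\<^esub>i\<in>{..<n}. a i \<odot>\<^bsub>M\<^esub> e i) = ?B \<oplus>\<^bsub>M\<^esub> ?A" .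
    have "e k = l' \<oplus>\<^bsub>M\<^esub> (b n \<odot>\<^bsub>M\<^esub> e n \<oplus>\<^bsub>M\<^esub> ?B)" using b(3) fin[OF b(2)] by simp
    also have "\<dots> = (l' \<oplus>\<^bsub>M\<^esub> (b n \<otimes> u) \<odot>\<^bsub>M\<^esub> l) \<oplus>\<^bsub>M\<^esub> (?B \<oplus>\<^bsub>M\<^esub> ?A)"
      unfolding bne using l'c lc bn u Ac Bc by (simp add: M.a_ac)
    finally have "e k = (l' \<oplus>\<^bsub>M\<^esub> (b n \<otimes> u) \<odot>\<^bsub>M\<^esub> l) \<oplus>\<^bsub>M\<^esub> (\<Oplus>\<^bsub>M\<^esub>i\<in>{..<n}. a i \<odot>\<^bsub>M\<^esub> e i)" using sum by simp
    moreover have "l' \<oplus>\<^bsub>M\<^esub> (b n \<otimes> u) \<odot>\<^bsub>M\<^esub> l \<in> L" using SL(2,3) b(1) l(1) bn u by simp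
    ultimately show "\<exists>l\<in>L. \<exists>c. (\<forall>i. c i \<in> J) \<and> e k = l \<oplus>\<^bsub>M\<^esub> (\<Oplus>\<^bsub>M\<^esub>i\<in>{..<n}. c i \<odot>\<^bsub>M\<^esub> e i)"
      using aJ by blast
  qed
  have finL: "(\<Oplus>\<^bsub>M\<^esub>i\<in>{..<m}. c i \<odot>\<^bsub>M\<^esub> e i) \<in> L" if "m \<le> n" for m
    using that
  proof (induction m)
    case 0
    then show ?case using SL(1) by simp
  next
    case (Suc m)
    have "(\<Oplus>\<^bsub>M\<^esub>i\<in>{..<Suc m}. c i \<odot>\<^bsub>M\<^esub> e i) = c m \<odot>\<^bsub>M\<^esub> e m \<oplus>\<^bsub>M\<^esub> (\<Oplus>\<^bsub>M\<^esub>i\<in>{..<m}. c i \<odot>\<^bsub>M\<^esub> e i)"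
      unfolding lessThan_Suc by (rule M.finsum_insert) (use Suc.prems l JR ec in auto)
    then show ?case using Suc SL(2,3) IH[of m] l(2) JR by simp
  qed
  have "e n \<in> L" using en SL(2,3) l(1) u(1) finL[of n] by simp
  then show ?case using IH[of k] Suc.prems(3) by (cases "k = n") auto
qed simp

end

section \<open>Extensions of modules\<close>

text \<open>A short exact sequence from \<open>N1\<close> through \<open>N\<close> to
  \<open>N2\<close>, with maps \<open>i\<close> and \<open>p\<close>.\<close>

locale extension = N1: module A N1 + N: module A N + N2: module A N2
  for A :: "('a, 'c) ring_scheme" and N1 :: "('a, 'l, 'x) module_scheme"
    and N :: "('a, 'm, 'y) module_scheme" and N2 :: "('a, 'n, 'z) module_scheme" +
  fixes i p
  assumes i_closed [simp]: "x \<in> carrier N1 \<Longrightarrow> i x \<in> carrier N"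
    and p_closed [simp]: "y \<in> carrier N \<Longrightarrow> p y \<in> carrier N2"
    and i_add: "x \<in> carrier N1 \<Longrightarrow> x' \<in> carrier N1 \<Longrightarrow> i (x \<oplus>\<^bsub>N1\<^esub> x') = i x \<oplus>\<^bsub>N\<^esub> i x'"
    and i_smult: "a \<in> carrier A \<Longrightarrow> x \<in> carrier N1 \<Longrightarrow> i (a \<odot>\<^bsub>N1\<^esub> x) = a \<odot>\<^bsub>N\<^esub> i x"
    and p_add: "y \<in> carrier N \<Longrightarrow> y' \<in> carrier N \<Longrightarrow> p (y \<oplus>\<^bsub>N\<^esub> y') = p y \<oplus>\<^bsub>N2\<^esub> p y'"
    and p_smult: "a \<in> carrier A \<Longrightarrow> y \<in> carrier N \<Longrightarrow> p (a \<odot>\<^bsub>N\<^esub> y) = a \<odot>\<^bsub>N2\<^esub> p y"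
    and i_inj: "x \<in> carrier N1 \<Longrightarrow> i x = \<zero>\<^bsub>N\<^esub> \<Longrightarrow> x = \<zero>\<^bsub>N1\<^esub>"
    and p_surj: "z \<in> carrier N2 \<Longrightarrow> \<exists>y\<in>carrier N. p y = z"
    and exact: "y \<in> carrier N \<Longrightarrow> p y = \<zero>\<^bsub>N2\<^esub> \<longleftrightarrow> (\<exists>x\<in>carrier N1. y = i x)"
begin

lemma p_zero: "p \<zero>\<^bsub>N\<^esub> = \<zero>\<^bsub>N2\<^esub>"
  using p_smult[of "\<zero>\<^bsub>A\<^esub>" "\<zero>\<^bsub>N\<^esub>"] by simp

lemma i_zero: "i \<zero>\<^bsub>N1\<^esub> = \<zero>\<^bsub>N\<^esub>"
  using i_smult[of "\<zero>\<^bsub>A\<^esub>" "\<zero>\<^bsub>N1\<^esub>"] by simp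

lemma p_diff: "y \<in> carrier N \<Longrightarrow> y' \<in> carrier N \<Longrightarrow> p (y \<ominus>\<^bsub>N\<^esub> y') = p y \<ominus>\<^bsub>N2\<^esub> p y'"
  using p_add[of y "\<ominus>\<^bsub>N\<^esub> y'"] p_smult[of "\<ominus>\<^bsub>A\<^esub> \<one>\<^bsub>A\<^esub>" y']
  by (simp add: a_minus_def N.smult_l_minus N2.smult_l_minus)

lemma i_diff: "y \<in> carrier N1 \<Longrightarrow> y' \<in> carrier N1 \<Longrightarrow> i (y \<ominus>\<^bsub>N1\<^esub> y') = i y \<ominus>\<^bsub>N\<^esub> i y'"
  using i_add[of y "\<ominus>\<^bsub>N1\<^esub> y'"] i_smult[of "\<ominus>\<^bsub>A\<^esub> \<one>\<^bsub>A\<^esub>" y']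
  by (simp add: a_minus_def N.smult_l_minus N1.smult_l_minus)

lemma vimage_p: "submodule L A N2 \<Longrightarrow> submodule {y \<in> carrier N. p y \<in> L} A N"
  by (rule N.submoduleI') (auto simp: p_zero p_add p_smult dest: submoduleD)

lemma vimage_i: "submodule L A N \<Longrightarrow> submodule {x \<in> carrier N1. i x \<in> L} A N1"
  by (rule N1.submoduleI') (auto simp: i_zero i_add i_smult dest: submoduleD)

lemma image_p:
  assumes "submodule L A N"
  shows "submodule (p ` L) A N2"
proof (rule N2.submoduleI')
  note S = submoduleD[OF assms]
  show "p ` L \<subseteq> carrier N2" using S(4) by auto
  show "\<zero>\<^bsub>N2\<^esub> \<in> p ` L" using S(1) p_zero by (metis image_eqI)
  fix x y assume "x \<in> p ` L" "y \<in> p ` L"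
  then obtain x' y' where "x' \<in> L" "x = p x'" "y' \<in> L" "y = p y'" by blast
  then show "x \<oplus>\<^bsub>N2\<^esub> y \<in> p ` L" using S(2,4) p_add[of x' y'] by (metis image_eqI subsetD)
next
  note S = submoduleD[OF assms]
  fix a x assume "a \<in> carrier A" "x \<in> p ` L"
  then obtain x' where "a \<in> carrier A" "x' \<in> L" "x = p x'" by blast
  then show "a \<odot>\<^bsub>N2\<^esub> x \<in> p ` L" using S(3,4) p_smult[of a x'] by (metis image_eqI subsetD)
qed

lemma p_seq:
  assumes "set xs \<subseteq> carrier A" "y \<in> seq_submodule A N xs"
  shows "p y \<in> seq_submodule A N2 xs"
proof -
  have "seq_submodule A N xs \<subseteq> {y \<in> carrier N. p y \<in> seq_submodule A N2 xs}"
  proof (rule N.seq_submodule_le[OF vimage_p[OF N2.seq_submodule_is_submodule[OF assms(1)]]])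
    fix x m assume "x \<in> set xs" "m \<in> carrier N"
    then show "x \<odot>\<^bsub>N\<^esub> m \<in> {y \<in> carrier N. p y \<in> seq_submodule A N2 xs}"
      using assms(1) p_smult[of x m] N2.seq_submodule_mem[of x xs "p m"] by auto
  qed
  then show ?thesis using assms(2) by auto
qed

lemma i_seq:
  assumes "set xs \<subseteq> carrier A" "y \<in> seq_submodule A N1 xs"
  shows "i y \<in> seq_submodule A N xs"
proof -
  have "seq_submodule A N1 xs \<subseteq> {y \<in> carrier N1. i y \<in> seq_submodule A N xs}"
  proof (rule N1.seq_submodule_le[OF vimage_i[OF N.seq_submodule_is_submodule[OF assms(1)]]])
    fix x m assume "x \<in> set xs" "m \<in> carrier N1"
    then show "x \<odot>\<^bsub>N1\<^esub> m \<in> {y \<in> carrier N1. i y \<in> seq_submodule A N xs}"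
      using assms(1) i_smult[of x m] N.seq_submodule_mem[of x xs "i m"] by auto
  qed
  then show ?thesis using assms(2) by auto
qed

lemma lift_seq:
  assumes "set xs \<subseteq> carrier A" "z \<in> seq_submodule A N2 xs"
  shows "\<exists>y\<in>seq_submodule A N xs. p y = z"
proof -
  have "seq_submodule A N2 xs \<subseteq> p ` seq_submodule A N xs"
  proof (rule N2.seq_submodule_le[OF image_p[OF N.seq_submodule_is_submodule[OF assms(1)]]])
    fix x m assume xm: "x \<in> set xs" "m \<in> carrier N2"
    then obtain n where "n \<in> carrier N" "p n = m" using p_surj by blast
    then show "x \<odot>\<^bsub>N2\<^esub> m \<in> p ` seq_submodule A N xs"
      using xm assms(1) p_smult[of x n] N.seq_submodule_mem[of x xs n] by (metis image_eqI subsetD)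
  qed
  then show ?thesis using assms(2) by blast
qed

lemma decompose:
  assumes "set xs \<subseteq> carrier A" "y \<in> carrier N" "p y \<in> seq_submodule A N2 xs"
  obtains n x where "n \<in> seq_submodule A N xs" "x \<in> carrier N1" "y = n \<oplus>\<^bsub>N\<^esub> i x"
proof -
  obtain n where n: "n \<in> seq_submodule A N xs" "p n = p y" using lift_seq[OF assms(1,3)] by blast
  have nc: "n \<in> carrier N" using n submoduleD(4)[OF N.seq_submodule_is_submodule[OF assms(1)]] by auto
  have "p (y \<ominus>\<^bsub>N\<^esub> n) = \<zero>\<^bsub>N2\<^esub>" using p_diff[OF assms(2) nc] n(2) p_closed[OF assms(2)] by (simp add: N2.M.r_neg a_minus_def)
  then obtain x where x: "x \<in> carrier N1" "y \<ominus>\<^bsub>N\<^esub> n = i x" using exact[of "y \<ominus>\<^bsub>N\<^esub> n"] assms(2) nc by auto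
  have "y = n \<oplus>\<^bsub>N\<^esub> (y \<ominus>\<^bsub>N\<^esub> n)" using N.M.add_minus_cancel[OF assms(2) nc] by simp
  then show ?thesis using that n(1) x by simp
qed

text \<open>Regularity on \<open>N2\<close> makes \<open>N1\<close> meet (xs)N only in (xs)N1. If i
  y = z + x m, exactness and regularity show that p m already lies in the submodule of the earlier
  elements of \<open>N2\<close>; so m may be replaced by an element of \<open>N1\<close>, and
  induction applies.\<close>

lemma seq_restrict:
  assumes "set xs \<subseteq> carrier A"
    "\<And>j m. j < length xs \<Longrightarrow> m \<in> carrier N2 \<Longrightarrow> (xs ! j) \<odot>\<^bsub>N2\<^esub> m \<in> seq_submodule A N2 (take j xs) \<Longrightarrow>
      m \<in> seq_submodule A N2 (take j xs)"
    "y \<in> carrier N1" "i y \<in> seq_submodule A N xs"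
  shows "y \<in> seq_submodule A N1 xs"
  using assms
proof (induction xs arbitrary: y rule: rev_induct)
  case Nil
  then show ?case using i_inj by (simp add: N.seq_submodule_Nil N1.seq_submodule_Nil)
next
  case (snoc x xs)
  have x: "x \<in> carrier A" and xs: "set xs \<subseteq> carrier A" using snoc.prems(1) by auto
  have sN: "submodule (seq_submodule A N xs) A N" by (rule N.seq_submodule_is_submodule[OF xs])
  note S = submoduleD[OF sN]
  obtain z m where zm: "z \<in> seq_submodule A N xs" "m \<in> carrier N" "i y = z \<oplus>\<^bsub>N\<^esub> x \<odot>\<^bsub>N\<^esub> m"
    using N.seq_submodule_snoc[OF xs x snoc.prems(4)] by blast
  have zc: "z \<in> carrier N" using zm(1) S(4) by auto
  have "p (i y) = \<zero>\<^bsub>N2\<^esub>" using exact[of "i y"] snoc.prems(3) by auto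
  then have "p z \<oplus>\<^bsub>N2\<^esub> x \<odot>\<^bsub>N2\<^esub> p m = \<zero>\<^bsub>N2\<^esub>"
    using zm zc x by (simp add: p_add p_smult)
  then have "x \<odot>\<^bsub>N2\<^esub> p m = \<ominus>\<^bsub>N2\<^esub> p z"
    using zc zm(2) x by (intro N2.M.sum_zero_eq_uminus) auto
  moreover have "\<ominus>\<^bsub>N2\<^esub> p z \<in> seq_submodule A N2 xs"
    using N2.submoduleE(3)[OF N2.seq_submodule_is_submodule[OF xs] p_seq[OF xs zm(1)]] .
  ultimately have "p m \<in> seq_submodule A N2 xs"
    using snoc.prems(2)[of "length xs" "p m"] zm(2) by simp
  then obtain n t where nt: "n \<in> seq_submodule A N xs" "t \<in> carrier N1" "m = n \<oplus>\<^bsub>N\<^esub> i t"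
    using decompose[OF xs zm(2)] by blast
  have nc: "n \<in> carrier N" using nt(1) S(4) by auto
  have ic: "i t \<in> carrier N" "x \<odot>\<^bsub>N\<^esub> i t \<in> carrier N" "x \<odot>\<^bsub>N\<^esub> n \<in> carrier N" using nt(2) nc x by auto
  have iy: "i y = (z \<oplus>\<^bsub>N\<^esub> x \<odot>\<^bsub>N\<^esub> n) \<oplus>\<^bsub>N\<^esub> x \<odot>\<^bsub>N\<^esub> i t"
    unfolding zm(3) nt(3) N.smult_r_distr[OF x nc ic(1)] using N.M.a_assoc[OF zc ic(3,2)] by simp
  have "i (y \<ominus>\<^bsub>N1\<^esub> x \<odot>\<^bsub>N1\<^esub> t) = i y \<ominus>\<^bsub>N\<^esub> x \<odot>\<^bsub>N\<^esub> i t"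
    using i_diff[of y "x \<odot>\<^bsub>N1\<^esub> t"] i_smult[OF x nt(2)] snoc.prems(3) nt(2) x by simp
  also have "\<dots> = z \<oplus>\<^bsub>N\<^esub> x \<odot>\<^bsub>N\<^esub> n"
    unfolding iy by (rule N.M.add_diff_cancel_right) (use zc ic in auto)
  also have "\<dots> \<in> seq_submodule A N xs" using S(2,3) zm(1) nt(1) x by simp
  finally have "y \<ominus>\<^bsub>N1\<^esub> x \<odot>\<^bsub>N1\<^esub> t \<in> seq_submodule A N1 xs"
  proof (rule snoc.IH[OF xs, rotated 2])
    fix j m assume "j < length xs" "m \<in> carrier N2" "xs ! j \<odot>\<^bsub>N2\<^esub> m \<in> seq_submodule A N2 (take j xs)"
    then show "m \<in> seq_submodule A N2 (take j xs)"
      using snoc.prems(2)[of j m] by (simp add: nth_append)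
  qed (use snoc.prems(3) x nt in auto)
  then have "y \<ominus>\<^bsub>N1\<^esub> x \<odot>\<^bsub>N1\<^esub> t \<in> seq_submodule A N1 (xs @ [x])"
    using N1.seq_submodule_mono[of xs "xs @ [x]"] by auto
  moreover have "x \<odot>\<^bsub>N1\<^esub> t \<in> seq_submodule A N1 (xs @ [x])"
    using N1.seq_submodule_mem[of x "xs @ [x]" t] nt(2) by simp
  ultimately have "(y \<ominus>\<^bsub>N1\<^esub> x \<odot>\<^bsub>N1\<^esub> t) \<oplus>\<^bsub>N1\<^esub> x \<odot>\<^bsub>N1\<^esub> t \<in> seq_submodule A N1 (xs @ [x])"
    using submoduleD(2)[OF N1.seq_submodule_is_submodule[OF snoc.prems(1)]] by blast
  moreover have "(y \<ominus>\<^bsub>N1\<^esub> x \<odot>\<^bsub>N1\<^esub> t) \<oplus>\<^bsub>N1\<^esub> x \<odot>\<^bsub>N1\<^esub> t = y"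
    by (rule N1.M.minus_add_cancel) (use snoc.prems(3) x nt(2) in auto)
  ultimately show ?case by simp
qed

text \<open>If x m lies in the submodule of the earlier elements, regularity on \<open>N2\<close>
  moves m into \<open>N1\<close> modulo that submodule, \<open>seq_restrict\<close> moves the
  relation there, and regularity on \<open>N1\<close> finishes.\<close>

lemma regular_seq_extension:
  assumes r1: "regular_seq A N1 xs" and r2: "regular_seq A N2 xs"
  shows "regular_seq A N xs"
proof -
  have xs: "set xs \<subseteq> carrier A" using r1 by (simp add: regular_seq_def)
  have tk: "set (take j xs) \<subseteq> carrier A" for j using xs set_take_subset by fastforce
  have "m \<in> seq_submodule A N (take j xs)"
    if j: "j < length xs" and m: "m \<in> carrier N" "(xs ! j) \<odot>\<^bsub>N\<^esub> m \<in> seq_submodule A N (take j xs)" for j m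
  proof -
    let ?ys = "take j xs" and ?x = "xs ! j"
    have x: "?x \<in> carrier A" using xs j by auto
    note S = submoduleD[OF N.seq_submodule_is_submodule[OF tk[of j]]]
    have "?x \<odot>\<^bsub>N2\<^esub> p m \<in> seq_submodule A N2 ?ys"
      using p_seq[OF tk m(2)] p_smult[OF x m(1)] by simp
    then have "p m \<in> seq_submodule A N2 ?ys" using r2 j m(1) by (simp add: regular_seq_def)
    then obtain n t where nt: "n \<in> seq_submodule A N ?ys" "t \<in> carrier N1" "m = n \<oplus>\<^bsub>N\<^esub> i t"
      using decompose[OF tk m(1)] by blast
    have nc: "n \<in> carrier N" using nt(1) S(4) by auto
    have "i (?x \<odot>\<^bsub>N1\<^esub> t) = ?x \<odot>\<^bsub>N\<^esub> m \<ominus>\<^bsub>N\<^esub> ?x \<odot>\<^bsub>N\<^esub> n"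
    proof -
      have ic: "i t \<in> carrier N" using nt(2) by simp
      have "?x \<odot>\<^bsub>N\<^esub> m \<ominus>\<^bsub>N\<^esub> ?x \<odot>\<^bsub>N\<^esub> n = ?x \<odot>\<^bsub>N\<^esub> i t"
        unfolding nt(3) N.smult_r_distr[OF x nc ic] by (rule N.M.add_diff_cancel_left) (use x nc ic in auto)
      then show ?thesis using i_smult[OF x nt(2)] by simp
    qed
    also have "\<dots> \<in> seq_submodule A N ?ys"
      by (rule N.submodule_diff[OF N.seq_submodule_is_submodule[OF tk] m(2) S(3)[OF x nt(1)]])
    finally have "?x \<odot>\<^bsub>N1\<^esub> t \<in> seq_submodule A N1 ?ys"
    proof (rule seq_restrict[OF tk, rotated 2])
      fix l m assume l: "l < length ?ys" "m \<in> carrier N2" "?ys ! l \<odot>\<^bsub>N2\<^esub> m \<in> seq_submodule A N2 (take l ?ys)"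
      then have "l < length xs" "take l ?ys = take l xs" "?ys ! l = xs ! l" using j by (auto simp: min_def)
      then show "m \<in> seq_submodule A N2 (take l ?ys)" using r2 l(2,3) by (simp add: regular_seq_def)
    qed (use x nt in auto)
    then have "t \<in> seq_submodule A N1 ?ys" using r1 j nt(2) by (simp add: regular_seq_def)
    then have "i t \<in> seq_submodule A N ?ys" by (rule i_seq[OF tk])
    then show ?thesis using nt S(2) by simp
  qed
  moreover have "seq_submodule A N xs \<noteq> carrier N"
  proof
    assume eq: "seq_submodule A N xs = carrier N"
    have "carrier N2 \<subseteq> seq_submodule A N2 xs"
    proof
      fix z assume "z \<in> carrier N2"
      then obtain y where "y \<in> carrier N" "p y = z" using p_surj by blast
      then show "z \<in> seq_submodule A N2 xs" using p_seq[OF xs] eq by blast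
    qed
    then show False
      using r2 submoduleD(4)[OF N2.seq_submodule_is_submodule[OF xs]] by (auto simp: regular_seq_def)
  qed
  ultimately show ?thesis using xs by (simp add: regular_seq_def)
qed

end

section \<open>Frobenius\<close>

lemma (in cring) nat_ring_add: "[(m + n :: nat)] \<cdot> \<one> = [m] \<cdot> \<one> \<oplus> [n] \<cdot> \<one>"
  using add.nat_pow_mult[of \<one> m n] by simp

lemma (in cring) binomial:
  assumes a: "a \<in> carrier R" and b: "b \<in> carrier R"
  shows "(a \<oplus> b) [^] (n :: nat) = (\<Oplus>k\<in>{..n}. [(n choose k)] \<cdot> \<one> \<otimes> (a [^] k \<otimes> b [^] (n - k)))"
proof (induction n)
  case 0
  then show ?case using a b by simp
next
  case (Suc n)
  define c where "c = (\<lambda>m k. [(m choose k)] \<cdot> \<one>)"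
  have c: "c m k \<in> carrier R" for m k by (simp add: c_def)
  have c0: "c m 0 = \<one>" "k > m \<Longrightarrow> c m k = \<zero>" "c (Suc m) (Suc k) = c m k \<oplus> c m (Suc k)" for m k
    by (simp_all add: c_def binomial_eq_0 nat_ring_add)
  define t where "t = (\<lambda>m k. c m k \<otimes> (a [^] k \<otimes> b [^] (m - k)))"
  define u where "u = (\<lambda>k. c n k \<otimes> (a [^] Suc k \<otimes> b [^] (n - k)))"
  define v where "v = (\<lambda>k. c n k \<otimes> (a [^] k \<otimes> b [^] (Suc n - k)))"
  have cl: "t m k \<in> carrier R" "u k \<in> carrier R" "v k \<in> carrier R" for m k
    using a b c by (simp_all add: t_def u_def v_def)
  have sc: "(\<Oplus>k\<in>{..n}. u k) \<in> carrier R" "(\<Oplus>k\<in>{..n}. v (Suc k)) \<in> carrier R"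
    "(\<Oplus>k\<in>{..n}. v k) \<in> carrier R" "(\<Oplus>k\<in>{..n}. t n k) \<in> carrier R"
    by (rule finsum_closed; use cl in auto)+
  have A: "(\<Oplus>k\<in>{..n}. t n k) \<otimes> a = (\<Oplus>k\<in>{..n}. u k)"
  proof -
    have "(\<Oplus>k\<in>{..n}. t n k) \<otimes> a = (\<Oplus>k\<in>{..n}. t n k \<otimes> a)"
      by (rule finsum_ldistr) (use cl a in auto)
    also have "\<dots> = (\<Oplus>k\<in>{..n}. u k)"
    proof (rule finsum_cong_closed)
      show "t n k \<otimes> a = u k" for k using a b c by (simp add: t_def u_def m_ac)
    qed (rule cl)
    finally show ?thesis .
  qed
  have B: "(\<Oplus>k\<in>{..n}. t n k) \<otimes> b = (\<Oplus>k\<in>{..n}. v k)"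
  proof -
    have "(\<Oplus>k\<in>{..n}. t n k) \<otimes> b = (\<Oplus>k\<in>{..n}. t n k \<otimes> b)"
      by (rule finsum_ldistr) (use cl b in auto)
    also have "\<dots> = (\<Oplus>k\<in>{..n}. v k)"
    proof (rule finsum_cong_closed)
      show "t n k \<otimes> b = v k" if "k \<in> {..n}" for k
        using that a b c by (simp add: t_def v_def m_ac Suc_diff_le)
    qed (rule cl)
    finally show ?thesis .
  qed
  have V: "(\<Oplus>k\<in>{..n}. v k) = (\<Oplus>k\<in>{..n}. v (Suc k)) \<oplus> v 0"
  proof -
    have "(\<Oplus>k\<in>{..Suc n}. v k) = v (Suc n) \<oplus> (\<Oplus>k\<in>{..n}. v k)"
      by (rule finsum_Suc) (use cl in auto)
    moreover have "v (Suc n) = \<zero>" using a b c0(2)[of n "Suc n"] by (simp add: v_def)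
    moreover have "(\<Oplus>k\<in>{..Suc n}. v k) = (\<Oplus>k\<in>{..n}. v (Suc k)) \<oplus> v 0"
      by (rule finsum_Suc2) (use cl in auto)
    ultimately show ?thesis using sc by simp
  qed
  have "(\<Oplus>k\<in>{..Suc n}. t (Suc n) k) = (\<Oplus>k\<in>{..n}. t (Suc n) (Suc k)) \<oplus> t (Suc n) 0"
    by (rule finsum_Suc2) (use cl in auto)
  also have "(\<Oplus>k\<in>{..n}. t (Suc n) (Suc k)) = (\<Oplus>k\<in>{..n}. u k \<oplus> v (Suc k))"
  proof (rule finsum_cong_closed)
    show "t (Suc n) (Suc k) = u k \<oplus> v (Suc k)" for k
      using a b c unfolding t_def u_def v_def c0(3) by (simp add: l_distr)
  qed (use cl in auto)
  also have "\<dots> = (\<Oplus>k\<in>{..n}. u k) \<oplus> (\<Oplus>k\<in>{..n}. v (Suc k))"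
    by (rule finsum_addf) (use cl in auto)
  also have "t (Suc n) 0 = v 0" by (simp add: t_def v_def c0(1))
  also have "(\<Oplus>k\<in>{..n}. u k) \<oplus> (\<Oplus>k\<in>{..n}. v (Suc k)) \<oplus> v 0 = (\<Oplus>k\<in>{..n}. u k) \<oplus> ((\<Oplus>k\<in>{..n}. v (Suc k)) \<oplus> v 0)"
    by (rule a_assoc) (use sc cl in auto)
  also have "\<dots> = (\<Oplus>k\<in>{..n}. t n k) \<otimes> a \<oplus> (\<Oplus>k\<in>{..n}. t n k) \<otimes> b"
    unfolding A B V ..
  also have "\<dots> = (\<Oplus>k\<in>{..n}. t n k) \<otimes> (a \<oplus> b)"
    by (rule r_distr[symmetric]) (use a b sc in auto)
  also have "\<dots> = (a \<oplus> b) [^] Suc n" using Suc by (simp add: t_def c_def)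
  finally show ?case by (simp only: t_def c_def)
qed

lemma (in cring) frobenius_add:
  assumes a: "a \<in> carrier R" and b: "b \<in> carrier R"
    and p: "normalization_semidom_class.prime (p :: nat)" and char: "[p] \<cdot> \<one> = \<zero>"
  shows "(a \<oplus> b) [^] (p ^ e) = a [^] (p ^ e) \<oplus> b [^] (p ^ e)"
proof (induction e)
  case 0
  then show ?case using a b by simp
next
  case (Suc e)
  have add: "(x \<oplus> y) [^] p = x [^] p \<oplus> y [^] p" if x: "x \<in> carrier R" and y: "y \<in> carrier R" for x y
  proof -
    let ?t = "\<lambda>k. [(p choose k)] \<cdot> \<one> \<otimes> (x [^] k \<otimes> y [^] (p - k))"
    have p0: "0 < p" using p by (rule prime_gt_0_nat)
    have cl: "?t k \<in> carrier R" for k using x y by simp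
    have zero: "?t k = \<zero>" if k: "k \<in> {..p} - {0, p}" for k
    proof -
      have "p dvd (p choose k)" by (rule dvd_choose_prime) (use k p p0 in auto)
      then obtain c where c: "p choose k = p * c" by (auto simp: dvd_def)
      have "[(p * c)] \<cdot> \<one> = [c] \<cdot> ([p] \<cdot> \<one>)" using add.nat_pow_pow[of \<one> c p] by (simp add: mult.commute)
      then show ?thesis unfolding c using char x y by simp
    qed
    have "(x \<oplus> y) [^] p = (\<Oplus>k\<in>{..p}. ?t k)" by (rule binomial[OF x y])
    also have "\<dots> = (\<Oplus>k\<in>{0, p}. ?t k)"
      by (rule finsum_mono_neutral) (use zero cl in auto)
    also have "\<dots> = ?t 0 \<oplus> ?t p"
      using p0 x y by (subst finsum_insert) auto
    also have "\<dots> = x [^] p \<oplus> y [^] p" using x y by (simp add: a_comm)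
    finally show ?thesis .
  qed
  have pe: "z [^] (p ^ Suc e) = (z [^] (p ^ e)) [^] p" if "z \<in> carrier R" for z
    using that by (simp add: nat_pow_pow mult.commute)
  have "(a \<oplus> b) [^] (p ^ Suc e) = (a [^] (p ^ e) \<oplus> b [^] (p ^ e)) [^] p"
    using pe[of "a \<oplus> b"] Suc a b by simp
  also have "\<dots> = a [^] (p ^ Suc e) \<oplus> b [^] (p ^ Suc e)"
    using add[of "a [^] (p ^ e)" "b [^] (p ^ e)"] a b pe by simp
  finally show ?case .
qed

lemma (in cring) frobenius_finsum:
  assumes p: "normalization_semidom_class.prime (p :: nat)" and char: "[p] \<cdot> \<one> = \<zero>"
    and "finite A" "\<And>i. i \<in> A \<Longrightarrow> f i \<in> carrier R"
  shows "(finsum R f A) [^] (p ^ e) = (\<Oplus>i\<in>A. f i [^] (p ^ e))"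
  using assms(3,4)
proof (induction A rule: finite_induct)
  case empty
  have "p ^ e > 0" using p prime_gt_0_nat by simp
  then show ?case by (simp add: nat_pow_zero)
next
  case (insert x F)
  have "(finsum R f (insert x F)) [^] (p ^ e) = (f x \<oplus> finsum R f F) [^] (p ^ e)"
    using insert by simp
  also have "\<dots> = f x [^] (p ^ e) \<oplus> (finsum R f F) [^] (p ^ e)"
    by (rule frobenius_add[OF _ _ p char]) (use insert in auto)
  also have "\<dots> = (\<Oplus>i\<in>insert x F. f i [^] (p ^ e))" using insert by simp
  finally show ?case .
qed

text \<open>A root of X^n - a; coefficient lists start with the leading coefficient.\<close>

lemma (in algebraically_closed) exists_nth_root:
  assumes a: "a \<in> carrier L" and n: "n > 0"
  shows "\<exists>x\<in>carrier L. x [^] (n :: nat) = a"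
proof -
  define P where "P = \<one> # replicate (n - 1) \<zero> @ [\<ominus> a]"
  have "polynomial (carrier L) P" using a by (auto simp: P_def polynomial_def)
  then have P: "P \<in> carrier (poly_ring L)" by (simp add: univ_poly_carrier)
  have "size (roots P) = length P - 1" using roots_over_carrier[OF P] by (simp add: splitted_def)
  also have "length P - 1 = n" using n by (simp add: P_def)
  finally have "roots P \<noteq> {#}" using n by auto
  then obtain x where "x \<in># roots P" by (meson multiset_nonemptyE)
  then have x: "x \<in> carrier L" "eval P x = \<zero>"
    using roots_mem_iff_is_root[OF P] by (auto simp: is_root_def)
  have "eval (replicate k \<zero> @ [\<ominus> a]) x = \<ominus> a" for k
    by (induction k) (use a x in auto)
  then have "eval P x = x [^] n \<oplus> \<ominus> a" using n x by (simp add: P_def)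
  then have "x [^] n = a" using x a by (metis minus_equality minus_minus nat_pow_closed a_inv_closed)
  then show ?thesis using x by blast
qed

section \<open>Series modules of cones, and the Frobenius map on series\<close>

locale perfect_hypersurface = hypersurface K d r
  for K :: "'k ring" (structure) and d r +
  fixes p :: nat
  assumes alg_closed: "algebraically_closed K"
    and p_prime: "normalization_semidom_class.prime p"
    and char_p: "[p] \<cdot> \<one> = \<zero>"
begin

definition Ser :: "(nat \<Rightarrow> int) \<Rightarrow> (int poly \<Rightarrow> 'k, int poly \<Rightarrow> 'k) module" where
  "Ser c = \<lparr>carrier = {f \<in> L.LC. \<forall>h. f h \<noteq> \<zero> \<longrightarrow> h \<in> Cone c}, monoid.mult = undefined, one = undefined,
     ring.zero = (\<lambda>_. \<zero>), add = (\<lambda>f g h. f h \<oplus> g h), module.smult = conv K\<rparr>"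

lemma Ser_simps [simp]:
  "ring.zero (Ser c) = (\<lambda>_. \<zero>)" "add (Ser c) = (\<lambda>f g h. f h \<oplus> g h)" "module.smult (Ser c) = conv K"
  by (simp_all add: Ser_def)

lemma Ser_memD: "f \<in> carrier (Ser c) \<Longrightarrow> f \<in> L.LC" "f \<in> carrier (Ser c) \<Longrightarrow> f h \<noteq> \<zero> \<Longrightarrow> h \<in> Cone c"
  by (auto simp: Ser_def)

lemma Ser_memI: "f \<in> L.LC \<Longrightarrow> (\<And>h. f h \<noteq> \<zero> \<Longrightarrow> h \<in> Cone c) \<Longrightarrow> f \<in> carrier (Ser c)"
  by (auto simp: Ser_def)

lemma Ser_conv:
  assumes "a \<in> carrier QQ" "f \<in> carrier (Ser c)"
  shows "conv K a f \<in> carrier (Ser c)"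
proof (rule Ser_memI)
  show "conv K a f \<in> L.LC" using QQ_LC[OF assms(1)] Ser_memD(1)[OF assms(2)] by simp
  show "h \<in> Cone c" if "conv K a f h \<noteq> \<zero>" for h
    by (rule conv_supp[OF QQ_supp[OF assms(1)] Ser_memD(2)[OF assms(2)] that])
qed

lemma Ser_add:
  assumes "f \<in> carrier (Ser c)" "g \<in> carrier (Ser c)"
  shows "(\<lambda>h. f h \<oplus> g h) \<in> carrier (Ser c)"
proof (rule Ser_memI)
  show "(\<lambda>h. f h \<oplus> g h) \<in> L.LC" using Ser_memD(1) assms by simp
  show "h \<in> Cone c" if "f h \<oplus> g h \<noteq> \<zero>" for h
  proof (rule ccontr)
    assume "h \<notin> Cone c"
    then have "f h = \<zero>" "g h = \<zero>" using Ser_memD(2) assms by blast+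
    then show False using that by simp
  qed
qed

lemma Ser_module: "module QQ (Ser c)"
proof (rule moduleI)
  show "cring QQ" by (rule QQ_cring)
  show "abelian_group (Ser c)"
  proof (rule abelian_groupI)
    fix x assume x: "x \<in> carrier (Ser c)"
    have "(\<lambda>h. \<ominus> x h) \<in> carrier (Ser c)"
    proof (rule Ser_memI)
      show "(\<lambda>h. \<ominus> x h) \<in> L.LC" using Ser_memD(1)[OF x] by simp
      show "h \<in> Cone c" if "\<ominus> x h \<noteq> \<zero>" for h
        using Ser_memD(2)[OF x, of h] that by (metis minus_zero)
    qed
    then show "\<exists>y\<in>carrier (Ser c). y \<oplus>\<^bsub>Ser c\<^esub> x = \<zero>\<^bsub>Ser c\<^esub>"
      using Ser_memD(1)[OF x] by (intro bexI[of _ "\<lambda>h. \<ominus> x h"]) (simp_all add: l_neg)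
  next
    show "\<zero>\<^bsub>Ser c\<^esub> \<in> carrier (Ser c)" by (rule Ser_memI) auto
  next
    fix x y assume "x \<in> carrier (Ser c)" "y \<in> carrier (Ser c)"
    then show "x \<oplus>\<^bsub>Ser c\<^esub> y \<in> carrier (Ser c)" using Ser_add by simp
  qed (auto dest!: Ser_memD(1) simp: a_ac)
next
  fix a x assume "a \<in> carrier QQ" "x \<in> carrier (Ser c)"
  then show "a \<odot>\<^bsub>Ser c\<^esub> x \<in> carrier (Ser c)" using Ser_conv by simp
next
  fix a b x assume *: "a \<in> carrier QQ" "b \<in> carrier QQ" "x \<in> carrier (Ser c)"
  note L = QQ_LC[OF *(1)] QQ_LC[OF *(2)] Ser_memD(1)[OF *(3)]
  show "(a \<oplus>\<^bsub>QQ\<^esub> b) \<odot>\<^bsub>Ser c\<^esub> x = a \<odot>\<^bsub>Ser c\<^esub> x \<oplus>\<^bsub>Ser c\<^esub> b \<odot>\<^bsub>Ser c\<^esub> x"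
    using L.conv_add_left[OF L] by simp
  show "(a \<otimes>\<^bsub>QQ\<^esub> b) \<odot>\<^bsub>Ser c\<^esub> x = a \<odot>\<^bsub>Ser c\<^esub> (b \<odot>\<^bsub>Ser c\<^esub> x)"
    using L.conv_assoc[OF L] by simp
next
  fix a x y assume *: "a \<in> carrier QQ" "x \<in> carrier (Ser c)" "y \<in> carrier (Ser c)"
  show "a \<odot>\<^bsub>Ser c\<^esub> (x \<oplus>\<^bsub>Ser c\<^esub> y) = a \<odot>\<^bsub>Ser c\<^esub> x \<oplus>\<^bsub>Ser c\<^esub> a \<odot>\<^bsub>Ser c\<^esub> y"
    using LR.r_distr[of x y a] QQ_LC[OF *(1)] Ser_memD(1)[OF *(2)] Ser_memD(1)[OF *(3)] by simp
next
  fix x assume "x \<in> carrier (Ser c)"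
  then show "\<one>\<^bsub>QQ\<^esub> \<odot>\<^bsub>Ser c\<^esub> x = x" using LR.l_one[of x] Ser_memD(1)[of x] by simp
qed

lemma Ser_lmonom: "h \<in> Cone c \<Longrightarrow> a \<in> carrier K \<Longrightarrow> lmonom K h a \<in> carrier (Ser c)"
  by (rule Ser_memI) (auto simp: lmonom_def[of K h a] intro: L.lmonom_in_LC[of a h, unfolded lmonom_def] split: if_splits)

text \<open>The series is split at u-exponent t, and the two parts are divided by the corner
  monomials of \<open>Cone_shift\<close>.\<close>

lemma Ser_generators:
  assumes c: "\<And>i. i < d \<Longrightarrow> c i \<le> int (r i) * t" "\<And>i. i < d \<Longrightarrow> int (r i) * (t - 1) \<le> c i"
    and f: "f \<in> carrier (Ser c)"
  defines "g\<^sub>1 \<equiv> lmonom K (vec (\<lambda>_. 0) t) \<one>" and "g\<^sub>2 \<equiv> lmonom K (vec (\<lambda>i. c i - int (r i) * (t - 1)) (t - 1)) \<one>"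
  shows "\<exists>a\<in>carrier QQ. \<exists>b\<in>carrier QQ. f = (\<lambda>h. conv K a g\<^sub>1 h \<oplus> conv K b g\<^sub>2 h)"
proof -
  let ?p = "vec (\<lambda>_. 0) t" and ?q = "vec (\<lambda>i. c i - int (r i) * (t - 1)) (t - 1)"
  define a where "a = (\<lambda>h. if t \<le> uu (h + ?p) then f (h + ?p) else \<zero>)"
  define b where "b = (\<lambda>h. if uu (h + ?q) < t then f (h + ?q) else \<zero>)"
  have fL: "f \<in> L.LC" by (rule Ser_memD(1)[OF f])
  have fc: "f h \<in> carrier K" for h using fL by simp
  have a: "a \<in> carrier QQ"
  proof (rule QQ_I)
    show "a h \<in> carrier K" for h using fc by (simp add: a_def)
    show "h \<in> HH" if "a h \<noteq> \<zero>" for h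
    proof -
      have "t \<le> uu (h + ?p)" "h + ?p \<in> Cone c" using that Ser_memD(2)[OF f] by (auto simp: a_def split: if_splits)
      then show ?thesis using Cone_shift(1)[OF c, of "h + ?p"] by simp
    qed
  qed
  have b: "b \<in> carrier QQ"
  proof (rule QQ_I)
    show "b h \<in> carrier K" for h using fc by (simp add: b_def)
    show "h \<in> HH" if "b h \<noteq> \<zero>" for h
    proof -
      have "uu (h + ?q) < t" "h + ?q \<in> Cone c" using that Ser_memD(2)[OF f] by (auto simp: b_def split: if_splits)
      then show ?thesis using Cone_shift(2)[OF c, of "h + ?q"] by simp
    qed
  qed
  have m: "conv K x (lmonom K g \<one>) h = x (h - g)" if x: "x \<in> carrier QQ" for x g h
    using L.conv_comm[OF QQ_LC[OF x] L.lmonom_in_LC[OF one_closed]] L.lmonom_conv[OF one_closed QQ_LC[OF x]] QQ_closed[OF x]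
    by simp
  have "f h = conv K a g\<^sub>1 h \<oplus> conv K b g\<^sub>2 h" for h
    unfolding g\<^sub>1_def g\<^sub>2_def m[OF a] m[OF b] using fc by (simp add: a_def b_def)
  then show ?thesis using a b by (intro bexI[of _ a] bexI[of _ b]) auto
qed

lemma Ser_fg:
  assumes c: "\<And>i. i < d \<Longrightarrow> c i \<le> int (r i) * t" "\<And>i. i < d \<Longrightarrow> int (r i) * (t - 1) \<le> c i"
  shows "fg_module QQ (Ser c)"
proof -
  interpret M: module QQ "Ser c" by (rule Ser_module)
  let ?p = "vec (\<lambda>_. 0) t" and ?q = "vec (\<lambda>i. c i - int (r i) * (t - 1)) (t - 1)"
  let ?G = "{lmonom K ?p \<one>, lmonom K ?q \<one>}"
  have "?p \<in> Cone c" "?q \<in> Cone c" using c by (auto simp: vec_in_Cone)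
  then have G: "?G \<subseteq> carrier (Ser c)" using Ser_lmonom by auto
  have sub: "submodule (mod_span QQ (Ser c) ?G) QQ (Ser c)" by (rule M.span_submodule[OF G])
  have "carrier (Ser c) \<subseteq> mod_span QQ (Ser c) ?G"
  proof
    fix f assume "f \<in> carrier (Ser c)"
    from Ser_generators[OF c this] obtain a b where ab: "a \<in> carrier QQ" "b \<in> carrier QQ"
      "f = (\<lambda>h. conv K a (lmonom K ?p \<one>) h \<oplus> conv K b (lmonom K ?q \<one>) h)" by blast
    have "lmonom K ?p \<one> \<in> mod_span QQ (Ser c) ?G" "lmonom K ?q \<one> \<in> mod_span QQ (Ser c) ?G"
      using mod_span_subset[of ?G QQ "Ser c"] by auto
    then have "conv K a (lmonom K ?p \<one>) \<in> mod_span QQ (Ser c) ?G" "conv K b (lmonom K ?q \<one>) \<in> mod_span QQ (Ser c) ?G"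
      using submoduleD(3)[OF sub ab(1)] submoduleD(3)[OF sub ab(2)] by simp_all
    then show "f \<in> mod_span QQ (Ser c) ?G" unfolding ab(3) using submoduleD(2)[OF sub] by simp
  qed
  then have "mod_span QQ (Ser c) ?G = carrier (Ser c)" using submoduleD(4)[OF sub] by blast
  then show ?thesis unfolding fg_module_def using Ser_module G by (intro conjI exI[of _ ?G]) auto
qed

lemma coeff_scale: "poly.coeff (of_nat n * h :: int poly) i = int n * poly.coeff h i"
  by (simp add: of_nat_poly)

lemma uu_scale: "uu (of_nat n * h) = int n * uu h"
  by (simp add: uu_def coeff_scale right_diff_distrib sum_distrib_left[symmetric])

lemma Grp_scale [simp]: "h \<in> Grp \<Longrightarrow> of_nat n * h \<in> Grp"
  by (simp add: Grp_def coeff_scale)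

lemma lmonom_pow: "a \<in> carrier K \<Longrightarrow> (lmonom K h a) [^]\<^bsub>LL\<^esub> (n :: nat) = lmonom K (of_nat n * h) (a [^] n)"
proof (induction n)
  case (Suc n)
  then show ?case using L.lmonom_lmonom[of "a [^] n" a "of_nat n * h" h]
    by (simp add: algebra_simps)
qed simp

lemma QQ_pow: "x [^]\<^bsub>QQ\<^esub> (n :: nat) = x [^]\<^bsub>LL\<^esub> n"
  by (induction n) simp_all

definition fr :: "nat \<Rightarrow> nat" where "fr k = p ^ k"

lemma fr_pos: "0 < fr k" using p_prime prime_gt_0_nat by (simp add: fr_def)

lemma LL_char: "[p] \<cdot>\<^bsub>LL\<^esub> \<one>\<^bsub>LL\<^esub> = \<zero>\<^bsub>LL\<^esub>"
proof -
  have "[n] \<cdot>\<^bsub>LL\<^esub> \<one>\<^bsub>LL\<^esub> = lmonom K 0 ([n] \<cdot> \<one>)" for n :: nat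
    by (induction n) (auto simp: lmonom_def fun_eq_iff)
  then show ?thesis using char_p by (auto simp: lmonom_def)
qed

text \<open>Additivity of Frobenius covers finite sums only, so the series is cut at a weight N
  above that of the exponent in question. The finite head is raised term by term, and the q-th power
  of the tail still has weight at least N.\<close>

lemma QQ_frobenius:
  assumes a: "a \<in> carrier QQ"
  shows "(a [^]\<^bsub>QQ\<^esub> fr k) (of_nat (fr k) * h) = a h [^] fr k"
    and "(\<And>g. h \<noteq> of_nat (fr k) * g) \<Longrightarrow> (a [^]\<^bsub>QQ\<^esub> fr k) h = \<zero>"
proof -
  let ?q = "fr k"
  have main: "(a [^]\<^bsub>QQ\<^esub> ?q) h = (\<Oplus>g\<in>B. lmonom K (of_nat ?q * g) (a g [^] ?q) h)"
    if B: "B = {g \<in> HH. wt g < N}" and N: "wt h < N" for B N h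
  proof -
    have finB: "finite B" unfolding B by (rule HH_finite)
    define s where "s = (\<lambda>h. if h \<in> B then a h else \<zero>)"
    define t where "t = (\<lambda>h. if h \<in> B then \<zero> else a h)"
    have sQ: "s \<in> carrier QQ" by (rule QQ_I) (use QQ_closed[OF a] QQ_supp[OF a] in \<open>auto simp: s_def split: if_splits\<close>)
    have tQ: "t \<in> carrier QQ" by (rule QQ_I) (use QQ_closed[OF a] QQ_supp[OF a] in \<open>auto simp: t_def split: if_splits\<close>)
    have ast: "a = s \<oplus>\<^bsub>LL\<^esub> t" using QQ_closed[OF a] by (auto simp: s_def t_def)
    have tw: "N \<le> wt h" if "t h \<noteq> \<zero>" for h
      using that QQ_supp[OF a, of h] by (auto simp: t_def B split: if_splits)
    have tpow: "N \<le> wt h" if "(t [^]\<^bsub>LL\<^esub> Suc n) h \<noteq> \<zero>" for n h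
    proof -
      have "t [^]\<^bsub>LL\<^esub> n \<in> carrier QQ" using QR.nat_pow_closed[OF tQ, of n] by (simp add: QQ_pow)
      moreover have "conv K (t [^]\<^bsub>LL\<^esub> n) t h \<noteq> \<zero>" using that by simp
      then obtain x y where "(t [^]\<^bsub>LL\<^esub> n) x \<noteq> \<zero>" "t y \<noteq> \<zero>" "h = x + y" by (rule L.conv_nonzeroE)
      ultimately show ?thesis using tw[of y] QQ_supp HH_bounds(2)[of x] by (auto simp: wt_add)
    qed
    have t0: "(t [^]\<^bsub>LL\<^esub> ?q) h = \<zero>"
    proof -
      obtain n where "?q = Suc n" using fr_pos[of k] by (cases ?q) auto
      then show ?thesis using tpow[of n h] N by (metis not_less)
    qed
    have sfin: "s = finsum LL (\<lambda>g. lmonom K g (a g)) B"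
    proof -
      have "finsum LL (\<lambda>g. lmonom K g (a g)) B = (\<lambda>h. \<Oplus>g\<in>B. lmonom K g (a g) h)"
        by (rule L.laurent_finsum[OF finB]) (use QQ_closed[OF a] in auto)
      also have "\<dots> = s"
      proof
        fix h
        have "(\<Oplus>g\<in>B. lmonom K g (a g) h) = (\<Oplus>g\<in>B. if g = h then a g else \<zero>)"
          by (rule finsum_cong_closed) (use QQ_closed[OF a] in \<open>auto simp: lmonom_def\<close>)
        also have "\<dots> = s h" using finsum_if_point[OF finB, of h a] QQ_closed[OF a] by (simp add: s_def)
        finally show "(\<Oplus>g\<in>B. lmonom K g (a g) h) = s h" .
      qed
      finally show ?thesis ..
    qed
    have "s [^]\<^bsub>LL\<^esub> ?q = finsum LL (\<lambda>g. (lmonom K g (a g)) [^]\<^bsub>LL\<^esub> ?q) B"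
      unfolding sfin fr_def
      by (rule LR.frobenius_finsum[OF p_prime LL_char finB]) (use QQ_closed[OF a] in auto)
    also have "\<dots> = finsum LL (\<lambda>g. lmonom K (of_nat ?q * g) (a g [^] ?q)) B"
      by (rule LR.finsum_cong') (use QQ_closed[OF a] in \<open>auto simp: lmonom_pow\<close>)
    also have "\<dots> = (\<lambda>h. \<Oplus>g\<in>B. lmonom K (of_nat ?q * g) (a g [^] ?q) h)"
      by (rule L.laurent_finsum[OF finB]) (use QQ_closed[OF a] in auto)
    finally have s: "(s [^]\<^bsub>LL\<^esub> ?q) h = (\<Oplus>g\<in>B. lmonom K (of_nat ?q * g) (a g [^] ?q) h)" by simp
    have "a [^]\<^bsub>LL\<^esub> ?q = s [^]\<^bsub>LL\<^esub> ?q \<oplus>\<^bsub>LL\<^esub> t [^]\<^bsub>LL\<^esub> ?q"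
      unfolding ast fr_def
      by (rule LR.frobenius_add[OF _ _ p_prime LL_char]) (use QQ_LC[OF sQ] QQ_LC[OF tQ] in auto)
    then have "(a [^]\<^bsub>LL\<^esub> ?q) h = (s [^]\<^bsub>LL\<^esub> ?q) h"
      using t0 LR.nat_pow_closed[of s ?q] QQ_LC[OF sQ] by simp
    then show ?thesis using s by (simp add: QQ_pow)
  qed
  have q0: "?q \<noteq> 0" using fr_pos[of k] by simp
  show "(a [^]\<^bsub>QQ\<^esub> ?q) (of_nat ?q * h) = a h [^] ?q"
  proof -
    \<comment> \<open>N must exceed the weight of the exponent looked at and also that of
      \<open>h\<close>, so that \<open>h\<close> itself belongs to the head.\<close>
    define N where "N = max (wt h) (wt (of_nat ?q * h)) + 1"
    let ?B = "{g \<in> HH. wt g < N}"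
    have "(a [^]\<^bsub>QQ\<^esub> ?q) (of_nat ?q * h) = (\<Oplus>g\<in>?B. lmonom K (of_nat ?q * g) (a g [^] ?q) (of_nat ?q * h))"
      by (rule main[OF refl]) (simp add: N_def)
    also have "\<dots> = (\<Oplus>g\<in>?B. if g = h then a g [^] ?q else \<zero>)"
      by (rule finsum_cong_closed) (use QQ_closed[OF a] q0 in \<open>auto simp: lmonom_def\<close>)
    also have "\<dots> = (if h \<in> ?B then a h [^] ?q else \<zero>)"
      by (rule finsum_if_point[OF HH_finite]) (use QQ_closed[OF a] in auto)
    also have "\<dots> = a h [^] ?q"
    proof (cases "h \<in> HH")
      case True
      then show ?thesis by (simp add: N_def)
    next
      case False
      then have "a h = \<zero>" using QQ_supp[OF a] by blast
      then show ?thesis using False q0 by (simp add: nat_pow_zero)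
    qed
    finally show ?thesis .
  qed
  show "(a [^]\<^bsub>QQ\<^esub> ?q) h = \<zero>" if "\<And>g. h \<noteq> of_nat ?q * g"
  proof -
    have "(a [^]\<^bsub>QQ\<^esub> ?q) h = (\<Oplus>g\<in>{g \<in> HH. wt g < wt h + 1}. lmonom K (of_nat ?q * g) (a g [^] ?q) h)"
      by (rule main[OF refl]) simp
    also have "\<dots> = \<zero>" by (rule finsum_zero_cong) (use that in \<open>auto simp: lmonom_def\<close>)
    finally show ?thesis .
  qed
qed

definition rt :: "nat \<Rightarrow> 'k \<Rightarrow> 'k" where
  "rt k = inv_into (carrier K) (\<lambda>x. x [^] fr k)"

text \<open>Injective because Frobenius is additive and K has no nilpotents, surjective because K
  contains all q-th roots.\<close>

lemma frobenius_bij: "bij_betw (\<lambda>x. x [^] fr k) (carrier K) (carrier K)"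
proof -
  interpret AC: algebraically_closed K by (rule alg_closed)
  have add: "(x \<oplus> y) [^] fr k = x [^] fr k \<oplus> y [^] fr k" if "x \<in> carrier K" "y \<in> carrier K" for x y
    unfolding fr_def by (rule frobenius_add[OF that p_prime char_p])
  have "inj_on (\<lambda>x. x [^] fr k) (carrier K)"
  proof (rule inj_onI)
    fix x y assume xy: "x \<in> carrier K" "y \<in> carrier K" "x [^] fr k = y [^] fr k"
    have "(x \<ominus> y) [^] fr k \<oplus> y [^] fr k = y [^] fr k"
      using add[of "x \<ominus> y" y] xy by (simp add: minus_eq a_assoc l_neg)
    then have "(x \<ominus> y) [^] fr k = \<zero>" using xy by (metis add.l_cancel_one' add.r_cancel_one' minus_closed nat_pow_closed)
    then have "x \<ominus> y = \<zero>"
    proof -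
      have "z [^] n = \<zero> \<Longrightarrow> z \<in> carrier K \<Longrightarrow> z = \<zero>" for z and n :: nat
        by (induction n) (auto simp: integral_iff)
      then show ?thesis using \<open>(x \<ominus> y) [^] fr k = \<zero>\<close> xy by (meson minus_closed)
    qed
    then show "x = y" using xy by (simp add: r_right_minus_eq)
  qed
  moreover have "(\<lambda>x. x [^] fr k) ` carrier K = carrier K"
    using AC.exists_nth_root[OF _ fr_pos] by (auto simp: image_iff) (metis)
  ultimately show ?thesis by (simp add: bij_betw_def)
qed

lemma rt_closed [simp]: "x \<in> carrier K \<Longrightarrow> rt k x \<in> carrier K"
  unfolding rt_def using bij_betwE[OF bij_betw_inv_into[OF frobenius_bij]] by blast

lemma rt_pow: "x \<in> carrier K \<Longrightarrow> rt k x [^] fr k = x"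
  unfolding rt_def using bij_betw_inv_into_right[OF frobenius_bij] .

lemma pow_rt: "x \<in> carrier K \<Longrightarrow> rt k (x [^] fr k) = x"
  unfolding rt_def using bij_betw_inv_into_left[OF frobenius_bij] .

lemma rt_add: "x \<in> carrier K \<Longrightarrow> y \<in> carrier K \<Longrightarrow> rt k (x \<oplus> y) = rt k x \<oplus> rt k y"
  using pow_rt[of "rt k x \<oplus> rt k y" k] frobenius_add[OF _ _ p_prime char_p, of "rt k x" "rt k y" k]
  by (simp add: rt_pow fr_def[symmetric])

lemma rt_mult: "x \<in> carrier K \<Longrightarrow> y \<in> carrier K \<Longrightarrow> rt k (x \<otimes> y) = rt k x \<otimes> rt k y"
  using pow_rt[of "rt k x \<otimes> rt k y" k] by (simp add: rt_pow nat_pow_distrib)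

lemma rt_zero [simp]: "rt k \<zero> = \<zero>"
  using pow_rt[of \<zero> k] fr_pos[of k] by (simp add: nat_pow_zero)

lemma rt_eq_zero: "x \<in> carrier K \<Longrightarrow> rt k x = \<zero> \<longleftrightarrow> x = \<zero>"
  using rt_pow[of x k] fr_pos[of k] by (metis nat_pow_zero neq0_conv rt_zero)

lemma rt_finsum:
  assumes "finite A" "\<And>i. i \<in> A \<Longrightarrow> f i \<in> carrier K"
  shows "rt k (finsum K f A) = (\<Oplus>i\<in>A. rt k (f i))"
  using assms by (induction A rule: finite_induct) (auto simp: rt_add)

end

section \<open>Finite F-representation type\<close>

definition (in ring_isomorphism) scalars_along :: "('b, 'n) module \<Rightarrow> ('a, 'n) module" where
  "scalars_along N = \<lparr>carrier = carrier N, monoid.mult = monoid.mult N, one = one N, ring.zero = ring.zero N,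
     add = add N, module.smult = (\<lambda>a. module.smult N (\<psi> a))\<rparr>"

lemma (in ring_isomorphism) restrict_scalars:
  assumes N: "module B N"
  shows "module A (scalars_along N)" "semilinear_iso A B \<psi> (scalars_along N) N (\<lambda>x. x)"
proof -
  interpret N: module B N by (rule N)
  let ?M = "scalars_along N"
  have psi: "\<psi> a \<in> carrier B" if "a \<in> carrier A" for a using bij_betwE[OF bij] that by blast
  note h = ring_iso_memE[OF iso]
  have M: "carrier ?M = carrier N" "add ?M = add N" "ring.zero ?M = ring.zero N"
    "module.smult ?M = (\<lambda>a. module.smult N (\<psi> a))" by (simp_all add: scalars_along_def)
  show "module A ?M"
  proof (rule moduleI)
    show "cring A" by (rule A.cring_axioms)
    show "abelian_group ?M"
    proof (rule abelian_groupI)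
      fix x assume "x \<in> carrier ?M"
      then show "\<exists>y\<in>carrier ?M. y \<oplus>\<^bsub>?M\<^esub> x = \<zero>\<^bsub>?M\<^esub>"
        by (intro bexI[of _ "\<ominus>\<^bsub>N\<^esub> x"]) (auto simp: M N.M.l_neg)
    qed (auto simp: M N.M.a_ac)
  qed (use psi h in \<open>auto simp: M N.smult_l_distr N.smult_r_distr N.smult_assoc1\<close>)
  show "semilinear_iso A B \<psi> ?M N (\<lambda>x. x)"
    using bij by (simp add: semilinear_iso_def M bij_betw_def)
qed

text \<open>Brings a module over \<open>B\<close>, of whatever carrier type, to the fixed carrier
  type in which \<open>has_FFRT\<close> and \<open>finite_CM_type\<close> quantify over
  \<open>A\<close>-modules.\<close>

lemma (in ring_isomorphism) fgmod_representative:
  fixes N :: "('b, 'n) module"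
  assumes N: "fg_module B N"
  obtains M :: "'a fgmod" and h where "fg_module A M" "semilinear_iso A B \<psi> M N h"
proof -
  have mN: "module B N" using N by (simp add: fg_module_def)
  let ?M = "scalars_along N"
  note rs = restrict_scalars[OF mN]
  interpret s: semilinear B N A ?M "inv_into (carrier A) \<psi>" "inv_into (carrier ?M) (\<lambda>x. x)"
    by (rule semilinear.inverse)
      (intro semilinear.intro semilinear_axioms.intro rs mN)
  have "fg_module A ?M" by (rule s.fg_image[OF N])
  then obtain M :: "'a fgmod" where M: "fg_module A M" "mod_iso A ?M M"
    using fg_module_representative by blast
  obtain k where k: "semilinear_iso A A (\<lambda>a. a) ?M M k" using M(2) by (auto simp: mod_iso_semilinear)
  have "semilinear_iso A A (inv_into (carrier A) (\<lambda>a. a)) M ?M (inv_into (carrier ?M) k)"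
    by (rule semilinear_iso_sym[OF rs(1) k])
  from semilinear_iso_trans[OF this rs(2)]
  have "semilinear_iso A B (\<lambda>a. \<psi> (inv_into (carrier A) (\<lambda>a. a) a)) M N (inv_into (carrier ?M) k)" .
  then have "semilinear_iso A B \<psi> M N (inv_into (carrier ?M) k)"
    by (rule semilinear_iso_cong) (simp add: inv_into_f_f[of "\<lambda>a. a"])
  then show ?thesis using that M(1) by blast
qed

lemma (in ring_isomorphism) ring_char_eq: "ring_char A = ring_char B"
proof -
  note h = ring_iso_memE[OF iso]
  have z: "\<psi> \<zero>\<^bsub>A\<^esub> = \<zero>\<^bsub>B\<^esub>" using ring_hom_zero[OF _ A.ring_axioms B.ring_axioms] iso by (simp add: ring_iso_def)
  have "\<psi> ([n] \<cdot>\<^bsub>A\<^esub> \<one>\<^bsub>A\<^esub>) = [n] \<cdot>\<^bsub>B\<^esub> \<one>\<^bsub>B\<^esub>" for n :: nat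
    by (induction n) (auto simp: z h)
  then have "[n] \<cdot>\<^bsub>A\<^esub> \<one>\<^bsub>A\<^esub> = \<zero>\<^bsub>A\<^esub> \<longleftrightarrow> [n] \<cdot>\<^bsub>B\<^esub> \<one>\<^bsub>B\<^esub> = \<zero>\<^bsub>B\<^esub>" for n :: nat
    using bij z by (metis A.add.nat_pow_closed A.one_closed A.zero_closed bij_betw_def inj_on_def)
  then have "(\<lambda>n :: nat. [n] \<cdot>\<^bsub>A\<^esub> \<one>\<^bsub>A\<^esub> = \<zero>\<^bsub>A\<^esub>) = (\<lambda>n. [n] \<cdot>\<^bsub>B\<^esub> \<one>\<^bsub>B\<^esub> = \<zero>\<^bsub>B\<^esub>)" by blast
  from fun_cong[OF this] show ?thesis unfolding ring_char_def by (simp only:)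
qed

section \<open>Splitting a series by residues of its exponents\<close>

context perfect_hypersurface
begin

definition Res :: "nat \<Rightarrow> int poly set" where
  "Res k = {c \<in> Grp. (\<forall>i<d. 0 \<le> poly.coeff c i \<and> poly.coeff c i < int (fr k)) \<and> 0 \<le> uu c \<and> uu c < int (fr k)}"

text \<open>The bound c' for which c + q h lies in \<open>HH\<close> exactly when h lies in
  \<open>Cone c'\<close>. The negated floor division is a ceiling.\<close>

definition off :: "nat \<Rightarrow> int poly \<Rightarrow> nat \<Rightarrow> int" where
  "off k c i = (if i < d then - ((poly.coeff c i + int (r i) * uu c) div int (fr k)) else 0)"

text \<open>The component of y in the residue class of c modulo q. Taking q-th roots of the
  coefficients turns the action through q-th powers into the ordinary one.\<close>

definition theta :: "nat \<Rightarrow> int poly \<Rightarrow> (int poly \<Rightarrow> 'k) \<Rightarrow> int poly \<Rightarrow> 'k" where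
  "theta k c y = (\<lambda>h. rt k (y (c + of_nat (fr k) * h)))"

lemma Res_finite: "finite (Res k)"
proof (rule finite_subset)
  let ?q = "int (fr k)"
  show "Res k \<subseteq> (\<lambda>(m, u). vec m u) ` (({..<d} \<rightarrow>\<^sub>E {0..<?q}) \<times> {0..<?q})"
  proof
    fix c assume c: "c \<in> Res k"
    have "vec (restrict (poly.coeff c) {..<d}) (uu c) = vec (poly.coeff c) (uu c)"
      by (rule vec_cong) simp
    also have "\<dots> = c" using c by (simp add: Res_def)
    finally have "c = vec (restrict (poly.coeff c) {..<d}) (uu c)" ..
    moreover have "(restrict (poly.coeff c) {..<d}, uu c) \<in> ({..<d} \<rightarrow>\<^sub>E {0..<?q}) \<times> {0..<?q}"
      using c by (auto simp: Res_def)
    ultimately show "c \<in> (\<lambda>(m, u). vec m u) ` (({..<d} \<rightarrow>\<^sub>E {0..<?q}) \<times> {0..<?q})"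
      by (metis (mono_tags, lifting) case_prod_conv image_eqI)
  qed
  show "finite ((\<lambda>(m, u). vec m u) ` (({..<d} \<rightarrow>\<^sub>E {0..<?q}) \<times> {0..<?q}))"
    by (intro finite_imageI finite_cartesian_product finite_PiE) auto
qed

text \<open>For a residue, 0 <= c_i + r_i k <= (q-1)(r_i+1), so the quotient by q is at most r_i.
  That this bound is independent of q is the finiteness in FFRT.\<close>

lemma off_bounds:
  assumes c: "c \<in> Res k" and i: "i < d"
  shows "- int (r i) \<le> off k c i" "off k c i \<le> 0"
proof -
  let ?q = "int (fr k)" and ?a = "poly.coeff c i + int (r i) * uu c"
  have q: "0 < ?q" using fr_pos by simp
  have "int (r i) * uu c \<le> int (r i) * (?q - 1)" using c by (intro mult_left_mono) (auto simp: Res_def)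
  then have "?a < ?q * (int (r i) + 1)" using c i by (auto simp: Res_def algebra_simps)
  moreover have "0 \<le> ?a" using c i by (auto simp: Res_def)
  moreover have "?q * (?a div ?q) \<le> ?a" using q by (metis mult_div_mod_eq le_add_same_cancel1 pos_mod_sign)
  ultimately have "?q * (?a div ?q) < ?q * (int (r i) + 1)" "0 \<le> ?a div ?q"
    using pos_imp_zdiv_nonneg_iff[OF q, of ?a] by linarith+
  then have "?a div ?q < int (r i) + 1" "0 \<le> ?a div ?q" using q by (simp_all only: mult_less_cancel_left_pos)
  then show "- int (r i) \<le> off k c i" "off k c i \<le> 0" using i by (auto simp: off_def)
qed

text \<open>Coordinates of a residue lie between 0 and q-1 and do not affect the sign conditions on
  h; the second family of inequalities is divided by q and rounded.\<close>

lemma shift_in_HH: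
  assumes c: "c \<in> Res k"
  shows "c + of_nat (fr k) * h \<in> HH \<longleftrightarrow> h \<in> Cone (off k c)"
proof -
  let ?q = "int (fr k)"
  have q: "0 < ?q" using fr_pos by simp
  have Grp: "c + of_nat (fr k) * h \<in> Grp \<longleftrightarrow> h \<in> Grp"
    using c q by (auto simp: Grp_def coeff_scale Res_def)
  have 1: "0 \<le> poly.coeff c i + ?q * x \<longleftrightarrow> 0 \<le> x" if "i < d" for i x
  proof
    assume "0 \<le> poly.coeff c i + ?q * x"
    then have "- ?q < ?q * x" using c that by (auto simp: Res_def)
    then have "?q * (-1) < ?q * x" by simp
    then show "0 \<le> x" using q by (simp only: mult_less_cancel_left_pos)
  next
    assume "0 \<le> x"
    then show "0 \<le> poly.coeff c i + ?q * x" using c that q by (auto simp: Res_def)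
  qed
  have 2: "0 \<le> a + ?q * x \<longleftrightarrow> - (a div ?q) \<le> x" for a x :: int
  proof -
    have "0 \<le> (a + ?q * x) div ?q \<longleftrightarrow> 0 \<le> a + ?q * x" by (rule pos_imp_zdiv_nonneg_iff[OF q])
    then show ?thesis using q by (simp add: algebra_simps) linarith
  qed
  have "0 \<le> poly.coeff (c + of_nat (fr k) * h) i + int (r i) * uu (c + of_nat (fr k) * h) \<longleftrightarrow>
      off k c i \<le> poly.coeff h i + int (r i) * uu h" if "i < d" for i
  proof -
    have "poly.coeff (c + of_nat (fr k) * h) i + int (r i) * uu (c + of_nat (fr k) * h) =
      (poly.coeff c i + int (r i) * uu c) + ?q * (poly.coeff h i + int (r i) * uu h)"
      unfolding uu_add coeff_add coeff_scale uu_scale by (simp add: algebra_simps)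
    then show ?thesis using 2[of "poly.coeff c i + int (r i) * uu c" "poly.coeff h i + int (r i) * uu h"] that
      by (simp only: off_def if_True)
  qed
  moreover have "0 \<le> poly.coeff (c + of_nat (fr k) * h) i \<longleftrightarrow> 0 \<le> poly.coeff h i" if "i < d" for i
    using 1[OF that] by (simp add: coeff_scale)
  ultimately show ?thesis unfolding Cone_def using Grp by auto
qed

lemma Ser_I:
  assumes "\<And>h. f h \<in> carrier K" "\<And>h. f h \<noteq> \<zero> \<Longrightarrow> h \<in> Cone c"
    "\<And>i. i < d \<Longrightarrow> c i \<le> int (r i) * t" "\<And>i. i < d \<Longrightarrow> int (r i) * (t - 1) \<le> c i"
  shows "f \<in> carrier (Ser c)"
proof (rule Ser_memI)
  show "f \<in> L.LC"
  proof (rule L.LCI)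
    show "finite {h. f h \<noteq> \<zero> \<and> wt h \<le> n}" for n
      by (rule finite_subset[OF _ Cone_finite[OF assms(3,4), of n]]) (use assms(2) in auto)
  qed (rule assms(1))
qed (rule assms(2))

lemma theta_closed:
  assumes c: "c \<in> Res k" and y: "y \<in> carrier QQ"
  shows "theta k c y \<in> carrier (Ser (off k c))"
proof (rule Ser_I[where t = 0])
  show "theta k c y h \<in> carrier K" for h using QQ_closed[OF y] by (simp add: theta_def)
  show "h \<in> Cone (off k c)" if "theta k c y h \<noteq> \<zero>" for h
  proof -
    have "y (c + of_nat (fr k) * h) \<noteq> \<zero>" using that by (auto simp: theta_def)
    then show ?thesis using QQ_supp[OF y] shift_in_HH[OF c] by blast
  qed
qed (use off_bounds[OF c] in auto)

lemma theta_add: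
  assumes "y \<in> carrier QQ" "z \<in> carrier QQ"
  shows "theta k c (\<lambda>h. y h \<oplus> z h) = (\<lambda>h. theta k c y h \<oplus> theta k c z h)"
  using QQ_closed assms by (auto simp: theta_def rt_add)

lemma scale_inj: "of_nat (fr k) * g = of_nat (fr k) * (h :: int poly) \<longleftrightarrow> g = h"
  using fr_pos[of k] by simp

text \<open>The q-th power of x is supported on multiples of q, so multiplication by it preserves
  residue classes, and the roots undo the q-th powers of the coefficients of x.\<close>

lemma theta_smult:
  assumes c: "c \<in> Res k" and x: "x \<in> carrier QQ" and y: "y \<in> carrier QQ"
  shows "theta k c (conv K (x [^]\<^bsub>QQ\<^esub> fr k) y) = conv K x (theta k c y)"
proof
  fix h
  let ?q = "of_nat (fr k) :: int poly" and ?X = "x [^]\<^bsub>QQ\<^esub> fr k"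
  have XQ: "?X \<in> carrier QQ" by (rule QR.nat_pow_closed[OF x])
  have tL: "theta k c y \<in> L.LC" by (rule Ser_memD(1)[OF theta_closed[OF c y]])
  have xc: "x g \<in> carrier K" and yc: "y g \<in> carrier K" for g using QQ_closed x y by auto
  define F where "F = {s. x s \<noteq> \<zero> \<and> theta k c y (h - s) \<noteq> \<zero>}"
  have finF: "finite F" unfolding F_def by (rule L.conv_finite[OF QQ_LC[OF x] tL])
  have arg: "c + ?q * h - ?q * g = c + ?q * (h - g)" for g by (simp add: algebra_simps)
  have "conv K ?X y (c + ?q * h) = (\<Oplus>s\<in>(\<lambda>g. ?q * g) ` F. ?X s \<otimes> y (c + ?q * h - s))"
  proof (rule L.conv_eq[OF QQ_LC[OF XQ] QQ_LC[OF y]])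
    show "finite ((\<lambda>g. ?q * g) ` F)" using finF by simp
    fix s assume s: "?X s \<noteq> \<zero>" "y (c + ?q * h - s) \<noteq> \<zero>"
    obtain g where g: "s = ?q * g" using QQ_frobenius(2)[OF x, of s k] s(1) by blast
    have "x g \<noteq> \<zero>"
    proof
      assume "x g = \<zero>"
      then have "?X s = \<zero>" using QQ_frobenius(1)[OF x, of k g] g fr_pos[of k] by (simp add: nat_pow_zero)
      then show False using s(1) by simp
    qed
    moreover have "theta k c y (h - g) \<noteq> \<zero>"
      using s(2) rt_eq_zero[OF yc] unfolding g arg theta_def by blast
    ultimately show "s \<in> (\<lambda>g. ?q * g) ` F" using g by (auto simp: F_def)
  qed
  also have "\<dots> = (\<Oplus>g\<in>F. ?X (?q * g) \<otimes> y (c + ?q * h - ?q * g))"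
  proof (rule finsum_reindex)
    show "inj_on (\<lambda>g. ?q * g) F" using fr_pos[of k] by (intro inj_onI) (simp only: scale_inj)
    show "(\<lambda>s. ?X s \<otimes> y (c + ?q * h - s)) \<in> (\<lambda>g. ?q * g) ` F \<rightarrow> carrier K" using QQ_closed[OF XQ] yc by auto
  qed
  also have "\<dots> = (\<Oplus>g\<in>F. x g [^] fr k \<otimes> y (c + ?q * (h - g)))"
    by (rule finsum_cong_closed) (use xc yc in \<open>auto simp: QQ_frobenius(1)[OF x] arg\<close>)
  finally have eq: "conv K ?X y (c + ?q * h) = (\<Oplus>g\<in>F. x g [^] fr k \<otimes> y (c + ?q * (h - g)))" .
  have "theta k c (conv K ?X y) h = (\<Oplus>g\<in>F. rt k (x g [^] fr k \<otimes> y (c + ?q * (h - g))))"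
    unfolding theta_def eq by (rule rt_finsum[OF finF]) (use xc yc in auto)
  also have "\<dots> = (\<Oplus>g\<in>F. x g \<otimes> theta k c y (h - g))"
    by (rule finsum_cong_closed) (use xc yc in \<open>auto simp: rt_mult pow_rt theta_def\<close>)
  also have "\<dots> = conv K x (theta k c y) h" by (simp add: conv_def F_def)
  finally show "theta k c (conv K ?X y) h = conv K x (theta k c y) h" .
qed

lemma residue_decomposition:
  fixes k :: nat
  assumes h: "h \<in> Grp"
  defines "q \<equiv> int (fr k)"
  defines "c \<equiv> vec (\<lambda>i. poly.coeff h i mod q) (uu h mod q)" and "g \<equiv> vec (\<lambda>i. poly.coeff h i div q) (uu h div q)"
  shows "c \<in> Res k" "h = c + of_nat (fr k) * g"
    and "c' \<in> Res k \<Longrightarrow> h = c' + of_nat (fr k) * g' \<Longrightarrow> c' = c \<and> g' = g"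
proof -
  have q: "0 < q" using fr_pos by (simp add: q_def)
  show cR: "c \<in> Res k" using q by (auto simp: c_def Res_def q_def)
  show eq: "h = c + of_nat (fr k) * g"
    by (rule Grp_eqI) (use h in \<open>auto simp: c_def g_def coeff_scale uu_scale q_def\<close>)
  assume c': "c' \<in> Res k" and h': "h = c' + of_nat (fr k) * g'"
  have "c' = c"
  proof (rule Grp_eqI)
    show "c' \<in> Grp" "c \<in> Grp" using c' cR by (auto simp: Res_def)
    have "poly.coeff h i = poly.coeff c' i + q * poly.coeff g' i" for i
      by (simp add: h' coeff_scale q_def)
    then show "poly.coeff c' i = poly.coeff c i" if "i < d" for i
      using that c' by (auto simp: c_def Res_def q_def)
    have "uu h = uu c' + q * uu g'" by (simp add: h' uu_scale q_def)
    then show "uu c' = uu c" using c' by (auto simp: c_def Res_def q_def)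
  qed
  moreover from this have "of_nat (fr k) * g' = of_nat (fr k) * g" using h' eq by (metis add_left_cancel)
  ultimately show "c' = c \<and> g' = g" using scale_inj by blast
qed

lemma theta_inj:
  assumes y: "y \<in> carrier QQ" and z: "z \<in> carrier QQ" and eq: "\<And>c. c \<in> Res k \<Longrightarrow> theta k c y = theta k c z"
  shows "y = z"
proof
  fix h
  show "y h = z h"
  proof (cases "h \<in> HH")
    case True
    then have "h \<in> Grp" by (rule ConeD)
    from residue_decomposition(1,2)[OF this] obtain c g where c: "c \<in> Res k" "h = c + of_nat (fr k) * g" by blast
    have "rt k (y h) = rt k (z h)" using fun_cong[OF eq[OF c(1)], of g] by (simp add: theta_def c(2))
    then show ?thesis using rt_pow QQ_closed y z by metis
  next
    case False
    then have "y h = \<zero>" "z h = \<zero>" using QQ_supp y z by blast+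
    then show ?thesis by simp
  qed
qed

text \<open>Every exponent of \<open>Grp\<close> belongs to exactly one residue class, so the
  components can be prescribed independently; raising to the q-th power undoes the roots.\<close>

lemma theta_surj:
  assumes z: "\<And>c. c \<in> Res k \<Longrightarrow> z c \<in> carrier (Ser (off k c))"
  shows "\<exists>y\<in>carrier QQ. \<forall>c\<in>Res k. theta k c y = z c"
proof -
  define q where "q = int (fr k)"
  define res where "res = (\<lambda>h. vec (\<lambda>i. poly.coeff h i mod q) (uu h mod q))"
  define qt where "qt = (\<lambda>h. vec (\<lambda>i. poly.coeff h i div q) (uu h div q))"
  have dec: "res h \<in> Res k" "h = res h + of_nat (fr k) * qt h" if "h \<in> Grp" for h
    using residue_decomposition(1,2)[OF that, of k] by (auto simp: res_def qt_def q_def)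
  define y where "y = (\<lambda>h. if h \<in> Grp then z (res h) (qt h) [^] fr k else \<zero>)"
  have zc: "z c g \<in> carrier K" if "c \<in> Res k" for c g using Ser_memD(1)[OF z[OF that]] by simp
  have "y \<in> carrier QQ"
  proof (rule QQ_I)
    show "y h \<in> carrier K" for h using zc dec(1) by (auto simp: y_def)
    show "h \<in> HH" if nz: "y h \<noteq> \<zero>" for h
    proof -
      have h: "h \<in> Grp" using nz by (auto simp: y_def split: if_splits)
      have "z (res h) (qt h) \<noteq> \<zero>"
      proof
        assume "z (res h) (qt h) = \<zero>"
        then have "y h = \<zero>" using h fr_pos[of k] by (simp add: y_def nat_pow_zero)
        then show False using nz by simp
      qed
      then have "qt h \<in> Cone (off k (res h))" using Ser_memD(2)[OF z[OF dec(1)[OF h]]] by blast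
      then have "res h + of_nat (fr k) * qt h \<in> HH" using shift_in_HH[OF dec(1)[OF h]] by blast
      then show ?thesis using dec(2)[OF h] by simp
    qed
  qed
  moreover have "theta k c y = z c" if c: "c \<in> Res k" for c
  proof
    fix g
    show "theta k c y g = z c g"
    proof (cases "g \<in> Grp")
      case True
      let ?h = "c + of_nat (fr k) * g"
      have hG: "?h \<in> Grp" using c True by (auto simp: Res_def)
      have "c = res ?h \<and> g = qt ?h"
        using residue_decomposition(3)[OF hG c refl] by (simp add: res_def qt_def q_def)
      then have "y ?h = z c g [^] fr k" using hG by (simp add: y_def)
      then show ?thesis using pow_rt[OF zc[OF c]] by (simp add: theta_def)
    next
      case False
      have "z c g = \<zero>" using Ser_memD(2)[OF z[OF c], of g] ConeD(1) False by blast
      moreover have "c + of_nat (fr k) * g \<notin> Grp"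
        using False c fr_pos[of k] by (auto simp: Grp_def coeff_scale Res_def)
      ultimately show ?thesis by (simp add: theta_def y_def)
    qed
  qed
  ultimately show ?thesis by blast
qed

text \<open>The summands are the modules \<open>Ser b\<close> for the finitely many integer vectors
  with -r <= b <= 0, and the multiplicity of \<open>Ser b\<close> is the number of residues c with
  \<open>off k c = b\<close>.\<close>

theorem FFRT:
  assumes iso: "ring_isomorphism A QQ \<psi>" and noeth: "noetherian_ring A" and char: "ring_char A = p"
  shows "has_FFRT A"
proof -
  interpret I: ring_isomorphism A QQ \<psi> by (rule iso)
  define BS where "BS = {b :: nat \<Rightarrow> int. (\<forall>i<d. - int (r i) \<le> b i \<and> b i \<le> 0) \<and> (\<forall>i\<ge>d. b i = 0)}"
  have "finite BS"
  proof (rule finite_subset)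
    show "BS \<subseteq> (\<lambda>g i. if i < d then g i else 0) ` ({..<d} \<rightarrow>\<^sub>E {- int (\<Sum>i<d. r i)..0})"
    proof
      fix b assume b: "b \<in> BS"
      have "b i \<ge> - int (\<Sum>i<d. r i)" if "i < d" for i
      proof -
        have "int (r i) \<le> int (\<Sum>i<d. r i)" using that by (intro of_nat_mono member_le_sum) auto
        moreover have "- int (r i) \<le> b i" using b that by (simp add: BS_def)
        ultimately show ?thesis by linarith
      qed
      then have m: "restrict b {..<d} \<in> {..<d} \<rightarrow>\<^sub>E {- int (\<Sum>i<d. r i)..0}" using b by (auto simp: BS_def)
      have e: "b = (\<lambda>i. if i < d then restrict b {..<d} i else 0)" using b by (auto simp: BS_def fun_eq_iff)
      show "b \<in> (\<lambda>g i. if i < d then g i else 0) ` ({..<d} \<rightarrow>\<^sub>E {- int (\<Sum>i<d. r i)..0})"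
        by (rule image_eqI[where x = "restrict b {..<d}"]) (rule e, rule m)
    qed
    show "finite ((\<lambda>g i. if i < d then g i else (0::int)) ` ({..<d} \<rightarrow>\<^sub>E {- int (\<Sum>i<d. r i)..0}))"
      by (intro finite_imageI finite_PiE) auto
  qed
  then obtain \<beta> and s :: nat where bs: "BS = \<beta> ` {i. i < s}" "inj_on \<beta> {i. i < s}"
    using finite_imp_nat_seg_image_inj_on by metis
  have bB: "\<beta> j \<in> BS" if "j < s" for j using bs(1) that by auto
  have "\<exists>M :: 'a fgmod. \<exists>h. fg_module A M \<and> semilinear_iso A QQ \<psi> M (Ser (\<beta> j)) h" if "j < s" for j
  proof -
    have "fg_module QQ (Ser (\<beta> j))"
      by (rule Ser_fg[where t = 0]) (use bB[OF that] in \<open>auto simp: BS_def\<close>)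
    then show ?thesis using I.fgmod_representative by metis
  qed
  then obtain M :: "nat \<Rightarrow> 'a fgmod" and h where M: "\<And>j. j < s \<Longrightarrow> fg_module A (M j)"
    "\<And>j. j < s \<Longrightarrow> semilinear_iso A QQ \<psi> (M j) (Ser (\<beta> j)) (h j)" by metis
  have "\<exists>t :: nat \<Rightarrow> nat. mod_iso A (frobenius_push A k (self_module A))
      (mod_dsum (SIGMA j:{..<s}. {..<t j}) (\<lambda>(j, k). M j))" for k
  proof -
    define cls where "cls = (\<lambda>j. {c \<in> Res k. off k c = \<beta> j})"
    have fincls: "finite (cls j)" for j by (rule finite_subset[OF _ Res_finite[of k]]) (auto simp: cls_def)
    define t where "t = (\<lambda>j. card (cls j))"
    have "\<exists>g. bij_betw g {..<t j} (cls j)" for j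
      using ex_bij_betw_nat_finite[OF fincls[of j]] by (simp add: t_def atLeast0LessThan)
    then obtain g where g: "\<And>j. bij_betw (g j) {..<t j} (cls j)" by metis
    let ?S = "SIGMA j:{..<s}. {..<t j}"
    \<comment> \<open>Numbers the residues by the index set of the direct sum: the first index gives
      the offset, the second counts the residues with that offset.\<close>
    define \<kappa> where "\<kappa> = (\<lambda>q. g (fst q) (snd q))"
    have kX: "\<kappa> q \<in> cls (fst q)" "fst q < s" if "q \<in> ?S" for q
      using that bij_betwE[OF g[of "fst q"]] by (auto simp: \<kappa>_def)
    have kR: "\<kappa> q \<in> Res k" "off k (\<kappa> q) = \<beta> (fst q)" if "q \<in> ?S" for q using kX[OF that] by (auto simp: cls_def)
    have kinj: "q = q'" if "q \<in> ?S" "q' \<in> ?S" "\<kappa> q = \<kappa> q'" for q q'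
    proof -
      have "\<beta> (fst q) = \<beta> (fst q')" using kR(2)[OF that(1)] kR(2)[OF that(2)] that(3) by simp
      then have f: "fst q = fst q'" using bs(2) kX(2) that(1,2) by (auto simp: inj_on_def)
      moreover have "snd q = snd q'"
        using g[of "fst q"] that f by (auto simp: \<kappa>_def bij_betw_def inj_on_def)
      ultimately show ?thesis by (rule prod_eqI)
    qed
    have ksurj: "\<exists>q\<in>?S. \<kappa> q = c" if c: "c \<in> Res k" for c
    proof -
      have "off k c \<in> BS" using off_bounds[OF c] by (auto simp: BS_def) (simp add: off_def)
      then obtain j where j: "j < s" "off k c = \<beta> j" using bs(1) by auto
      then have "c \<in> cls j" using c by (simp add: cls_def)
      then obtain l where "l < t j" "g j l = c" using bij_betw_imp_surj_on[OF g[of j]] by (metis imageE lessThan_iff)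
      then show ?thesis using j by (intro bexI[of _ "(j, l)"]) (auto simp: \<kappa>_def)
    qed
    have modM: "module A (M j)" if "j < s" for j using M(1)[OF that] by (simp add: fg_module_def)
    have sl: "semilinear A (M j) QQ (Ser (\<beta> j)) \<psi> (h j)" if "j < s" for j
      by (intro semilinear.intro semilinear_axioms.intro modM M(2) Ser_module that)
    have psi: "\<psi> a \<in> carrier QQ" if "a \<in> carrier A" for a using bij_betwE[OF I.bij] that by blast
    note hom = ring_iso_memE[OF I.iso]
    let ?iv = "\<lambda>j. inv_into (carrier (M j)) (h j)"
    \<comment> \<open>The decomposition map: the residue components, carried back to the
      representatives over \<open>A\<close>.\<close>
    define F where "F = (\<lambda>x. \<lambda>q\<in>?S. ?iv (fst q) (theta k (\<kappa> q) (\<psi> x)))"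
    have th: "theta k (\<kappa> q) (\<psi> x) \<in> carrier (Ser (\<beta> (fst q)))" if "q \<in> ?S" "x \<in> carrier A" for q x
      using theta_closed[OF kR(1)[OF that(1)] psi[OF that(2)]] kR(2)[OF that(1)] by simp
    let ?D = "mod_dsum ?S (\<lambda>(j, k). M j)"
    have D: "carrier ?D = (\<Pi>\<^sub>E q\<in>?S. carrier (M (fst q)))"
      "x \<oplus>\<^bsub>?D\<^esub> y = (\<lambda>q\<in>?S. x q \<oplus>\<^bsub>M (fst q)\<^esub> y q)" "a \<odot>\<^bsub>?D\<^esub> x = (\<lambda>q\<in>?S. a \<odot>\<^bsub>M (fst q)\<^esub> x q)" for x y a
      by (simp_all add: mod_dsum_def case_prod_beta)
    have ivc: "?iv j z \<in> carrier (M j)" "h j (?iv j z) = z" if "j < s" "z \<in> carrier (Ser (\<beta> j))" for j z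
      using semilinear.h_closed[OF semilinear.inverse[OF sl[OF that(1)]] that(2)] semilinear.h_inv[OF sl[OF that(1)] that(2)] by auto
    have "bij_betw F (carrier A) (carrier ?D)"
      unfolding bij_betw_def
    proof (intro conjI inj_onI equalityI subsetI)
      fix x y assume xy: "x \<in> carrier A" "y \<in> carrier A" and eq: "F x = F y"
      have "theta k c (\<psi> x) = theta k c (\<psi> y)" if c: "c \<in> Res k" for c
      proof -
        obtain q where q: "q \<in> ?S" "\<kappa> q = c" using ksurj[OF c] by blast
        have "?iv (fst q) (theta k c (\<psi> x)) = ?iv (fst q) (theta k c (\<psi> y))"
          using fun_cong[OF eq, of q] q by (simp add: F_def)
        then show ?thesis
          using ivc(2)[OF kX(2)[OF q(1)] th[OF q(1) xy(1)]] ivc(2)[OF kX(2)[OF q(1)] th[OF q(1) xy(2)]] q(2) by metis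
      qed
      then have "\<psi> x = \<psi> y" by (rule theta_inj[OF psi[OF xy(1)] psi[OF xy(2)]])
      then show "x = y" using I.bij xy by (auto simp: bij_betw_def inj_on_def)
    next
      fix w assume "w \<in> F ` carrier A"
      then obtain x where x: "x \<in> carrier A" "w = F x" by blast
      show "w \<in> carrier ?D" unfolding D(1) x(2) F_def using ivc(1)[OF kX(2) th] x(1) by auto
    next
      fix w assume w: "w \<in> carrier ?D"
      \<comment> \<open>\<open>THE\<close> inverts the numbering \<kappa>, which is injective on the
        index set.\<close>
      define z where "z = (\<lambda>c. h (fst (THE q. q \<in> ?S \<and> \<kappa> q = c)) (w (THE q. q \<in> ?S \<and> \<kappa> q = c)))"
      have zk: "z (\<kappa> q) = h (fst q) (w q)" if "q \<in> ?S" for q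
      proof -
        have "(THE q'. q' \<in> ?S \<and> \<kappa> q' = \<kappa> q) = q" using kinj that by (intro the_equality) auto
        then show ?thesis by (simp add: z_def)
      qed
      have wq: "w q \<in> carrier (M (fst q))" if "q \<in> ?S" for q using w that unfolding D(1) by (rule PiE_mem)
      have "z c \<in> carrier (Ser (off k c))" if c: "c \<in> Res k" for c
      proof -
        obtain q where q: "q \<in> ?S" "\<kappa> q = c" using ksurj[OF c] by blast
        show ?thesis using zk[OF q(1)] semilinear.h_closed[OF sl[OF kX(2)[OF q(1)]] wq[OF q(1)]] kR(2)[OF q(1)] q(2) by simp
      qed
      from theta_surj[OF this] obtain y where y: "y \<in> carrier QQ" "\<And>c. c \<in> Res k \<Longrightarrow> theta k c y = z c" by blast
      obtain x where x: "x \<in> carrier A" "\<psi> x = y" using bij_betw_imp_surj_on[OF I.bij] y(1) by (metis imageE)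
      have "F x = w"
      proof (rule PiE_ext[of _ ?S "\<lambda>q. carrier (M (fst q))"])
        show "F x \<in> (\<Pi>\<^sub>E q\<in>?S. carrier (M (fst q)))" unfolding F_def using ivc(1)[OF kX(2) th] x(1) by auto
        show "w \<in> (\<Pi>\<^sub>E q\<in>?S. carrier (M (fst q)))" using w unfolding D(1) .
        fix q assume q: "q \<in> ?S"
        show "F x q = w q"
          using q y(2)[OF kR(1)[OF q]] zk[OF q] semilinear.inv_h[OF sl[OF kX(2)[OF q]] wq[OF q]]
          by (simp add: F_def x(2))
      qed
      then show "w \<in> F ` carrier A" using x(1) by blast
    qed
    moreover have "F (x \<oplus>\<^bsub>A\<^esub> y) = F x \<oplus>\<^bsub>?D\<^esub> F y" if xy: "x \<in> carrier A" "y \<in> carrier A" for x y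
      unfolding D(2)
    proof (rule ext)
      fix q
      show "F (x \<oplus>\<^bsub>A\<^esub> y) q = (\<lambda>q\<in>?S. F x q \<oplus>\<^bsub>M (fst q)\<^esub> F y q) q"
      proof (cases "q \<in> ?S")
        case True
        have "theta k (\<kappa> q) (\<psi> (x \<oplus>\<^bsub>A\<^esub> y)) = theta k (\<kappa> q) (\<psi> x) \<oplus>\<^bsub>Ser (\<beta> (fst q))\<^esub> theta k (\<kappa> q) (\<psi> y)"
          using hom(3)[OF xy] theta_add[OF psi[OF xy(1)] psi[OF xy(2)]] by simp
        then show ?thesis
          using True semilinear.h_add[OF semilinear.inverse[OF sl[OF kX(2)[OF True]]] th[OF True xy(1)] th[OF True xy(2)]]
          by (simp add: F_def)
      qed (simp add: F_def)
    qed
    moreover have "F ((a [^]\<^bsub>A\<^esub> fr k) \<otimes>\<^bsub>A\<^esub> x) = a \<odot>\<^bsub>?D\<^esub> F x" if ax: "a \<in> carrier A" "x \<in> carrier A" for a x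
      unfolding D(3)
    proof (rule ext)
      fix q
      show "F ((a [^]\<^bsub>A\<^esub> fr k) \<otimes>\<^bsub>A\<^esub> x) q = (\<lambda>q\<in>?S. a \<odot>\<^bsub>M (fst q)\<^esub> F x q) q"
      proof (cases "q \<in> ?S")
        case True
        have pw: "\<psi> (a [^]\<^bsub>A\<^esub> n) = \<psi> a [^]\<^bsub>QQ\<^esub> n" for n :: nat
          by (induction n) (use ax hom in auto)
        have "theta k (\<kappa> q) (\<psi> ((a [^]\<^bsub>A\<^esub> fr k) \<otimes>\<^bsub>A\<^esub> x)) = \<psi> a \<odot>\<^bsub>Ser (\<beta> (fst q))\<^esub> theta k (\<kappa> q) (\<psi> x)"
          using hom(2)[OF I.A.nat_pow_closed[OF ax(1)] ax(2), of "fr k"] pw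
            theta_smult[OF kR(1)[OF True] psi[OF ax(1)] psi[OF ax(2)]] by simp
        then show ?thesis
          using True semilinear.h_smult[OF semilinear.inverse[OF sl[OF kX(2)[OF True]]] psi[OF ax(1)] th[OF True ax(2)]]
            bij_betw_inv_into_left[OF I.bij ax(1)]
          by (simp add: F_def)
      qed (simp add: F_def)
    qed
    ultimately have "mod_iso A (frobenius_push A k (self_module A)) ?D"
      unfolding mod_iso_def
      by (intro exI[of _ F]) (simp add: frobenius_push_def self_module_def char fr_def)
    then show ?thesis by blast
  qed
  then show ?thesis
    unfolding has_FFRT_def using I.A.cring_axioms noeth p_prime M(1) char by blast
qed

end

section \<open>Depth of the cone modules\<close>

context perfect_hypersurface
begin

abbreviation ev\<^sub>u :: "int poly" where "ev\<^sub>u \<equiv> vec (\<lambda>_. 0) 1"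
abbreviation ev\<^sub>v :: "int poly" where "ev\<^sub>v \<equiv> vec (\<lambda>i. int (r i)) (- 1)"
abbreviation ex :: "nat \<Rightarrow> int poly" where "ex l \<equiv> vec (\<lambda>i. if i = l then 1 else 0) 0"

abbreviation xm :: "nat \<Rightarrow> int poly \<Rightarrow> 'k" where "xm l \<equiv> lmonom K (ex l) \<one>"
abbreviation um :: "int poly \<Rightarrow> 'k" where "um \<equiv> lmonom K ev\<^sub>u \<one>"
abbreviation vm :: "int poly \<Rightarrow> 'k" where "vm \<equiv> lmonom K ev\<^sub>v \<one>"

lemma unit_exponents: "ev\<^sub>u \<in> HH" "ev\<^sub>v \<in> HH" "ex l \<in> HH"
  by (auto simp: vec_in_Cone)

lemma xm_uv_QQ: "xm l \<in> carrier QQ" "um \<in> carrier QQ" "vm \<in> carrier QQ"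
  by (rule lmonom_QQ[OF _ one_closed], rule unit_exponents)+

lemma one_lmonom_conv: "f \<in> L.LC \<Longrightarrow> conv K (lmonom K g \<one>) f = (\<lambda>h. f (h - g))"
  using L.lmonom_conv[OF one_closed, of f g] by (simp add: fun_eq_iff)

lemma Cone_diff_ex:
  assumes h: "h \<in> Cone c" and l: "l < d"
  shows "h - ex l \<in> Cone c \<longleftrightarrow> 1 \<le> poly.coeff h l \<and> c l + 1 \<le> poly.coeff h l + int (r l) * uu h"
proof
  assume "h - ex l \<in> Cone c"
  from ConeD(2,3)[OF this l] show "1 \<le> poly.coeff h l \<and> c l + 1 \<le> poly.coeff h l + int (r l) * uu h" using l by simp
next
  assume *: "1 \<le> poly.coeff h l \<and> c l + 1 \<le> poly.coeff h l + int (r l) * uu h"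
  have "0 \<le> poly.coeff (h - ex l) i \<and> c i \<le> poly.coeff (h - ex l) i + int (r i) * uu (h - ex l)" if i: "i < d" for i
    using ConeD(2,3)[OF h i] * i by (cases "i = l") auto
  then show "h - ex l \<in> Cone c" using ConeD(1)[OF h] by (simp add: Cone_def)
qed

text \<open>Coefficientwise description of (x_0,...,x_(i-1)) times \<open>Ser c\<close>: every
  exponent can be lowered in one of the first i variables without leaving the cone.\<close>

definition Sub :: "(nat \<Rightarrow> int) \<Rightarrow> nat \<Rightarrow> (int poly \<Rightarrow> 'k) set" where
  "Sub c i = {f \<in> carrier (Ser c). \<forall>h. f h \<noteq> \<zero> \<longrightarrow> (\<exists>l<i. h - ex l \<in> Cone c)}"

lemma Sub_submodule: "submodule (Sub c i) QQ (Ser c)"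
proof (rule module.submoduleI'[OF Ser_module])
  show "\<zero>\<^bsub>Ser c\<^esub> \<in> Sub c i" using submoduleD(1)[OF module.carrier_is_submodule[OF Ser_module]] by (simp add: Sub_def)
next
  fix f g assume f: "f \<in> Sub c i" and g: "g \<in> Sub c i"
  have "\<exists>l<i. h - ex l \<in> Cone c" if "f h \<oplus> g h \<noteq> \<zero>" for h
  proof -
    have "f h \<noteq> \<zero> \<or> g h \<noteq> \<zero>" using that by auto
    then show ?thesis using f g by (auto simp: Sub_def)
  qed
  then show "f \<oplus>\<^bsub>Ser c\<^esub> g \<in> Sub c i" using f g Ser_add[of f c g] by (simp add: Sub_def)
next
  fix a f assume a: "a \<in> carrier QQ" and f: "f \<in> Sub c i"
  have "\<exists>l<i. h - ex l \<in> Cone c" if nz: "conv K a f h \<noteq> \<zero>" for h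
  proof -
    obtain x y where xy: "a x \<noteq> \<zero>" "f y \<noteq> \<zero>" "h = x + y" using nz by (rule L.conv_nonzeroE)
    obtain l where l: "l < i" "y - ex l \<in> Cone c" using f xy(2) by (auto simp: Sub_def)
    have "x + (y - ex l) \<in> Cone c" by (rule Cone_add[OF QQ_supp[OF a xy(1)] l(2)])
    then show ?thesis using l(1) xy(3) by (intro exI[of _ l]) (simp add: algebra_simps)
  qed
  then show "a \<odot>\<^bsub>Ser c\<^esub> f \<in> Sub c i" using f Ser_conv[OF a, of f c] by (simp add: Sub_def)
qed (auto simp: Sub_def)

text \<open>For the harder inclusion the terms divisible by the last variable are peeled off as a
  multiple of it; what remains has only exponents that can be lowered in an earlier
  variable.\<close>

lemma seq_submodule_Ser:
  assumes "i \<le> d"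
  shows "seq_submodule QQ (Ser c) (map xm [0..<i]) = Sub c i"
proof
  interpret M: module QQ "Ser c" by (rule Ser_module)
  have sx: "set (map xm [0..<j]) \<subseteq> carrier QQ" for j using xm_uv_QQ(1) by auto
  show "seq_submodule QQ (Ser c) (map xm [0..<i]) \<subseteq> Sub c i"
  proof (rule M.seq_submodule_le[OF Sub_submodule])
    fix x m assume "x \<in> set (map xm [0..<i])" and m: "m \<in> carrier (Ser c)"
    then obtain l where l: "l < i" "x = xm l" by auto
    have "conv K x m \<in> carrier (Ser c)" using Ser_conv[OF xm_uv_QQ(1) m] l(2) by simp
    moreover have "conv K x m h = m (h - ex l)" for h using one_lmonom_conv[OF Ser_memD(1)[OF m]] l(2) by simp
    ultimately show "x \<odot>\<^bsub>Ser c\<^esub> m \<in> Sub c i" using Ser_memD(2)[OF m] l(1) by (auto simp: Sub_def)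
  qed
  show "Sub c i \<subseteq> seq_submodule QQ (Ser c) (map xm [0..<i])"
    using assms
  proof (induction i)
    case 0
    show ?case
    proof
      fix f assume "f \<in> Sub c 0"
      then have "f = \<zero>\<^bsub>Ser c\<^esub>" by (auto simp: Sub_def)
      then show "f \<in> seq_submodule QQ (Ser c) (map xm [0..<0])"
        using submoduleD(1)[OF M.seq_submodule_is_submodule[OF sx[of 0]]] by simp
    qed
  next
    case (Suc i)
    show ?case
    proof
      fix f assume f: "f \<in> Sub c (Suc i)"
      then have fS: "f \<in> carrier (Ser c)" by (simp add: Sub_def)
      have fc: "f h \<in> carrier K" for h using Ser_memD(1)[OF fS] by simp
      define g where "g = (\<lambda>h. if h \<in> Cone c then f (h + ex i) else \<zero>)"
      define f' where "f' = (\<lambda>h. if h - ex i \<in> Cone c then \<zero> else f h)"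
      have gL: "g \<in> L.LC"
      proof (rule L.LCI)
        fix n
        have "finite ((\<lambda>h. h - ex i) ` {h. f h \<noteq> \<zero> \<and> wt h \<le> n + wt (ex i)})"
          using L.LC_finite[OF Ser_memD(1)[OF fS]] by blast
        moreover have "{h. g h \<noteq> \<zero> \<and> wt h \<le> n} \<subseteq> (\<lambda>h. h - ex i) ` {h. f h \<noteq> \<zero> \<and> wt h \<le> n + wt (ex i)}"
        proof
          fix h assume "h \<in> {h. g h \<noteq> \<zero> \<and> wt h \<le> n}"
          then have "f (h + ex i) \<noteq> \<zero>" "wt (h + ex i) \<le> n + wt (ex i)" by (auto simp: g_def wt_add split: if_splits)
          then show "h \<in> (\<lambda>h. h - ex i) ` {h. f h \<noteq> \<zero> \<and> wt h \<le> n + wt (ex i)}"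
            by (intro image_eqI[of _ _ "h + ex i"]) auto
        qed
        ultimately show "finite {h. g h \<noteq> \<zero> \<and> wt h \<le> n}" by (rule finite_subset[rotated])
      qed (use fc in \<open>simp add: g_def\<close>)
      have g: "g \<in> carrier (Ser c)" by (rule Ser_memI[OF gL]) (auto simp: g_def split: if_splits)
      have f'S: "f' \<in> carrier (Ser c)"
      proof (rule Ser_memI)
        show "f' \<in> L.LC"
        proof (rule L.LCI)
          fix n show "finite {h. f' h \<noteq> \<zero> \<and> wt h \<le> n}"
            by (rule finite_subset[OF _ L.LC_finite[OF Ser_memD(1)[OF fS], of n]]) (auto simp: f'_def)
        qed (use fc in \<open>simp add: f'_def\<close>)
      qed (use Ser_memD(2)[OF fS] in \<open>auto simp: f'_def split: if_splits\<close>)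
      have f': "f' \<in> Sub c i"
      proof -
        have "\<exists>l<i. h - ex l \<in> Cone c" if nz: "f' h \<noteq> \<zero>" for h
        proof -
          have h: "f h \<noteq> \<zero>" "h - ex i \<notin> Cone c" using nz by (auto simp: f'_def split: if_splits)
          then obtain l where "l < Suc i" "h - ex l \<in> Cone c" using f by (auto simp: Sub_def)
          moreover from this have "l \<noteq> i" using h(2) by auto
          ultimately show ?thesis by (intro exI[of _ l]) auto
        qed
        then show ?thesis using f'S by (simp add: Sub_def)
      qed
      have "f = f' \<oplus>\<^bsub>Ser c\<^esub> xm i \<odot>\<^bsub>Ser c\<^esub> g"
        unfolding Ser_simps one_lmonom_conv[OF gL] using fc by (auto simp: f'_def g_def)
      moreover have "f' \<in> seq_submodule QQ (Ser c) (map xm [0..<Suc i])"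
      proof -
        have "f' \<in> seq_submodule QQ (Ser c) (map xm [0..<i])" using Suc f' by auto
        also have "\<dots> \<subseteq> seq_submodule QQ (Ser c) (map xm [0..<Suc i])" by (rule M.seq_submodule_mono) auto
        finally show ?thesis .
      qed
      moreover have "xm i \<odot>\<^bsub>Ser c\<^esub> g \<in> seq_submodule QQ (Ser c) (map xm [0..<Suc i])"
        by (rule M.seq_submodule_mem[OF _ g]) auto
      ultimately show "f \<in> seq_submodule QQ (Ser c) (map xm [0..<Suc i])"
        using submoduleD(2)[OF M.seq_submodule_is_submodule[OF sx[of "Suc i"]]] by metis
    qed
  qed
qed

text \<open>The exponents in \<open>Cone c\<close> that are minimal for a given exponent of $u$: these survive modulo
  $x_0,\dots,x_{d-1}$.\<close>

definition floor_exp :: "(nat \<Rightarrow> int) \<Rightarrow> int \<Rightarrow> int poly" where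
  "floor_exp c k = vec (\<lambda>i. max 0 (c i - int (r i) * k)) k"

text \<open>An exponent of the cone that cannot be lowered in any variable is determined by its
  u-exponent.\<close>

lemma Sub_d: "Sub c d = {f \<in> carrier (Ser c). \<forall>k. f (floor_exp c k) = \<zero>}"
proof -
  have "floor_exp c k \<in> Cone c" for k by (auto simp: floor_exp_def vec_in_Cone)
  then have 1: "floor_exp c k - ex l \<notin> Cone c" if "l < d" for k l
    using Cone_diff_ex[of "floor_exp c k" c l] that by (auto simp: floor_exp_def)
  have 2: "h = floor_exp c (uu h)" if h: "h \<in> Cone c" and n: "\<forall>l<d. h - ex l \<notin> Cone c" for h
  proof (rule Grp_eqI)
    fix i assume i: "i < d"
    show "poly.coeff h i = poly.coeff (floor_exp c (uu h)) i"
      using n i Cone_diff_ex[OF h i] ConeD(2,3)[OF h i] by (auto simp: floor_exp_def)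
  qed (use ConeD(1)[OF h] in \<open>simp_all add: floor_exp_def\<close>)
  show ?thesis
  proof (intro equalityI subsetI)
    fix f assume "f \<in> Sub c d"
    then show "f \<in> {f \<in> carrier (Ser c). \<forall>k. f (floor_exp c k) = \<zero>}" using 1 by (auto simp: Sub_def)
  next
    fix f assume f: "f \<in> {f \<in> carrier (Ser c). \<forall>k. f (floor_exp c k) = \<zero>}"
    then have fS: "f \<in> carrier (Ser c)" by simp
    have "\<exists>l<d. h - ex l \<in> Cone c" if nz: "f h \<noteq> \<zero>" for h
    proof (rule ccontr)
      assume "\<not> (\<exists>l<d. h - ex l \<in> Cone c)"
      then have "h = floor_exp c (uu h)" using 2[OF Ser_memD(2)[OF fS nz]] by blast
      then show False using f nz by (metis (mono_tags, lifting) mem_Collect_eq)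
    qed
    then show "f \<in> Sub c d" using fS by (simp add: Sub_def)
  qed
qed

section \<open>The sequence of all variables followed by u+v\<close>

definition params :: "(int poly \<Rightarrow> 'k) list" where
  "params = map xm [0..<d] @ [um \<oplus>\<^bsub>QQ\<^esub> vm]"

lemma length_params: "length params = Suc d" by (simp add: params_def)

lemma params_MM: "set params \<subseteq> MM"
proof -
  have ne: "ex l \<noteq> 0" if "l < d" for l
    using arg_cong[of "ex l" 0 "\<lambda>p. poly.coeff p l"] coeff_vec_less[OF that, of "\<lambda>i. if i = l then 1 else 0" 0] by auto
  have uv: "ev\<^sub>u \<noteq> 0" "ev\<^sub>v \<noteq> 0" by (metis uu_vec uu_0 zero_neq_one neg_equal_0_iff_equal)+
  have "xm l \<in> MM" if "l < d" for l using ne[OF that] xm_uv_QQ(1) by (auto simp: MM_def lmonom_def)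
  moreover have "um \<in> MM" "vm \<in> MM" using uv xm_uv_QQ(2,3) by (auto simp: MM_def lmonom_def)
  moreover have "um \<oplus>\<^bsub>QQ\<^esub> vm \<in> MM" by (rule additive_subgroup.a_closed[OF ideal.axioms(1)[OF MM_ideal]]) fact+
  ultimately show ?thesis by (auto simp: params_def)
qed

text \<open>For the variables: if h and h + x_i - x_j lie in the cone with j < i, so does h - x_j.
  Modulo all variables only the floor exponents survive, one for each u-exponent k. There the
  coefficient of (u+v)y at k+1 is that of y at k if k >= 1, and the one at k-1 is that of y at k if
  k <= 0, since the other summand leaves the cone. The floor exponent for k = 0 is not reached by
  u+v, because of \<open>c l < r l\<close>; so the last quotient is nonzero.\<close>

theorem Ser_regular:
  assumes c: "\<And>i. i < d \<Longrightarrow> 0 \<le> c i" "\<And>i. i < d \<Longrightarrow> c i \<le> int (r i)" and l: "l < d" "c l < int (r l)"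
  shows "regular_seq QQ (Ser c) params"
proof -
  interpret M: module QQ "Ser c" by (rule Ser_module)
  have sx: "set (map xm [0..<j]) \<subseteq> carrier QQ" for j using xm_uv_QQ(1) by auto
  obtain l' where l': "l' < d" "0 < r l'" by (rule r_pos')
  have uvQ: "um \<oplus>\<^bsub>QQ\<^esub> vm \<in> carrier QQ" using xm_uv_QQ(2,3) by (rule QR.a_closed)
  have pQ: "set params \<subseteq> carrier QQ" using sx[of d] uvQ by (auto simp: params_def)
  have uv: "((um \<oplus>\<^bsub>QQ\<^esub> vm) \<odot>\<^bsub>Ser c\<^esub> y) h = y (h - ev\<^sub>u) \<oplus> y (h - ev\<^sub>v)" if y: "y \<in> carrier (Ser c)" for y h
    using L.conv_add_left[OF QQ_LC[OF xm_uv_QQ(2)] QQ_LC[OF xm_uv_QQ(3)] Ser_memD(1)[OF y]]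
      one_lmonom_conv[OF Ser_memD(1)[OF y]] by simp
  have y0: "y h = \<zero>" if "y \<in> carrier (Ser c)" "h \<notin> Cone c" for y h using Ser_memD(2) that by blast
  have yc: "y h \<in> carrier K" if "y \<in> carrier (Ser c)" for y h using Ser_memD(1)[OF that] by simp
  have mono: "int (r i) * k \<le> int (r i) * k'" if "k \<le> k'" for i k k' using that by (intro mult_left_mono) auto
  have high: "floor_exp c k = vec (\<lambda>_. 0) k" if "1 \<le> k" for k
    unfolding floor_exp_def
  proof (rule vec_cong)
    fix i assume "i < d"
    from c(2)[OF this] mono[OF that, of i] show "max 0 (c i - int (r i) * k) = 0" by simp
  qed
  have low: "floor_exp c k = vec (\<lambda>i. c i - int (r i) * k) k" if "k \<le> 0" for k
    unfolding floor_exp_def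
  proof (rule vec_cong)
    fix i assume "i < d"
    from c(1)[OF this] mono[OF that, of i] show "max 0 (c i - int (r i) * k) = c i - int (r i) * k" by simp
  qed
  have notin1: "vec (\<lambda>i. c i - int (r i) * k) k - ev\<^sub>u \<notin> Cone c" for k
    using l' by (auto simp: vec_diff vec_in_Cone algebra_simps intro!: exI[of _ l'])
  have notin2: "vec (\<lambda>_. 0) k - ev\<^sub>v \<notin> Cone c" for k
    using l' by (auto simp: vec_diff vec_in_Cone algebra_simps intro!: exI[of _ l'])
  have notin3: "vec (\<lambda>i. c i - int (r i) * 0) 0 - ev\<^sub>v \<notin> Cone c"
    using l by (auto simp: vec_diff vec_in_Cone algebra_simps intro!: exI[of _ l])
  have last: "y \<in> Sub c d" if y: "y \<in> carrier (Ser c)" "(um \<oplus>\<^bsub>QQ\<^esub> vm) \<odot>\<^bsub>Ser c\<^esub> y \<in> Sub c d" for y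
  proof -
    have *: "y (floor_exp c k - ev\<^sub>u) \<oplus> y (floor_exp c k - ev\<^sub>v) = \<zero>" for k
      using y(2) uv[OF y(1), of "floor_exp c k"] unfolding Sub_d by simp
    have "y (floor_exp c k) = \<zero>" for k
    proof (cases "1 \<le> k")
      case True
      have eq: "vec (\<lambda>_. 0) (k + 1) - ev\<^sub>u = vec (\<lambda>_. 0) k" by (simp add: vec_diff)
      have "y (vec (\<lambda>_. 0) (k + 1) - ev\<^sub>u) \<oplus> y (vec (\<lambda>_. 0) (k + 1) - ev\<^sub>v) = \<zero>"
        using *[of "k + 1"] high[of "k + 1"] True by simp
      then show ?thesis
        unfolding eq y0[OF y(1) notin2] high[OF True] using yc[OF y(1)] by simp
    next
      case False
      let ?w = "vec (\<lambda>i. c i - int (r i) * (k - 1)) (k - 1)"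
      have eq: "?w - ev\<^sub>v = vec (\<lambda>i. c i - int (r i) * k) k" by (simp add: vec_diff algebra_simps)
      have "y (?w - ev\<^sub>u) \<oplus> y (?w - ev\<^sub>v) = \<zero>" using *[of "k - 1"] low[of "k - 1"] False by simp
      moreover have "floor_exp c k = vec (\<lambda>i. c i - int (r i) * k) k" by (rule low) (use False in simp)
      ultimately show ?thesis unfolding eq y0[OF y(1) notin1] using yc[OF y(1)] by simp
    qed
    then show ?thesis using y(1) unfolding Sub_d by simp
  qed
  have step: "y \<in> Sub c i" if i: "i < d" and y: "y \<in> carrier (Ser c)" "xm i \<odot>\<^bsub>Ser c\<^esub> y \<in> Sub c i" for y i
  proof -
    have "\<exists>j<i. h - ex j \<in> Cone c" if nz: "y h \<noteq> \<zero>" for h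
    proof -
      have h: "h \<in> Cone c" by (rule Ser_memD(2)[OF y(1) nz])
      have "(xm i \<odot>\<^bsub>Ser c\<^esub> y) (h + ex i) = y h" using one_lmonom_conv[OF Ser_memD(1)[OF y(1)]] by simp
      moreover have "\<forall>g. (xm i \<odot>\<^bsub>Ser c\<^esub> y) g \<noteq> \<zero> \<longrightarrow> (\<exists>j<i. g - ex j \<in> Cone c)" using y(2) unfolding Sub_def by blast
      ultimately obtain j where j: "j < i" "h + ex i - ex j \<in> Cone c" using nz by metis
      have "1 \<le> poly.coeff h j \<and> c j + 1 \<le> poly.coeff h j + int (r j) * uu h"
        using ConeD(2,3)[OF j(2), of j] j(1) i by simp
      then have "h - ex j \<in> Cone c" using Cone_diff_ex[OF h, of j] j(1) i by simp
      then show ?thesis using j(1) by blast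
    qed
    then show ?thesis using y(1) by (simp add: Sub_def)
  qed
  have tk: "take j params = map xm [0..<j]" if "j \<le> d" for j using that by (simp add: params_def take_map)
  have reg: "y \<in> seq_submodule QQ (Ser c) (take j params)"
    if j: "j < length params" and y: "y \<in> carrier (Ser c)" "params ! j \<odot>\<^bsub>Ser c\<^esub> y \<in> seq_submodule QQ (Ser c) (take j params)" for j y
  proof -
    have jd: "j \<le> d" using j by (simp add: length_params)
    have eq: "seq_submodule QQ (Ser c) (take j params) = Sub c j" using seq_submodule_Ser[OF jd] tk[OF jd] by simp
    show ?thesis
    proof (cases "j = d")
      case True
      then have "params ! j = um \<oplus>\<^bsub>QQ\<^esub> vm" by (simp add: params_def nth_append)
      then show ?thesis using y last eq True by metis
    next
      case False
      then have "params ! j = xm j" "j < d" using jd by (auto simp: params_def nth_append)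
      then show ?thesis using y step eq by metis
    qed
  qed
  have "seq_submodule QQ (Ser c) params \<noteq> carrier (Ser c)"
  proof
    assume eq: "seq_submodule QQ (Ser c) params = carrier (Ser c)"
    let ?w = "vec (\<lambda>i. c i - int (r i) * 0) 0"
    have w: "floor_exp c 0 = ?w" by (rule low) simp
    have "?w \<in> Cone c" using c(1) by (simp add: vec_in_Cone)
    then have "lmonom K ?w \<one> \<in> carrier (Ser c)" using Ser_lmonom by blast
    then have "lmonom K ?w \<one> \<in> seq_submodule QQ (Ser c) (map xm [0..<d] @ [um \<oplus>\<^bsub>QQ\<^esub> vm])"
      using eq by (simp add: params_def)
    from M.seq_submodule_snoc[OF sx uvQ this] obtain z y where zy: "z \<in> seq_submodule QQ (Ser c) (map xm [0..<d])"
      "y \<in> carrier (Ser c)" "lmonom K ?w \<one> = z \<oplus>\<^bsub>Ser c\<^esub> (um \<oplus>\<^bsub>QQ\<^esub> vm) \<odot>\<^bsub>Ser c\<^esub> y" by blast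
    have "z ?w = \<zero>" using zy(1) unfolding seq_submodule_Ser[OF order_refl] Sub_d w[symmetric] by simp
    moreover have "((um \<oplus>\<^bsub>QQ\<^esub> vm) \<odot>\<^bsub>Ser c\<^esub> y) ?w = \<zero>"
      unfolding uv[OF zy(2)] y0[OF zy(2) notin1] y0[OF zy(2) notin3] by simp
    ultimately have "lmonom K ?w \<one> ?w = \<zero>" unfolding zy(3) Ser_simps(2) by (metis l_zero zero_closed)
    then show False by (simp add: lmonom_def)
  qed
  then show ?thesis unfolding regular_seq_def using pQ reg by blast
qed

end

section \<open>Infinitely many maximal Cohen-Macaulay modules\<close>

locale mcm_family = perfect_hypersurface K d r p
  for K :: "'k ring" (structure) and d r p +
  fixes \<iota> \<gamma> :: nat
  assumes idx: "\<iota> < d" "\<gamma> < d" "\<iota> \<noteq> \<gamma>" and r_iota: "0 < r \<iota>"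
    and other: "\<exists>l<d. l \<noteq> \<gamma> \<and> 0 < r l - (if l = \<iota> then 1 else 0)"
    and big: "\<exists>l<d. 2 * (if l = \<iota> then 1 else 0) < r l"
begin

text \<open>The factors $a=x_\iota$ and $b=f/x_\iota$ of $f$, and the powers $z=x_\gamma^n$, where $n>r_\gamma$.
  The assumption \<open>other\<close> says that $b$ does not divide any power of $x_\gamma$, and \<open>big\<close> that $f$ does not
  divide $a^2$.\<close>

definition a\<^sub>i :: "nat \<Rightarrow> int" where "a\<^sub>i = (\<lambda>i. if i = \<iota> then 1 else 0)"
definition b\<^sub>i :: "nat \<Rightarrow> int" where "b\<^sub>i = (\<lambda>i. int (r i) - a\<^sub>i i)"
definition z\<^sub>i :: "nat \<Rightarrow> nat \<Rightarrow> int" where "z\<^sub>i n = (\<lambda>i. if i = \<gamma> then int n else 0)"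

abbreviation ea :: "int poly" where "ea \<equiv> vec a\<^sub>i 0"
abbreviation eb :: "int poly" where "eb \<equiv> vec b\<^sub>i 0"
abbreviation ez :: "nat \<Rightarrow> int poly" where "ez n \<equiv> vec (z\<^sub>i n) 0"

abbreviation DA :: "int poly set" where "DA \<equiv> Cone a\<^sub>i"
abbreviation DB :: "int poly set" where "DB \<equiv> Cone b\<^sub>i"

lemma a_bounds: "0 \<le> a\<^sub>i i" "i < d \<Longrightarrow> a\<^sub>i i \<le> int (r i)"
  using r_iota by (auto simp: a\<^sub>i_def)

lemma b_bounds: "i < d \<Longrightarrow> 0 \<le> b\<^sub>i i" "b\<^sub>i i \<le> int (r i)"
  using a_bounds by (auto simp: b\<^sub>i_def)

lemma b_other: obtains l where "l < d" "l \<noteq> \<gamma>" "0 < b\<^sub>i l"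
  using other r_iota by (auto simp: b\<^sub>i_def a\<^sub>i_def split: if_splits)

lemma HH_mems: "ev\<^sub>u \<in> HH" "ev\<^sub>v \<in> HH" "ex l \<in> HH" "ea \<in> HH" "eb \<in> HH" "ez n \<in> HH"
  using a_bounds b_bounds by (auto simp: vec_in_Cone z\<^sub>i_def)

text \<open>The module is the submodule of \<open>QQ \<times> QQ\<close> generated by $(u,0)$, $(0,u)$, $(a,0)$ and $(z,b)$. The last two
  are the columns of the matrix with rows $(a,z)$ and $(0,b)$, which with the matrix with rows $(b,-z)$ and
  $(0,a)$ is a matrix factorization of $f$. Membership of $(\alpha,\beta)$ means that $a\beta$ and
  $b\alpha - z\beta$ lie in $(u)$, expressed by coefficients.\<close>

definition Fam :: "nat \<Rightarrow> (int poly \<Rightarrow> 'k, (int poly \<Rightarrow> 'k) \<times> (int poly \<Rightarrow> 'k)) module" where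
  "Fam n = \<lparr>carrier = {(\<alpha>, \<beta>). \<alpha> \<in> carrier QQ \<and> \<beta> \<in> carrier (Ser b\<^sub>i) \<and>
       (\<forall>h. uu h \<le> 0 \<and> h \<notin> DA \<longrightarrow> \<alpha> h = \<beta> (h + eb - ez n))},
     monoid.mult = undefined, one = undefined, ring.zero = ((\<lambda>_. \<zero>), (\<lambda>_. \<zero>)),
     add = (\<lambda>(\<alpha>, \<beta>) (\<alpha>', \<beta>'). ((\<lambda>h. \<alpha> h \<oplus> \<alpha>' h), (\<lambda>h. \<beta> h \<oplus> \<beta>' h))),
     module.smult = (\<lambda>a (\<alpha>, \<beta>). (conv K a \<alpha>, conv K a \<beta>))\<rparr>"

lemma Fam_simps [simp]:
  "ring.zero (Fam n) = ((\<lambda>_. \<zero>), (\<lambda>_. \<zero>))"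
  "x \<oplus>\<^bsub>Fam n\<^esub> y = ((\<lambda>h. fst x h \<oplus> fst y h), (\<lambda>h. snd x h \<oplus> snd y h))"
  "a \<odot>\<^bsub>Fam n\<^esub> x = (conv K a (fst x), conv K a (snd x))"
  by (simp_all add: Fam_def case_prod_beta)

lemma Fam_mem: "x \<in> carrier (Fam n) \<longleftrightarrow> fst x \<in> carrier QQ \<and> snd x \<in> carrier (Ser b\<^sub>i) \<and>
       (\<forall>h. uu h \<le> 0 \<and> h \<notin> DA \<longrightarrow> fst x h = snd x (h + eb - ez n))"
  by (auto simp: Fam_def)

lemma FamD:
  assumes "x \<in> carrier (Fam n)"
  shows "fst x \<in> carrier QQ" "snd x \<in> carrier (Ser b\<^sub>i)" "fst x \<in> L.LC" "snd x \<in> L.LC"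
    "\<And>h. fst x h \<in> carrier K" "\<And>h. snd x h \<in> carrier K"
    "\<And>h. uu h \<le> 0 \<Longrightarrow> h \<notin> DA \<Longrightarrow> fst x h = snd x (h + eb - ez n)"
    "\<And>h. h \<notin> HH \<Longrightarrow> fst x h = \<zero>" "\<And>h. h \<notin> DB \<Longrightarrow> snd x h = \<zero>"
proof -
  show m: "fst x \<in> carrier QQ" "snd x \<in> carrier (Ser b\<^sub>i)"
    "\<And>h. uu h \<le> 0 \<Longrightarrow> h \<notin> DA \<Longrightarrow> fst x h = snd x (h + eb - ez n)" using assms by (auto simp: Fam_mem)
  show L: "fst x \<in> L.LC" "snd x \<in> L.LC" using QQ_LC[OF m(1)] Ser_memD(1)[OF m(2)] by auto
  show "\<And>h. fst x h \<in> carrier K" "\<And>h. snd x h \<in> carrier K" using L by auto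
  show "\<And>h. h \<notin> HH \<Longrightarrow> fst x h = \<zero>" using QQ_supp[OF m(1)] by blast
  show "\<And>h. h \<notin> DB \<Longrightarrow> snd x h = \<zero>" using Ser_memD(2)[OF m(2)] by blast
qed

text \<open>The condition concerns h outside \<open>DA\<close> with \<open>uu h \<le> 0\<close>.
  Subtracting s from \<open>HH\<close> cannot lead into \<open>DA\<close>, but it can make the
  u-exponent positive. Then both coefficients vanish: elements of \<open>HH\<close> with positive
  u-exponent belong to \<open>DA\<close>, and if the second exponent were in \<open>DB\<close>, then
  h itself would be in \<open>DA\<close>.\<close>

lemma Fam_smult_closed:
  assumes a: "a \<in> carrier QQ" and x: "x \<in> carrier (Fam n)"
  shows "a \<odot>\<^bsub>Fam n\<^esub> x \<in> carrier (Fam n)"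
proof -
  note X = FamD[OF x]
  have aL: "a \<in> L.LC" by (rule QQ_LC[OF a])
  have "conv K a (fst x) h = conv K a (snd x) (h + eb - ez n)" if h: "uu h \<le> 0" "h \<notin> DA" for h
  proof -
    have eq: "fst x (h - s) = snd x (h + eb - ez n - s)" if s: "s \<in> HH" for s
    proof -
      have nDA: "h - s \<notin> DA" using Cone_add[OF s, of "h - s" a\<^sub>i] h(2) by auto
      have arg: "h - s + eb - ez n = h + eb - ez n - s" by simp
      show ?thesis
      proof (cases "uu (h - s) \<le> 0")
        case True
        then show ?thesis using X(7)[OF True nDA] arg by simp
      next
        case False
        have "h - s \<notin> HH"
        proof
          assume hs: "h - s \<in> HH"
          have "a\<^sub>i i \<le> poly.coeff (h - s) i + int (r i) * uu (h - s)" if "i < d" for i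
          proof -
            have "int (r i) * 1 \<le> int (r i) * uu (h - s)" using False by (intro mult_left_mono) auto
            then show ?thesis using a_bounds(2)[OF that] ConeD(2)[OF hs that] by linarith
          qed
          then have "h - s \<in> DA" using ConeD(1,2)[OF hs] by (simp add: Cone_def)
          then show False using nDA by simp
        qed
        then have "fst x (h - s) = \<zero>" by (rule X(8))
        moreover have "h + eb - ez n - s \<notin> DB"
        proof
          assume D: "h + eb - ez n - s \<in> DB"
          note D' = ConeD[OF D]
          have hG: "h \<in> Grp"
          proof -
            have "h = (h + eb - ez n - s) + s - eb + ez n" by simp
            also have "\<dots> \<in> Grp" by (rule Grp_add[OF Grp_diff[OF Grp_add[OF D'(1) ConeD(1)[OF s]] vec_in_Grp] vec_in_Grp])
            finally show ?thesis .
          qed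
          have "0 \<le> poly.coeff h i \<and> a\<^sub>i i \<le> poly.coeff h i + int (r i) * uu h" if i: "i < d" for i
          proof -
            have s1: "0 \<le> poly.coeff s i + int (r i) * uu s" using ConeD(3)[OF s i] by simp
            have k: "int (r i) * (uu h - uu s) \<ge> int (r i) * 1" using False by (intro mult_left_mono) auto
            have D2: "0 \<le> poly.coeff h i + b\<^sub>i i - z\<^sub>i n i - poly.coeff s i" using D'(2)[OF i] i by simp
            have z0: "0 \<le> z\<^sub>i n i" by (simp add: z\<^sub>i_def)
            have k': "int (r i) * uu h \<ge> int (r i) + int (r i) * uu s" using k by (simp add: algebra_simps)
            have "a\<^sub>i i \<le> poly.coeff h i + int (r i) * uu h"
              using D2 z0 k' s1 by (simp add: b\<^sub>i_def)
            moreover have "int (r i) * uu h \<le> 0" using h(1) by (simp add: mult_nonneg_nonpos)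
            ultimately show ?thesis using a_bounds(1)[of i] by linarith
          qed
          then have "h \<in> DA" using hG by (simp add: Cone_def)
          then show False using h(2) by simp
        qed
        then have "snd x (h + eb - ez n - s) = \<zero>" by (rule X(9))
        ultimately show ?thesis by simp
      qed
    qed
    define F where "F = {s. a s \<noteq> \<zero> \<and> fst x (h - s) \<noteq> \<zero>} \<union> {s. a s \<noteq> \<zero> \<and> snd x (h + eb - ez n - s) \<noteq> \<zero>}"
    have fin: "finite F" unfolding F_def using L.conv_finite[OF aL X(3)] L.conv_finite[OF aL X(4)] by blast
    have "conv K a (fst x) h = (\<Oplus>s\<in>F. a s \<otimes> fst x (h - s))"
      by (rule L.conv_eq[OF aL X(3) fin]) (auto simp: F_def)
    also have "\<dots> = (\<Oplus>s\<in>F. a s \<otimes> snd x (h + eb - ez n - s))"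
    proof (rule finsum_cong_closed)
      fix s assume "s \<in> F"
      then have "a s \<noteq> \<zero>" by (auto simp: F_def)
      then have "s \<in> HH" using QQ_supp[OF a] by simp
      then show "a s \<otimes> fst x (h - s) = a s \<otimes> snd x (h + eb - ez n - s)" using eq by simp
      show "a s \<otimes> snd x (h + eb - ez n - s) \<in> carrier K" using aL X(4) by simp
    qed
    also have "\<dots> = conv K a (snd x) (h + eb - ez n)"
      by (rule L.conv_eq[OF aL X(4) fin, symmetric]) (auto simp: F_def)
    finally show ?thesis .
  qed
  moreover have "conv K a (fst x) \<in> carrier QQ" using QR.m_closed[OF a X(1)] by simp
  ultimately show ?thesis using Ser_conv[OF a X(2)] by (simp add: Fam_mem)
qed

lemma Fam_add_closed:
  assumes x: "x \<in> carrier (Fam n)" and y: "y \<in> carrier (Fam n)"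
  shows "x \<oplus>\<^bsub>Fam n\<^esub> y \<in> carrier (Fam n)"
  using FamD[OF x] FamD[OF y] QR.a_closed[OF FamD(1)[OF x] FamD(1)[OF y]] Ser_add[OF FamD(2)[OF x] FamD(2)[OF y]]
  by (simp add: Fam_mem)

lemma Fam_zero_closed: "\<zero>\<^bsub>Fam n\<^esub> \<in> carrier (Fam n)"
  using QR.zero_closed module.carrier_is_submodule[OF Ser_module, THEN submoduleD(1), of b\<^sub>i] by (simp add: Fam_mem)

lemma Fam_module: "module QQ (Fam n)"
proof (rule moduleI)
  show "cring QQ" by (rule QQ_cring)
  have one: "\<ominus> \<one> \<in> carrier K" by simp
  show "abelian_group (Fam n)"
  proof (rule abelian_groupI)
    fix x assume x: "x \<in> carrier (Fam n)"
    note X = FamD[OF x]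
    have m: "lmonom K 0 (\<ominus> \<one>) \<in> carrier QQ" by (rule lmonom_QQ) auto
    show "\<exists>y\<in>carrier (Fam n). y \<oplus>\<^bsub>Fam n\<^esub> x = \<zero>\<^bsub>Fam n\<^esub>"
    proof (rule bexI[OF _ Fam_smult_closed[OF m x]])
      show "(lmonom K 0 (\<ominus> \<one>) \<odot>\<^bsub>Fam n\<^esub> x) \<oplus>\<^bsub>Fam n\<^esub> x = \<zero>\<^bsub>Fam n\<^esub>"
        using X(5,6) by (simp add: fun_eq_iff L.lmonom_conv[OF one X(3)] L.lmonom_conv[OF one X(4)] l_minus l_neg)
    qed
  next
    fix x y assume x: "x \<in> carrier (Fam n)" and y: "y \<in> carrier (Fam n)"
    show "x \<oplus>\<^bsub>Fam n\<^esub> y \<in> carrier (Fam n)" by (rule Fam_add_closed[OF x y])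
    show "x \<oplus>\<^bsub>Fam n\<^esub> y = y \<oplus>\<^bsub>Fam n\<^esub> x" using FamD(5,6)[OF x] FamD(5,6)[OF y] by (simp add: a_comm)
  next
    fix x y z assume x: "x \<in> carrier (Fam n)" and y: "y \<in> carrier (Fam n)" and z: "z \<in> carrier (Fam n)"
    show "x \<oplus>\<^bsub>Fam n\<^esub> y \<oplus>\<^bsub>Fam n\<^esub> z = x \<oplus>\<^bsub>Fam n\<^esub> (y \<oplus>\<^bsub>Fam n\<^esub> z)"
      using FamD(5,6)[OF x] FamD(5,6)[OF y] FamD(5,6)[OF z] by (simp add: a_assoc)
  next
    fix x assume x: "x \<in> carrier (Fam n)"
    show "\<zero>\<^bsub>Fam n\<^esub> \<oplus>\<^bsub>Fam n\<^esub> x = x" using FamD(5,6)[OF x] by (simp add: prod_eq_iff)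
  qed (rule Fam_zero_closed)
next
  fix a x assume "a \<in> carrier QQ" "x \<in> carrier (Fam n)"
  then show "a \<odot>\<^bsub>Fam n\<^esub> x \<in> carrier (Fam n)" by (rule Fam_smult_closed)
next
  fix a b x assume *: "a \<in> carrier QQ" "b \<in> carrier QQ" "x \<in> carrier (Fam n)"
  note ab = QQ_LC[OF *(1)] QQ_LC[OF *(2)] and X = FamD(3,4)[OF *(3)]
  show "(a \<oplus>\<^bsub>QQ\<^esub> b) \<odot>\<^bsub>Fam n\<^esub> x = a \<odot>\<^bsub>Fam n\<^esub> x \<oplus>\<^bsub>Fam n\<^esub> b \<odot>\<^bsub>Fam n\<^esub> x"
    using L.conv_add_left[OF ab X(1)] L.conv_add_left[OF ab X(2)] by simp
  show "(a \<otimes>\<^bsub>QQ\<^esub> b) \<odot>\<^bsub>Fam n\<^esub> x = a \<odot>\<^bsub>Fam n\<^esub> (b \<odot>\<^bsub>Fam n\<^esub> x)"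
    using L.conv_assoc[OF ab X(1)] L.conv_assoc[OF ab X(2)] by simp
next
  fix a x y assume *: "a \<in> carrier QQ" "x \<in> carrier (Fam n)" "y \<in> carrier (Fam n)"
  note aL = QQ_LC[OF *(1)] and X = FamD(3,4)[OF *(2)] and Y = FamD(3,4)[OF *(3)]
  show "a \<odot>\<^bsub>Fam n\<^esub> (x \<oplus>\<^bsub>Fam n\<^esub> y) = a \<odot>\<^bsub>Fam n\<^esub> x \<oplus>\<^bsub>Fam n\<^esub> a \<odot>\<^bsub>Fam n\<^esub> y"
    using LR.r_distr[of "fst x" "fst y" a] LR.r_distr[of "snd x" "snd y" a] aL X Y by simp
next
  fix x assume "x \<in> carrier (Fam n)"
  then show "\<one>\<^bsub>QQ\<^esub> \<odot>\<^bsub>Fam n\<^esub> x = x"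
    using LR.l_one[of "fst x"] LR.l_one[of "snd x"] FamD(3,4)[of x n] by simp
qed

text \<open>The first component that lifts \<beta> along the projection, with only the coefficients
  that membership in \<open>Fam n\<close> dictates.\<close>

definition sect :: "nat \<Rightarrow> (int poly \<Rightarrow> 'k) \<Rightarrow> int poly \<Rightarrow> 'k" where
  "sect n \<beta> = (\<lambda>h. if uu h \<le> 0 \<and> h \<notin> DA then \<beta> (h + eb - ez n) else \<zero>)"

lemma sect_mem:
  assumes b: "\<beta> \<in> carrier (Ser b\<^sub>i)"
  shows "(sect n \<beta>, \<beta>) \<in> carrier (Fam n)"
proof -
  have "sect n \<beta> \<in> carrier QQ"
  proof (rule QQ_I)
    show "sect n \<beta> h \<in> carrier K" for h using Ser_memD(1)[OF b] by (simp add: sect_def)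
    show "h \<in> HH" if "sect n \<beta> h \<noteq> \<zero>" for h
    proof -
      have "uu h \<le> 0" "\<beta> (h + eb - ez n) \<noteq> \<zero>" using that by (auto simp: sect_def split: if_splits)
      then have D: "h + eb - ez n \<in> DB" using Ser_memD(2)[OF b] by blast
      have "h = (h + eb - ez n) - eb + ez n" by simp
      also have "\<dots> \<in> Grp" by (rule Grp_add[OF Grp_diff[OF ConeD(1)[OF D] vec_in_Grp] vec_in_Grp])
      finally have hG: "h \<in> Grp" .
      have "0 \<le> poly.coeff h i \<and> 0 \<le> poly.coeff h i + int (r i) * uu h" if i: "i < d" for i
      proof -
        have "b\<^sub>i i \<le> poly.coeff h i + b\<^sub>i i - z\<^sub>i n i + int (r i) * uu h" using ConeD(3)[OF D i] i by simp
        moreover have "0 \<le> z\<^sub>i n i" by (simp add: z\<^sub>i_def)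
        moreover have "int (r i) * uu h \<le> 0" using \<open>uu h \<le> 0\<close> by (simp add: mult_nonneg_nonpos)
        ultimately show ?thesis by linarith
      qed
      then show ?thesis using hG by (simp add: Cone_def)
    qed
  qed
  then show ?thesis using b by (simp add: Fam_mem sect_def)
qed

lemma DA_subset_HH: "DA \<subseteq> HH"
  using a_bounds(1) by (auto simp: Cone_def intro: order.trans)

text \<open>If the second component is 0, membership says that exponents of the first with
  u-exponent at most 0 lie in \<open>DA\<close>; for positive u-exponent all of \<open>HH\<close>
  lies there.\<close>

lemma Fam_extension: "extension QQ (Ser a\<^sub>i) (Fam n) (Ser b\<^sub>i) (\<lambda>\<alpha>. (\<alpha>, (\<lambda>_. \<zero>))) snd"
proof (intro extension.intro extension_axioms.intro Ser_module Fam_module)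
  have z: "(\<lambda>_. \<zero>) \<in> carrier (Ser b\<^sub>i)" by (rule Ser_memI) auto
  show mem: "(x, (\<lambda>_. \<zero>)) \<in> carrier (Fam n)" if x: "x \<in> carrier (Ser a\<^sub>i)" for x
  proof -
    have "x \<in> carrier QQ"
      by (rule QQ_I) (use Ser_memD[OF x] DA_subset_HH in auto)
    moreover have "x h = \<zero>" if "h \<notin> DA" for h using Ser_memD(2)[OF x] that by blast
    ultimately show ?thesis using z by (simp add: Fam_mem)
  qed
  show "snd y \<in> carrier (Ser b\<^sub>i)" if "y \<in> carrier (Fam n)" for y by (rule FamD(2)[OF that])
  show "\<exists>y\<in>carrier (Fam n). snd y = z" if "z \<in> carrier (Ser b\<^sub>i)" for z
    using sect_mem[OF that, of n] by (intro bexI[of _ "(sect n z, z)"]) auto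
  show "snd y = \<zero>\<^bsub>Ser b\<^sub>i\<^esub> \<longleftrightarrow> (\<exists>x\<in>carrier (Ser a\<^sub>i). y = (x, (\<lambda>_. \<zero>)))" if y: "y \<in> carrier (Fam n)" for y
  proof
    assume s: "snd y = \<zero>\<^bsub>Ser b\<^sub>i\<^esub>"
    have "fst y \<in> carrier (Ser a\<^sub>i)"
    proof (rule Ser_memI[OF FamD(3)[OF y]])
      fix h assume nz: "fst y h \<noteq> \<zero>"
      then have hH: "h \<in> HH" using FamD(8)[OF y] by blast
      show "h \<in> DA"
      proof (rule ccontr)
        assume nD: "h \<notin> DA"
        have "\<not> uu h \<le> 0"
        proof
          assume "uu h \<le> 0"
          then have "fst y h = \<zero>" using FamD(7)[OF y _ nD] s by simp
          then show False using nz by simp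
        qed
        then have "a\<^sub>i i \<le> poly.coeff h i + int (r i) * uu h" if "i < d" for i
        proof -
          have "int (r i) * 1 \<le> int (r i) * uu h" using \<open>\<not> uu h \<le> 0\<close> by (intro mult_left_mono) auto
          then show ?thesis using a_bounds(2)[OF that] ConeD(2)[OF hH that] by linarith
        qed
        then have "h \<in> DA" using ConeD(1,2)[OF hH] by (simp add: Cone_def)
        then show False using nD by simp
      qed
    qed
    then show "\<exists>x\<in>carrier (Ser a\<^sub>i). y = (x, (\<lambda>_. \<zero>))"
      using s by (intro bexI[of _ "fst y"]) (auto simp: prod_eq_iff)
  qed auto
  have conv0: "conv K a (\<lambda>_. \<zero>) = (\<lambda>_. \<zero>)" if "a \<in> carrier QQ" for a
    using LR.r_null[of a] QQ_LC[OF that] by simp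
  show "(a \<odot>\<^bsub>Ser a\<^sub>i\<^esub> x, (\<lambda>_. \<zero>)) = a \<odot>\<^bsub>Fam n\<^esub> (x, (\<lambda>_. \<zero>))" if "a \<in> carrier QQ" "x \<in> carrier (Ser a\<^sub>i)" for a x
    using conv0[OF that(1)] by simp
qed auto

end

lemma (in module) set_add_commute:
  assumes "A \<subseteq> carrier M" "B \<subseteq> carrier M"
  shows "A <+>\<^bsub>M\<^esub> B = B <+>\<^bsub>M\<^esub> A"
proof -
  have "A <+>\<^bsub>M\<^esub> B \<subseteq> B <+>\<^bsub>M\<^esub> A" if AB: "A \<subseteq> carrier M" "B \<subseteq> carrier M" for A B
  proof
    fix y assume "y \<in> A <+>\<^bsub>M\<^esub> B"
    then obtain a b where ab: "a \<in> A" "b \<in> B" "y = a \<oplus>\<^bsub>M\<^esub> b" by (auto simp: set_add_def set_mult_def)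
    then have "y = b \<oplus>\<^bsub>M\<^esub> a" using M.a_comm AB by blast
    then show "y \<in> B <+>\<^bsub>M\<^esub> A" using ab(1,2) by (auto simp: set_add_def set_mult_def)
  qed
  then show ?thesis using assms by blast
qed

text \<open>Indecomposability is defined by submodules. The projection turns a decomposition into an
  idempotent endomorphism, on which the matrix computation modulo the maximal ideal
  operates.\<close>

lemma (in module) direct_sum_projection:
  assumes sub: "submodule N\<^sub>1 R M" "submodule N\<^sub>2 R M" and sum: "N\<^sub>1 <+>\<^bsub>M\<^esub> N\<^sub>2 = carrier M"
    and int: "N\<^sub>1 \<inter> N\<^sub>2 = {\<zero>\<^bsub>M\<^esub>}"
  obtains \<pi> where "\<And>y. y \<in> carrier M \<Longrightarrow> \<pi> y \<in> N\<^sub>1" "\<And>y. y \<in> carrier M \<Longrightarrow> \<exists>b\<in>N\<^sub>2. y = \<pi> y \<oplus>\<^bsub>M\<^esub> b"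
    "\<And>a b. a \<in> N\<^sub>1 \<Longrightarrow> b \<in> N\<^sub>2 \<Longrightarrow> \<pi> (a \<oplus>\<^bsub>M\<^esub> b) = a"
    "\<And>x y. x \<in> carrier M \<Longrightarrow> y \<in> carrier M \<Longrightarrow> \<pi> (x \<oplus>\<^bsub>M\<^esub> y) = \<pi> x \<oplus>\<^bsub>M\<^esub> \<pi> y"
    "\<And>c x. c \<in> carrier R \<Longrightarrow> x \<in> carrier M \<Longrightarrow> \<pi> (c \<odot>\<^bsub>M\<^esub> x) = c \<odot>\<^bsub>M\<^esub> \<pi> x"
proof -
  note S1 = submoduleD[OF sub(1)] and S2 = submoduleD[OF sub(2)]
  have uniq: "a = a'" if "a \<in> N\<^sub>1" "a' \<in> N\<^sub>1" "b \<in> N\<^sub>2" "b' \<in> N\<^sub>2" "a \<oplus>\<^bsub>M\<^esub> b = a' \<oplus>\<^bsub>M\<^esub> b'" for a a' b b'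
  proof -
    have c: "a \<in> carrier M" "a' \<in> carrier M" "b \<in> carrier M" "b' \<in> carrier M" using that S1(4) S2(4) by auto
    have swap: "(x \<oplus>\<^bsub>M\<^esub> y) \<oplus>\<^bsub>M\<^esub> (\<ominus>\<^bsub>M\<^esub> a' \<oplus>\<^bsub>M\<^esub> \<ominus>\<^bsub>M\<^esub> b) = (x \<ominus>\<^bsub>M\<^esub> a') \<oplus>\<^bsub>M\<^esub> (y \<ominus>\<^bsub>M\<^esub> b)"
      if "x \<in> carrier M" "y \<in> carrier M" for x y
      using c that by (simp add: M.minus_eq M.a_ac)
    have "a \<ominus>\<^bsub>M\<^esub> a' = (a \<oplus>\<^bsub>M\<^esub> b) \<oplus>\<^bsub>M\<^esub> (\<ominus>\<^bsub>M\<^esub> a' \<oplus>\<^bsub>M\<^esub> \<ominus>\<^bsub>M\<^esub> b)"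
      unfolding swap[OF c(1,3)] using c by (simp add: M.minus_eq M.r_neg)
    also have "\<dots> = b' \<ominus>\<^bsub>M\<^esub> b"
      unfolding that(5) swap[OF c(2,4)] using c by (simp add: M.minus_eq M.r_neg)
    finally have eq: "a \<ominus>\<^bsub>M\<^esub> a' = b' \<ominus>\<^bsub>M\<^esub> b" .
    have "a \<ominus>\<^bsub>M\<^esub> a' \<in> N\<^sub>1" by (rule submodule_diff[OF sub(1) that(1,2)])
    moreover have "a \<ominus>\<^bsub>M\<^esub> a' \<in> N\<^sub>2" unfolding eq by (rule submodule_diff[OF sub(2) that(4,3)])
    ultimately have "a \<ominus>\<^bsub>M\<^esub> a' = \<zero>\<^bsub>M\<^esub>" using int by blast
    then show ?thesis using c M.minus_equality[of a "\<ominus>\<^bsub>M\<^esub> a'"] by (simp add: M.minus_eq)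
  qed
  have ex: "\<exists>a\<in>N\<^sub>1. \<exists>b\<in>N\<^sub>2. y = a \<oplus>\<^bsub>M\<^esub> b" if "y \<in> carrier M" for y
  proof -
    have "y \<in> N\<^sub>1 <+>\<^bsub>M\<^esub> N\<^sub>2" using that sum by simp
    then show ?thesis by (auto simp: set_add_def set_mult_def)
  qed
  define \<pi> where "\<pi> = (\<lambda>y. SOME a. a \<in> N\<^sub>1 \<and> (\<exists>b\<in>N\<^sub>2. y = a \<oplus>\<^bsub>M\<^esub> b))"
  have p: "\<pi> y \<in> N\<^sub>1 \<and> (\<exists>b\<in>N\<^sub>2. y = \<pi> y \<oplus>\<^bsub>M\<^esub> b)" if "y \<in> carrier M" for y
    unfolding \<pi>_def by (rule someI_ex) (use ex[OF that] in blast)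
  have sp: "\<pi> (a \<oplus>\<^bsub>M\<^esub> b) = a" if "a \<in> N\<^sub>1" "b \<in> N\<^sub>2" for a b
  proof -
    have "a \<oplus>\<^bsub>M\<^esub> b \<in> carrier M" using that S1(4) S2(4) by auto
    then obtain b' where "\<pi> (a \<oplus>\<^bsub>M\<^esub> b) \<in> N\<^sub>1" "b' \<in> N\<^sub>2" "a \<oplus>\<^bsub>M\<^esub> b = \<pi> (a \<oplus>\<^bsub>M\<^esub> b) \<oplus>\<^bsub>M\<^esub> b'" using p by blast
    then show ?thesis using uniq[OF that(1) _ that(2)] by metis
  qed
  show ?thesis
  proof (rule that)
    fix x y assume xy: "x \<in> carrier M" "y \<in> carrier M"
    obtain b where b: "b \<in> N\<^sub>2" "x = \<pi> x \<oplus>\<^bsub>M\<^esub> b" using p[OF xy(1)] by blast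
    obtain b' where b': "b' \<in> N\<^sub>2" "y = \<pi> y \<oplus>\<^bsub>M\<^esub> b'" using p[OF xy(2)] by blast
    note m = p[OF xy(1), THEN conjunct1] p[OF xy(2), THEN conjunct1]
    have c: "\<pi> x \<in> carrier M" "\<pi> y \<in> carrier M" "b \<in> carrier M" "b' \<in> carrier M"
      using m b(1) b'(1) S1(4) S2(4) by auto
    have "(\<pi> x \<oplus>\<^bsub>M\<^esub> b) \<oplus>\<^bsub>M\<^esub> (\<pi> y \<oplus>\<^bsub>M\<^esub> b') = (\<pi> x \<oplus>\<^bsub>M\<^esub> \<pi> y) \<oplus>\<^bsub>M\<^esub> (b \<oplus>\<^bsub>M\<^esub> b')"
      using c by (simp add: M.a_ac)
    then have "x \<oplus>\<^bsub>M\<^esub> y = (\<pi> x \<oplus>\<^bsub>M\<^esub> \<pi> y) \<oplus>\<^bsub>M\<^esub> (b \<oplus>\<^bsub>M\<^esub> b')" using b(2) b'(2) by simp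
    then show "\<pi> (x \<oplus>\<^bsub>M\<^esub> y) = \<pi> x \<oplus>\<^bsub>M\<^esub> \<pi> y" using sp[OF S1(2)[OF m] S2(2)[OF b(1) b'(1)]] by simp
  next
    fix c x assume cx: "c \<in> carrier R" "x \<in> carrier M"
    obtain b where b: "b \<in> N\<^sub>2" "x = \<pi> x \<oplus>\<^bsub>M\<^esub> b" using p[OF cx(2)] by blast
    have m: "\<pi> x \<in> N\<^sub>1" using p[OF cx(2)] by blast
    have "c \<odot>\<^bsub>M\<^esub> (\<pi> x \<oplus>\<^bsub>M\<^esub> b) = c \<odot>\<^bsub>M\<^esub> \<pi> x \<oplus>\<^bsub>M\<^esub> c \<odot>\<^bsub>M\<^esub> b"
      using cx(1) m b(1) S1(4) S2(4) by (intro smult_r_distr) auto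
    then have "c \<odot>\<^bsub>M\<^esub> x = c \<odot>\<^bsub>M\<^esub> \<pi> x \<oplus>\<^bsub>M\<^esub> c \<odot>\<^bsub>M\<^esub> b" using b(2) by simp
    then show "\<pi> (c \<odot>\<^bsub>M\<^esub> x) = c \<odot>\<^bsub>M\<^esub> \<pi> x" using sp[OF S1(3)[OF cx(1) m] S2(3)[OF cx(1) b(1)]] by simp
  qed (use p sp in auto)
qed

section \<open>Generators and coordinates modulo the maximal ideal\<close>

context mcm_family
begin

abbreviation xa :: "int poly \<Rightarrow> 'k" where "xa \<equiv> lmonom K ea \<one>"
abbreviation xb :: "int poly \<Rightarrow> 'k" where "xb \<equiv> lmonom K eb \<one>"
abbreviation xz :: "nat \<Rightarrow> int poly \<Rightarrow> 'k" where "xz n \<equiv> lmonom K (ez n) \<one>"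

definition gen :: "nat \<Rightarrow> nat \<Rightarrow> (int poly \<Rightarrow> 'k) \<times> (int poly \<Rightarrow> 'k)" where
  "gen n i = (if i = 0 then (um, \<lambda>_. \<zero>) else if i = 1 then (\<lambda>_. \<zero>, um)
     else if i = 2 then (xa, \<lambda>_. \<zero>) else (xz n, xb))"

text \<open>Coordinates with respect to the generators modulo the maximal ideal, each read off as a
  coefficient at an exponent proper to its generator.\<close>

definition cf :: "nat \<Rightarrow> (int poly \<Rightarrow> 'k) \<times> (int poly \<Rightarrow> 'k) \<Rightarrow> 'k" where
  "cf i y = (if i = 0 then fst y ev\<^sub>u else if i = 1 then snd y ev\<^sub>u
     else if i = 2 then fst y ea else snd y eb)"

lemma notin_Cone: "i < d \<Longrightarrow> poly.coeff h i < 0 \<or> poly.coeff h i + int (r i) * uu h < c i \<Longrightarrow> h \<notin> Cone c"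
  by (auto simp: Cone_def)

lemma abz_QQ: "xa \<in> carrier QQ" "xb \<in> carrier QQ" "xz n \<in> carrier QQ"
  by (rule lmonom_QQ[OF _ one_closed], rule HH_mems)+

lemma conv_lmonom_one: "x \<in> carrier QQ \<Longrightarrow> conv K x (lmonom K g \<one>) h = x (h - g)"
  using L.conv_comm[OF QQ_LC L.lmonom_in_LC[OF one_closed]] one_lmonom_conv[OF QQ_LC] by simp

lemma zero_conv: "x \<in> carrier QQ \<Longrightarrow> conv K x (\<lambda>_. \<zero>) = (\<lambda>_. \<zero>)"
  using LR.r_null[of x] QQ_LC by simp

lemma a_iota: "a\<^sub>i \<iota> = 1" "a\<^sub>i \<gamma> = 0" and z_iota: "z\<^sub>i n \<iota> = 0" "z\<^sub>i n \<gamma> = int n"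
  and b_iota: "b\<^sub>i \<iota> = int (r \<iota>) - 1" "b\<^sub>i \<gamma> = int (r \<gamma>)"
  using idx by (auto simp: a\<^sub>i_def z\<^sub>i_def b\<^sub>i_def)

lemma gen_mem:
  assumes "i < 4"
  shows "gen n i \<in> carrier (Fam n)"
proof -
  have z: "(\<lambda>_. \<zero>) \<in> carrier QQ" "(\<lambda>_. \<zero>) \<in> carrier (Ser b\<^sub>i)"
    using QR.zero_closed submoduleD(1)[OF module.carrier_is_submodule[OF Ser_module], of b\<^sub>i] by auto
  have ub: "um \<in> carrier (Ser b\<^sub>i)" by (rule Ser_lmonom[OF _ one_closed]) (use b_bounds in \<open>simp add: vec_in_Cone\<close>)
  have bb: "xb \<in> carrier (Ser b\<^sub>i)" by (rule Ser_lmonom[OF _ one_closed]) (use b_bounds in \<open>simp add: vec_in_Cone\<close>)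
  have u0: "um h = \<zero>" if "uu h \<le> 0" for h using that by (auto simp: lmonom_def)
  have "(um, \<lambda>_. \<zero>) \<in> carrier (Fam n)" using xm_uv_QQ(2) z u0 by (simp add: Fam_mem)
  moreover have "(\<lambda>_. \<zero>, um) \<in> carrier (Fam n)" using ub z u0 by (simp add: Fam_mem)
  moreover have "ea \<in> DA" using a_bounds(1) by (simp add: vec_in_Cone)
  then have "(xa, \<lambda>_. \<zero>) \<in> carrier (Fam n)" using abz_QQ z by (auto simp: Fam_mem lmonom_def)
  moreover have "(xz n, xb) \<in> carrier (Fam n)"
  proof -
    have "h = ez n \<longleftrightarrow> h + eb - ez n = eb" for h by (metis add_diff_cancel_left' add.commute add_diff_cancel diff_add_cancel add_right_cancel)
    then show ?thesis using abz_QQ bb by (auto simp: Fam_mem lmonom_def)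
  qed
  ultimately show ?thesis using assms by (simp add: gen_def)
qed

lemma Fam_gen_sum:
  assumes c: "\<And>i. c i \<in> carrier QQ"
  shows "(\<Oplus>\<^bsub>Fam n\<^esub>i\<in>{..<4::nat}. c i \<odot>\<^bsub>Fam n\<^esub> gen n i) =
    ((\<lambda>h. conv K (c 0) um h \<oplus> conv K (c 2) xa h \<oplus> conv K (c 3) (xz n) h), (\<lambda>h. conv K (c 1) um h \<oplus> conv K (c 3) xb h))"
proof -
  interpret M: module QQ "Fam n" by (rule Fam_module)
  have cc: "c i \<odot>\<^bsub>Fam n\<^esub> gen n i \<in> carrier (Fam n)" if "i < 4" for i by (rule M.smult_closed[OF c gen_mem[OF that]])
  have 4: "{..<4::nat} = {0, 1, 2, 3}" by auto
  have "(\<Oplus>\<^bsub>Fam n\<^esub>i\<in>{..<4::nat}. c i \<odot>\<^bsub>Fam n\<^esub> gen n i) = c 0 \<odot>\<^bsub>Fam n\<^esub> gen n 0 \<oplus>\<^bsub>Fam n\<^esub> (c 1 \<odot>\<^bsub>Fam n\<^esub> gen n 1 \<oplus>\<^bsub>Fam n\<^esub>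
      (c 2 \<odot>\<^bsub>Fam n\<^esub> gen n 2 \<oplus>\<^bsub>Fam n\<^esub> c 3 \<odot>\<^bsub>Fam n\<^esub> gen n 3))"
    unfolding 4 using cc by (simp add: M.M.finsum_insert Pi_def del: Fam_simps)
  also have "\<dots> = ((\<lambda>h. conv K (c 0) um h \<oplus> conv K (c 2) xa h \<oplus> conv K (c 3) (xz n) h), (\<lambda>h. conv K (c 1) um h \<oplus> conv K (c 3) xb h))"
    using QQ_closed[OF c] by (simp add: gen_def conv_lmonom_one[OF c] zero_conv[OF c] a_assoc)
  finally show ?thesis .
qed

text \<open>The two generators of \<open>Ser b\<^sub>i\<close> are lifted, and the two of
  \<open>Ser a\<^sub>i\<close> take care of the difference; both pairs come from the threshold t =
  1.\<close>

lemma Fam_generators: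
  assumes y: "y \<in> carrier (Fam n)"
  shows "\<exists>c. (\<forall>i. c i \<in> carrier QQ) \<and> y = (\<Oplus>\<^bsub>Fam n\<^esub>i\<in>{..<4::nat}. c i \<odot>\<^bsub>Fam n\<^esub> gen n i)"
proof -
  interpret E: extension QQ "Ser a\<^sub>i" "Fam n" "Ser b\<^sub>i" "\<lambda>\<alpha>. (\<alpha>, (\<lambda>_. \<zero>))" snd by (rule Fam_extension)
  note Y = FamD[OF y]
  have g1: "vec (\<lambda>i. b\<^sub>i i - int (r i) * (1 - 1)) (1 - 1) = eb" "vec (\<lambda>i. a\<^sub>i i - int (r i) * (1 - 1)) (1 - 1) = ea"
    by (simp_all add: vec_eq_iff)
  have "\<exists>s\<in>carrier QQ. \<exists>t\<in>carrier QQ. snd y = (\<lambda>h. conv K s um h \<oplus> conv K t xb h)"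
    using Ser_generators[where t = 1 and c = "b\<^sub>i", OF _ _ Y(2)] b_bounds g1(1) by simp
  then obtain s t where st: "s \<in> carrier QQ" "t \<in> carrier QQ" "snd y = (\<lambda>h. conv K s um h \<oplus> conv K t xb h)" by blast
  define w where "w = s \<odot>\<^bsub>Fam n\<^esub> gen n 1 \<oplus>\<^bsub>Fam n\<^esub> t \<odot>\<^bsub>Fam n\<^esub> gen n 3"
  have w: "w \<in> carrier (Fam n)" unfolding w_def using st gen_mem by (intro E.N.M.a_closed E.N.smult_closed) auto
  have ws: "snd w = snd y" "fst w = (\<lambda>h. conv K t (xz n) h)"
    using st QQ_closed[OF st(2)] by (auto simp: w_def gen_def zero_conv conv_lmonom_one)
  have yw: "y \<ominus>\<^bsub>Fam n\<^esub> w \<in> carrier (Fam n)" using y w by simp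
  have "snd (y \<ominus>\<^bsub>Fam n\<^esub> w) = snd y \<ominus>\<^bsub>Ser b\<^sub>i\<^esub> snd w" by (rule E.p_diff[OF y w])
  also have "\<dots> = \<zero>\<^bsub>Ser b\<^sub>i\<^esub>" using ws(1) Y(2) by (metis E.N2.M.r_neg E.N2.M.minus_eq)
  finally obtain x where x: "x \<in> carrier (Ser a\<^sub>i)" "y \<ominus>\<^bsub>Fam n\<^esub> w = (x, \<lambda>_. \<zero>)" using E.exact[OF yw] by blast
  have "\<exists>s\<in>carrier QQ. \<exists>t\<in>carrier QQ. x = (\<lambda>h. conv K s um h \<oplus> conv K t xa h)"
    using Ser_generators[where t = 1 and c = "a\<^sub>i", OF _ _ x(1)] a_bounds g1(2) by simp
  then obtain s' t' where st': "s' \<in> carrier QQ" "t' \<in> carrier QQ" "x = (\<lambda>h. conv K s' um h \<oplus> conv K t' xa h)" by blast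
  have "(y \<ominus>\<^bsub>Fam n\<^esub> w) \<oplus>\<^bsub>Fam n\<^esub> w = y" by (rule E.N.M.minus_add_cancel[OF y w])
  then have "y = (x, \<lambda>_. \<zero>) \<oplus>\<^bsub>Fam n\<^esub> w" using x(2) by simp
  then have fy: "fst y = (\<lambda>h. conv K s' um h \<oplus> conv K t' xa h \<oplus> conv K t (xz n) h)"
    using st'(3) ws(2) by simp
  define c where "c = (\<lambda>i::nat. if i = 0 then s' else if i = 1 then s else if i = 2 then t' else t)"
  have cQ: "c i \<in> carrier QQ" for i using st st' by (simp add: c_def)
  have "y = (\<Oplus>\<^bsub>Fam n\<^esub>i\<in>{..<4::nat}. c i \<odot>\<^bsub>Fam n\<^esub> gen n i)"
    unfolding Fam_gen_sum[OF cQ] by (rule prod_eqI) (simp_all add: fy st(3) c_def)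
  then show ?thesis using cQ by blast
qed

lemma Fam_span:
  assumes L: "submodule L QQ (Fam n)" and g: "\<And>i. i < 4 \<Longrightarrow> gen n i \<in> L"
  shows "L = carrier (Fam n)"
proof
  interpret M: module QQ "Fam n" by (rule Fam_module)
  note S = submoduleD[OF L]
  show "L \<subseteq> carrier (Fam n)" by (rule S(4))
  show "carrier (Fam n) \<subseteq> L"
  proof
    fix y assume y: "y \<in> carrier (Fam n)"
    obtain c where c: "\<And>i. c i \<in> carrier QQ" "y = (\<Oplus>\<^bsub>Fam n\<^esub>i\<in>{..<4::nat}. c i \<odot>\<^bsub>Fam n\<^esub> gen n i)"
      using Fam_generators[OF y] by blast
    have "(\<Oplus>\<^bsub>Fam n\<^esub>i\<in>{..<k}. c i \<odot>\<^bsub>Fam n\<^esub> gen n i) \<in> L" if "k \<le> 4" for k :: nat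
      using that
    proof (induction k)
      case (Suc k)
      have "(\<Oplus>\<^bsub>Fam n\<^esub>i\<in>{..<Suc k}. c i \<odot>\<^bsub>Fam n\<^esub> gen n i) =
          c k \<odot>\<^bsub>Fam n\<^esub> gen n k \<oplus>\<^bsub>Fam n\<^esub> (\<Oplus>\<^bsub>Fam n\<^esub>i\<in>{..<k}. c i \<odot>\<^bsub>Fam n\<^esub> gen n i)"
        unfolding lessThan_Suc using Suc.prems c(1) gen_mem M.smult_closed
        by (intro M.M.finsum_insert) (auto simp del: Fam_simps)
      then show ?case using S(2)[OF S(3)[OF c(1) g[of k]] Suc.IH] Suc.prems by (simp del: Fam_simps)
    qed (use S(1) in \<open>simp del: Fam_simps\<close>)
    then show "y \<in> L" using c(2) by simp
  qed
qed

lemma Fam_fg: "fg_module QQ (Fam n)"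
proof -
  interpret M: module QQ "Fam n" by (rule Fam_module)
  let ?G = "gen n ` {..<4}"
  have G: "?G \<subseteq> carrier (Fam n)" using gen_mem by auto
  have "mod_span QQ (Fam n) ?G = carrier (Fam n)"
    by (rule Fam_span[OF M.span_submodule[OF G]]) (rule subsetD[OF mod_span_subset], simp)
  then show ?thesis unfolding fg_module_def using Fam_module G by (intro conjI exI[of _ ?G]) auto
qed

text \<open>Minimality of the generators: an exponent read by \<open>cf\<close> never differs from
  the exponent of another generator in the same component by an element of \<open>HH\<close>, so
  only the constant term of one coefficient contributes.\<close>

lemma Fam_coeffs:
  assumes n: "r \<gamma> < n" and c: "\<And>i. c i \<in> carrier QQ" and i: "i < 4"
  shows "cf i (\<Oplus>\<^bsub>Fam n\<^esub>i\<in>{..<4::nat}. c i \<odot>\<^bsub>Fam n\<^esub> gen n i) = c i 0"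
proof -
  obtain l where l: "l < d" "l \<noteq> \<gamma>" "0 < b\<^sub>i l" by (rule b_other)
  have z: "c j h = \<zero>" if "h \<notin> HH" for j h using QQ_supp[OF c] that by blast
  have "ev\<^sub>u - ea \<notin> HH" "eb - ev\<^sub>u \<notin> HH"
    by (rule notin_Cone[OF idx(1)], use idx in \<open>simp add: vec_diff a_iota b_iota\<close>)+
  moreover have "ea - ez n \<notin> HH" "ev\<^sub>u - ez n \<notin> HH"
    by (rule notin_Cone[OF idx(2)], use idx n in \<open>simp add: vec_diff a_iota z_iota\<close>)+
  moreover have "ev\<^sub>u - eb \<notin> HH" "ea - ev\<^sub>u \<notin> HH"
    using l by (auto intro!: notin_Cone[OF l(1)] simp: b\<^sub>i_def)
  ultimately show ?thesis
    using i QQ_closed[OF c] unfolding Fam_gen_sum[OF c] cf_def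
    by (auto simp: conv_lmonom_one[OF c] z less_Suc_eq numeral_eq_Suc)
qed

lemma cf_closed: "y \<in> carrier (Fam n) \<Longrightarrow> cf i y \<in> carrier K"
  using FamD(5,6) by (simp add: cf_def)

lemma cf_add: "cf i (x \<oplus>\<^bsub>Fam n\<^esub> y) = cf i x \<oplus> cf i y"
  by (simp add: cf_def)

lemma cf_zero_MM:
  assumes n: "r \<gamma> < n" and y: "y \<in> carrier (Fam n)" and z: "\<And>i. i < 4 \<Longrightarrow> cf i y = \<zero>"
  shows "\<exists>c. (\<forall>i. c i \<in> MM) \<and> y = (\<Oplus>\<^bsub>Fam n\<^esub>i\<in>{..<4::nat}. c i \<odot>\<^bsub>Fam n\<^esub> gen n i)"
proof -
  interpret M: module QQ "Fam n" by (rule Fam_module)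
  obtain c where c: "\<And>i. c i \<in> carrier QQ" "y = (\<Oplus>\<^bsub>Fam n\<^esub>i\<in>{..<4::nat}. c i \<odot>\<^bsub>Fam n\<^esub> gen n i)"
    using Fam_generators[OF y] by blast
  have m: "c i \<in> MM" if "i < 4" for i using Fam_coeffs[OF n c(1) that] z[OF that] c by (simp add: MM_def)
  have "(\<lambda>_. \<zero>) \<in> MM" using QR.zero_closed by (simp add: MM_def)
  moreover have "(\<Oplus>\<^bsub>Fam n\<^esub>i\<in>{..<4::nat}. (if i < 4 then c i else (\<lambda>_. \<zero>)) \<odot>\<^bsub>Fam n\<^esub> gen n i) = y"
    unfolding c(2) by (rule M.M.finsum_cong') (use c(1) gen_mem M.smult_closed in \<open>auto simp del: Fam_simps\<close>)
  ultimately show ?thesis using m by (intro exI[of _ "\<lambda>i. if i < 4 then c i else (\<lambda>_. \<zero>)"]) auto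
qed

lemma cf_smult:
  assumes n: "r \<gamma> < n" and x: "x \<in> carrier QQ" and y: "y \<in> carrier (Fam n)" and i: "i < 4"
  shows "cf i (x \<odot>\<^bsub>Fam n\<^esub> y) = x 0 \<otimes> cf i y"
proof -
  interpret M: module QQ "Fam n" by (rule Fam_module)
  obtain c where c: "\<And>i. c i \<in> carrier QQ" "y = (\<Oplus>\<^bsub>Fam n\<^esub>i\<in>{..<4::nat}. c i \<odot>\<^bsub>Fam n\<^esub> gen n i)"
    using Fam_generators[OF y] by blast
  have xc: "conv K x (c i) \<in> carrier QQ" for i using QR.m_closed[OF x c(1)] by simp
  have "x \<odot>\<^bsub>Fam n\<^esub> y = (\<Oplus>\<^bsub>Fam n\<^esub>i\<in>{..<4::nat}. x \<odot>\<^bsub>Fam n\<^esub> (c i \<odot>\<^bsub>Fam n\<^esub> gen n i))"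
    unfolding c(2) by (rule M.finsum_smult_ldistr[OF _ x]) (use c(1) gen_mem M.smult_closed in \<open>auto simp del: Fam_simps\<close>)
  also have "\<dots> = (\<Oplus>\<^bsub>Fam n\<^esub>i\<in>{..<4::nat}. conv K x (c i) \<odot>\<^bsub>Fam n\<^esub> gen n i)"
  proof (rule M.M.finsum_cong')
    show "(\<lambda>i. conv K x (c i) \<odot>\<^bsub>Fam n\<^esub> gen n i) \<in> {..<4} \<rightarrow> carrier (Fam n)"
      using xc gen_mem M.smult_closed by (auto simp del: Fam_simps)
    fix i :: nat assume "i \<in> {..<4}"
    then show "x \<odot>\<^bsub>Fam n\<^esub> (c i \<odot>\<^bsub>Fam n\<^esub> gen n i) = conv K x (c i) \<odot>\<^bsub>Fam n\<^esub> gen n i"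
      using M.smult_assoc1[OF x c(1) gen_mem] by (simp del: Fam_simps)
  qed simp
  finally show ?thesis using Fam_coeffs[OF n xc i] Fam_coeffs[OF n c(1) i] conv_0[OF x c(1)] c(2) by simp
qed

text \<open>Regularity passes from the two ends of the extension to the middle. The strict
  inequality that \<open>Ser_regular\<close> asks for holds at a variable of b for
  \<open>Ser a\<^sub>i\<close> and at \<iota> for \<open>Ser b\<^sub>i\<close>. The bounds on depth
  and dimension then leave only equality.\<close>

theorem MCM_Fam: "MCM QQ (Fam n)"
proof -
  obtain l where l: "l < d" "l \<noteq> \<gamma>" "0 < b\<^sub>i l" by (rule b_other)
  interpret E: extension QQ "Ser a\<^sub>i" "Fam n" "Ser b\<^sub>i" "\<lambda>\<alpha>. (\<alpha>, (\<lambda>_. \<zero>))" snd by (rule Fam_extension)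
  have "regular_seq QQ (Ser a\<^sub>i) params"
    by (rule Ser_regular[OF _ _ l(1)]) (use a_bounds l(3) in \<open>auto simp: b\<^sub>i_def\<close>)
  moreover have "regular_seq QQ (Ser b\<^sub>i) params"
    by (rule Ser_regular[OF _ _ idx(1)]) (use b_bounds in \<open>auto simp: b_iota\<close>)
  ultimately have reg: "regular_seq QQ (Fam n) params" by (rule E.regular_seq_extension)
  have "gen n 0 \<noteq> \<zero>\<^bsub>Fam n\<^esub>"
  proof
    assume "gen n 0 = \<zero>\<^bsub>Fam n\<^esub>"
    then have "um ev\<^sub>u = \<zero>" by (simp add: gen_def)
    then show False by (simp add: lmonom_def)
  qed
  then have nz: "carrier (Fam n) \<noteq> {\<zero>\<^bsub>Fam n\<^esub>}" using gen_mem[of 0 n] by auto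
  have "enat (Suc d) \<in> {enat (length xs) | xs. set xs \<subseteq> max_ideal QQ \<and> regular_seq QQ (Fam n) xs}"
    using reg params_MM length_params unfolding max_ideal_QQ by force
  then have "enat (Suc d) \<le> depth QQ (Fam n)" using nz unfolding depth_def by (simp add: Sup_upper)
  moreover have "depth QQ (Fam n) \<le> krull_dim QQ" by (rule E.N.depth_le_krull_dim[OF nz QQ_noetherian])
  ultimately show ?thesis using krull_dim_QQ_le Fam_fg by (simp add: MCM_def)
qed

section \<open>Homomorphisms between members of the family\<close>

definition Fam_lin :: "nat \<Rightarrow> nat \<Rightarrow> ((int poly \<Rightarrow> 'k) \<times> (int poly \<Rightarrow> 'k) \<Rightarrow> (int poly \<Rightarrow> 'k) \<times> (int poly \<Rightarrow> 'k)) \<Rightarrow> bool" where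
  "Fam_lin n' n h \<longleftrightarrow> (\<forall>y\<in>carrier (Fam n'). h y \<in> carrier (Fam n)) \<and>
    (\<forall>x\<in>carrier (Fam n'). \<forall>y\<in>carrier (Fam n'). h (x \<oplus>\<^bsub>Fam n'\<^esub> y) = h x \<oplus>\<^bsub>Fam n\<^esub> h y) \<and>
    (\<forall>x\<in>carrier QQ. \<forall>y\<in>carrier (Fam n'). h (x \<odot>\<^bsub>Fam n'\<^esub> y) = x \<odot>\<^bsub>Fam n\<^esub> h y)"

lemma Fam_linD:
  assumes "Fam_lin n' n h"
  shows "\<And>y. y \<in> carrier (Fam n') \<Longrightarrow> h y \<in> carrier (Fam n)"
    "\<And>x y. x \<in> carrier (Fam n') \<Longrightarrow> y \<in> carrier (Fam n') \<Longrightarrow> h (x \<oplus>\<^bsub>Fam n'\<^esub> y) = h x \<oplus>\<^bsub>Fam n\<^esub> h y"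
    "\<And>x y. x \<in> carrier QQ \<Longrightarrow> y \<in> carrier (Fam n') \<Longrightarrow> h (x \<odot>\<^bsub>Fam n'\<^esub> y) = x \<odot>\<^bsub>Fam n\<^esub> h y"
  using assms unfolding Fam_lin_def by blast+

text \<open>The action of a homomorphism on the generators modulo the maximal ideal is read off from the relations
  $u g_1 = a p_1$ and $u g_2 = z p_1 + b p_2$.\<close>

lemma Fam_hom:
  assumes n: "r \<gamma> < n'" "n' \<le> n"
    and lin: "Fam_lin n' n h"
  defines "m i j \<equiv> cf i (h (gen n' j))"
  shows "m 1 0 = \<zero>" "m 2 0 = \<zero>" "m 3 0 = \<zero>"
    "m 2 1 = \<zero>" "m 3 1 = \<zero>"
    "m 0 2 = \<zero>" "m 1 2 = \<zero>" "m 2 2 = m 0 0" "m 3 2 = \<zero>"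
    "m 0 3 = \<zero>" "m 1 3 = \<zero>" "m 3 3 = m 1 1"
    "n' = n \<Longrightarrow> m 1 1 = m 0 0" "n' < n \<Longrightarrow> m 0 0 = \<zero>"
proof -
  note closed = Fam_linD(1)[OF lin] and add = Fam_linD(2)[OF lin] and smult = Fam_linD(3)[OF lin]
  obtain l where l: "l < d" "l \<noteq> \<gamma>" "0 < b\<^sub>i l" by (rule b_other)
  obtain l' where l': "l' < d" "a\<^sub>i l' < b\<^sub>i l'"
    using big by (auto simp: b\<^sub>i_def a\<^sub>i_def split: if_splits)
  define P\<^sub>1 where "P\<^sub>1 = h (gen n' 0)"
  define P\<^sub>2 where "P\<^sub>2 = h (gen n' 1)"
  define G\<^sub>1 where "G\<^sub>1 = h (gen n' 2)"
  define G\<^sub>2 where "G\<^sub>2 = h (gen n' 3)"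
  have mem: "P\<^sub>1 \<in> carrier (Fam n)" "P\<^sub>2 \<in> carrier (Fam n)" "G\<^sub>1 \<in> carrier (Fam n)" "G\<^sub>2 \<in> carrier (Fam n)"
    unfolding P\<^sub>1_def P\<^sub>2_def G\<^sub>1_def G\<^sub>2_def by (intro closed gen_mem; simp)+
  have ll: "conv K (lmonom K g \<one>) (lmonom K g' \<one>) = lmonom K (g + g') \<one>" for g g' :: "int poly"
    using L.lmonom_lmonom[OF one_closed one_closed] by simp
  have rel1: "um \<odot>\<^bsub>Fam n'\<^esub> gen n' 2 = xa \<odot>\<^bsub>Fam n'\<^esub> gen n' 0"
    using zero_conv xm_uv_QQ abz_QQ by (simp add: gen_def ll add.commute)
  have rel2: "um \<odot>\<^bsub>Fam n'\<^esub> gen n' 3 = xz n' \<odot>\<^bsub>Fam n'\<^esub> gen n' 0 \<oplus>\<^bsub>Fam n'\<^esub> xb \<odot>\<^bsub>Fam n'\<^esub> gen n' 1"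
    using zero_conv xm_uv_QQ abz_QQ by (simp add: gen_def ll add.commute)
  have g: "gen n' 0 \<in> carrier (Fam n')" "gen n' 1 \<in> carrier (Fam n')" "gen n' 2 \<in> carrier (Fam n')" "gen n' 3 \<in> carrier (Fam n')"
    by (intro gen_mem; simp)+
  have h1: "um \<odot>\<^bsub>Fam n\<^esub> G\<^sub>1 = xa \<odot>\<^bsub>Fam n\<^esub> P\<^sub>1"
    using smult[OF xm_uv_QQ(2) g(3)] smult[OF abz_QQ(1) g(1)] rel1 by (simp only: P\<^sub>1_def G\<^sub>1_def)
  have h2: "um \<odot>\<^bsub>Fam n\<^esub> G\<^sub>2 = xz n' \<odot>\<^bsub>Fam n\<^esub> P\<^sub>1 \<oplus>\<^bsub>Fam n\<^esub> xb \<odot>\<^bsub>Fam n\<^esub> P\<^sub>2"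
    using smult[OF xm_uv_QQ(2) g(4)] smult[OF abz_QQ(3) g(1)] smult[OF abz_QQ(2) g(2)]
      add[OF Fam_smult_closed[OF abz_QQ(3) g(1)] Fam_smult_closed[OF abz_QQ(2) g(2)]] rel2
    by (simp only: P\<^sub>1_def P\<^sub>2_def G\<^sub>2_def)
  note D1 = FamD[OF mem(1)] and D2 = FamD[OF mem(2)] and E1 = FamD[OF mem(3)] and E2 = FamD[OF mem(4)]
  have f1: "fst G\<^sub>1 (h - ev\<^sub>u) = fst P\<^sub>1 (h - ea)" and s1: "snd G\<^sub>1 (h - ev\<^sub>u) = snd P\<^sub>1 (h - ea)" for h
    using h1 one_lmonom_conv[OF D1(3)] one_lmonom_conv[OF D1(4)] one_lmonom_conv[OF E1(3)] one_lmonom_conv[OF E1(4)]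
    by (auto simp: fun_eq_iff)
  have f2: "fst G\<^sub>2 (h - ev\<^sub>u) = fst P\<^sub>1 (h - ez n') \<oplus> fst P\<^sub>2 (h - eb)"
    and s2: "snd G\<^sub>2 (h - ev\<^sub>u) = snd P\<^sub>1 (h - ez n') \<oplus> snd P\<^sub>2 (h - eb)" for h
    using h2 one_lmonom_conv[OF D1(3)] one_lmonom_conv[OF D1(4)] one_lmonom_conv[OF D2(3)] one_lmonom_conv[OF D2(4)]
      one_lmonom_conv[OF E2(3)] one_lmonom_conv[OF E2(4)]
    by (auto simp: fun_eq_iff)
  have sh: "h + ev\<^sub>u - ev\<^sub>u = h" for h :: "int poly" by simp
  note F1 = f1[of "_ + ev\<^sub>u", unfolded sh] and S1 = s1[of "_ + ev\<^sub>u", unfolded sh]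
    and F2 = f2[of "_ + ev\<^sub>u", unfolded sh] and S2 = s2[of "_ + ev\<^sub>u", unfolded sh]
  have ezDA: "ez k \<notin> DA" for k by (rule notin_Cone[OF idx(1)]) (use idx in \<open>simp add: a_iota z_iota\<close>)
  have uez: "uu (ez k) \<le> 0" for k by simp

  \<comment> \<open>Each of these non-memberships removes one term from a coefficient relation.
    \<open>l'\<close> is a variable showing that f does not divide a^2, and \<open>l\<close> is a
    variable of b other than x_\<gamma>.\<close>
  have z1: "ea + ea - ev\<^sub>u \<notin> HH"
    by (rule notin_Cone[OF l'(1)]) (use l' in \<open>simp add: vec_add vec_diff b\<^sub>i_def\<close>)
  have z2: "eb + ea - ev\<^sub>u \<notin> DB"
    by (rule notin_Cone[OF l(1)]) (use l in \<open>simp add: vec_add vec_diff b\<^sub>i_def\<close>)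
  have z3: "ea \<notin> DB" by (rule notin_Cone[OF l'(1)]) (use l' in \<open>simp add: vec_add vec_diff\<close>)
  have z4: "ez n + ev\<^sub>u - ea \<notin> HH" "ev\<^sub>u + ev\<^sub>u - ea \<notin> HH" "ev\<^sub>u + ev\<^sub>u - ea \<notin> DB"
    by (rule notin_Cone[OF idx(1)], use idx in \<open>simp add: vec_add vec_diff a_iota z_iota\<close>)+
  have z5: "eb + ev\<^sub>u - ez n' \<notin> DB" "eb + eb - ez n' \<notin> DB" "ev\<^sub>u + ev\<^sub>u - ez n' \<notin> HH" "ev\<^sub>u + ev\<^sub>u - ez n' \<notin> DB"
      "ea + eb - ez n' \<notin> HH"
    by (rule notin_Cone[OF idx(2)], use idx n in \<open>simp add: vec_add vec_diff a_iota z_iota b_iota\<close>)+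
  have z6: "ez k + ev\<^sub>u - eb \<notin> HH" "ev\<^sub>u + ev\<^sub>u - eb \<notin> HH" "ev\<^sub>u + ev\<^sub>u - eb \<notin> DB" for k
    by (rule notin_Cone[OF l(1)], use l in \<open>simp add: vec_add vec_diff z\<^sub>i_def\<close>)+
  have z7: "ev\<^sub>v \<notin> DA" "eb + eb - ev\<^sub>u \<notin> DB"
    by (rule notin_Cone[OF idx(1)], use idx in \<open>simp add: vec_add vec_diff a_iota b_iota algebra_simps\<close>)+
  have z8: "ev\<^sub>v + eb - ez n \<notin> DB"
    by (rule notin_Cone[OF idx(2)]) (use idx n in \<open>simp add: vec_add vec_diff b_iota z_iota\<close>)
  have vab: "ea + eb - ev\<^sub>u = ev\<^sub>v" by (rule Grp_eqI) (auto simp: b\<^sub>i_def)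

  have P1_2: "fst P\<^sub>1 ea = \<zero>"
    using F1[of "ea + ea - ev\<^sub>u"] E1(8)[OF z1] by simp
  have P1_3: "snd P\<^sub>1 eb = \<zero>"
    using S1[of "eb + ea - ev\<^sub>u"] E1(9)[OF z2] by simp
  have P1_1: "snd P\<^sub>1 ev\<^sub>u = \<zero>"
    using S1[of ea] E1(9)[OF z3] by simp
  have G1_2: "fst G\<^sub>1 ea = fst P\<^sub>1 ev\<^sub>u"
    using F1[of ea] by simp
  have G1_0: "fst G\<^sub>1 ev\<^sub>u = \<zero>" and G1_1: "snd G\<^sub>1 ev\<^sub>u = \<zero>"
    using F1[of ev\<^sub>u] S1[of ev\<^sub>u] D1(8)[OF z4(2)] D1(9)[OF z4(3)] by simp_all
  \<comment> \<open>Membership in \<open>Fam n\<close> ties this coefficient to the first component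
    at the exponent of z, where the relation gives 0.\<close>
  have G1_3: "snd G\<^sub>1 eb = \<zero>"
    using E1(7)[OF uez ezDA, of n] F1[of "ez n"] D1(8)[OF z4(1)] by simp
  have G2_3: "snd G\<^sub>2 eb = snd P\<^sub>2 ev\<^sub>u"
    using S2[of eb] D1(9)[OF z5(1)] D2(6) by simp
  have G2_z: "fst G\<^sub>2 (ez k) = fst P\<^sub>1 (ez k + ev\<^sub>u - ez n')" for k
    using F2[of "ez k"] D2(8)[OF z6(1)] D1(5) by simp
  have G2_0: "fst G\<^sub>2 ev\<^sub>u = \<zero>" and G2_1: "snd G\<^sub>2 ev\<^sub>u = \<zero>"
    using F2[of ev\<^sub>u] S2[of ev\<^sub>u] D1(8)[OF z5(3)] D1(9)[OF z5(4)] D2(8)[OF z6(2)] D2(9)[OF z6(3)] by simp_all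
  \<comment> \<open>The exponent of f/u is that of v. There membership equates the first component
    of \<open>G\<^sub>2\<close> with a coefficient of the second at an exponent outside
    \<open>DB\<close>.\<close>
  have P2_2: "fst P\<^sub>2 ea = \<zero>"
  proof -
    have "fst G\<^sub>2 ev\<^sub>v = snd G\<^sub>2 (ev\<^sub>v + eb - ez n)" by (rule E2(7)[OF _ z7(1)]) simp
    then have "fst G\<^sub>2 (ea + eb - ev\<^sub>u) = \<zero>" using E2(9)[OF z8] vab by simp
    then show ?thesis using F2[of "ea + eb - ev\<^sub>u"] D1(8)[OF z5(5)] D2(5) by simp
  qed
  have P2_3: "snd P\<^sub>2 eb = \<zero>"
    using S2[of "eb + eb - ev\<^sub>u"] E2(9)[OF z7(2)] D1(9)[OF z5(2)] D2(6) by simp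
  \<comment> \<open>Both diagonal entries appear in the first component of \<open>G\<^sub>2\<close>
    at the exponent of z: one through the relation, the other through membership.\<close>
  have same: "snd P\<^sub>2 ev\<^sub>u = fst P\<^sub>1 ev\<^sub>u" if "n' = n"
    using E2(7)[OF uez ezDA, of n] G2_z[of n] G2_3 that by simp
  \<comment> \<open>At the exponent of the smaller power z', membership refers to the exponent of
    z'b/z, which lies outside \<open>DB\<close>.\<close>
  have less: "fst P\<^sub>1 ev\<^sub>u = \<zero>" if "n' < n"
  proof -
    have "ez n' + eb - ez n \<notin> DB"
      by (rule notin_Cone[OF idx(2)]) (use idx that in \<open>simp add: b_iota z_iota\<close>)
    then have "fst G\<^sub>2 (ez n') = \<zero>" using E2(7)[OF uez ezDA, of n'] E2(9) by simp
    then show ?thesis using G2_z[of n'] by simp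
  qed
  note mdef = m_def cf_def P\<^sub>1_def P\<^sub>2_def G\<^sub>1_def G\<^sub>2_def
  show "m 1 0 = \<zero>" "m 2 0 = \<zero>" "m 3 0 = \<zero>" using P1_1 P1_2 P1_3 by (simp_all add: mdef)
  show "m 2 1 = \<zero>" "m 3 1 = \<zero>" using P2_2 P2_3 by (simp_all add: mdef)
  show "m 0 2 = \<zero>" "m 1 2 = \<zero>" "m 2 2 = m 0 0" "m 3 2 = \<zero>" using G1_0 G1_1 G1_2 G1_3 by (simp_all add: mdef)
  show "m 0 3 = \<zero>" "m 1 3 = \<zero>" "m 3 3 = m 1 1" using G2_0 G2_1 G2_3 by (simp_all add: mdef)
  show "n' = n \<Longrightarrow> m 1 1 = m 0 0" using same by (simp add: mdef)
  show "n' < n \<Longrightarrow> m 0 0 = \<zero>" using less by (simp add: mdef)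
qed

lemma cf_hom:
  assumes n: "r \<gamma> < n'" "r \<gamma> < n"
    and lin: "Fam_lin n' n h"
    and y: "y \<in> carrier (Fam n')" and i: "i < 4"
  shows "cf i (h y) = cf 0 y \<otimes> cf i (h (gen n' 0)) \<oplus> (cf 1 y \<otimes> cf i (h (gen n' 1)) \<oplus>
      (cf 2 y \<otimes> cf i (h (gen n' 2)) \<oplus> cf 3 y \<otimes> cf i (h (gen n' 3))))"
proof -
  note closed = Fam_linD(1)[OF lin] and add = Fam_linD(2)[OF lin] and smult = Fam_linD(3)[OF lin]
  interpret M: module QQ "Fam n'" by (rule Fam_module)
  obtain c where c: "\<And>i. c i \<in> carrier QQ" "y = (\<Oplus>\<^bsub>Fam n'\<^esub>i\<in>{..<4::nat}. c i \<odot>\<^bsub>Fam n'\<^esub> gen n' i)"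
    using Fam_generators[OF y] by blast
  have cc: "c i \<odot>\<^bsub>Fam n'\<^esub> gen n' i \<in> carrier (Fam n')" if "i < 4" for i by (rule M.smult_closed[OF c(1) gen_mem[OF that]])
  have 4: "{..<4::nat} = {0, 1, 2, 3}" by auto
  have "y = c 0 \<odot>\<^bsub>Fam n'\<^esub> gen n' 0 \<oplus>\<^bsub>Fam n'\<^esub> (c 1 \<odot>\<^bsub>Fam n'\<^esub> gen n' 1 \<oplus>\<^bsub>Fam n'\<^esub>
      (c 2 \<odot>\<^bsub>Fam n'\<^esub> gen n' 2 \<oplus>\<^bsub>Fam n'\<^esub> c 3 \<odot>\<^bsub>Fam n'\<^esub> gen n' 3))"
    unfolding c(2) 4 using cc by (simp add: M.M.finsum_insert Pi_def del: Fam_simps)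
  then have "h y = c 0 \<odot>\<^bsub>Fam n\<^esub> h (gen n' 0) \<oplus>\<^bsub>Fam n\<^esub> (c 1 \<odot>\<^bsub>Fam n\<^esub> h (gen n' 1) \<oplus>\<^bsub>Fam n\<^esub>
      (c 2 \<odot>\<^bsub>Fam n\<^esub> h (gen n' 2) \<oplus>\<^bsub>Fam n\<^esub> c 3 \<odot>\<^bsub>Fam n\<^esub> h (gen n' 3)))"
    using add smult c(1) cc gen_mem M.M.a_closed by (simp del: Fam_simps)
  moreover have "cf i (c j \<odot>\<^bsub>Fam n\<^esub> h (gen n' j)) = cf j y \<otimes> cf i (h (gen n' j))" if "j < 4" for j
    using cf_smult[OF n(2) c(1) closed[OF gen_mem[OF that]] i] Fam_coeffs[OF n(1) c(1) that] c(2) by simp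
  ultimately show ?thesis by (simp only: cf_add)
qed

lemma cf_gen0: "cf i (gen n 0) = (if i = 0 then \<one> else \<zero>)"
  by (simp add: cf_def gen_def lmonom_def vec_eq_iff)

text \<open>All coordinates of the image of the first generator vanish, so the inverse map would
  return an element whose coordinate at that generator is 0 instead of 1.\<close>

theorem Fam_not_iso:
  assumes n: "r \<gamma> < n'" "n' < n"
  shows "\<not> mod_iso QQ (Fam n') (Fam n)"
proof
  assume "mod_iso QQ (Fam n') (Fam n)"
  then obtain h where "semilinear_iso QQ QQ (\<lambda>a. a) (Fam n') (Fam n) h" by (auto simp: mod_iso_semilinear)
  then interpret h: semilinear QQ "Fam n'" QQ "Fam n" "\<lambda>a. a" h
    by (intro semilinear.intro semilinear_axioms.intro Fam_module)
  interpret k: semilinear QQ "Fam n" QQ "Fam n'" "inv_into (carrier QQ) (\<lambda>a. a)" "inv_into (carrier (Fam n')) h"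
    by (rule h.inverse)
  let ?k = "inv_into (carrier (Fam n')) h"
  have nn: "r \<gamma> < n" "n' \<le> n" using n by auto
  have g: "gen n' 0 \<in> carrier (Fam n')" by (rule gen_mem) simp
  have "Fam_lin n' n h" unfolding Fam_lin_def using h.h_closed h.h_add h.h_smult by blast
  note H = Fam_hom[OF n(1) nn(2) this]
  have z: "cf j (h (gen n' 0)) = \<zero>" if "j < 4" for j
  proof -
    have "j = 0 \<or> j = 1 \<or> j = 2 \<or> j = 3" using that by auto
    then show ?thesis using H(1,2,3) H(14)[OF n(2)] by auto
  qed
  have ks: "?k (x \<odot>\<^bsub>Fam n\<^esub> y) = x \<odot>\<^bsub>Fam n'\<^esub> ?k y" if "x \<in> carrier QQ" "y \<in> carrier (Fam n)" for x y
    using k.h_smult[OF that] h.inv_psi[OF that(1)] by simp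
  have kl: "Fam_lin n n' ?k" unfolding Fam_lin_def using k.h_closed k.h_add ks by blast
  have "cf 0 (?k (h (gen n' 0))) = \<zero>"
    using cf_hom[OF nn(1) n(1) kl h.h_closed[OF g], of 0] z
      cf_closed[OF k.h_closed[OF gen_mem]] by simp
  then show False using h.inv_h[OF g] by (simp add: cf_gen0)
qed

text \<open>A nonunit 1 - a would generate a proper ideal and so lie in \<open>MM\<close>, which
  would force 1 into \<open>MM\<close>.\<close>

lemma MM_units: "a \<in> MM \<Longrightarrow> \<one>\<^bsub>QQ\<^esub> \<ominus>\<^bsub>QQ\<^esub> a \<in> Units QQ"
proof (rule ccontr)
  assume a: "a \<in> MM" and nu: "\<one>\<^bsub>QQ\<^esub> \<ominus>\<^bsub>QQ\<^esub> a \<notin> Units QQ"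
  have aQ: "a \<in> carrier QQ" using a by (simp add: MM_def)
  let ?x = "\<one>\<^bsub>QQ\<^esub> \<ominus>\<^bsub>QQ\<^esub> a"
  have x: "?x \<in> carrier QQ" using aQ by (intro QR.minus_closed QR.one_closed)
  have "PIdl\<^bsub>QQ\<^esub> ?x \<noteq> carrier QQ"
  proof
    assume "PIdl\<^bsub>QQ\<^esub> ?x = carrier QQ"
    then have "\<one>\<^bsub>QQ\<^esub> \<in> PIdl\<^bsub>QQ\<^esub> ?x" using QR.one_closed by simp
    then obtain y where "y \<in> carrier QQ" "\<one>\<^bsub>QQ\<^esub> = y \<otimes>\<^bsub>QQ\<^esub> ?x" unfolding cgenideal_def by blast
    then show False using nu x QR.m_comm unfolding Units_def by (metis (mono_tags, lifting) mem_Collect_eq)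
  qed
  then have "?x \<in> MM" using proper_ideal_subset_MM[OF QR.cgenideal_ideal[OF x]] QR.cgenideal_self[OF x] by blast
  then have "?x \<oplus>\<^bsub>QQ\<^esub> a \<in> MM" using additive_subgroup.a_closed[OF ideal.axioms(1)[OF MM_ideal]] a by blast
  moreover have "?x \<oplus>\<^bsub>QQ\<^esub> a = \<one>\<^bsub>QQ\<^esub>" by (rule QR.minus_add_cancel[OF QR.one_closed aQ])
  ultimately have "\<one>\<^bsub>QQ\<^esub> \<in> MM" by simp
  then show False by (simp add: MM_def lmonom_def)
qed

text \<open>The entry assumed to vanish equals all diagonal entries of the projection, so modulo the
  maximal ideal only the entries (0,1) and (2,3) can be nonzero. Such a matrix squares to 0, and
  being idempotent it is 0; by Nakayama's lemma the complement is then the whole module.\<close>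

lemma Fam_summand_zero:
  assumes n: "r \<gamma> < n" and sub: "submodule N\<^sub>1 QQ (Fam n)" "submodule N\<^sub>2 QQ (Fam n)"
    and int: "N\<^sub>1 \<inter> N\<^sub>2 = {\<zero>\<^bsub>Fam n\<^esub>}"
    and closed: "\<And>y. y \<in> carrier (Fam n) \<Longrightarrow> \<pi> y \<in> N\<^sub>1"
    and compl: "\<And>y. y \<in> carrier (Fam n) \<Longrightarrow> \<exists>b\<in>N\<^sub>2. y = \<pi> y \<oplus>\<^bsub>Fam n\<^esub> b"
    and idem: "\<And>y. y \<in> N\<^sub>1 \<Longrightarrow> \<pi> y = y"
    and add: "\<And>x y. x \<in> carrier (Fam n) \<Longrightarrow> y \<in> carrier (Fam n) \<Longrightarrow> \<pi> (x \<oplus>\<^bsub>Fam n\<^esub> y) = \<pi> x \<oplus>\<^bsub>Fam n\<^esub> \<pi> y"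
    and smult: "\<And>x y. x \<in> carrier QQ \<Longrightarrow> y \<in> carrier (Fam n) \<Longrightarrow> \<pi> (x \<odot>\<^bsub>Fam n\<^esub> y) = x \<odot>\<^bsub>Fam n\<^esub> \<pi> y"
    and z: "cf 0 (\<pi> (gen n 0)) = \<zero>"
  shows "N\<^sub>1 = {\<zero>\<^bsub>Fam n\<^esub>}"
proof -
  interpret M: module QQ "Fam n" by (rule Fam_module)
  have pc: "\<pi> y \<in> carrier (Fam n)" if "y \<in> carrier (Fam n)" for y
    using closed[OF that] submoduleD(4)[OF sub(1)] by blast
  have mc: "cf i (\<pi> (gen n j)) \<in> carrier K" if "j < 4" for i j using cf_closed[OF pc[OF gen_mem[OF that]]] .
  have lin: "Fam_lin n n \<pi>" unfolding Fam_lin_def using pc add smult by blast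
  note H = Fam_hom[OF n order_refl lin]
  have H0: "cf 1 (\<pi> (gen n 1)) = \<zero>" "cf 2 (\<pi> (gen n 2)) = \<zero>" "cf 3 (\<pi> (gen n 3)) = \<zero>"
    using H(8,12) H(13)[OF refl] z by auto
  have c: "cf 0 (\<pi> y) = cf 1 y \<otimes> cf 0 (\<pi> (gen n 1))" "cf 1 (\<pi> y) = \<zero>"
    "cf 2 (\<pi> y) = cf 3 y \<otimes> cf 2 (\<pi> (gen n 3))" "cf 3 (\<pi> y) = \<zero>" if y: "y \<in> carrier (Fam n)" for y
    using cf_hom[OF n n lin y, of 0] cf_hom[OF n n lin y, of 1] cf_hom[OF n n lin y, of 2] cf_hom[OF n n lin y, of 3]
      H(1-7,9-11) H0 z cf_closed[OF y] mc by simp_all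
  have "cf i (\<pi> (\<pi> y)) = \<zero>" if y: "y \<in> carrier (Fam n)" and i: "i < 4" for i y
  proof -
    have "i = 0 \<or> i = 1 \<or> i = 2 \<or> i = 3" using i by auto
    then show ?thesis using c[OF pc[OF y]] c(2,4)[OF y] mc by auto
  qed
  then have pz: "cf i (\<pi> y) = \<zero>" if "y \<in> carrier (Fam n)" "i < 4" for i y
    using that idem[OF closed[OF that(1)]] by metis
  have "gen n k \<in> N\<^sub>2" if k: "k < 4" for k
  proof (rule M.nakayama[OF MM_ideal MM_units gen_mem sub(2) _ k])
    fix k :: nat assume k: "k < 4"
    note gk = gen_mem[OF k, of n]
    obtain b where b: "b \<in> N\<^sub>2" "gen n k = \<pi> (gen n k) \<oplus>\<^bsub>Fam n\<^esub> b" using compl[OF gk] by blast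
    have bc: "b \<in> carrier (Fam n)" using b(1) submoduleD(4)[OF sub(2)] by blast
    obtain c where c: "\<forall>i. c i \<in> MM" "\<pi> (gen n k) = (\<Oplus>\<^bsub>Fam n\<^esub>i\<in>{..<4::nat}. c i \<odot>\<^bsub>Fam n\<^esub> gen n i)"
      using cf_zero_MM[OF n pc[OF gk]] pz[OF gk] by blast
    have "gen n k = b \<oplus>\<^bsub>Fam n\<^esub> (\<Oplus>\<^bsub>Fam n\<^esub>i\<in>{..<4::nat}. c i \<odot>\<^bsub>Fam n\<^esub> gen n i)"
      using b(2) M.M.a_comm[OF pc[OF gk] bc] c(2) by (simp del: Fam_simps)
    then show "\<exists>l\<in>N\<^sub>2. \<exists>c. (\<forall>i. c i \<in> MM) \<and> gen n k = l \<oplus>\<^bsub>Fam n\<^esub> (\<Oplus>\<^bsub>Fam n\<^esub>i\<in>{..<4::nat}. c i \<odot>\<^bsub>Fam n\<^esub> gen n i)"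
      using b(1) c(1) by blast
  qed
  then have "N\<^sub>2 = carrier (Fam n)" by (rule Fam_span[OF sub(2)])
  then show ?thesis using int submoduleD(4)[OF sub(1)] by blast
qed

text \<open>The diagonal entry of the projection is an idempotent of the field. If it is 1, the
  complementary projection has entry 0, so in either case \<open>Fam_summand_zero\<close> applies to
  one of the summands.\<close>

theorem Fam_indecomposable:
  assumes n: "r \<gamma> < n"
  shows "indecomposable QQ (Fam n)"
  unfolding indecomposable_def
proof (intro conjI allI impI)
  interpret M: module QQ "Fam n" by (rule Fam_module)
  have g: "gen n 0 \<in> carrier (Fam n)" by (rule gen_mem) simp
  have "gen n 0 \<noteq> \<zero>\<^bsub>Fam n\<^esub>"
  proof
    assume "gen n 0 = \<zero>\<^bsub>Fam n\<^esub>"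
    then have "cf 0 (gen n 0) = \<zero>" by (simp add: cf_def)
    then show False by (simp add: cf_gen0)
  qed
  then show "carrier (Fam n) \<noteq> {\<zero>\<^bsub>Fam n\<^esub>}" using g by blast
  fix N\<^sub>1 N\<^sub>2
  assume "submodule N\<^sub>1 QQ (Fam n) \<and> submodule N\<^sub>2 QQ (Fam n) \<and> N\<^sub>1 <+>\<^bsub>Fam n\<^esub> N\<^sub>2 = carrier (Fam n) \<and> N\<^sub>1 \<inter> N\<^sub>2 = {\<zero>\<^bsub>Fam n\<^esub>}"
  then have sub: "submodule N\<^sub>1 QQ (Fam n)" "submodule N\<^sub>2 QQ (Fam n)"
    and sum: "N\<^sub>1 <+>\<^bsub>Fam n\<^esub> N\<^sub>2 = carrier (Fam n)" and int: "N\<^sub>1 \<inter> N\<^sub>2 = {\<zero>\<^bsub>Fam n\<^esub>}" by blast+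
  note S1 = submoduleD[OF sub(1)] and S2 = submoduleD[OF sub(2)]
  have comm: "a \<oplus>\<^bsub>Fam n\<^esub> b = b \<oplus>\<^bsub>Fam n\<^esub> a" if "a \<in> N\<^sub>1" "b \<in> N\<^sub>2" for a b
    by (rule M.M.a_comm[OF subsetD[OF S1(4) that(1)] subsetD[OF S2(4) that(2)]])
  have sum': "N\<^sub>2 <+>\<^bsub>Fam n\<^esub> N\<^sub>1 = carrier (Fam n)"
    using M.set_add_commute[OF S1(4) S2(4)] sum by simp
  have int': "N\<^sub>2 \<inter> N\<^sub>1 = {\<zero>\<^bsub>Fam n\<^esub>}" using int by (simp only: Int_commute)
  obtain \<pi> where p: "\<And>y. y \<in> carrier (Fam n) \<Longrightarrow> \<pi> y \<in> N\<^sub>1"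
    "\<And>y. y \<in> carrier (Fam n) \<Longrightarrow> \<exists>b\<in>N\<^sub>2. y = \<pi> y \<oplus>\<^bsub>Fam n\<^esub> b"
    "\<And>a b. a \<in> N\<^sub>1 \<Longrightarrow> b \<in> N\<^sub>2 \<Longrightarrow> \<pi> (a \<oplus>\<^bsub>Fam n\<^esub> b) = a"
    "\<And>x y. x \<in> carrier (Fam n) \<Longrightarrow> y \<in> carrier (Fam n) \<Longrightarrow> \<pi> (x \<oplus>\<^bsub>Fam n\<^esub> y) = \<pi> x \<oplus>\<^bsub>Fam n\<^esub> \<pi> y"
    "\<And>c x. c \<in> carrier QQ \<Longrightarrow> x \<in> carrier (Fam n) \<Longrightarrow> \<pi> (c \<odot>\<^bsub>Fam n\<^esub> x) = c \<odot>\<^bsub>Fam n\<^esub> \<pi> x"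
    by (rule M.direct_sum_projection[OF sub sum int]) blast
  obtain \<rho> where q: "\<And>y. y \<in> carrier (Fam n) \<Longrightarrow> \<rho> y \<in> N\<^sub>2"
    "\<And>y. y \<in> carrier (Fam n) \<Longrightarrow> \<exists>b\<in>N\<^sub>1. y = \<rho> y \<oplus>\<^bsub>Fam n\<^esub> b"
    "\<And>a b. a \<in> N\<^sub>2 \<Longrightarrow> b \<in> N\<^sub>1 \<Longrightarrow> \<rho> (a \<oplus>\<^bsub>Fam n\<^esub> b) = a"
    "\<And>x y. x \<in> carrier (Fam n) \<Longrightarrow> y \<in> carrier (Fam n) \<Longrightarrow> \<rho> (x \<oplus>\<^bsub>Fam n\<^esub> y) = \<rho> x \<oplus>\<^bsub>Fam n\<^esub> \<rho> y"
    "\<And>c x. c \<in> carrier QQ \<Longrightarrow> x \<in> carrier (Fam n) \<Longrightarrow> \<rho> (c \<odot>\<^bsub>Fam n\<^esub> x) = c \<odot>\<^bsub>Fam n\<^esub> \<rho> x"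
    by (rule M.direct_sum_projection[OF sub(2,1) sum' int']) blast
  have pc: "\<pi> y \<in> carrier (Fam n)" if "y \<in> carrier (Fam n)" for y using p(1)[OF that] S1(4) by blast
  have pid: "\<pi> y = y" if "y \<in> N\<^sub>1" for y
    using p(3)[OF that S2(1)] M.M.r_zero[OF subsetD[OF S1(4) that]] by (simp del: Fam_simps)
  have qid: "\<rho> y = y" if "y \<in> N\<^sub>2" for y
    using q(3)[OF that S1(1)] M.M.r_zero[OF subsetD[OF S2(4) that]] by (simp del: Fam_simps)
  define c0 where "c0 = cf 0 (\<pi> (gen n 0))"
  have lc: "c0 \<in> carrier K" unfolding c0_def by (rule cf_closed[OF pc[OF g]])
  have mc: "cf i (\<pi> (gen n j)) \<in> carrier K" if "j < 4" for i j using cf_closed[OF pc[OF gen_mem[OF that]]] .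
  have lin: "Fam_lin n n \<pi>" unfolding Fam_lin_def using pc p(4,5) by blast
  note H = Fam_hom[OF n order_refl lin]
  have "cf 0 (\<pi> (\<pi> (gen n 0))) = c0 \<otimes> c0"
    using cf_hom[OF n n lin pc[OF g], of 0] H(1,2,3) mc lc unfolding c0_def[symmetric] by simp
  then have "c0 \<otimes> c0 = c0" using pid[OF p(1)[OF g]] by (simp add: c0_def)
  then have "c0 \<otimes> (c0 \<ominus> \<one>) = \<zero>" using lc by (simp add: r_distr minus_eq r_minus r_neg)
  then have "c0 = \<zero> \<or> c0 \<ominus> \<one> = \<zero>" by (rule integral[OF _ lc minus_closed[OF lc one_closed]])
  then consider "c0 = \<zero>" | "c0 = \<one>" using lc by auto
  then show "N\<^sub>1 = {\<zero>\<^bsub>Fam n\<^esub>} \<or> N\<^sub>2 = {\<zero>\<^bsub>Fam n\<^esub>}"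
  proof cases
    case 1
    have "N\<^sub>1 = {\<zero>\<^bsub>Fam n\<^esub>}"
      by (rule Fam_summand_zero[OF n sub int p(1,2) pid p(4,5)]) (use 1 in \<open>simp_all add: c0_def\<close>)
    then show ?thesis ..
  next
    case 2
    obtain b where b: "b \<in> N\<^sub>2" "gen n 0 = \<pi> (gen n 0) \<oplus>\<^bsub>Fam n\<^esub> b" using p(2)[OF g] by blast
    have bc: "b \<in> carrier (Fam n)" using b(1) S2(4) by blast
    have "gen n 0 = b \<oplus>\<^bsub>Fam n\<^esub> \<pi> (gen n 0)" using comm[OF p(1)[OF g] b(1)] b(2) by metis
    then have rb: "\<rho> (gen n 0) = b" using q(3)[OF b(1) p(1)[OF g]] by metis
    have "cf 0 (gen n 0) = c0 \<oplus> cf 0 b" using b(2) cf_add[of 0 n "\<pi> (gen n 0)" b] unfolding c0_def by metis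
    then have "\<one> = \<one> \<oplus> cf 0 b" using 2 by (simp add: cf_gen0)
    then have "cf 0 b = \<zero>" using cf_closed[OF bc] by (metis add.l_cancel_one' one_closed)
    then have "N\<^sub>2 = {\<zero>\<^bsub>Fam n\<^esub>}"
      by (intro Fam_summand_zero[OF n sub(2,1) int' q(1,2) qid q(4,5)]) (simp_all add: rb)
    then show ?thesis ..
  qed
qed

end

lemma (in ring_isomorphism) MCM_indecomposable_transport:
  assumes iso: "module A M" "module B N" "semilinear_iso A B \<psi> M N h" and loc: "noetherian_local B"
    and N: "MCM B N" "indecomposable B N"
  shows "MCM A M \<and> indecomposable A M"
proof -
  interpret s: semilinear A M B N \<psi> h
    by (intro semilinear.intro semilinear_axioms.intro iso)
  interpret s': semilinear B N A M "inv_into (carrier A) \<psi>" "inv_into (carrier M) h" by (rule s.inverse)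
  have m: "\<psi> ` max_ideal A = max_ideal B" by (rule max_ideal_image[OF loc])
  have "\<exists>!I. maximalideal I A" using noetherian_local_transport[OF loc] by (simp add: noetherian_local_def)
  then have "maximalideal (max_ideal A) A" unfolding max_ideal_def by (rule theI')
  then have "max_ideal A \<subseteq> carrier A"
    using ideal.axioms(1)[OF maximalideal.axioms(1)] additive_subgroup.a_subset by blast
  then have "inv_into (carrier A) \<psi> ` max_ideal B = max_ideal A"
    unfolding m[symmetric] using bij_betw_imp_inj_on[OF bij] by (rule inv_into_image_cancel[rotated])
  then have "depth A M = depth B N" using s.depth_le s'.depth_le m by (simp add: antisym)
  then show ?thesis
    using N krull_dim_eq s'.fg_image s'.indecomposable_image by (auto simp: MCM_def)
qed

section \<open>Infinitely many isomorphism classes over an isomorphic ring\<close>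

context mcm_family
begin

text \<open>A finite list would contain one module isomorphic to two different members of the
  family.\<close>

theorem not_finite_CM_type:
  fixes A :: "('b, 'c) ring_scheme"
  assumes "ring_isomorphism A QQ \<psi>"
  shows "\<not> finite_CM_type A"
proof
  interpret I: ring_isomorphism A QQ \<psi> by (rule assms)
  assume "finite_CM_type A"
  then obtain \<M> :: "'b fgmod set" where fin: "finite \<M>"
    and cov: "\<And>N :: 'b fgmod. MCM A N \<Longrightarrow> indecomposable A N \<Longrightarrow> \<exists>M\<in>\<M>. mod_iso A N M"
    unfolding finite_CM_type_def by blast
  have "\<exists>M :: 'b fgmod. \<exists>h. fg_module A M \<and> semilinear_iso A QQ \<psi> M (Fam n) h" for n
    using I.fgmod_representative[OF Fam_fg] by metis
  then obtain M :: "nat \<Rightarrow> 'b fgmod" and h where M: "\<And>n. fg_module A (M n)"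
    "\<And>n. semilinear_iso A QQ \<psi> (M n) (Fam n) (h n)" by metis
  have mM: "module A (M n)" for n using M(1) by (simp add: fg_module_def)
  have "\<exists>N\<in>\<M>. mod_iso A (M n) N" if n: "r \<gamma> < n" for n
    using I.MCM_indecomposable_transport[OF mM Fam_module M(2) QQ_local MCM_Fam Fam_indecomposable[OF n]] cov by blast
  then obtain N where N: "\<And>n. r \<gamma> < n \<Longrightarrow> N n \<in> \<M>" "\<And>n. r \<gamma> < n \<Longrightarrow> mod_iso A (M n) (N n)" by metis
  have "N ` {r \<gamma><..} \<subseteq> \<M>" using N(1) by auto
  then have "finite (N ` {r \<gamma><..})" using fin finite_subset by blast
  then have "\<not> inj_on N {r \<gamma><..}" using infinite_Ioi[of "r \<gamma>"] finite_imageD by blast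
  then obtain n m where nm: "r \<gamma> < n" "n < m" "N n = N m"
    unfolding inj_on_def by (metis greaterThan_iff linorder_neqE_nat)
  obtain k where k: "semilinear_iso A A (\<lambda>a. a) (M n) (N n) k" using N(2)[OF nm(1)] by (auto simp: mod_iso_semilinear)
  obtain k' where k': "semilinear_iso A A (\<lambda>a. a) (M m) (N n) k'"
    using N(2)[of m] nm by (auto simp: mod_iso_semilinear)
  \<comment> \<open>The composite runs from \<open>Fam n\<close> to \<open>M n\<close>, to the
    common module, back to \<open>M m\<close> and on to \<open>Fam m\<close>; the ring maps along it
    cancel to the identity.\<close>
  from semilinear_iso_trans[OF semilinear_iso_trans[OF semilinear_iso_trans[OF semilinear_iso_sym[OF mM M(2)] k]
      semilinear_iso_sym[OF mM k']] M(2)]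
  have "semilinear_iso QQ QQ (\<lambda>a. \<psi> (inv_into (carrier A) (\<lambda>a. a) (inv_into (carrier A) \<psi> a))) (Fam n) (Fam m)
    (\<lambda>x. h m (inv_into (carrier (M m)) k' (k (inv_into (carrier (M n)) (h n) x))))" .
  then have "semilinear_iso QQ QQ (\<lambda>a. a) (Fam n) (Fam m)
    (\<lambda>x. h m (inv_into (carrier (M m)) k' (k (inv_into (carrier (M n)) (h n) x))))"
  proof (rule semilinear_iso_cong)
    fix a assume a: "a \<in> carrier QQ"
    have c: "inv_into (carrier A) \<psi> a \<in> carrier A" "\<psi> (inv_into (carrier A) \<psi> a) = a"
      using bij_betw_imp_surj_on[OF I.bij] a by (auto intro: inv_into_into f_inv_into_f)
    then show "\<psi> (inv_into (carrier A) (\<lambda>a. a) (inv_into (carrier A) \<psi> a)) = a"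
      using inv_into_f_f[of "\<lambda>a. a" "carrier A"] by simp
  qed
  then have "mod_iso QQ (Fam n) (Fam m)" by (auto simp: mod_iso_semilinear)
  then show False using Fam_not_iso[OF nm(1,2)] by blast
qed

end

theorem theorem5p24:
  fixes K :: "'k ring"
    and S :: "((nat \<Rightarrow> nat) \<Rightarrow> 'k) ring"
    and f :: "(nat \<Rightarrow> nat) \<Rightarrow> 'k"
    and d :: nat
    and r :: "nat \<Rightarrow> nat"
  assumes "algebraically_closed K"
    and "infinite (carrier K)"
    and "normalization_semidom_class.prime (ring_char K)"
    and "ring_char K > 2"
    and "d > 2"
    and "S = mps d K"
    and "f = (\<Otimes>\<^bsub>S\<^esub>i\<in>{..<d}. mps_var d K i [^]\<^bsub>S\<^esub> r i)"
    and "(\<Sum>i<d. r i) > 3"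
  shows "noetherian_local (R_star S f) \<and> has_FFRT (R_star S f) \<and> \<not> finite_CM_type (R_star S f)"
proof -
  interpret K: algebraically_closed K by (rule assms(1))
  define p where "p = ring_char K"
  have ex: "\<exists>n::nat. n > 0 \<and> [n] \<cdot>\<^bsub>K\<^esub> \<one>\<^bsub>K\<^esub> = \<zero>\<^bsub>K\<^esub>"
    using assms(4) by (auto simp: ring_char_def split: if_splits)
  then have char: "[p] \<cdot>\<^bsub>K\<^esub> \<one>\<^bsub>K\<^esub> = \<zero>\<^bsub>K\<^esub>"
    using LeastI_ex[OF ex] unfolding p_def ring_char_def by simp
  interpret H: perfect_hypersurface K d r p
    by unfold_locales (use assms char in \<open>simp_all add: p_def\<close>)
  have S: "S = H.SS" and f: "f = H.mon" using assms(6,7) by (simp_all add: H.mon_def)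
  obtain \<psi> where "\<psi> \<in> ring_iso (R_star S f) H.QQ" using H.R_star_iso S f by blast
  then have iso: "ring_isomorphism (R_star S f) H.QQ \<psi>"
    using H.R_star_cring H.QQ_cring by (intro ring_isomorphism.intro ring_isomorphism_axioms.intro) (simp_all add: S f)
  interpret I: ring_isomorphism "R_star S f" H.QQ \<psi> by (rule iso)
  have loc: "noetherian_local (R_star S f)" by (rule I.noetherian_local_transport[OF H.QQ_local])
  \<comment> \<open>Constants embed, so the series ring has the characteristic of K.\<close>
  have one: "[n] \<cdot>\<^bsub>H.QQ\<^esub> \<one>\<^bsub>H.QQ\<^esub> = lmonom K 0 ([n] \<cdot>\<^bsub>K\<^esub> \<one>\<^bsub>K\<^esub>)" for n :: nat
    by (induction n) (auto simp: lmonom_def fun_eq_iff)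
  have "[n] \<cdot>\<^bsub>H.QQ\<^esub> \<one>\<^bsub>H.QQ\<^esub> = \<zero>\<^bsub>H.QQ\<^esub> \<longleftrightarrow> [n] \<cdot>\<^bsub>K\<^esub> \<one>\<^bsub>K\<^esub> = \<zero>\<^bsub>K\<^esub>" for n :: nat
    unfolding one by (auto simp: lmonom_def fun_eq_iff)
  then have "(\<lambda>n :: nat. [n] \<cdot>\<^bsub>H.QQ\<^esub> \<one>\<^bsub>H.QQ\<^esub> = \<zero>\<^bsub>H.QQ\<^esub>) = (\<lambda>n. [n] \<cdot>\<^bsub>K\<^esub> \<one>\<^bsub>K\<^esub> = \<zero>\<^bsub>K\<^esub>)" by blast
  from fun_cong[OF this] have "ring_char H.QQ = p" unfolding p_def ring_char_def by (simp only:)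
  then have "has_FFRT (R_star S f)"
    using H.FFRT[OF iso] loc I.ring_char_eq by (simp add: noetherian_local_def)
  moreover obtain \<iota> \<gamma> where "\<iota> < d" "\<gamma> < d" "\<iota> \<noteq> \<gamma>" "0 < r \<iota>"
    "\<exists>l<d. l \<noteq> \<gamma> \<and> 0 < r l - (if l = \<iota> then 1 else 0)" "\<exists>l<d. 2 * (if l = \<iota> then 1 else 0) < r l"
  proof -
    \<comment> \<open>x_\<iota> will be a variable of largest exponent.\<close>
    have "Max (r ` {..<d}) \<in> r ` {..<d}" using assms(5) by (intro Max_in) auto
    then obtain \<iota> where "\<iota> < d" and m: "Max (r ` {..<d}) = r \<iota>" by auto
    moreover have "r j \<le> r \<iota>" if "j < d" for j unfolding m[symmetric] using that by (intro Max_ge) auto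
    ultimately have i: "\<iota> < d" "\<And>j. j < d \<Longrightarrow> r j \<le> r \<iota>" by auto
    have pos: "0 < r \<iota>"
    proof (rule ccontr)
      assume "\<not> 0 < r \<iota>"
      then have "(\<Sum>i<d. r i) = 0" using i(2) by force
      then show False using assms(8) by simp
    qed
    \<comment> \<open>As the degree exceeds 3, a second variable must occur if no exponent exceeds
      3.\<close>
    have two: "\<exists>l\<in>{..<d} - {\<iota>}. 0 < r l" if "r \<iota> \<le> 3"
    proof (rule ccontr)
      assume "\<not> (\<exists>l\<in>{..<d} - {\<iota>}. 0 < r l)"
      then have "(\<Sum>i\<in>{..<d} - {\<iota>}. r i) = 0" by simp
      then have "(\<Sum>i<d. r i) = r \<iota>" using i(1) by (simp add: sum.remove[of "{..<d}" \<iota>])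
      then show False using assms(8) that by simp
    qed
    \<comment> \<open>f does not divide x_\<iota>^2: either another variable occurs, or the exponent
      of x_\<iota> is at least 4.\<close>
    have big: "\<exists>l<d. 2 * (if l = \<iota> then 1 else 0) < r l"
    proof (cases "r \<iota> \<le> 3")
      case True
      then obtain l where "l < d" "l \<noteq> \<iota>" "0 < r l" using two by auto
      then show ?thesis by (intro exI[of _ l]) simp
    next
      case False
      then show ?thesis using i(1) by (intro exI[of _ \<iota>]) simp
    qed
    \<comment> \<open>If x_\<iota> still occurs in b, any other variable may serve as x_\<gamma>.
      Otherwise f is squarefree, x_\<gamma> is taken from its variables, and the degree supplies a
      third one, which divides b.\<close>
    show ?thesis
    proof (cases "2 \<le> r \<iota>")
      case True
      obtain \<gamma> :: nat where "\<gamma> < d" "\<iota> \<noteq> \<gamma>" using assms(5) by (cases "\<iota> = 0") (auto intro: that[of 0] that[of 1])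
      moreover from this have "\<exists>l<d. l \<noteq> \<gamma> \<and> 0 < r l - (if l = \<iota> then 1 else 0)"
        using i(1) True by (intro exI[of _ \<iota>]) simp
      ultimately show ?thesis using i(1) pos big by (intro that)
    next
      case False
      then have le1: "r j \<le> 1" if "j < d" for j using i(2)[OF that] by simp
      obtain \<gamma> where g: "\<gamma> < d" "\<gamma> \<noteq> \<iota>" "0 < r \<gamma>" using two False by auto
      have "\<exists>l\<in>{..<d} - {\<iota>} - {\<gamma>}. 0 < r l"
      proof (rule ccontr)
        assume "\<not> (\<exists>l\<in>{..<d} - {\<iota>} - {\<gamma>}. 0 < r l)"
        then have "(\<Sum>i\<in>{..<d} - {\<iota>} - {\<gamma>}. r i) = 0" by simp
        then have "(\<Sum>i<d. r i) = r \<iota> + r \<gamma>"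
          using i(1) g by (simp add: sum.remove[of "{..<d}" \<iota>] sum.remove[of "{..<d} - {\<iota>}" \<gamma>])
        then show False using assms(8) le1[OF i(1)] le1[OF g(1)] by simp
      qed
      then obtain l where "l < d" "l \<noteq> \<iota>" "l \<noteq> \<gamma>" "0 < r l" by auto
      then have "\<exists>l<d. l \<noteq> \<gamma> \<and> 0 < r l - (if l = \<iota> then 1 else 0)"
        by (intro exI[of _ l]) simp
      then show ?thesis using i(1) g(1) g(2)[symmetric] pos big by (intro that)
    qed
  qed
  then interpret M: mcm_family K d r p \<iota> \<gamma> by unfold_locales
  have "\<not> finite_CM_type (R_star S f)" by (rule M.not_finite_CM_type[OF iso])
  ultimately show ?thesis using loc by blast
qed

end
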